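(* Suppose $N=2$, $\deg a=4$ and $P(x,a)=x^3-ax$. Assume that $\mathrm{lht}_2(L)\le3$ for an oriented link $L$. Then $\mathrm{tw}_P(L)\le1$. Consequently, $\{\tilde E^{(r)}(L)\}$ collapses at its $E^{(1)}$- or $E^{(2)}$-page. Moreover, there exists a (possibly empty) sequence of pairs of integers $\{(i_1,s_1),\dots,(i_n,s_n)\}$ such that, as bigraded $\mathbb C$-spaces, \[H_2(L)\cong\hat{\mathcal H}_P(L)\oplus\bigoplus_{l=1}^n(\mathbb C\|i_l\|\{s_l\}\oplus\mathbb C\|i_l-1\|\{s_l+4\}).\]
   Context: Equivariant Khovanov-Rozansky homology. The following is applied with $N=2$, $k=2$ and $P=x^3-ax$; $H_2$ denotes $H_N$ for $N=2$. Here $a$ is a variable of degree $2k$ and every $x$-variable has degree $2$. For $R=\mathbb C[x_1,\dots,x_m,a]$, the polynomial grading is the grading by these degrees; the $x$-filtration $\mathcal F_x$ is the increasing filtration with $\mathcal F_x^nR$ spanned by monomials $a^p\prod x_i^{l_i}$ with $\sum 2l_i\le n$. $\{s\}$ shifts both the polynomial grading and the $x$-filtration up by $s$. A matrix factorization of $w\in R$ consists of free $R$-modules $M^0,M^1$ and $R$-maps $M^0\to M^1\to M^0$ whose composites in both orders are multiplication by $w$; homomorphisms, homotopies and tensor products are the usual $\mathbb Z_2$-graded ones. For homogeneous $b,c\in R$ with $\deg(bc)=2N+2$, $(b,c)_R$ denotes $R\xrightarrow{b}R\{N+1-\deg b\}\xrightarrow{c}R$; a matrix with rows $(b_1,c_1),\dots,(b_l,c_l)$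 denotes the tensor product over $R$ of the $(b_i,c_i)_R$. Given an oriented link diagram $D$, mark finitely many points away from crossings, at least one on each arc between crossings and on each crossingless circle, by distinct variables $x_1,\dots,x_m$, put $R=\mathbb C[x_1,\dots,x_m,a]$, and cut $D$ at the marked points. An arc $\Gamma_{i;p}$ from $x_p$ to $x_i$ gets $C_P(\Gamma_{i;p})=(v_{i;p},x_i-x_p)_R$ in homological degree $0$, $v_{i;p}=\frac{P(x_i,a)-P(x_p,a)}{x_i-x_p}$. For a crossing drawn with strands running left to right, with incoming endpoints $x_p$ (top), $x_q$ (bottom) and outgoing endpoints $x_i$ (top), $x_j$ (bottom), let $\Gamma_{i;p}\sqcup\Gamma_{j;q}$ be the pair of parallel arcs, with $C_P(\Gamma_{i;p}\sqcup\Gamma_{j;q})=C_P(\Gamma_{i;p})\otimes_RC_P(\Gamma_{j;q})$, and $\Gamma_{i,j;p,q}$ the graph in which the two incoming strands merge into a wide edge that then splits into the two outgoing strands, with \[C_P(\Gamma_{i,j;p,q})=\begin{pmatrix}u^{\langle1\rangle}&x_i+x_j-x_p-x_q\\ u^{\langle2\rangle}&x_ix_j-x_px_q\end{pmatrix}_R\{-1\},\] where $G(X,Y,a)$ is the unique polynomial with $G(x_i+x_j,x_ix_j,a)=P(x_i,a)+P(x_j,a)$, $u^{\langle1\rangle}=\frac{G(x_i+x_j,x_ix_j,a)-G(x_p+x_q,x_ix_j,a)}{x_i+x_j-x_p-x_q}$, $u^{\langle2\rangle}=\frac{G(x_p+x_q,x_ix_j,a)-G(x_p+x_q,x_px_q,a)}{x_ix_j-x_px_q}$.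 (If endpoints carry the same variable, compute with distinct variables and then identify.) Up to homotopy and nonzero scalars there are unique homotopically non-trivial homomorphisms $\chi_0:C_P(\Gamma_{i;p}\sqcup\Gamma_{j;q})\to C_P(\Gamma_{i,j;p,q})$ and $\chi_1:C_P(\Gamma_{i,j;p,q})\to C_P(\Gamma_{i;p}\sqcup\Gamma_{j;q})$ homogeneous of degree $1$; these can be chosen to raise $\mathcal F_x$ by at most $1$. With $\|i\|$ meaning "in homological degree $i$", a positive crossing gets $0\to C_P(\Gamma_{i,j;p,q})\|-1\|\{N\}\xrightarrow{\chi_1}C_P(\Gamma_{i;p}\sqcup\Gamma_{j;q})\|0\|\{N-1\}\to0$, a negative crossing gets $0\to C_P(\Gamma_{i;p}\sqcup\Gamma_{j;q})\|0\|\{1-N\}\xrightarrow{\chi_0}C_P(\Gamma_{i,j;p,q})\|1\|\{-N\}\to0$. $C_P(D)$ is the tensor product over $R$ of all pieces, with homological grading, polynomial grading, filtration $\mathcal F_x$, differential $d_{mf}$ (from the matrix factorizations) and differential $d_\chi$ (from the $\chi$ maps, raising homological degree by $1$). Put $C_N(D)=C_P(D)/aC_P(D)$, $\hat C_P(D)=C_P(D)/(a-1)C_P(D)$, and $H_P(D)=H(H(C_P(D),d_{mf}),d_\chi)$, $H_N(D)=H(H(C_N(D),d_{mf}),d_\chi)$, $\hat H_P(D)=H(H(\hat C_P(D),d_{mf}),d_\chi)$. $H_P,H_N$ are bigraded (homological, polynomial); $\hat H_P$ has the homological grading and the filtration $\mathcal F_x$. Filtrations on homology consist of classes of cycles in the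 given filtration level, and quotients carry the image filtration. These are link invariants, written $H_P(L),H_N(L),\hat H_P(L)$; superscript $i$ denotes homological degree, and $H_N^{i,j}(L)$ is the part of homological degree $i$ and polynomial degree $j$. $\hat{\mathcal H}_P(L)=\bigoplus_{i,j}\mathcal F_x^j\hat H_P^i(L)/\mathcal F_x^{j-1}\hat H_P^i(L)$, bigraded by $(i,j)$. $\mathbb C\|i\|\{s\}$ is a copy of $\mathbb C$ in homological degree $i$ and polynomial degree $s$. Numerical invariants. $\mathrm{tw}_P(L)=\min\{m\in\mathbb Z_{\ge0}\mid a^mH_P(L)\text{ is a free }\mathbb C[a]\text{-module}\}$. $\mathrm{lht}_N(L)=\max\{\tfrac{j_1-j_2}{2}\mid\exists i\in\mathbb Z\text{ with }H_N^{i,j_1}(L)\ne0,\ H_N^{i+1,j_2}(L)\ne0\}$, undefined if this set is empty. Exact couples. An exact couple $(A,E,f,g,h)$ of $\mathbb Z^{\oplus2}$-graded $\mathbb C$-spaces consists of homogeneous maps $f:A\to A$, $g:A\to E$, $h:E\to A$ forming an exact triangle. With $d=g\circ h$, its derived couple is $(A',E',f',g',h')$ with $A'=f(A)$, $E'=\ker d/d(E)$, $f'=f|_{A'}$, $g'(f(\beta))=[g(\beta)]$, $h'([\eta])=h(\eta)$. Iterating gives couples indexed by $r\ge1$. The short exact sequence of complexes $0\to H(C_P(D),d_{mf})\xrightarrow{a}H(C_P(D),d_{mf})\xrightarrow{\pi_a}H(C_N(D),d_{mf})\to0$ induces the exact couple $(H_P(L),H_N(L),a,\pi_a,\Delta)$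 with $\Delta$ the connecting homomorphism; $\{\tilde E^{(r)}(L)\}_{r\ge1}$ is the resulting sequence of $E$-terms. It collapses at $E^{(t)}$ if $\tilde E^{(t+r)}(L)\cong\tilde E^{(t)}(L)$ for all $r\ge0$. *)

theory Defs
  imports
    Complex_Main
    "HOL-Library.Poly_Mapping"
    "HOL-Library.Function_Algebras"
    "HOL-Library.Product_Plus"
    "HOL-Library.Extended_Nat"
begin

section \<open>Complex vector spaces, subquotients, bigraded spaces\<close>

class complex_space = ab_group_add +
  fixes scaleC :: "complex \<Rightarrow> 'a \<Rightarrow> 'a" (infixr \<open>*\<^sub>C\<close> 75)
  assumes scaleC_add_right: "c *\<^sub>C (u + v) = c *\<^sub>C u + c *\<^sub>C v"
    and scaleC_add_left: "(c + d) *\<^sub>C v = c *\<^sub>C v + d *\<^sub>C v"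
    and scaleC_scaleC: "c *\<^sub>C d *\<^sub>C v = (c * d) *\<^sub>C v"
    and scaleC_one: "1 *\<^sub>C v = v"

lemma scaleC_zero_right: "c *\<^sub>C (0 :: 'a :: complex_space) = 0"
  using scaleC_add_right[of c "0 :: 'a" 0] by simp

instantiation complex :: complex_space
begin
definition scaleC_complex :: "complex \<Rightarrow> complex \<Rightarrow> complex" where "scaleC_complex c z = c * z"
instance by standard (auto simp: scaleC_complex_def algebra_simps)
end

instantiation prod :: (complex_space, complex_space) complex_space
begin
definition scaleC_prod :: "complex \<Rightarrow> 'a \<times> 'b \<Rightarrow> 'a \<times> 'b"
  where "scaleC_prod c z = (c *\<^sub>C fst z, c *\<^sub>C snd z)"
instance by standard
    (auto simp: scaleC_prod_def scaleC_add_right scaleC_add_left scaleC_scaleC scaleC_one)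
end

instantiation "fun" :: (type, complex_space) complex_space
begin
definition scaleC_fun :: "complex \<Rightarrow> ('a \<Rightarrow> 'b) \<Rightarrow> 'a \<Rightarrow> 'b"
  where "scaleC_fun c f = (\<lambda>x. c *\<^sub>C f x)"
instance by standard
    (auto simp: scaleC_fun_def scaleC_add_right scaleC_add_left scaleC_scaleC scaleC_one fun_eq_iff)
end

instantiation poly_mapping :: (type, complex_space) complex_space
begin
definition scaleC_poly_mapping :: "complex \<Rightarrow> ('a \<Rightarrow>\<^sub>0 'b) \<Rightarrow> 'a \<Rightarrow>\<^sub>0 'b"
  where "scaleC_poly_mapping c = Poly_Mapping.map (scaleC c)"
lemma lookup_scaleC: "Poly_Mapping.lookup (c *\<^sub>C f) k = c *\<^sub>C Poly_Mapping.lookup f k"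
  by (simp add: scaleC_poly_mapping_def map.rep_eq when_def scaleC_zero_right)
instance by standard
    (auto intro!: poly_mapping_eqI simp: lookup_scaleC lookup_add
      scaleC_add_right scaleC_add_left scaleC_scaleC scaleC_one)
end

text \<open>
  A pair \<open>(Z, B)\<close> of subspaces \<open>B \<subseteq> Z\<close> of an ambient space stands for the quotient \<open>Z / B\<close>. Iterated
  homology and the pages of a spectral sequence then remain subquotients of one ambient space.
\<close>

type_synonym 'v subquot = "'v set \<times> 'v set"

definition sq_zero :: "'v subquot \<Rightarrow> bool"
  where "sq_zero Q \<longleftrightarrow> fst Q \<subseteq> snd Q"

text \<open>
  The map \<open>\<phi>\<close> chooses a representative of the image of each class; linearity is required modulo the
  denominator of the target, i.e. of the induced map of quotients.
\<close>

definition sq_iso :: "'v::complex_space subquot \<Rightarrow> 'w::complex_space subquot \<Rightarrow> bool"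
  where "sq_iso Q Q' \<longleftrightarrow> (\<exists>\<phi>.
    \<phi> ` fst Q \<subseteq> fst Q' \<and>
    (\<forall>u\<in>fst Q. \<forall>v\<in>fst Q. \<phi> (u + v) - (\<phi> u + \<phi> v) \<in> snd Q') \<and>
    (\<forall>c. \<forall>v\<in>fst Q. \<phi> (c *\<^sub>C v) - c *\<^sub>C \<phi> v \<in> snd Q') \<and>
    (\<forall>v\<in>fst Q. \<phi> v \<in> snd Q' \<longleftrightarrow> v \<in> snd Q) \<and>
    (\<forall>w\<in>fst Q'. \<exists>v\<in>fst Q. w - \<phi> v \<in> snd Q'))"

definition sq_homology :: "('v::ab_group_add \<Rightarrow> 'v) \<Rightarrow> 'v subquot \<Rightarrow> 'v subquot"
  where "sq_homology d Q =
    ({z \<in> fst Q. d z \<in> snd Q}, {d z + b | z b. z \<in> fst Q \<and> b \<in> snd Q})"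

text \<open>The image in \<open>Z / B\<close> of \<open>Z \<inter> F\<close>.\<close>

definition sq_filt :: "'v::ab_group_add set \<Rightarrow> 'v subquot \<Rightarrow> 'v subquot"
  where "sq_filt F Q = ({z + b | z b. z \<in> fst Q \<inter> F \<and> b \<in> snd Q}, snd Q)"

type_synonym 'v bigraded = "int \<Rightarrow> int \<Rightarrow> 'v subquot"

definition bg_iso :: "'v::complex_space bigraded \<Rightarrow> 'w::complex_space bigraded \<Rightarrow> bool"
  where "bg_iso M M' \<longleftrightarrow> (\<forall>i j. sq_iso (M i j) (M' i j))"

definition bg_sum :: "'v bigraded \<Rightarrow> 'w bigraded \<Rightarrow> ('v \<times> 'w) bigraded"
  where "bg_sum M M' i j = (fst (M i j) \<times> fst (M' i j), snd (M i j) \<times> snd (M' i j))"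

definition bg_family_sum :: "nat \<Rightarrow> (nat \<Rightarrow> 'v::zero bigraded) \<Rightarrow> (nat \<Rightarrow> 'v) bigraded"
  where "bg_family_sum n M i j =
    ({v. (\<forall>l<n. v l \<in> fst (M l i j)) \<and> (\<forall>l\<ge>n. v l = 0)},
     {v. (\<forall>l<n. v l \<in> snd (M l i j)) \<and> (\<forall>l\<ge>n. v l = 0)})"

text \<open>\<open>\<complex>\<parallel>i\<parallel>{s}\<close>\<close>

definition bg_C :: "int \<Rightarrow> int \<Rightarrow> complex bigraded"
  where "bg_C i s i' s' = (if i' = i \<and> s' = s then UNIV else {0}, {0})"


section \<open>Exact couples\<close>

text \<open>
  The maps of an exact couple are homomorphisms of subquotients, given by the relation between
  representatives: \<open>(u, v)\<close> is in the relation iff the class of \<open>u\<close> is mapped to the class of \<open>v\<close>.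
\<close>

record ('v, 'w) couple =
  cA :: "'v subquot"
  cE :: "'w subquot"
  cf :: "('v \<times> 'v) set"
  cg :: "('v \<times> 'w) set"
  ch :: "('w \<times> 'v) set"

definition derived_couple :: "('v, 'w::ab_group_add) couple \<Rightarrow> ('v, 'w) couple"
  where "derived_couple K = (let
      d = ch K O cg K;
      A' = (cf K `` fst (cA K), snd (cA K));
      E' = ({e \<in> fst (cE K). \<exists>b\<in>snd (cE K). (e, b) \<in> d}, d `` fst (cE K))
    in \<lparr>cA = A', cE = E',
        cf = cf K \<inter> fst A' \<times> fst A',
        cg = {(\<alpha>, e'). \<exists>\<beta> e. (\<beta>, \<alpha>) \<in> cf K \<and> (\<beta>, e) \<in> cg K \<and> e' - e \<in> snd E'},
        ch = ch K \<inter> fst E' \<times> fst A'\<rparr>)"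


section \<open>The polynomial ring\<close>

text \<open>The variable with index \<open>0\<close> is \<open>a\<close>, the one with index \<open>i \<ge> 1\<close> is \<open>x\<^sub>i\<close>.\<close>

type_synonym pring = "(nat \<Rightarrow>\<^sub>0 nat) \<Rightarrow>\<^sub>0 complex"

definition Const :: "complex \<Rightarrow> pring"
  where "Const c = Poly_Mapping.single 0 c"

definition Var :: "nat \<Rightarrow> pring"
  where "Var i = Poly_Mapping.single (Poly_Mapping.single i 1) 1"

abbreviation a_var :: pring where "a_var \<equiv> Var 0"

definition polys :: "nat set \<Rightarrow> pring set"
  where "polys W = {f. \<forall>\<mu>\<in>Poly_Mapping.keys f. Poly_Mapping.keys \<mu> \<subseteq> W}"

definition mon_deg :: "(nat \<Rightarrow> int) \<Rightarrow> (nat \<Rightarrow>\<^sub>0 nat) \<Rightarrow> int"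
  where "mon_deg w \<mu> = (\<Sum>i\<in>Poly_Mapping.keys \<mu>. w i * int (Poly_Mapping.lookup \<mu> i))"

definition homogeneous :: "int \<Rightarrow> pring \<Rightarrow> bool"
  where "homogeneous n f \<longleftrightarrow>
    (\<forall>\<mu>\<in>Poly_Mapping.keys f. mon_deg (\<lambda>i. if i = 0 then 4 else 2) \<mu> = n)"

definition xfilt :: "int \<Rightarrow> pring set"
  where "xfilt n =
    {f. \<forall>\<mu>\<in>Poly_Mapping.keys f. mon_deg (\<lambda>i. if i = 0 then 0 else 2) \<mu> \<le> n}"

text \<open>The ring homomorphism renaming the variable \<open>i\<close> to \<open>\<sigma> i\<close>.\<close>

definition rename :: "(nat \<Rightarrow> nat) \<Rightarrow> pring \<Rightarrow> pring"
  where "rename \<sigma> f = (\<Sum>\<mu>\<in>Poly_Mapping.keys f. Const (Poly_Mapping.lookup f \<mu>) *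
    (\<Prod>i\<in>Poly_Mapping.keys \<mu>. Var (\<sigma> i) ^ Poly_Mapping.lookup \<mu> i))"


section \<open>The potential and the Koszul rows of the pieces\<close>

definition pot :: "pring \<Rightarrow> pring"
  where "pot x = x ^ 3 - a_var * x"

definition potG :: "pring \<Rightarrow> pring \<Rightarrow> pring"
  where "potG X Y = X ^ 3 - 3 * X * Y - a_var * X"

lemma potG_eq: "potG (x + y) (x * y) = pot x + pot y"
  by (simp add: pot_def potG_def power3_eq_cube algebra_simps)

text \<open>
  The difference quotients of \<^term>\<open>pot\<close> and \<^term>\<open>potG\<close> in closed form. Written like this they also
  make sense when some of the variables are identified.
\<close>

definition arc_v :: "pring \<Rightarrow> pring \<Rightarrow> pring"
  where "arc_v y x = y ^ 2 + y * x + x ^ 2 - a_var"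

definition wide_u1 :: "pring \<Rightarrow> pring \<Rightarrow> pring \<Rightarrow> pring \<Rightarrow> pring"
  where "wide_u1 yi yj xp xq = (yi + yj) ^ 2 + (yi + yj) * (xp + xq) + (xp + xq) ^ 2
    - 3 * (yi * yj) - a_var"

definition wide_u2 :: "pring \<Rightarrow> pring \<Rightarrow> pring \<Rightarrow> pring \<Rightarrow> pring"
  where "wide_u2 yi yj xp xq = - 3 * (xp + xq)"

lemma arc_v_eq: "arc_v y x * (y - x) = pot y - pot x"
  by (simp add: pot_def arc_v_def power3_eq_cube power2_eq_square algebra_simps)

lemma wide_u1_eq: "wide_u1 yi yj xp xq * (yi + yj - xp - xq) =
    potG (yi + yj) (yi * yj) - potG (xp + xq) (yi * yj)"
  by (simp add: potG_def wide_u1_def power3_eq_cube power2_eq_square algebra_simps)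

lemma wide_u2_eq: "wide_u2 yi yj xp xq * (yi * yj - xp * xq) =
    potG (xp + xq) (yi * yj) - potG (xp + xq) (xp * xq)"
  by (simp add: potG_def wide_u2_def algebra_simps)

text \<open>
  \<open>Arc p i\<close> is an arc from \<open>x\<^sub>p\<close> to \<open>x\<^sub>i\<close>. \<open>Crossing pos p q i j\<close> is a crossing, positive iff \<open>pos\<close>, which
  drawn with its strands running from left to right has incoming endpoints \<open>x\<^sub>p\<close> (top), \<open>x\<^sub>q\<close> (bottom)
  and outgoing endpoints \<open>x\<^sub>i\<close> (top), \<open>x\<^sub>j\<close> (bottom).
\<close>

datatype piece = Arc nat nat | Crossing bool nat nat nat nat

text \<open>
  The rows \<open>(b, c)\<close> of the Koszul matrix of a piece, together with \<open>deg b\<close> for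
  \<open>deg a = 4\<close>, \<open>deg x\<^sub>i = 2\<close>. The flag selects the
  resolution: \<open>False\<close> for the parallel arcs, \<open>True\<close> for the wide edge.
\<close>

fun rows :: "piece \<Rightarrow> bool \<Rightarrow> (pring \<times> pring \<times> int) list"
  where
    "rows (Arc p i) w = [(arc_v (Var i) (Var p), Var i - Var p, 4)]"
  | "rows (Crossing pos p q i j) False =
      [(arc_v (Var i) (Var p), Var i - Var p, 4),
       (arc_v (Var j) (Var q), Var j - Var q, 4)]"
  | "rows (Crossing pos p q i j) True =
      [(wide_u1 (Var i) (Var j) (Var p) (Var q), Var i + Var j - Var p - Var q, 4),
       (wide_u2 (Var i) (Var j) (Var p) (Var q), Var i * Var j - Var p * Var q, 2)]"

text \<open>
  A basis element of the tensor product of the factorizations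
  \<open>R \<rightarrow> R{N + 1 - deg b} \<rightarrow> R\<close> is a list of bits; the bit of a row is \<open>True\<close> iff the
  corresponding factor is the generator in odd degree. Here \<open>N + 1 = 3\<close>.
\<close>

definition odd_count :: "bool list \<Rightarrow> int"
  where "odd_count bs = int (count_list bs True)"

definition sgn_pow :: "int \<Rightarrow> pring"
  where "sgn_pow n = (if even n then 1 else - 1)"

definition koszul_deg :: "(pring \<times> pring \<times> int) list \<Rightarrow> bool list \<Rightarrow> int"
  where "koszul_deg rs bs = (\<Sum>r<length rs. if bs ! r then 3 - snd (snd (rs ! r)) else 0)"

text \<open>The coefficient of the basis element \<open>bs'\<close> in the differential of the basis element \<open>bs\<close>.\<close>

definition koszul_d :: "(pring \<times> pring \<times> int) list \<Rightarrow> bool list \<Rightarrow> bool list \<Rightarrow> pring"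
  where "koszul_d rs bs bs' = (\<Sum>r<length rs. if bs' = bs[r := \<not> bs ! r]
    then sgn_pow (odd_count (take r bs)) * (if bs ! r then fst (snd (rs ! r)) else fst (rs ! r))
    else 0)"

text \<open>The basis degree in \<open>C\<^sub>P(\<Gamma>)\<close>, including the shift \<open>{-1}\<close> of the wide edge.\<close>

definition mf_deg :: "piece \<Rightarrow> bool \<Rightarrow> bool list \<Rightarrow> int"
  where "mf_deg pc w bs = koszul_deg (rows pc w) bs + (if w then - 1 else 0)"


section \<open>The homomorphisms \<open>\<chi>\<^sub>0\<close> and \<open>\<chi>\<^sub>1\<close>\<close>

text \<open>
  They are matrices over \<open>\<complex>[x\<^sub>1, x\<^sub>2, x\<^sub>3, x\<^sub>4, a]\<close>, for a crossing with the distinct variables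
  \<open>p = 1\<close>, \<open>q = 2\<close>, \<open>i = 3\<close>, \<open>j = 4\<close>; the entry \<open>f s t\<close> is the coefficient of \<open>t\<close> in the image of \<open>s\<close>.
\<close>

type_synonym bmatrix = "bool list \<Rightarrow> bool list \<Rightarrow> pring"

definition bits2 :: "bool list set"
  where "bits2 = {bs. length bs = 2}"

definition local_d :: "bool \<Rightarrow> bmatrix"
  where "local_d w = koszul_d (rows (Crossing True 1 2 3 4) w)"

definition local_deg :: "bool \<Rightarrow> bool list \<Rightarrow> int"
  where "local_deg w = mf_deg (Crossing True 1 2 3 4) w"

definition bcomp :: "bmatrix \<Rightarrow> bmatrix \<Rightarrow> bmatrix"
  where "bcomp g f s t = (\<Sum>u\<in>bits2. f s u * g u t)"

text \<open>\<open>f\<close> is an \<open>R\<close>-linear map of \<open>\<int>\<^sub>2\<close>-degree \<open>e\<close>.\<close>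

definition local_map :: "int \<Rightarrow> bmatrix \<Rightarrow> bool"
  where "local_map e f \<longleftrightarrow> (\<forall>s\<in>bits2. \<forall>t\<in>bits2. f s t \<in> polys {0..4} \<and>
    (f s t \<noteq> 0 \<longrightarrow> even (odd_count s + odd_count t + e)))"

definition mf_hom :: "bool \<Rightarrow> bool \<Rightarrow> bmatrix \<Rightarrow> bool"
  where "mf_hom w w' f \<longleftrightarrow> local_map 0 f \<and>
    (\<forall>s\<in>bits2. \<forall>t\<in>bits2. bcomp (local_d w') f s t = bcomp f (local_d w) s t)"

definition null_homotopic :: "bool \<Rightarrow> bool \<Rightarrow> bmatrix \<Rightarrow> bool"
  where "null_homotopic w w' f \<longleftrightarrow> (\<exists>h. local_map 1 h \<and>
    (\<forall>s\<in>bits2. \<forall>t\<in>bits2. f s t = bcomp (local_d w') h s t + bcomp h (local_d w) s t))"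

text \<open>\<open>is_chi False\<close> characterizes the choices for \<open>\<chi>\<^sub>0\<close> and \<open>is_chi True\<close> those for \<open>\<chi>\<^sub>1\<close>.\<close>

definition is_chi :: "bool \<Rightarrow> bmatrix \<Rightarrow> bool"
  where "is_chi w \<chi> \<longleftrightarrow>
    mf_hom w (\<not> w) \<chi> \<and> \<not> null_homotopic w (\<not> w) \<chi> \<and>
    (\<forall>s\<in>bits2. \<forall>t\<in>bits2.
      homogeneous (local_deg w s + 1 - local_deg (\<not> w) t) (\<chi> s t) \<and>
      \<chi> s t \<in> xfilt (local_deg w s + 1 - local_deg (\<not> w) t))"

definition crossing_subst :: "nat \<Rightarrow> nat \<Rightarrow> nat \<Rightarrow> nat \<Rightarrow> nat \<Rightarrow> nat"
  where "crossing_subst p q i j = (\<lambda>l. l)(1 := p, 2 := q, 3 := i, 4 := j)"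


section \<open>Marked oriented link diagrams\<close>

fun ins :: "piece \<Rightarrow> nat list"
  where
    "ins (Arc p i) = [p]"
  | "ins (Crossing pos p q i j) = [p, q]"

fun outs :: "piece \<Rightarrow> nat list"
  where
    "outs (Arc p i) = [i]"
  | "outs (Crossing pos p q i j) = [i, j]"

text \<open>
  Planarity is expressed through the combinatorial map whose vertices are the pieces and whose edges
  are the marked points. The edge of the marked point \<open>v\<close> has the darts \<open>(v, True)\<close>, at the piece with
  outgoing endpoint \<open>v\<close>, and \<open>(v, False)\<close>, at the piece with incoming endpoint \<open>v\<close>. The darts at a
  piece are listed in counterclockwise order.
\<close>

type_synonym dart = "nat \<times> bool"

fun darts_at :: "piece \<Rightarrow> dart list"
  where
    "darts_at (Arc p i) = [(i, True), (p, False)]"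
  | "darts_at (Crossing pos p q i j) = [(i, True), (p, False), (q, False), (j, True)]"

definition rotation :: "piece list \<Rightarrow> (dart \<times> dart) set"
  where "rotation D = {(darts_at pc ! r, darts_at pc ! (Suc r mod length (darts_at pc))) | pc r.
    pc \<in> set D \<and> r < length (darts_at pc)}"

definition flip :: "(dart \<times> dart) set"
  where "flip = {((v, e), (v, \<not> e)) | v e. True}"

definition darts :: "piece list \<Rightarrow> dart set"
  where "darts D = (\<Union>pc\<in>set D. set (darts_at pc))"

definition num_faces :: "piece list \<Rightarrow> nat"
  where "num_faces D = card (darts D // (flip O rotation D)\<^sup>*)"

definition num_components :: "piece list \<Rightarrow> nat"
  where "num_components D = card (darts D // (flip \<union> rotation D)\<^sup>*)"

definition planar :: "nat \<Rightarrow> piece list \<Rightarrow> bool"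
  where "planar m D \<longleftrightarrow>
    int (length D) - int m + int (num_faces D) = 2 * int (num_components D)"

text \<open>
  A diagram cut at its marked points \<open>1, \<dots>, m\<close>: every marked point is the outgoing endpoint of exactly
  one piece and the incoming endpoint of exactly one piece. Pieces only meet at marked points, so that
  there is one on each arc between crossings and on each crossingless circle.
\<close>

definition marked_diagram :: "nat \<Rightarrow> piece list \<Rightarrow> bool"
  where "marked_diagram m D \<longleftrightarrow>
    distinct (concat (map ins D)) \<and> set (concat (map ins D)) = {1..m} \<and>
    distinct (concat (map outs D)) \<and> set (concat (map outs D)) = {1..m} \<and>
    planar m D"


section \<open>The complex of matrix factorizations of a diagram\<close>

text \<open>A basis element of the complex of a piece: a resolution and a Koszul basis element.\<close>

type_synonym cell = "bool \<times> bool list"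

definition cells :: "piece \<Rightarrow> cell set"
  where "cells pc = {(w, bs). (w \<longrightarrow> (\<exists>pos p q i j. pc = Crossing pos p q i j)) \<and>
    length bs = length (rows pc w)}"

fun hshift :: "piece \<Rightarrow> bool \<Rightarrow> int"
  where
    "hshift (Arc p i) w = 0"
  | "hshift (Crossing True p q i j) w = (if w then - 1 else 0)"
  | "hshift (Crossing False p q i j) w = (if w then 1 else 0)"

text \<open>The shifts \<open>{N}\<close>, \<open>{N - 1}\<close>, \<open>{1 - N}\<close>, \<open>{-N}\<close> for \<open>N = 2\<close>.\<close>

fun qshift :: "piece \<Rightarrow> bool \<Rightarrow> int"
  where
    "qshift (Arc p i) w = 0"
  | "qshift (Crossing True p q i j) w = (if w then 2 else 1)"
  | "qshift (Crossing False p q i j) w = (if w then - 2 else - 1)"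

definition cell_hdeg :: "piece \<Rightarrow> cell \<Rightarrow> int"
  where "cell_hdeg pc c = hshift pc (fst c)"

definition cell_qdeg :: "piece \<Rightarrow> cell \<Rightarrow> int"
  where "cell_qdeg pc c = mf_deg pc (fst c) (snd c) + qshift pc (fst c)"

definition cell_parity :: "piece \<Rightarrow> cell \<Rightarrow> int"
  where "cell_parity pc c = odd_count (snd c)"

definition cell_dmf :: "piece \<Rightarrow> cell \<Rightarrow> cell \<Rightarrow> pring"
  where "cell_dmf pc c c' =
    (if fst c = fst c' then koszul_d (rows pc (fst c)) (snd c) (snd c') else 0)"

fun cell_dchi :: "bmatrix \<Rightarrow> bmatrix \<Rightarrow> piece \<Rightarrow> cell \<Rightarrow> cell \<Rightarrow> pring"
  where
    "cell_dchi \<chi>0 \<chi>1 (Arc p i) c c' = 0"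
  | "cell_dchi \<chi>0 \<chi>1 (Crossing True p q i j) c c' = (if fst c \<and> \<not> fst c'
      then rename (crossing_subst p q i j) (\<chi>1 (snd c) (snd c')) else 0)"
  | "cell_dchi \<chi>0 \<chi>1 (Crossing False p q i j) c c' = (if \<not> fst c \<and> fst c'
      then rename (crossing_subst p q i j) (\<chi>0 (snd c) (snd c')) else 0)"

text \<open>The tensor product of all pieces has as basis the lists of cells, one for each piece.\<close>

type_synonym chain = "cell list \<Rightarrow> pring"

definition gens :: "piece list \<Rightarrow> cell list set"
  where "gens D = listset (map cells D)"

definition chains :: "nat \<Rightarrow> piece list \<Rightarrow> chain set"
  where "chains m D = {v. (\<forall>g. v g \<in> polys {0..m}) \<and> (\<forall>g. g \<notin> gens D \<longrightarrow> v g = 0)}"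

definition total_deg :: "(piece \<Rightarrow> cell \<Rightarrow> int) \<Rightarrow> piece list \<Rightarrow> cell list \<Rightarrow> int"
  where "total_deg e D g = (\<Sum>k<length D. e (D ! k) (g ! k))"

text \<open>
  The differential of a tensor product of complexes with differentials \<open>\<delta>\<close>; \<open>e\<close> is the degree that
  governs the usual sign. The coefficient at \<open>g\<close> collects the contributions of all basis elements
  that differ from \<open>g\<close> in one cell.
\<close>

definition tensor_d ::
    "(piece \<Rightarrow> cell \<Rightarrow> int) \<Rightarrow> (piece \<Rightarrow> cell \<Rightarrow> cell \<Rightarrow> pring) \<Rightarrow> piece list \<Rightarrow> chain \<Rightarrow> chain"
  where "tensor_d e \<delta> D v = (\<lambda>g. if g \<in> gens D
    then \<Sum>k<length D. \<Sum>c\<in>cells (D ! k).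
      sgn_pow (total_deg e (take k D) (take k g)) * \<delta> (D ! k) c (g ! k) * v (g[k := c])
    else 0)"

definition d_mf :: "piece list \<Rightarrow> chain \<Rightarrow> chain"
  where "d_mf = tensor_d cell_parity cell_dmf"

definition d_chi :: "bmatrix \<Rightarrow> bmatrix \<Rightarrow> piece list \<Rightarrow> chain \<Rightarrow> chain"
  where "d_chi \<chi>0 \<chi>1 = tensor_d cell_hdeg (cell_dchi \<chi>0 \<chi>1)"

definition smul :: "pring \<Rightarrow> chain \<Rightarrow> chain"
  where "smul r v = (\<lambda>g. r * v g)"

definition hom_part :: "piece list \<Rightarrow> int \<Rightarrow> chain set"
  where "hom_part D i = {v. \<forall>g. v g \<noteq> 0 \<longrightarrow> total_deg cell_hdeg D g = i}"

definition pol_part :: "piece list \<Rightarrow> int \<Rightarrow> chain set"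
  where "pol_part D j = {v. \<forall>g. homogeneous (j - total_deg cell_qdeg D g) (v g)}"

definition x_filtration :: "piece list \<Rightarrow> int \<Rightarrow> chain set"
  where "x_filtration D n = {v. \<forall>g. v g \<in> xfilt (n - total_deg cell_qdeg D g)}"

definition C_P :: "nat \<Rightarrow> piece list \<Rightarrow> chain subquot"
  where "C_P m D = (chains m D, {0})"

definition C_N :: "nat \<Rightarrow> piece list \<Rightarrow> chain subquot"
  where "C_N m D = (chains m D, smul a_var ` chains m D)"

definition C_hat :: "nat \<Rightarrow> piece list \<Rightarrow> chain subquot"
  where "C_hat m D = (chains m D, smul (a_var - 1) ` chains m D)"


section \<open>The homologies and their invariants\<close>

definition KR_homology ::
    "bmatrix \<Rightarrow> bmatrix \<Rightarrow> piece list \<Rightarrow> chain subquot \<Rightarrow> chain subquot"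
  where "KR_homology \<chi>0 \<chi>1 D Q = sq_homology (d_chi \<chi>0 \<chi>1 D) (sq_homology (d_mf D) Q)"

definition H_P :: "bmatrix \<Rightarrow> bmatrix \<Rightarrow> nat \<Rightarrow> piece list \<Rightarrow> chain subquot"
  where "H_P \<chi>0 \<chi>1 m D = KR_homology \<chi>0 \<chi>1 D (C_P m D)"

definition H_N :: "bmatrix \<Rightarrow> bmatrix \<Rightarrow> nat \<Rightarrow> piece list \<Rightarrow> chain subquot"
  where "H_N \<chi>0 \<chi>1 m D = KR_homology \<chi>0 \<chi>1 D (C_N m D)"

definition H_hat :: "bmatrix \<Rightarrow> bmatrix \<Rightarrow> nat \<Rightarrow> piece list \<Rightarrow> chain subquot"
  where "H_hat \<chi>0 \<chi>1 m D = KR_homology \<chi>0 \<chi>1 D (C_hat m D)"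

text \<open>
  The bigraded pieces of a subquotient \<open>Z / B\<close> with \<open>Z\<close> and \<open>B\<close> spanned by homogeneous elements.
\<close>

definition bigrade :: "piece list \<Rightarrow> chain subquot \<Rightarrow> chain bigraded"
  where "bigrade D Q i j =
    (fst Q \<inter> hom_part D i \<inter> pol_part D j, snd Q \<inter> hom_part D i \<inter> pol_part D j)"

definition gr_hat :: "bmatrix \<Rightarrow> bmatrix \<Rightarrow> nat \<Rightarrow> piece list \<Rightarrow> chain bigraded"
  where "gr_hat \<chi>0 \<chi>1 m D i j = (let
      H = H_hat \<chi>0 \<chi>1 m D;
      H\<^sub>i = (fst H \<inter> hom_part D i, snd H \<inter> hom_part D i)
    in (fst (sq_filt (x_filtration D j) H\<^sub>i), fst (sq_filt (x_filtration D (j - 1)) H\<^sub>i)))"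

definition free_Ca :: "chain subquot \<Rightarrow> bool"
  where "free_Ca Q \<longleftrightarrow> (\<exists>S\<subseteq>fst Q.
    (\<forall>z\<in>fst Q. \<exists>T p. finite T \<and> T \<subseteq> S \<and> (\<forall>s\<in>T. p s \<in> polys {0}) \<and>
      z - (\<Sum>s\<in>T. smul (p s) s) \<in> snd Q) \<and>
    (\<forall>T p. finite T \<and> T \<subseteq> S \<and> (\<forall>s\<in>T. p s \<in> polys {0}) \<and>
      (\<Sum>s\<in>T. smul (p s) s) \<in> snd Q \<longrightarrow> (\<forall>s\<in>T. p s = 0)))"

definition sq_mult :: "pring \<Rightarrow> chain subquot \<Rightarrow> chain subquot"
  where "sq_mult r Q = ({smul r z + b | z b. z \<in> fst Q \<and> b \<in> snd Q}, snd Q)"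

text \<open>The infimum in \<^typ>\<open>enat\<close> is the minimum, and \<open>\<infinity>\<close> if there is no such \<open>n\<close>.\<close>

definition tw_P :: "bmatrix \<Rightarrow> bmatrix \<Rightarrow> nat \<Rightarrow> piece list \<Rightarrow> enat"
  where "tw_P \<chi>0 \<chi>1 m D = (INF n\<in>{n. free_Ca (sq_mult (a_var ^ n) (H_P \<chi>0 \<chi>1 m D))}. enat n)"

definition lht_N :: "bmatrix \<Rightarrow> bmatrix \<Rightarrow> nat \<Rightarrow> piece list \<Rightarrow> rat option"
  where "lht_N \<chi>0 \<chi>1 m D = (let
      H = bigrade D (H_N \<chi>0 \<chi>1 m D);
      S = {(of_int j\<^sub>1 - of_int j\<^sub>2) / 2 | i j\<^sub>1 j\<^sub>2. \<not> sq_zero (H i j\<^sub>1) \<and> \<not> sq_zero (H (i + 1) j\<^sub>2)}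
    in if S = {} then None else Some (Max S))"

text \<open>
  The connecting homomorphism sends the class of \<open>z\<close> to the class of \<open>w\<close> if \<open>y\<close> is a lift of \<open>z\<close> to
  \<open>H(C\<^sub>P(D), d\<^sub>m\<^sub>f)\<close> such that the class of \<open>d\<^sub>\<chi> y\<close> equals that of \<open>a w\<close>.
\<close>

definition KR_couple :: "bmatrix \<Rightarrow> bmatrix \<Rightarrow> nat \<Rightarrow> piece list \<Rightarrow> (chain, chain) couple"
  where "KR_couple \<chi>0 \<chi>1 m D = (let
      M\<^sub>P = sq_homology (d_mf D) (C_P m D);
      M\<^sub>N = sq_homology (d_mf D) (C_N m D);
      H\<^sub>P = H_P \<chi>0 \<chi>1 m D;
      H\<^sub>N = H_N \<chi>0 \<chi>1 m D
    in \<lparr>cA = H\<^sub>P, cE = H\<^sub>N,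
        cf = {(u, v). u \<in> fst H\<^sub>P \<and> v \<in> fst H\<^sub>P \<and> v - smul a_var u \<in> snd H\<^sub>P},
        cg = {(u, v). u \<in> fst H\<^sub>P \<and> v \<in> fst H\<^sub>N \<and> v - u \<in> snd H\<^sub>N},
        ch = {(z, w). z \<in> fst H\<^sub>N \<and> w \<in> fst H\<^sub>P \<and> (\<exists>y\<in>fst M\<^sub>P.
          y - z \<in> snd M\<^sub>N \<and> d_chi \<chi>0 \<chi>1 D y - smul a_var w \<in> snd M\<^sub>P)}\<rparr>)"

text \<open>The pages are indexed by \<open>r \<ge> 1\<close>; the first one is \<^term>\<open>H_N\<close>.\<close>

definition E_page :: "bmatrix \<Rightarrow> bmatrix \<Rightarrow> nat \<Rightarrow> piece list \<Rightarrow> nat \<Rightarrow> chain bigraded"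
  where "E_page \<chi>0 \<chi>1 m D r =
    bigrade D (cE ((derived_couple ^^ (r - 1)) (KR_couple \<chi>0 \<chi>1 m D)))"

definition collapses_at :: "bmatrix \<Rightarrow> bmatrix \<Rightarrow> nat \<Rightarrow> piece list \<Rightarrow> nat \<Rightarrow> bool"
  where "collapses_at \<chi>0 \<chi>1 m D t \<longleftrightarrow>
    (\<forall>r. bg_iso (E_page \<chi>0 \<chi>1 m D (t + r)) (E_page \<chi>0 \<chi>1 m D t))"

end

theory Submission
  imports Defs
begin

text \<open>
  \<open>H(C\<^sub>P(D), d\<^sub>m\<^sub>f)\<close> has no \<open>a\<close>-torsion and is finitely generated: one entry of each Koszul row is a nonzerodivisor
  modulo the entries chosen before, so that the row can be traded for the quotient by that entry. An arc
  identifies two variables, a wide edge acts like a cup and a cap, i.e. identifies \<open>x\<^sub>p\<close> with \<open>- x\<^sub>q\<close>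
  and \<open>x\<^sub>i\<close> with \<open>- x\<^sub>j\<close>, and closing a strand imposes \<open>3 x\<^sup>2 = a\<close>.

  Hence \<open>H\<^sub>P\<close> and \<open>H\<^sub>2\<close> are linked by a long exact sequence. A torsion class of order \<open>a\<^sup>n\<close> contributes to
  \<open>H\<^sub>2\<close> in adjacent homological degrees, with polynomial degrees that differ by at least \<open>4 n\<close>; since
  \<open>lht\<^sub>2 \<le> 3\<close> bounds this difference by \<open>6\<close>, \<open>n = 1\<close>. So \<open>H\<^sub>P\<close> is a sum of copies of \<open>\<complex>[a]\<close>, which
  survive for \<open>a = 1\<close>, and of \<open>\<complex>[a] / a\<close>, each of which yields a pair in \<open>H\<^sub>2\<close>.
\<close>

text \<open>Which entry of a row is a nonzerodivisor depends on the strands. If the two ends to be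
  joined belong to different strands, a linear entry identifies their variables; if they belong to
  the same strand, this linear relation holds already and a quadratic entry has to take over. The
  induction over the pieces therefore carries along how the half-edges have been joined so far. For
  \<open>N = 2\<close> the wide edge fits into this scheme because its second left entry is
  \<open>- 3 * (x_p + x_q)\<close>, linear with an invertible constant. Relations are recorded as
  the kernel of a normal form map on one fixed ring, so everything stays a subquotient of one space
  of chains.

  At \<open>a = 1\<close> the polynomial grading survives only modulo 4, the degree of
  \<open>a\<close>. The x-filtration restores it: the graded piece of level \<open>j\<close> is the
  degree \<open>j\<close> part of the homology over C[a] modulo torsion and multiples of
  \<open>a\<close>, so it counts free generators. All bidegrees modulo \<open>a\<close> are
  finite-dimensional, and the decomposition follows by comparing dimensions.\<close>

lemma pring_sum_monomials: "f = (\<Sum>\<mu>\<in>Poly_Mapping.keys f. Poly_Mapping.single \<mu> (Poly_Mapping.lookup f \<mu>))"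
  for f :: "'a \<Rightarrow>\<^sub>0 'b::comm_monoid_add"
proof (rule poly_mapping_eqI)
  fix \<nu>
  have "Poly_Mapping.lookup (\<Sum>\<mu>\<in>Poly_Mapping.keys f. Poly_Mapping.single \<mu> (Poly_Mapping.lookup f \<mu>)) \<nu>
    = (\<Sum>\<mu>\<in>Poly_Mapping.keys f. if \<mu> = \<nu> then Poly_Mapping.lookup f \<mu> else 0)"
    by (simp add: lookup_sum lookup_single when_def)
  also have "\<dots> = Poly_Mapping.lookup f \<nu>"
    by (simp add: sum.delta' in_keys_iff)
  finally show "Poly_Mapping.lookup f \<nu> = Poly_Mapping.lookup
    (\<Sum>\<mu>\<in>Poly_Mapping.keys f. Poly_Mapping.single \<mu> (Poly_Mapping.lookup f \<mu>)) \<nu>" by simp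
qed

lemma pring_monomial_induct [case_names zero single add]:
  assumes "P 0" "\<And>\<mu> c. \<mu> \<in> Poly_Mapping.keys f \<Longrightarrow> P (Poly_Mapping.single \<mu> c)"
    "\<And>f g. P f \<Longrightarrow> P g \<Longrightarrow> P (f + g)"
  shows "P (f :: 'a \<Rightarrow>\<^sub>0 'b::comm_monoid_add)"
proof -
  have "P (\<Sum>\<mu>\<in>A. Poly_Mapping.single \<mu> (Poly_Mapping.lookup f \<mu>))"
    if "finite A" "A \<subseteq> Poly_Mapping.keys f" for A
    using that by (induction A rule: finite_induct) (auto intro: assms)
  from this[of "Poly_Mapping.keys f"] show ?thesis
    using pring_sum_monomials[of f] by simp
qed

lemma Const_add: "Const (c + d) = Const c + Const d" by (simp add: Const_def single_add)
lemma Const_mult: "Const (c * d) = Const c * Const d" by (simp add: Const_def mult_single)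
lemma Const_uminus: "Const (- c) = - Const c" by (simp add: Const_def single_uminus)
lemma Const_0 [simp]: "Const 0 = 0" by (simp add: Const_def)
lemma Const_1 [simp]: "Const 1 = 1" by (simp add: Const_def)
lemma Const_numeral: "Const (numeral n) = numeral n" by (simp add: Const_def)
lemma Const_eq_0_iff [simp]: "Const c = 0 \<longleftrightarrow> c = 0"
  by (metis Const_0 Const_def lookup_single_eq)
lemma lookup_Const_mult: "Poly_Mapping.lookup (Const c * f) \<mu> = c * Poly_Mapping.lookup f \<mu>"
  unfolding Const_def mult_map_scale_conv_mult[symmetric]
  by (simp add: map.rep_eq when_def)

lemma Const_mult_single: "Const c * Poly_Mapping.single \<mu> d = Poly_Mapping.single \<mu> (c * d)"
  by (simp add: Const_def mult_single)

section \<open>Subrings of polynomials in a given set of variables\<close>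

lemma polys_iff: "f \<in> polys W \<longleftrightarrow> (\<forall>\<mu>. Poly_Mapping.lookup f \<mu> \<noteq> 0 \<longrightarrow> Poly_Mapping.keys \<mu> \<subseteq> W)"
  by (auto simp: polys_def in_keys_iff)

lemma polys_0 [simp]: "0 \<in> polys W" by (simp add: polys_def)
lemma polys_Const [simp]: "Const c \<in> polys W" by (simp add: polys_def Const_def)
lemma polys_1 [simp]: "1 \<in> polys W" using polys_Const[of 1 W] by simp
lemma polys_Var [simp]: "Var i \<in> polys W \<longleftrightarrow> i \<in> W" by (simp add: polys_def Var_def)

lemma polys_add: "f \<in> polys W \<Longrightarrow> g \<in> polys W \<Longrightarrow> f + g \<in> polys W"
  using keys_add[of f g] by (auto simp: polys_def)
lemma polys_uminus: "f \<in> polys W \<Longrightarrow> - f \<in> polys W"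
  by (simp add: polys_iff)
lemma polys_diff: "f \<in> polys W \<Longrightarrow> g \<in> polys W \<Longrightarrow> f - g \<in> polys W"
  using polys_add[of f W "- g"] polys_uminus[of g W] by simp
lemma keys_plus_subset: "Poly_Mapping.keys (\<mu> + \<nu> :: nat \<Rightarrow>\<^sub>0 nat) = Poly_Mapping.keys \<mu> \<union> Poly_Mapping.keys \<nu>"
  by (auto simp: in_keys_iff lookup_add)
lemma polys_mult: "f \<in> polys W \<Longrightarrow> g \<in> polys W \<Longrightarrow> f * g \<in> polys W"
  unfolding polys_def using subsetD[OF keys_mult[of f g]] by (fastforce simp: keys_plus_subset)
lemma polys_power: "f \<in> polys W \<Longrightarrow> f ^ n \<in> polys W"
  by (induction n) (auto intro: polys_mult)
lemma polys_sum: "(\<And>x. x \<in> A \<Longrightarrow> f x \<in> polys W) \<Longrightarrow> sum f A \<in> polys W"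
  by (induction A rule: infinite_finite_induct) (auto intro: polys_add)
lemma polys_prod: "(\<And>x. x \<in> A \<Longrightarrow> f x \<in> polys W) \<Longrightarrow> prod f A \<in> polys W"
  by (induction A rule: infinite_finite_induct) (auto intro: polys_mult)
lemma polys_numeral [simp]: "numeral n \<in> polys W"
  using polys_Const[of "numeral n" W] by (simp add: Const_numeral)
lemma polys_mono: "W \<subseteq> W' \<Longrightarrow> f \<in> polys W \<Longrightarrow> f \<in> polys W'"
  by (auto simp: polys_def)
lemma polys_single: "Poly_Mapping.keys \<mu> \<subseteq> W \<Longrightarrow> Poly_Mapping.single \<mu> c \<in> polys W"
  by (auto simp: polys_def)
lemmas polys_intros = polys_add polys_uminus polys_diff polys_mult polys_power

lemma scaleC_eq_Const: "c *\<^sub>C (f::pring) = Const c * f"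
  by (rule poly_mapping_eqI) (simp add: lookup_scaleC scaleC_complex_def lookup_Const_mult)

lemma Var_power: "Var i ^ n = Poly_Mapping.single (Poly_Mapping.single i n) 1"
  by (induction n) (auto simp: Var_def mult_single single_add[symmetric])

lemma single_Var: "Poly_Mapping.single (Poly_Mapping.single i 1 + \<mu>) c = Var i * Poly_Mapping.single \<mu> c"
  by (simp add: Var_def mult_single)

lemma single_induct_aux:
  assumes "\<And>c. P (Const c)"
    "\<And>f i. P f \<Longrightarrow> i \<in> W \<Longrightarrow> P (Var i * f)"
    "Poly_Mapping.keys \<mu> \<subseteq> W"
  shows "P (Poly_Mapping.single \<mu> c)"
  using assms(3)
proof (induction "\<Sum>i\<in>Poly_Mapping.keys \<mu>. Poly_Mapping.lookup \<mu> i" arbitrary: \<mu> rule: less_induct)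
  case less
  show ?case
  proof (cases "\<mu> = 0")
    case True then show ?thesis using assms(1)[of c] by (simp add: Const_def)
  next
    case False
    then obtain i where i: "i \<in> Poly_Mapping.keys \<mu>"
      using poly_mapping_eqI[of \<mu> 0] by (auto simp: in_keys_iff)
    define \<nu> where "\<nu> = \<mu> - Poly_Mapping.single i 1"
    have \<mu>: "\<mu> = Poly_Mapping.single i 1 + \<nu>"
      using i by (intro poly_mapping_eqI) (auto simp: \<nu>_def lookup_add lookup_minus lookup_single when_def in_keys_iff)
    have sub: "Poly_Mapping.keys \<nu> \<subseteq> Poly_Mapping.keys \<mu>" by (metis \<mu> keys_plus_subset Un_upper2)
    have "(\<Sum>j\<in>Poly_Mapping.keys \<nu>. Poly_Mapping.lookup \<nu> j) = (\<Sum>j\<in>Poly_Mapping.keys \<mu>. Poly_Mapping.lookup \<nu> j)"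
      by (rule sum.mono_neutral_left) (use sub in \<open>auto simp: in_keys_iff\<close>)
    also have "\<dots> < (\<Sum>j\<in>Poly_Mapping.keys \<mu>. Poly_Mapping.lookup \<mu> j)"
      by (rule sum_strict_mono_ex1) (use i in \<open>auto simp: \<mu> lookup_add lookup_single when_def\<close>)
    finally have "P (Poly_Mapping.single \<nu> c)" using less sub by blast
    then show ?thesis unfolding \<mu> single_Var using assms(2) i less.prems by blast
  qed
qed

text \<open>Splitting a monomial into single variables of \<open>W\<close> reduces statements about
  ring-like maps to multiplication by one variable at a time.\<close>

lemma polys_induct [consumes 1, case_names Const add Var]:
  assumes "f \<in> polys W" "\<And>c. P (Const c)"
    "\<And>f g. P f \<Longrightarrow> P g \<Longrightarrow> P (f + g)"
    "\<And>f i. P f \<Longrightarrow> i \<in> W \<Longrightarrow> P (Var i * f)"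
  shows "P f"
proof (induction f rule: pring_monomial_induct)
  case zero then show ?case using assms(2)[of 0] by simp
next
  case (single \<mu> c)
  then have "Poly_Mapping.keys \<mu> \<subseteq> W" using assms(1) by (auto simp: polys_def)
  then show ?case using single_induct_aux[of P W \<mu> c] assms by blast
qed (use assms in auto)

text \<open>Common form of the substitution \<open>rename\<close> and of the normal form
  \<open>reduct\<close>: both are determined linearly by their values on monomials, so
  multiplicativity becomes an identity between exponents.\<close>

definition lin_ext :: "((nat \<Rightarrow>\<^sub>0 nat) \<Rightarrow> pring) \<Rightarrow> pring \<Rightarrow> pring"
  where "lin_ext \<theta> f = (\<Sum>\<mu>\<in>Poly_Mapping.keys f. Const (Poly_Mapping.lookup f \<mu>) * \<theta> \<mu>)"

lemma lin_ext_superset: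
  "finite A \<Longrightarrow> Poly_Mapping.keys f \<subseteq> A \<Longrightarrow> lin_ext \<theta> f = (\<Sum>\<mu>\<in>A. Const (Poly_Mapping.lookup f \<mu>) * \<theta> \<mu>)"
  unfolding lin_ext_def by (rule sum.mono_neutral_left) (auto simp: in_keys_iff)

lemma lin_ext_add: "lin_ext \<theta> (f + g) = lin_ext \<theta> f + lin_ext \<theta> g"
proof -
  let ?A = "Poly_Mapping.keys f \<union> Poly_Mapping.keys g"
  have "lin_ext \<theta> h = (\<Sum>\<mu>\<in>?A. Const (Poly_Mapping.lookup h \<mu>) * \<theta> \<mu>)" if "h \<in> {f, g, f + g}" for h
    using that keys_add[of f g] by (intro lin_ext_superset) auto
  then show ?thesis by (simp add: lookup_add Const_add algebra_simps sum.distrib)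
qed

lemma lin_ext_single: "lin_ext \<theta> (Poly_Mapping.single \<mu> c) = Const c * \<theta> \<mu>"
  by (simp add: lin_ext_def)

lemma lin_ext_0 [simp]: "lin_ext \<theta> 0 = 0" by (simp add: lin_ext_def)

lemma lin_ext_polys: "f \<in> polys W \<Longrightarrow> (\<And>\<mu>. Poly_Mapping.keys \<mu> \<subseteq> W \<Longrightarrow> \<theta> \<mu> \<in> polys W') \<Longrightarrow> lin_ext \<theta> f \<in> polys W'"
  unfolding lin_ext_def by (intro polys_sum polys_mult polys_Const) (simp add: polys_def[of W])

lemma lin_ext_mult_left:
  assumes "\<And>\<mu>. \<theta> (\<nu> + \<mu>) = g * \<theta> \<mu>"
  shows "lin_ext \<theta> (Poly_Mapping.single \<nu> 1 * f) = g * lin_ext \<theta> f"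
  by (induction f rule: pring_monomial_induct)
    (auto simp: mult_single lin_ext_single lin_ext_add assms mult.left_commute distrib_left)

lemma lin_ext_mult:
  assumes "\<And>\<mu> \<nu>. \<theta> (\<mu> + \<nu>) = \<theta> \<mu> * \<theta> \<nu>"
  shows "lin_ext \<theta> (f * g) = lin_ext \<theta> f * lin_ext \<theta> g"
proof (induction f rule: pring_monomial_induct)
  case (single \<mu> c)
  then show ?case
    by (induction g rule: pring_monomial_induct)
      (auto simp: mult_single lin_ext_single lin_ext_add assms Const_mult algebra_simps)
qed (auto simp: lin_ext_add algebra_simps)

lemma rename_eq_lin_ext:
  "rename \<sigma> = lin_ext (\<lambda>\<mu>. \<Prod>i\<in>Poly_Mapping.keys \<mu>. Var (\<sigma> i) ^ Poly_Mapping.lookup \<mu> i)"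
  by (rule ext) (simp add: rename_def lin_ext_def)

lemma rename_add: "rename \<sigma> (f + g) = rename \<sigma> f + rename \<sigma> g"
  by (simp add: rename_eq_lin_ext lin_ext_add)

lemma rename_0 [simp]: "rename \<sigma> 0 = 0" by (simp add: rename_eq_lin_ext)

lemma rename_mult: "rename \<sigma> (f * g) = rename \<sigma> f * rename \<sigma> g"
  unfolding rename_eq_lin_ext
proof (rule lin_ext_mult)
  fix \<mu> \<nu> :: "nat \<Rightarrow>\<^sub>0 nat"
  let ?A = "Poly_Mapping.keys \<mu> \<union> Poly_Mapping.keys \<nu>"
  have "(\<Prod>i\<in>Poly_Mapping.keys h. Var (\<sigma> i) ^ Poly_Mapping.lookup h i)
      = (\<Prod>i\<in>?A. Var (\<sigma> i) ^ Poly_Mapping.lookup h i)" if "h \<in> {\<mu>, \<nu>}" for h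
    using that by (intro prod.mono_neutral_left) (auto simp: in_keys_iff)
  then show "(\<Prod>i\<in>Poly_Mapping.keys (\<mu> + \<nu>). Var (\<sigma> i) ^ Poly_Mapping.lookup (\<mu> + \<nu>) i) =
    (\<Prod>i\<in>Poly_Mapping.keys \<mu>. Var (\<sigma> i) ^ Poly_Mapping.lookup \<mu> i) *
    (\<Prod>i\<in>Poly_Mapping.keys \<nu>. Var (\<sigma> i) ^ Poly_Mapping.lookup \<nu> i)"
    by (simp add: keys_plus_subset lookup_add power_add prod.distrib)
qed

lemma rename_Const: "rename \<sigma> (Const c) = Const c"
  by (simp add: rename_eq_lin_ext lin_ext_single Const_def)

lemma rename_1 [simp]: "rename \<sigma> 1 = 1" using rename_Const[of \<sigma> 1] by simp
lemma rename_uminus: "rename \<sigma> (- f) = - rename \<sigma> f"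
  using rename_add[of \<sigma> f "- f"] by (simp add: minus_unique)
lemma rename_diff: "rename \<sigma> (f - g) = rename \<sigma> f - rename \<sigma> g"
  using rename_add[of \<sigma> f "- g"] by (simp add: rename_uminus)
lemma rename_numeral: "rename \<sigma> (numeral n) = numeral n"
  using rename_Const[of \<sigma> "numeral n"] by (simp add: Const_numeral)
lemma rename_power: "rename \<sigma> (f ^ n) = rename \<sigma> f ^ n"
  by (induction n) (auto simp: rename_mult)
lemma rename_Var: "rename \<sigma> (Var i) = Var (\<sigma> i)"
  by (simp add: rename_eq_lin_ext Var_def lin_ext_single)
lemma rename_sum: "rename \<sigma> (sum f A) = (\<Sum>x\<in>A. rename \<sigma> (f x))"
  by (induction A rule: infinite_finite_induct) (auto simp: rename_add)

lemmas rename_simps = rename_add rename_mult rename_Const rename_uminus rename_diff rename_numeral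
  rename_power rename_Var rename_sum

lemma rename_polys:
  assumes "f \<in> polys W" "\<sigma> ` W \<subseteq> W'"
  shows "rename \<sigma> f \<in> polys W'"
  using assms(1) by (induction rule: polys_induct)
    (use assms(2) in \<open>auto simp: rename_simps intro!: polys_add polys_mult\<close>)

section \<open>Homogeneous components\<close>

abbreviation pdeg :: "(nat \<Rightarrow>\<^sub>0 nat) \<Rightarrow> int"
  where "pdeg \<equiv> mon_deg (\<lambda>i. if i = 0 then 4 else 2)"

lemma mon_deg_superset:
  "finite A \<Longrightarrow> Poly_Mapping.keys \<mu> \<subseteq> A \<Longrightarrow> mon_deg w \<mu> = (\<Sum>i\<in>A. w i * int (Poly_Mapping.lookup \<mu> i))"
  unfolding mon_deg_def by (rule sum.mono_neutral_left) (auto simp: in_keys_iff)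

lemma mon_deg_add: "mon_deg w (\<mu> + \<nu>) = mon_deg w \<mu> + mon_deg w \<nu>"
proof -
  let ?A = "Poly_Mapping.keys \<mu> \<union> Poly_Mapping.keys \<nu>"
  have "mon_deg w h = (\<Sum>i\<in>?A. w i * int (Poly_Mapping.lookup h i))" if "h \<in> {\<mu>, \<nu>, \<mu> + \<nu>}" for h
    using that by (intro mon_deg_superset) (auto simp: keys_plus_subset)
  then show ?thesis by (simp add: lookup_add algebra_simps sum.distrib)
qed

lemma mon_deg_0 [simp]: "mon_deg w 0 = 0" by (simp add: mon_deg_def)
lemma mon_deg_single [simp]: "mon_deg w (Poly_Mapping.single i n) = w i * int n" by (simp add: mon_deg_def)
lemma mon_deg_nonneg: "(\<And>i. w i \<ge> 0) \<Longrightarrow> mon_deg w \<mu> \<ge> 0" by (auto simp: mon_deg_def intro: sum_nonneg)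
lemma mon_deg_mono: "(\<And>i. w i \<le> w' i) \<Longrightarrow> mon_deg w \<mu> \<le> mon_deg w' \<mu>"
  by (auto simp: mon_deg_def intro!: sum_mono mult_right_mono)

lemma homogeneous_iff: "homogeneous n f \<longleftrightarrow> (\<forall>\<mu>. Poly_Mapping.lookup f \<mu> \<noteq> 0 \<longrightarrow> pdeg \<mu> = n)"
  by (auto simp: homogeneous_def in_keys_iff)

lemma homogeneous_0 [simp]: "homogeneous n 0" by (simp add: homogeneous_def)
lemma homogeneousI: "(\<And>\<mu>. \<mu> \<in> Poly_Mapping.keys f \<Longrightarrow> pdeg \<mu> = n) \<Longrightarrow> homogeneous n f"
  unfolding homogeneous_def by (rule ballI)
lemma homogeneousD: "homogeneous n f \<Longrightarrow> \<mu> \<in> Poly_Mapping.keys f \<Longrightarrow> pdeg \<mu> = n"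
  unfolding homogeneous_def by (rule bspec)
lemma homogeneous_add:
  assumes "homogeneous n f" "homogeneous n g" shows "homogeneous n (f + g)"
proof (rule homogeneousI)
  fix \<mu> assume "\<mu> \<in> Poly_Mapping.keys (f + g)"
  then have "\<mu> \<in> Poly_Mapping.keys f \<or> \<mu> \<in> Poly_Mapping.keys g" using keys_add[of f g] by auto
  then show "pdeg \<mu> = n" using assms homogeneousD by (elim disjE)
qed
lemma homogeneous_uminus: "homogeneous n f \<Longrightarrow> homogeneous n (- f)"
  by (simp add: homogeneous_iff)
lemma homogeneous_diff: "homogeneous n f \<Longrightarrow> homogeneous n g \<Longrightarrow> homogeneous n (f - g)"
  using homogeneous_add[of n f "- g"] homogeneous_uminus[of n g] by simp
lemma homogeneous_mult:
  assumes "homogeneous n f" "homogeneous k g" shows "homogeneous (n + k) (f * g)"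
proof (rule homogeneousI)
  fix \<mu> assume "\<mu> \<in> Poly_Mapping.keys (f * g)"
  then obtain \<alpha> \<beta> where *: "\<mu> = \<alpha> + \<beta>" "\<alpha> \<in> Poly_Mapping.keys f" "\<beta> \<in> Poly_Mapping.keys g"
    using keys_mult[of f g] by auto
  show "pdeg \<mu> = n + k"
    unfolding *(1) mon_deg_add homogeneousD[OF assms(1) *(2)] homogeneousD[OF assms(2) *(3)] by (rule refl)
qed
lemma homogeneous_Const [simp]: "homogeneous 0 (Const c)" by (simp add: homogeneous_def Const_def)
lemma homogeneous_1 [simp]: "homogeneous 0 1" using homogeneous_Const[of 1] by simp
lemma homogeneous_Var: "homogeneous (if i = 0 then 4 else 2) (Var i)"
  by (simp add: homogeneous_def Var_def)
lemma homogeneous_sum: "(\<And>x. x \<in> A \<Longrightarrow> homogeneous n (f x)) \<Longrightarrow> homogeneous n (sum f A)"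
  by (induction A rule: infinite_finite_induct) (auto intro: homogeneous_add)

definition hcomp :: "int \<Rightarrow> pring \<Rightarrow> pring"
  where "hcomp n f = Poly_Mapping.mapp (\<lambda>\<mu> c. c when pdeg \<mu> = n) f"

lemma lookup_hcomp: "Poly_Mapping.lookup (hcomp n f) \<mu> = (Poly_Mapping.lookup f \<mu> when pdeg \<mu> = n)"
  by (simp add: hcomp_def lookup_mapp when_def in_keys_iff)

lemma hcomp_add: "hcomp n (f + g) = hcomp n f + hcomp n g"
  by (rule poly_mapping_eqI) (simp add: lookup_hcomp lookup_add when_def)
lemma hcomp_0 [simp]: "hcomp n 0 = 0"
  by (rule poly_mapping_eqI) (simp add: lookup_hcomp)
lemma hcomp_sum: "hcomp n (sum f A) = (\<Sum>x\<in>A. hcomp n (f x))"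
  by (induction A rule: infinite_finite_induct) (auto simp: hcomp_add)
lemma hcomp_scaleC: "hcomp n (c *\<^sub>C f) = c *\<^sub>C hcomp n f"
  by (rule poly_mapping_eqI) (simp add: lookup_hcomp lookup_scaleC when_def scaleC_complex_def)
lemma hcomp_hcomp: "hcomp n (hcomp k f) = (if n = k then hcomp n f else 0)"
  by (rule poly_mapping_eqI) (auto simp: lookup_hcomp when_def)
lemma homogeneous_hcomp: "homogeneous n (hcomp n f)"
  by (auto simp: homogeneous_iff lookup_hcomp when_def)
lemma hcomp_eq_iff: "hcomp n f = f \<longleftrightarrow> homogeneous n f"
proof
  assume "homogeneous n f"
  then show "hcomp n f = f"
    by (intro poly_mapping_eqI) (auto simp: lookup_hcomp homogeneous_iff when_def)
qed (metis homogeneous_hcomp)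
lemma hcomp_polys: "f \<in> polys W \<Longrightarrow> hcomp n f \<in> polys W"
  by (auto simp: polys_iff lookup_hcomp when_def)
lemma hcomp_neg: "n < 0 \<Longrightarrow> hcomp n f = 0"
proof (rule poly_mapping_eqI)
  fix \<mu> assume "n < 0"
  moreover have "pdeg \<mu> \<ge> 0" by (rule mon_deg_nonneg) auto
  ultimately show "Poly_Mapping.lookup (hcomp n f) \<mu> = Poly_Mapping.lookup 0 \<mu>"
    by (simp add: lookup_hcomp when_def)
qed

lemma hcomp_single: "hcomp n (Poly_Mapping.single \<mu> c) = (Poly_Mapping.single \<mu> c when pdeg \<mu> = n)"
  by (rule poly_mapping_eqI) (auto simp: lookup_hcomp lookup_single when_def)

lemma hcomp_mult:
  assumes "homogeneous k g" shows "hcomp n (g * f) = g * hcomp (n - k) f"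
proof (induction f rule: pring_monomial_induct)
  case (single \<nu> c)
  show ?case
  proof (cases "pdeg \<nu> = n - k")
    case True
    then have "homogeneous (n - k) (Poly_Mapping.single \<nu> c)" by (simp add: homogeneous_def)
    then have "homogeneous n (g * Poly_Mapping.single \<nu> c)" using homogeneous_mult[OF assms, of "n - k"] by simp
    then show ?thesis using True by (simp add: hcomp_eq_iff[THEN iffD2] hcomp_single)
  next
    case False
    have "homogeneous (k + pdeg \<nu>) (g * Poly_Mapping.single \<nu> c)"
      by (rule homogeneous_mult[OF assms]) (simp add: homogeneous_def)
    then have "hcomp n (g * Poly_Mapping.single \<nu> c) = 0"
      using False by (intro poly_mapping_eqI) (auto simp: lookup_hcomp homogeneous_iff when_def)
    then show ?thesis using False by (simp add: hcomp_single)
  qed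
qed (auto simp: hcomp_add algebra_simps)

lemma finite_hcomp_support: "finite {n. hcomp n f \<noteq> 0}"
proof (rule finite_subset)
  show "{n. hcomp n f \<noteq> 0} \<subseteq> pdeg ` Poly_Mapping.keys f"
  proof clarify
    fix n assume "hcomp n f \<noteq> 0"
    then obtain \<mu> where "Poly_Mapping.lookup (hcomp n f) \<mu> \<noteq> 0" by (metis lookup_zero poly_mapping_eqI)
    then show "n \<in> pdeg ` Poly_Mapping.keys f" by (auto simp: lookup_hcomp when_def in_keys_iff split: if_splits)
  qed
qed simp

lemma sum_hcomp:
  assumes "finite J" "{n. hcomp n f \<noteq> 0} \<subseteq> J"
  shows "(\<Sum>n\<in>J. hcomp n f) = f"
proof (rule poly_mapping_eqI)
  fix \<mu>
  have "Poly_Mapping.lookup (\<Sum>n\<in>J. hcomp n f) \<mu> = (\<Sum>n\<in>J. if n = pdeg \<mu> then Poly_Mapping.lookup f \<mu> else 0)"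
    by (simp add: lookup_sum lookup_hcomp when_def eq_commute)
  also have "\<dots> = Poly_Mapping.lookup f \<mu>"
  proof (cases "pdeg \<mu> \<in> J")
    case True then show ?thesis using assms by (simp add: sum.delta)
  next
    case False
    then have "hcomp (pdeg \<mu>) f = 0" using assms by blast
    then have "Poly_Mapping.lookup f \<mu> = 0" using lookup_hcomp[of "pdeg \<mu>" f \<mu>] by simp
    then show ?thesis using assms False by (simp add: sum.delta)
  qed
  finally show "Poly_Mapping.lookup (\<Sum>n\<in>J. hcomp n f) \<mu> = Poly_Mapping.lookup f \<mu>" .
qed

text \<open>The weight of \<open>a\<close> drops from 4 to 0 in the filtration, so the filtration
  degree of a monomial never exceeds its polynomial degree.\<close>

lemma xfilt_homogeneous:
  assumes "homogeneous n f" "n \<le> k"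
  shows "f \<in> xfilt k"
  unfolding xfilt_def
proof (clarify)
  fix \<mu> assume "\<mu> \<in> Poly_Mapping.keys f"
  then have "pdeg \<mu> = n" by (rule homogeneousD[OF assms(1)])
  moreover have "mon_deg (\<lambda>i. if i = 0 then 0 else 2) \<mu> \<le> pdeg \<mu>"
    by (rule mon_deg_mono) simp
  ultimately show "mon_deg (\<lambda>i. if i = 0 then 0 else 2) \<mu> \<le> k" using assms(2) by linarith
qed

lemma xfilt_add: "f \<in> xfilt n \<Longrightarrow> g \<in> xfilt n \<Longrightarrow> f + g \<in> xfilt n"
  using keys_add[of f g] by (auto simp: xfilt_def)

lemma xfilt_hcomp: "f \<in> xfilt n \<Longrightarrow> hcomp k f \<in> xfilt n"
  by (auto simp: xfilt_def in_keys_iff lookup_hcomp when_def split: if_splits)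

text \<open>A monomial whose degree exceeds its \<open>x\<close>-degree is divisible by \<open>a\<close>.\<close>

lemma homogeneous_xfilt_divide:
  assumes "homogeneous n f" "f \<in> xfilt k" "k < n" "f \<in> polys W"
  shows "\<exists>h. h \<in> polys W \<and> homogeneous (n - 4) h \<and> h \<in> xfilt k \<and> f = a_var * h"
proof -
  let ?s = "Poly_Mapping.single 0 1 :: nat \<Rightarrow>\<^sub>0 nat"
  have inj: "inj (\<lambda>\<mu>::nat \<Rightarrow>\<^sub>0 nat. ?s + \<mu>)" by (simp add: inj_on_def)
  \<comment> \<open>Division by \<open>a\<close> is the shift of exponents by \<open>?s\<close>;
    \<open>map_key\<close> reads off the shifted coefficients.\<close>
  obtain h where lk: "\<And>\<mu>. Poly_Mapping.lookup h \<mu> = Poly_Mapping.lookup f (?s + \<mu>)"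
    using map_key.rep_eq[OF inj, of f] by (metis comp_apply)
  have "P \<in> Poly_Mapping.keys f \<Longrightarrow> \<exists>\<mu>. P = ?s + \<mu>" for P
  proof -
    assume P: "P \<in> Poly_Mapping.keys f"
    have 1: "pdeg P = n" by (rule homogeneousD[OF assms(1) P])
    have 2: "mon_deg (\<lambda>i. if i = 0 then 0 else 2) P \<le> k"
      using assms(2) P unfolding xfilt_def by (elim CollectE) (rule bspec)
    \<comment> \<open>The two weights differ only at the variable 0, so a monomial without
      \<open>a\<close> would have equal degrees, against \<open>k < n\<close>.\<close>
    have "Poly_Mapping.lookup P 0 \<noteq> 0"
    proof
      assume "Poly_Mapping.lookup P 0 = 0"
      then have "0 \<notin> Poly_Mapping.keys P" by (simp add: in_keys_iff)
      then have "pdeg P = mon_deg (\<lambda>i. if i = 0 then 0 else 2) P"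
        unfolding mon_deg_def by (intro sum.cong refl) auto
      with 1 2 assms(3) show False by linarith
    qed
    then have "P = ?s + (P - ?s)"
      by (intro poly_mapping_eqI) (auto simp: lookup_add lookup_minus lookup_single when_def)
    then show ?thesis by blast
  qed
  note dv = this
  have f: "f = a_var * h"
  proof -
    have "a_var * h = (\<Sum>\<mu>\<in>Poly_Mapping.keys h. Poly_Mapping.single (?s + \<mu>) (Poly_Mapping.lookup f (?s + \<mu>)))"
      by (subst pring_sum_monomials[of h], simp only: sum_distrib_left) (simp add: Var_def mult_single lk)
    also have "\<dots> = (\<Sum>P\<in>(\<lambda>\<mu>. ?s + \<mu>) ` Poly_Mapping.keys h. Poly_Mapping.single P (Poly_Mapping.lookup f P))"
      by (subst sum.reindex) (auto simp: inj_on_def)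
    also have "(\<lambda>\<mu>. ?s + \<mu>) ` Poly_Mapping.keys h = Poly_Mapping.keys f"
    proof
      show "(\<lambda>\<mu>. ?s + \<mu>) ` Poly_Mapping.keys h \<subseteq> Poly_Mapping.keys f"
        by (auto simp: in_keys_iff lk)
      show "Poly_Mapping.keys f \<subseteq> (\<lambda>\<mu>. ?s + \<mu>) ` Poly_Mapping.keys h"
      proof
        fix P assume "P \<in> Poly_Mapping.keys f"
        moreover from dv[OF this] obtain \<mu> where "P = ?s + \<mu>" by (elim exE)
        ultimately show "P \<in> (\<lambda>\<mu>. ?s + \<mu>) ` Poly_Mapping.keys h" by (simp add: in_keys_iff lk)
      qed
    qed
    finally show ?thesis using pring_sum_monomials[of f] by simp
  qed
  have k: "\<mu> \<in> Poly_Mapping.keys h \<Longrightarrow> ?s + \<mu> \<in> Poly_Mapping.keys f" for \<mu>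
    by (simp add: in_keys_iff lk)
  have "h \<in> polys W"
    unfolding polys_def
  proof (intro CollectI ballI)
    fix \<mu> assume "\<mu> \<in> Poly_Mapping.keys h"
    then have "Poly_Mapping.keys (?s + \<mu>) \<subseteq> W" using k assms(4) unfolding polys_def by auto
    then show "Poly_Mapping.keys \<mu> \<subseteq> W" by (simp add: keys_plus_subset)
  qed
  moreover have "homogeneous (n - 4) h"
  proof (rule homogeneousI)
    fix \<mu> assume "\<mu> \<in> Poly_Mapping.keys h"
    then have "pdeg (?s + \<mu>) = n" using k homogeneousD[OF assms(1)] by simp
    then show "pdeg \<mu> = n - 4" unfolding mon_deg_add by simp
  qed
  moreover have "h \<in> xfilt k"
    unfolding xfilt_def
  proof (intro CollectI ballI)
    fix \<mu> assume "\<mu> \<in> Poly_Mapping.keys h"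
    then have "mon_deg (\<lambda>i. if i = 0 then 0 else 2) (?s + \<mu>) \<le> k"
      using k assms(2) unfolding xfilt_def by simp
    then show "mon_deg (\<lambda>i. if i = 0 then 0 else 2) \<mu> \<le> k" unfolding mon_deg_add by simp
  qed
  ultimately show ?thesis using f by blast
qed

section \<open>Reduction modulo a monic power of a variable\<close>

text \<open>The normal form modulo \<open>x\<^sup>k - t\<close>, where \<open>t\<close> does not involve \<open>x\<close>.\<close>

definition reduct :: "nat \<Rightarrow> nat \<Rightarrow> pring \<Rightarrow> pring \<Rightarrow> pring"
  where "reduct x k t = lin_ext (\<lambda>\<mu>. t ^ (Poly_Mapping.lookup \<mu> x div k) *
    Poly_Mapping.single (Poly_Mapping.update x (Poly_Mapping.lookup \<mu> x mod k) \<mu>) 1)"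

lemma reduct_add: "reduct x k t (f + g) = reduct x k t f + reduct x k t g"
  by (simp add: reduct_def lin_ext_add)

lemma reduct_Var_other:
  assumes "v \<noteq> x" shows "reduct x k t (Var v * f) = Var v * reduct x k t f"
  unfolding reduct_def Var_def
proof (rule lin_ext_mult_left)
  fix \<mu>
  have "Poly_Mapping.update x (Poly_Mapping.lookup \<mu> x mod k) (Poly_Mapping.single v 1 + \<mu>)
    = Poly_Mapping.single v 1 + Poly_Mapping.update x (Poly_Mapping.lookup \<mu> x mod k) \<mu>"
    using assms by (intro poly_mapping_eqI) (auto simp: lookup_update lookup_add lookup_single when_def)
  then show "t ^ (Poly_Mapping.lookup (Poly_Mapping.single v 1 + \<mu>) x div k) *
      Poly_Mapping.single (Poly_Mapping.update x (Poly_Mapping.lookup (Poly_Mapping.single v 1 + \<mu>) x mod k) (Poly_Mapping.single v 1 + \<mu>)) 1 =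
      Poly_Mapping.single (Poly_Mapping.single v 1) 1 * (t ^ (Poly_Mapping.lookup \<mu> x div k) * Poly_Mapping.single (Poly_Mapping.update x (Poly_Mapping.lookup \<mu> x mod k) \<mu>) 1)"
    using assms by (simp add: lookup_add lookup_single when_def mult_single mult.left_commute)
qed

lemma reduct_Const: "reduct x k t (Const c * f) = Const c * reduct x k t f"
proof -
  have "reduct x k t (Poly_Mapping.single 0 1 * (Const c * f)) = Const c * reduct x k t f"
    by (induction f rule: pring_monomial_induct)
      (auto simp: reduct_def mult_single lin_ext_single lin_ext_add algebra_simps Const_mult Const_mult_single)
  then show ?thesis by simp
qed

lemma reduct_mult:
  assumes "g \<in> polys W" "x \<notin> W" shows "reduct x k t (g * f) = g * reduct x k t f"
  using assms(1)
proof (induction g rule: polys_induct)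
  case (Var g i)
  then have "i \<noteq> x" using assms(2) by blast
  then show ?case using Var by (simp add: reduct_Var_other mult.assoc)
qed (simp_all add: reduct_Const reduct_add distrib_right)

lemma reduct_power:
  assumes "k > 0" shows "reduct x k t (Var x ^ k * f) = t * reduct x k t f"
  unfolding reduct_def Var_power
proof (rule lin_ext_mult_left)
  fix \<mu>
  have "Poly_Mapping.update x c (Poly_Mapping.single x k + \<mu>) = Poly_Mapping.update x c \<mu>" for c
    by (intro poly_mapping_eqI) (auto simp: lookup_update lookup_add lookup_single when_def)
  then show "t ^ (Poly_Mapping.lookup (Poly_Mapping.single x k + \<mu>) x div k) *
      Poly_Mapping.single (Poly_Mapping.update x (Poly_Mapping.lookup (Poly_Mapping.single x k + \<mu>) x mod k) (Poly_Mapping.single x k + \<mu>)) 1 =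
      t * (t ^ (Poly_Mapping.lookup \<mu> x div k) * Poly_Mapping.single (Poly_Mapping.update x (Poly_Mapping.lookup \<mu> x mod k) \<mu>) 1)"
    using assms by (simp add: lookup_add)
qed

lemma reduct_polys:
  assumes "f \<in> polys W" "t \<in> polys W" "x \<in> W" shows "reduct x k t f \<in> polys W"
  unfolding reduct_def
proof (rule lin_ext_polys[OF assms(1)])
  fix \<mu> :: "nat \<Rightarrow>\<^sub>0 nat" assume "Poly_Mapping.keys \<mu> \<subseteq> W"
  then have "Poly_Mapping.keys (Poly_Mapping.update x (Poly_Mapping.lookup \<mu> x mod k) \<mu>) \<subseteq> W"
    using assms(3) by (auto simp: keys_update)
  then show "t ^ (Poly_Mapping.lookup \<mu> x div k) *
      Poly_Mapping.single (Poly_Mapping.update x (Poly_Mapping.lookup \<mu> x mod k) \<mu>) 1 \<in> polys W"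
    by (intro polys_mult polys_power assms polys_single)
qed

lemma power_diff_multiple:
  assumes "u \<in> polys W" "t \<in> polys W"
  shows "\<exists>h\<in>polys W. u ^ n - t ^ n = (u - t) * h"
proof (induction n)
  case 0 then show ?case by (auto intro: bexI[of _ 0])
next
  case (Suc n)
  then obtain h where h: "h \<in> polys W" "u ^ n - t ^ n = (u - t) * h" by blast
  have "u ^ Suc n - t ^ Suc n = u * (u ^ n - t ^ n) + (u - t) * t ^ n" by (simp add: algebra_simps)
  also have "\<dots> = (u - t) * (u * h + t ^ n)" by (simp only: h) (simp add: algebra_simps)
  finally show ?case using h assms by (intro bexI[of _ "u * h + t ^ n"]) (auto intro!: polys_intros)
qed

text \<open>On a monomial with exponent \<open>k * q + r\<close> of \<open>x\<close> the difference
  is \<open>(x^k)^q - t^q\<close> times the remaining monomial, and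
  \<open>power_diff_multiple\<close> extracts the factor \<open>x^k - t\<close>.\<close>

lemma reduct_congruent:
  assumes "f \<in> polys W" "t \<in> polys W" "x \<in> W"
  shows "\<exists>h\<in>polys W. f - reduct x k t f = (Var x ^ k - t) * h"
proof (induction f rule: pring_monomial_induct)
  case zero show ?case by (auto simp: reduct_def intro: bexI[of _ 0])
next
  case (single \<mu> c)
  let ?\<nu> = "Poly_Mapping.update x (Poly_Mapping.lookup \<mu> x mod k) \<mu>"
  let ?q = "Poly_Mapping.lookup \<mu> x div k"
  have \<mu>W: "Poly_Mapping.keys \<mu> \<subseteq> W" using single assms(1) by (auto simp: polys_def)
  then have \<nu>: "Poly_Mapping.single ?\<nu> 1 \<in> polys W" by (intro polys_single) (use assms(3) in \<open>auto simp: keys_update\<close>)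
  have \<mu>: "\<mu> = Poly_Mapping.single x (k * ?q) + ?\<nu>"
    by (intro poly_mapping_eqI) (auto simp: lookup_update lookup_add lookup_single when_def)
  obtain h where h: "h \<in> polys W" "(Var x ^ k) ^ ?q - t ^ ?q = (Var x ^ k - t) * h"
    using power_diff_multiple[of "Var x ^ k" W t ?q] assms polys_power by auto
  have "Poly_Mapping.single \<mu> c = Const c * ((Var x ^ k) ^ ?q * Poly_Mapping.single ?\<nu> 1)"
    by (subst \<mu>) (simp add: Const_def power_mult[symmetric], simp add: Var_power mult_single)
  moreover have "reduct x k t (Poly_Mapping.single \<mu> c) = Const c * (t ^ ?q * Poly_Mapping.single ?\<nu> 1)"
    by (simp add: reduct_def lin_ext_single)
  ultimately have "Poly_Mapping.single \<mu> c - reduct x k t (Poly_Mapping.single \<mu> c)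
    = Const c * (((Var x ^ k) ^ ?q - t ^ ?q) * Poly_Mapping.single ?\<nu> 1)"
    by (simp only: right_diff_distrib left_diff_distrib)
  also have "\<dots> = (Var x ^ k - t) * (Const c * (h * Poly_Mapping.single ?\<nu> 1))"
    by (simp only: h) (simp add: algebra_simps)
  finally show ?case using h \<nu> by (intro bexI[of _ "Const c * (h * Poly_Mapping.single ?\<nu> 1)"] polys_mult) auto
next
  case (add f g)
  then obtain h h' where "h \<in> polys W" "h' \<in> polys W"
    "f - reduct x k t f = (Var x ^ k - t) * h" "g - reduct x k t g = (Var x ^ k - t) * h'" by blast
  moreover have "f + g - reduct x k t (f + g) = (f - reduct x k t f) + (g - reduct x k t g)"
    by (simp add: reduct_add)
  ultimately show ?case
    by (intro bexI[of _ "h + h'"]) (simp_all only: distrib_left polys_add)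
qed

text \<open>The polynomial ring is a domain, so being nonzero already makes such a relation a
  nonzerodivisor.\<close>

lemma Var_power_minus_nonzero:
  assumes "t \<in> polys W" "x \<notin> W" "k > 0" shows "Var x ^ k - t \<noteq> 0"
proof
  assume "Var x ^ k - t = 0"
  then have "Poly_Mapping.single (Poly_Mapping.single x k) 1 \<in> polys W" using assms by (simp add: Var_power)
  then show False using assms by (auto simp: polys_def split: if_splits)
qed

section \<open>The differentials of the tensor product\<close>

lemma gens_Nil [simp]: "gens [] = {[]}"
  by (simp add: gens_def)

lemma gens_Cons: "gens (pc # D) = {c # g | c g. c \<in> cells pc \<and> g \<in> gens D}"
  by (auto simp: gens_def set_Cons_def)

lemma Cons_in_gens [simp]: "c # g \<in> gens (pc # D) \<longleftrightarrow> c \<in> cells pc \<and> g \<in> gens D"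
  unfolding gens_Cons by blast

lemma gens_length: "g \<in> gens D \<Longrightarrow> length g = length D"
  by (induction D arbitrary: g) (auto simp: gens_Cons)

lemma gens_nth: "g \<in> gens D \<Longrightarrow> k < length D \<Longrightarrow> g ! k \<in> cells (D ! k)"
  by (induction D arbitrary: g k) (auto simp: gens_Cons nth_Cons split: nat.split)

lemma gens_update: "g \<in> gens D \<Longrightarrow> k < length D \<Longrightarrow> c \<in> cells (D ! k) \<Longrightarrow> g[k := c] \<in> gens D"
proof (induction D arbitrary: g k)
  case (Cons pc D)
  then obtain c' g' where "g = c' # g'" "c' \<in> cells pc" "g' \<in> gens D" unfolding gens_Cons by blast
  with Cons show ?case by (cases k) auto
qed simp

lemma length_2_conv: "length bs = 2 \<longleftrightarrow> (\<exists>x y. bs = [x, y])"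
  by (auto simp: numeral_2_eq_2 length_Suc_conv)

lemma bits2_eq: "bits2 = {[False, False], [False, True], [True, False], [True, True]}"
  unfolding bits2_def length_2_conv by auto

lemma cells_Arc: "cells (Arc p i) = {(False, [False]), (False, [True])}"
  by (auto simp: cells_def length_Suc_conv)

lemma length_rows_Crossing [simp]: "length (rows (Crossing pos p q i j) w) = 2"
  by (cases w) auto

lemma cells_Crossing: "cells (Crossing pos p q i j) = UNIV \<times> bits2"
  by (auto simp: cells_def bits2_def)

lemma finite_bits2 [simp]: "finite bits2" by (simp add: bits2_eq)

lemma finite_cells [simp]: "finite (cells pc)"
  by (cases pc) (auto simp: cells_Arc cells_Crossing)

lemma finite_gens [simp]: "finite (gens D)"
proof (induction D)
  case (Cons pc D)
  have "gens (pc # D) = (\<lambda>(c, g). c # g) ` (cells pc \<times> gens D)" by (auto simp: gens_Cons)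
  then show ?case using Cons by simp
qed simp

lemma total_deg_Nil [simp]: "total_deg e [] g = 0"
  by (simp add: total_deg_def)

lemma total_deg_Cons [simp]: "total_deg e (pc # D) (c # g) = e pc c + total_deg e D g"
  by (simp add: total_deg_def sum.lessThan_Suc_shift del: sum.lessThan_Suc)

lemma total_deg_update:
  "k < length D \<Longrightarrow> length g = length D \<Longrightarrow>
    total_deg e D (g[k := c]) = total_deg e D g + e (D ! k) c - e (D ! k) (g ! k)"
proof (induction D arbitrary: g k)
  case (Cons pc D)
  then obtain c' g' where "g = c' # g'" by (cases g) auto
  with Cons show ?case by (cases k) auto
qed simp

lemma sgn_pow_add: "sgn_pow (m + n) = sgn_pow m * sgn_pow n"
  by (auto simp: sgn_pow_def)

lemma sgn_pow_square [simp]: "sgn_pow m * sgn_pow m = 1" "sgn_pow m * (sgn_pow m * f) = f"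
  by (auto simp: sgn_pow_def)

lemma sgn_pow_polys [simp]: "sgn_pow n \<in> polys W"
  by (auto simp: sgn_pow_def polys_uminus)

lemma homogeneous_sgn_pow [simp]: "homogeneous 0 (sgn_pow n)"
  by (auto simp: sgn_pow_def homogeneous_uminus)

lemma tensor_d_Nil [simp]: "tensor_d e \<delta> [] v g = 0"
  by (simp add: tensor_d_def)

lemma tensor_d_outside: "g \<notin> gens D \<Longrightarrow> tensor_d e \<delta> D v g = 0"
  by (simp add: tensor_d_def)

text \<open>The recursion behind the inductions over diagrams: the summand with index 0 acts on the
  first piece without a sign, all others pass this piece and pick up its sign.\<close>

lemma tensor_d_Cons:
  assumes "c0 \<in> cells pc" "g \<in> gens D"
  shows "tensor_d e \<delta> (pc # D) v (c0 # g) =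
    (\<Sum>c\<in>cells pc. \<delta> pc c c0 * v (c # g)) + sgn_pow (e pc c0) * tensor_d e \<delta> D (\<lambda>h. v (c0 # h)) g"
  using assms
  by (simp add: tensor_d_def sum.lessThan_Suc_shift sgn_pow_add sum_distrib_left mult.assoc del: sum.lessThan_Suc)
    (simp add: sgn_pow_def)

lemma tensor_d_cong: "(\<And>g. g \<in> gens D \<Longrightarrow> v g = w g) \<Longrightarrow> tensor_d e \<delta> D v = tensor_d e \<delta> D w"
  by (auto simp: tensor_d_def fun_eq_iff gens_update intro!: sum.cong)

lemma tensor_d_add: "tensor_d e \<delta> D (\<lambda>g. v g + w g) g = tensor_d e \<delta> D v g + tensor_d e \<delta> D w g"
  by (simp add: tensor_d_def distrib_left sum.distrib)

lemma tensor_d_smul: "tensor_d e \<delta> D (\<lambda>g. r * v g) g = r * tensor_d e \<delta> D v g"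
  by (simp add: tensor_d_def sum_distrib_left mult.left_commute)

lemma tensor_d_zero: "tensor_d e \<delta> D (\<lambda>g. 0) g = 0"
  by (simp add: tensor_d_def)

lemma tensor_d_sum: "tensor_d e \<delta> D (\<lambda>g. \<Sum>c\<in>A. v c g) g = (\<Sum>c\<in>A. tensor_d e \<delta> D (v c) g)"
  by (induction A rule: infinite_finite_induct) (simp_all add: tensor_d_add tensor_d_zero)

lemma tensor_d_polys:
  assumes "\<And>pc c c'. pc \<in> set D \<Longrightarrow> c \<in> cells pc \<Longrightarrow> c' \<in> cells pc \<Longrightarrow> \<delta> pc c c' \<in> polys W"
    "\<And>g. v g \<in> polys W"
  shows "tensor_d e \<delta> D v g \<in> polys W"
  by (auto simp: tensor_d_def intro!: polys_sum polys_mult assms gens_nth)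

text \<open>\<open>\<kappa> = - 1\<close> is the square of a single differential, \<open>\<kappa> = 1\<close> the commutator of two.\<close>

lemma tensor_d_commutator:
  assumes
    "\<And>pc c0 c'. pc \<in> set D \<Longrightarrow> c0 \<in> cells pc \<Longrightarrow> c' \<in> cells pc \<Longrightarrow>
      (\<Sum>c\<in>cells pc. \<delta>1 pc c c0 * \<delta>2 pc c' c) - \<kappa> * (\<Sum>c\<in>cells pc. \<delta>2 pc c c0 * \<delta>1 pc c' c) =
      (if c' = c0 then w pc else 0)"
    "\<And>pc c c0. pc \<in> set D \<Longrightarrow> c0 \<in> cells pc \<Longrightarrow> c \<in> cells pc \<Longrightarrow>
      \<delta>1 pc c c0 * sgn_pow (e2 pc c) = \<kappa> * sgn_pow (e2 pc c0) * \<delta>1 pc c c0"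
    "\<And>pc c c0. pc \<in> set D \<Longrightarrow> c0 \<in> cells pc \<Longrightarrow> c \<in> cells pc \<Longrightarrow>
      sgn_pow (e1 pc c0) * \<delta>2 pc c c0 = \<kappa> * \<delta>2 pc c c0 * sgn_pow (e1 pc c)"
    "e1 = e2 \<or> (\<forall>pc. w pc = 0)"
    and g: "g \<in> gens D"
  shows "tensor_d e1 \<delta>1 D (tensor_d e2 \<delta>2 D v) g - \<kappa> * tensor_d e2 \<delta>2 D (tensor_d e1 \<delta>1 D v) g =
    (\<Sum>pc\<leftarrow>D. w pc) * v g"
  using assms(1-3) g
proof (induction D arbitrary: v g)
  case (Cons pc D)
  then obtain c0 h where g: "g = c0 # h" and c0: "c0 \<in> cells pc" and h: "h \<in> gens D"
    by (auto simp: gens_Cons)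
  let ?v = "\<lambda>c h. v (c # h)"
  let ?d1 = "tensor_d e1 \<delta>1 D" and ?d2 = "tensor_d e2 \<delta>2 D"
  \<comment> \<open>Of two successive differentials both may act on the first piece, one on it and
    the other on the rest, in two orders, or both on the rest. The first kind is settled by
    \<open>A\<close>, the mixed terms cancel by \<open>B\<close> and \<open>C\<close>, and the last
    kind is the induction hypothesis.\<close>
  have expand: "tensor_d e \<delta> (pc # D) (tensor_d e' \<delta>' (pc # D) v) (c0 # h) =
      (\<Sum>c'\<in>cells pc. (\<Sum>c\<in>cells pc. \<delta> pc c c0 * \<delta>' pc c' c) * v (c' # h))
      + (\<Sum>c\<in>cells pc. \<delta> pc c c0 * sgn_pow (e' pc c) * tensor_d e' \<delta>' D (?v c) h)
      + (\<Sum>c\<in>cells pc. sgn_pow (e pc c0) * \<delta>' pc c c0 * tensor_d e \<delta> D (?v c) h)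
      + sgn_pow (e pc c0) * sgn_pow (e' pc c0) * tensor_d e \<delta> D (tensor_d e' \<delta>' D (?v c0)) h"
    for e e' \<delta> \<delta>'
  proof -
    have "tensor_d e \<delta> D (\<lambda>h. tensor_d e' \<delta>' (pc # D) v (c0 # h)) =
       tensor_d e \<delta> D (\<lambda>h. (\<Sum>c\<in>cells pc. \<delta>' pc c c0 * v (c # h)) + sgn_pow (e' pc c0) * tensor_d e' \<delta>' D (?v c0) h)"
      by (rule tensor_d_cong) (simp add: tensor_d_Cons c0)
    then have 1: "tensor_d e \<delta> D (\<lambda>h. tensor_d e' \<delta>' (pc # D) v (c0 # h)) h =
      (\<Sum>c\<in>cells pc. \<delta>' pc c c0 * tensor_d e \<delta> D (?v c) h) + sgn_pow (e' pc c0) * tensor_d e \<delta> D (tensor_d e' \<delta>' D (?v c0)) h"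
      by (simp add: tensor_d_add tensor_d_sum tensor_d_smul)
    have 2: "(\<Sum>c\<in>cells pc. \<delta> pc c c0 * tensor_d e' \<delta>' (pc # D) v (c # h)) =
      (\<Sum>c\<in>cells pc. \<Sum>c'\<in>cells pc. \<delta> pc c c0 * \<delta>' pc c' c * v (c' # h)) +
      (\<Sum>c\<in>cells pc. \<delta> pc c c0 * sgn_pow (e' pc c) * tensor_d e' \<delta>' D (?v c) h)"
      by (simp add: tensor_d_Cons h distrib_left sum.distrib sum_distrib_left mult.assoc)
    show ?thesis
      unfolding tensor_d_Cons[OF c0 h] 1 2
      by (subst sum.swap) (simp add: distrib_left sum_distrib_left sum_distrib_right mult.assoc)
  qed
  have IH: "?d1 (?d2 (?v c0)) h - \<kappa> * ?d2 (?d1 (?v c0)) h = (\<Sum>pc\<leftarrow>D. w pc) * v (c0 # h)"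
    using Cons.IH[OF Cons.prems(1-3) h] by simp
  have A: "(\<Sum>c'\<in>cells pc. (\<Sum>c\<in>cells pc. \<delta>1 pc c c0 * \<delta>2 pc c' c) * v (c' # h))
    - \<kappa> * (\<Sum>c'\<in>cells pc. (\<Sum>c\<in>cells pc. \<delta>2 pc c c0 * \<delta>1 pc c' c) * v (c' # h)) = w pc * v (c0 # h)"
  proof -
    have "(\<Sum>c'\<in>cells pc. (\<Sum>c\<in>cells pc. \<delta>1 pc c c0 * \<delta>2 pc c' c) * v (c' # h))
      - \<kappa> * (\<Sum>c'\<in>cells pc. (\<Sum>c\<in>cells pc. \<delta>2 pc c c0 * \<delta>1 pc c' c) * v (c' # h)) =
      (\<Sum>c'\<in>cells pc. ((\<Sum>c\<in>cells pc. \<delta>1 pc c c0 * \<delta>2 pc c' c)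
        - \<kappa> * (\<Sum>c\<in>cells pc. \<delta>2 pc c c0 * \<delta>1 pc c' c)) * v (c' # h))"
      by (simp only: left_diff_distrib sum_subtractf mult.assoc sum_distrib_left[symmetric])
    also have "\<dots> = (\<Sum>c'\<in>cells pc. if c' = c0 then w pc * v (c0 # h) else 0)"
      by (rule sum.cong) (use Cons.prems(1)[of pc] c0 in auto)
    finally show ?thesis using c0 by simp
  qed
  have B: "(\<Sum>c\<in>cells pc. \<delta>1 pc c c0 * sgn_pow (e2 pc c) * ?d2 (?v c) h) =
      \<kappa> * (\<Sum>c\<in>cells pc. sgn_pow (e2 pc c0) * \<delta>1 pc c c0 * ?d2 (?v c) h)"
    unfolding sum_distrib_left by (rule sum.cong) (use Cons.prems(2)[of pc c0] c0 in \<open>auto simp: mult.assoc\<close>)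
  have C: "(\<Sum>c\<in>cells pc. sgn_pow (e1 pc c0) * \<delta>2 pc c c0 * ?d1 (?v c) h) =
      \<kappa> * (\<Sum>c\<in>cells pc. \<delta>2 pc c c0 * sgn_pow (e1 pc c) * ?d1 (?v c) h)"
    unfolding sum_distrib_left by (rule sum.cong) (use Cons.prems(3)[of pc c0] c0 in \<open>auto simp: mult.assoc\<close>)
  \<comment> \<open>For a square both signs agree and multiply to 1; for two different differentials
    the weights vanish.\<close>
  have W: "sgn_pow (e1 pc c0) * sgn_pow (e2 pc c0) * (\<Sum>pc\<leftarrow>D. w pc) = (\<Sum>pc\<leftarrow>D. w pc)"
  proof -
    have "(\<Sum>pc\<leftarrow>D. w pc) = 0" if "\<forall>pc. w pc = 0" using that by (induction D) simp_all
    then show ?thesis using assms(4) by fastforce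
  qed
  let ?s = "sgn_pow (e1 pc c0) * sgn_pow (e2 pc c0)"
  have "tensor_d e1 \<delta>1 (pc # D) (tensor_d e2 \<delta>2 (pc # D) v) g
      - \<kappa> * tensor_d e2 \<delta>2 (pc # D) (tensor_d e1 \<delta>1 (pc # D) v) g
    = w pc * v (c0 # h) + ?s * (?d1 (?d2 (?v c0)) h - \<kappa> * ?d2 (?d1 (?v c0)) h)"
    unfolding g expand B C A[symmetric] by (simp add: algebra_simps)
  also have "\<dots> = (\<Sum>pc\<leftarrow>pc # D. w pc) * v g"
    unfolding IH mult.assoc[symmetric] W g by (simp add: algebra_simps)
  finally show ?case .
qed simp

section \<open>The differentials on a piece\<close>

lemma koszul_d_1: "koszul_d [(b, c, n)] [x] [x'] = (if x' = (\<not> x) then (if x then c else b) else 0)"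
  by (auto simp: koszul_d_def sgn_pow_def odd_count_def)

lemma koszul_d_2: "koszul_d [(b1, c1, n1), (b2, c2, n2)] [x, y] [x', y'] =
    (if x' = (\<not> x) \<and> y' = y then (if x then c1 else b1) else 0) +
    (if x' = x \<and> y' = (\<not> y) then (if x then - 1 else 1) * (if y then c2 else b2) else 0)"
  by (auto simp: koszul_d_def sgn_pow_def odd_count_def)

fun piece_pot :: "piece \<Rightarrow> pring"
  where
    "piece_pot (Arc p i) = pot (Var i) - pot (Var p)"
  | "piece_pot (Crossing pos p q i j) = pot (Var i) + pot (Var j) - pot (Var p) - pot (Var q)"

text \<open>The two paths between basis elements that differ in both bits carry opposite signs and
  cancel; only the returns to the starting element remain.\<close>

lemma koszul_square_2:
  assumes "rs = [(b1, c1, n1), (b2, c2, n2)]" "s \<in> bits2" "t \<in> bits2"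
  shows "(\<Sum>u\<in>bits2. koszul_d rs u t * koszul_d rs s u) = (if s = t then b1 * c1 + b2 * c2 else 0)"
  using assms(2,3) unfolding assms(1) bits2_eq
  by (elim insertE emptyE) (simp_all add: koszul_d_2 mult.commute)

text \<open>Both resolutions of a crossing factor the same potential; for the wide edge the middle
  terms in \<open>potG\<close> telescope.\<close>

lemma row_pot:
  "arc_v (Var i) (Var p) * (Var i - Var p) + arc_v (Var j) (Var q) * (Var j - Var q) = piece_pot (Crossing pos p q i j)"
  "wide_u1 (Var i) (Var j) (Var p) (Var q) * (Var i + Var j - Var p - Var q) +
    wide_u2 (Var i) (Var j) (Var p) (Var q) * (Var i * Var j - Var p * Var q) = piece_pot (Crossing pos p q i j)"
  unfolding arc_v_eq wide_u1_eq wide_u2_eq by (simp_all add: potG_eq)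

lemma koszul_square_Crossing:
  assumes "s \<in> bits2" "t \<in> bits2"
  shows "(\<Sum>u\<in>bits2. koszul_d (rows (Crossing pos p q i j) w) u t * koszul_d (rows (Crossing pos p q i j) w) s u) =
    (if s = t then piece_pot (Crossing pos p q i j) else 0)"
proof (cases w)
  case True
  then have w: "w = True" by simp
  show ?thesis unfolding w rows.simps koszul_square_2[OF refl assms] row_pot(2)[of _ _ _ _ pos] by simp
next
  case False
  then have w: "w = False" by simp
  show ?thesis unfolding w rows.simps koszul_square_2[OF refl assms] row_pot(1)[of _ _ _ _ pos] by simp
qed

lemma sum_cells_Crossing: "(\<Sum>c\<in>cells (Crossing pos p q i j). f c) = (\<Sum>w\<in>UNIV. \<Sum>u\<in>bits2. f (w, u))"
  by (simp add: cells_Crossing sum.cartesian_product)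

lemma cell_dmf_square:
  assumes "c0 \<in> cells pc" "c' \<in> cells pc"
  shows "(\<Sum>c\<in>cells pc. cell_dmf pc c c0 * cell_dmf pc c' c) = (if c' = c0 then piece_pot pc else 0)"
proof (cases pc)
  case (Arc p i)
  show ?thesis
    using assms arc_v_eq[of "Var i" "Var p"] unfolding Arc cells_Arc
    by (auto simp: cell_dmf_def koszul_d_1 mult.commute)
next
  case (Crossing pos p q i j)
  obtain w0 s where c0: "c0 = (w0, s)" "s \<in> bits2" using assms(1) by (cases c0) (auto simp: Crossing cells_Crossing)
  obtain w' t where c': "c' = (w', t)" "t \<in> bits2" using assms(2) by (cases c') (auto simp: Crossing cells_Crossing)
  let ?k = "\<lambda>w. koszul_d (rows (Crossing pos p q i j) w)"
  have "(\<Sum>c\<in>cells pc. cell_dmf pc c c0 * cell_dmf pc c' c) =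
    (\<Sum>w\<in>UNIV. if w = w0 \<and> w = w' then (\<Sum>u\<in>bits2. ?k w u s * ?k w t u) else 0)"
    unfolding Crossing sum_cells_Crossing c0 c' cell_dmf_def by (rule sum.cong) auto
  also have "\<dots> = (\<Sum>w\<in>UNIV. if w = w0 \<and> w = w' then (if t = s then piece_pot pc else 0) else 0)"
    by (simp only: Crossing koszul_square_Crossing[OF c'(2) c0(2)])
  also have "\<dots> = (if c' = c0 then piece_pot pc else 0)" by (auto simp: c0 c' UNIV_bool)
  finally show ?thesis .
qed

lemma cell_dmf_parity:
  assumes "c0 \<in> cells pc" "c \<in> cells pc"
  shows "cell_dmf pc c c0 * sgn_pow (cell_parity pc c) = - 1 * sgn_pow (cell_parity pc c0) * cell_dmf pc c c0"
  using assms
  by (cases pc) (auto simp: cells_Arc cells_Crossing bits2_eq cell_dmf_def cell_parity_def koszul_d_1 koszul_d_2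
      sgn_pow_def odd_count_def)

lemma d_mf_square:
  assumes "g \<in> gens D"
  shows "d_mf D (d_mf D v) g = (\<Sum>pc\<leftarrow>D. piece_pot pc) * v g"
proof -
  \<comment> \<open>With \<open>\<kappa> = - 1\<close> the left side is twice the square. This
    explains the weights \<open>2 * piece_pot pc\<close>; the factor 2 is cancelled at the
    end.\<close>
  have "d_mf D (d_mf D v) g - (- 1) * d_mf D (d_mf D v) g = (\<Sum>pc\<leftarrow>D. 2 * piece_pot pc) * v g"
    unfolding d_mf_def
  proof (rule tensor_d_commutator)
    show "sgn_pow (cell_parity pc c0) * cell_dmf pc c c0 = - 1 * cell_dmf pc c c0 * sgn_pow (cell_parity pc c)"
      if "c0 \<in> cells pc" "c \<in> cells pc" for pc c c0
      using cell_dmf_parity[OF that] by (simp add: mult.assoc)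
  qed (use assms in \<open>auto simp: cell_dmf_square cell_dmf_parity\<close>)
  then show ?thesis by (simp add: sum_list_const_mult mult.assoc)
qed

text \<open>The closed forms of the difference quotients commute with every renaming of variables,
  also with one that identifies endpoints. Hence the chain map property of \<open>\<chi>\<close>,
  known for four distinct variables, passes to every crossing.\<close>

lemma rename_local_d:
  assumes "s \<in> bits2" "t \<in> bits2"
  shows "rename (crossing_subst p q i j) (local_d w s t) = koszul_d (rows (Crossing pos p q i j) w) s t"
  using assms unfolding bits2_eq
  by (cases w; elim insertE emptyE)
    (simp_all add: local_d_def koszul_d_2 rename_simps crossing_subst_def arc_v_def wide_u1_def wide_u2_def)

lemma rename_chi_commute:
  assumes "mf_hom w w' \<chi>" "s \<in> bits2" "t \<in> bits2"
  shows "(\<Sum>u\<in>bits2. koszul_d (rows (Crossing pos p q i j) w') u t * rename (crossing_subst p q i j) (\<chi> s u)) =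
    (\<Sum>u\<in>bits2. rename (crossing_subst p q i j) (\<chi> u t) * koszul_d (rows (Crossing pos p q i j) w) s u)"
proof -
  have "bcomp (local_d w') \<chi> s t = bcomp \<chi> (local_d w) s t"
    using assms by (simp add: mf_hom_def)
  then have "rename (crossing_subst p q i j) (bcomp (local_d w') \<chi> s t) = rename (crossing_subst p q i j) (bcomp \<chi> (local_d w) s t)"
    by simp
  then show ?thesis
    using assms by (simp add: bcomp_def rename_simps rename_local_d[where pos = pos] mult.commute)
qed

lemma is_chi_mf_hom: "is_chi w \<chi> \<Longrightarrow> mf_hom w (\<not> w) \<chi>"
  by (simp add: is_chi_def)

lemma cell_dmf_dchi_commute:
  assumes "is_chi False \<chi>0" "is_chi True \<chi>1" "c0 \<in> cells pc" "c' \<in> cells pc"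
  shows "(\<Sum>c\<in>cells pc. cell_dmf pc c c0 * cell_dchi \<chi>0 \<chi>1 pc c' c) =
    (\<Sum>c\<in>cells pc. cell_dchi \<chi>0 \<chi>1 pc c c0 * cell_dmf pc c' c)"
proof (cases pc)
  case (Crossing pos p q i j)
  obtain w0 s where c0: "c0 = (w0, s)" "s \<in> bits2" using assms(3) by (cases c0) (auto simp: Crossing cells_Crossing)
  obtain w' t where c': "c' = (w', t)" "t \<in> bits2" using assms(4) by (cases c') (auto simp: Crossing cells_Crossing)
  note h = rename_chi_commute[OF is_chi_mf_hom[OF assms(1)] c'(2) c0(2), where pos = pos]
    rename_chi_commute[OF is_chi_mf_hom[OF assms(2)] c'(2) c0(2), where pos = pos]
  show ?thesis
    unfolding Crossing sum_cells_Crossing c0 c' cell_dmf_def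
    by (cases pos; cases w0; cases w') (use h[of p q i j] in \<open>simp_all add: UNIV_bool\<close>)
qed simp

text \<open>\<open>cell_dchi\<close> leads from one resolution of a crossing to the other and never
  back.\<close>

lemma cell_dchi_square: "cell_dchi \<chi>0 \<chi>1 pc c c0 * cell_dchi \<chi>0 \<chi>1 pc c' c = 0"
proof (cases pc)
  case (Crossing pos p q i j)
  show ?thesis unfolding Crossing by (cases pos) auto
qed simp

lemma cell_dchi_hdeg:
  "cell_dchi \<chi>0 \<chi>1 pc c c0 = 0 \<or> cell_hdeg pc c0 = cell_hdeg pc c + 1"
proof (cases pc)
  case (Crossing pos p q i j)
  show ?thesis unfolding Crossing cell_hdeg_def by (cases pos) auto
qed simp

lemma cell_dmf_hdeg: "cell_dmf pc c c0 = 0 \<or> cell_hdeg pc c0 = cell_hdeg pc c"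
  by (simp add: cell_dmf_def cell_hdeg_def)

lemma d_chi_square: "d_chi \<chi>0 \<chi>1 D (d_chi \<chi>0 \<chi>1 D v) g = 0"
proof (cases "g \<in> gens D")
  case True
  let ?d = "d_chi \<chi>0 \<chi>1 D"
  have s: "cell_dchi \<chi>0 \<chi>1 pc c c0 * sgn_pow (cell_hdeg pc c) = - 1 * sgn_pow (cell_hdeg pc c0) * cell_dchi \<chi>0 \<chi>1 pc c c0" for pc c c0
    using cell_dchi_hdeg[of \<chi>0 \<chi>1 pc c c0] by (auto simp: sgn_pow_def)
  have "?d (?d v) g - (- 1) * ?d (?d v) g = (\<Sum>pc\<leftarrow>D. 0) * v g"
    unfolding d_chi_def
  proof (rule tensor_d_commutator)
    show "sgn_pow (cell_hdeg pc c0) * cell_dchi \<chi>0 \<chi>1 pc c c0 = - 1 * cell_dchi \<chi>0 \<chi>1 pc c c0 * sgn_pow (cell_hdeg pc c)" for pc c c0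
      using s[of pc c c0] by (simp add: mult.assoc)
  qed (use True s in \<open>auto simp: cell_dchi_square\<close>)
  then show ?thesis by (simp add: sum_list_0)
qed (simp add: d_chi_def tensor_d_outside)

lemma cell_dchi_parity:
  assumes "is_chi False \<chi>0" "is_chi True \<chi>1" "c0 \<in> cells pc" "c \<in> cells pc"
  shows "cell_dchi \<chi>0 \<chi>1 pc c c0 = 0 \<or> even (cell_parity pc c + cell_parity pc c0)"
proof (cases pc)
  case (Crossing pos p q i j)
  obtain w0 s where c0: "c0 = (w0, s)" "s \<in> bits2" using assms(3) by (cases c0) (auto simp: Crossing cells_Crossing)
  obtain w' t where c': "c = (w', t)" "t \<in> bits2" using assms(4) by (cases c) (auto simp: Crossing cells_Crossing)
  have "\<chi>0 t s = 0 \<or> even (odd_count t + odd_count s)" "\<chi>1 t s = 0 \<or> even (odd_count t + odd_count s)"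
    using is_chi_mf_hom[OF assms(1)] is_chi_mf_hom[OF assms(2)] c0(2) c'(2) by (auto simp: mf_hom_def local_map_def)
  then show ?thesis unfolding Crossing c0 c' cell_parity_def by (cases pos) auto
qed simp

lemma d_mf_d_chi_commute:
  assumes "is_chi False \<chi>0" "is_chi True \<chi>1"
  shows "d_mf D (d_chi \<chi>0 \<chi>1 D v) g = d_chi \<chi>0 \<chi>1 D (d_mf D v) g"
proof (cases "g \<in> gens D")
  case True
  have "d_mf D (d_chi \<chi>0 \<chi>1 D v) g - 1 * d_chi \<chi>0 \<chi>1 D (d_mf D v) g = (\<Sum>pc\<leftarrow>D. 0) * v g"
    unfolding d_chi_def d_mf_def
  proof (rule tensor_d_commutator)
    fix pc c0 c assume *: "pc \<in> set D" "c0 \<in> cells pc" "c \<in> cells pc"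
    show "cell_dmf pc c c0 * sgn_pow (cell_hdeg pc c) = 1 * sgn_pow (cell_hdeg pc c0) * cell_dmf pc c c0"
      using cell_dmf_hdeg[of pc c c0] by (auto simp: mult.commute)
    show "sgn_pow (cell_parity pc c0) * cell_dchi \<chi>0 \<chi>1 pc c c0 = 1 * cell_dchi \<chi>0 \<chi>1 pc c c0 * sgn_pow (cell_parity pc c)"
      using cell_dchi_parity[OF assms *(2,3)] by (auto simp: sgn_pow_def)
  qed (use True cell_dmf_dchi_commute[OF assms] in auto)
  then show ?thesis by (simp add: sum_list_0)
qed (simp add: d_mf_def d_chi_def tensor_d_outside)

section \<open>Degrees of the differentials\<close>

definition vars_in :: "nat \<Rightarrow> piece \<Rightarrow> bool"
  where "vars_in m pc \<longleftrightarrow> set (ins pc) \<subseteq> {1..m} \<and> set (outs pc) \<subseteq> {1..m}"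

lemma homogeneous_numeral_mult: "homogeneous n f \<Longrightarrow> homogeneous n (numeral k * f)"
  using homogeneous_mult[OF homogeneous_Const[of "numeral k"]] by (simp add: Const_numeral)

lemma homogeneous_power2: "homogeneous n f \<Longrightarrow> 2 * n = k \<Longrightarrow> homogeneous k (f ^ 2)"
  using homogeneous_mult[of n f n f] by (auto simp: power2_eq_square)

lemma homogeneous_mult': "homogeneous n f \<Longrightarrow> homogeneous k g \<Longrightarrow> n + k = l \<Longrightarrow> homogeneous l (f * g)"
  using homogeneous_mult by blast

lemma homogeneous_rows:
  assumes "vars_in m pc" "(b, c, n) \<in> set (rows pc w)" "w \<Longrightarrow> \<exists>pos p q i j. pc = Crossing pos p q i j"
  shows "homogeneous n b" "homogeneous (6 - n) c" "b \<in> polys {0..m}" "c \<in> polys {0..m}"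
proof -
  have V: "homogeneous 2 (Var v)" if "0 < v" for v using homogeneous_Var[of v] that by simp
  have A: "homogeneous 4 a_var" using homogeneous_Var[of 0] by simp
  have pos: "0 < v \<and> v \<le> m" if "v \<in> set (ins pc) \<union> set (outs pc)" for v
    using that assms(1) by (auto simp: vars_in_def)
  note hs = homogeneous_add homogeneous_diff homogeneous_numeral_mult homogeneous_power2[of 2]
    homogeneous_mult'[of 2 _ 2] V A
  have arc: "homogeneous 4 (arc_v (Var y) (Var x))" "homogeneous 2 (Var y - Var x)"
    "arc_v (Var y) (Var x) \<in> polys {0..m}" "Var y - Var x \<in> polys {0..m}" if "0 < x" "0 < y" "x \<le> m" "y \<le> m" for x y
    unfolding arc_v_def using that by (intro hs polys_intros; simp)+
  have u2: "wide_u2 yi yj xp xq = - (3 * (xp + xq))" for yi yj xp xq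
    by (simp add: wide_u2_def)
  have wide: "homogeneous 4 (wide_u1 (Var i) (Var j) (Var p) (Var q))" "homogeneous 2 (Var i + Var j - Var p - Var q)"
    "homogeneous 2 (wide_u2 (Var i) (Var j) (Var p) (Var q))" "homogeneous 4 (Var i * Var j - Var p * Var q)"
    "wide_u1 (Var i) (Var j) (Var p) (Var q) \<in> polys {0..m}" "Var i + Var j - Var p - Var q \<in> polys {0..m}"
    "wide_u2 (Var i) (Var j) (Var p) (Var q) \<in> polys {0..m}" "Var i * Var j - Var p * Var q \<in> polys {0..m}"
    if "0 < i" "0 < j" "0 < p" "0 < q" "i \<le> m" "j \<le> m" "p \<le> m" "q \<le> m" for i j p q
    unfolding wide_u1_def u2 using that by (intro hs homogeneous_uminus polys_intros; simp)+
  have "homogeneous n b \<and> homogeneous (6 - n) c \<and> b \<in> polys {0..m} \<and> c \<in> polys {0..m}"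
  proof (cases pc)
    case (Arc p i)
    with assms(2) show ?thesis using arc[of p i] pos[of p] pos[of i] by simp
  next
    case (Crossing ps p q i j)
    then have "0 < i \<and> i \<le> m" "0 < j \<and> j \<le> m" "0 < p \<and> p \<le> m" "0 < q \<and> q \<le> m" using pos by auto
    with assms(2) Crossing show ?thesis
      using arc[of p i] arc[of q j] wide[of i j p q] by (cases w) auto
  qed
  then show "homogeneous n b" "homogeneous (6 - n) c" "b \<in> polys {0..m}" "c \<in> polys {0..m}" by auto
qed

lemma cell_dmf_polys:
  assumes "vars_in m pc" "c \<in> cells pc" "c0 \<in> cells pc"
  shows "cell_dmf pc c c0 \<in> polys {0..m}"
proof (cases "fst c = fst c0")
  case True
  have r: "b \<in> polys {0..m} \<and> c' \<in> polys {0..m}" if "(b, c', n) \<in> set (rows pc (fst c))" for b c' n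
    using homogeneous_rows(3,4)[OF assms(1) that] assms(2) by (auto simp: cells_def)
  have "koszul_d (rows pc (fst c)) (snd c) (snd c0) \<in> polys {0..m}"
    unfolding koszul_d_def
  proof (intro polys_sum)
    fix k assume "k \<in> {..<length (rows pc (fst c))}"
    then have "rows pc (fst c) ! k \<in> set (rows pc (fst c))" by simp
    then show "(if snd c0 = (snd c)[k := \<not> snd c ! k] then sgn_pow (odd_count (take k (snd c))) *
      (if snd c ! k then fst (snd (rows pc (fst c) ! k)) else fst (rows pc (fst c) ! k)) else 0) \<in> polys {0..m}"
      using r[of "fst (rows pc (fst c) ! k)" "fst (snd (rows pc (fst c) ! k))" "snd (snd (rows pc (fst c) ! k))"]
      by (auto intro!: polys_mult)
  qed
  then show ?thesis by (simp add: cell_dmf_def True)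
qed (simp add: cell_dmf_def)

text \<open>Both arrows of a row have degree 3, which is \<open>N + 1\<close>: \<open>b\<close> ends
  in a generator of degree \<open>3 - deg b\<close>, and \<open>c\<close>, of degree
  \<open>6 - deg b\<close>, starts there.\<close>

lemma cell_dmf_homogeneous:
  assumes "vars_in m pc" "c \<in> cells pc" "c0 \<in> cells pc"
  shows "homogeneous (cell_qdeg pc c + 3 - cell_qdeg pc c0) (cell_dmf pc c c0)"
proof (cases pc)
  case (Arc p i)
  have *: "homogeneous 4 (arc_v (Var i) (Var p))" "homogeneous 2 (Var i - Var p)"
    using homogeneous_rows(1,2)[of m pc "arc_v (Var i) (Var p)" "Var i - Var p" 4 False] assms(1) by (auto simp: Arc)
  then show ?thesis
    using assms(2,3) unfolding Arc cells_Arc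
    by (auto simp: cell_dmf_def cell_qdeg_def mf_deg_def koszul_deg_def koszul_d_1)
next
  case (Crossing pos p q i j)
  obtain w0 s where c0: "c0 = (w0, s)" "s \<in> bits2" using assms(3) by (cases c0) (auto simp: Crossing cells_Crossing)
  obtain w t where c: "c = (w, t)" "t \<in> bits2" using assms(2) by (cases c) (auto simp: Crossing cells_Crossing)
  obtain b1 c1 n1 b2 c2 n2 where rs: "rows pc w = [(b1, c1, n1), (b2, c2, n2)]"
    unfolding Crossing by (cases w) auto
  have *: "homogeneous n1 b1" "homogeneous (6 - n1) c1" "homogeneous n2 b2" "homogeneous (6 - n2) c2"
    using homogeneous_rows(1,2)[OF assms(1), of b1 c1 n1 w] homogeneous_rows(1,2)[OF assms(1), of b2 c2 n2 w]
    unfolding rs using Crossing by simp_all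
  have kd: "koszul_deg (rows pc w) [x, y] = (if x then 3 - n1 else 0) + (if y then 3 - n2 else 0)" for x y
    by (simp add: koszul_deg_def rs lessThan_Suc numeral_2_eq_2)
  obtain x y x' y' where t: "t = [x, y]" "s = [x', y']" using c(2) c0(2) by (auto simp: bits2_def length_2_conv)
  show ?thesis
  proof (cases "w = w0")
    case True
    show ?thesis
      unfolding c c0 True[symmetric] t cell_dmf_def cell_qdeg_def mf_deg_def fst_conv snd_conv kd unfolding rs koszul_d_2
      by (cases x; cases y; cases x'; cases y') (use * in \<open>auto intro: homogeneous_uminus\<close>)
  qed (simp add: c c0 cell_dmf_def)
qed

text \<open>A variable may only be renamed to one of the same weight, so \<open>a\<close> has to be
  kept apart from the x-variables.\<close>

lemma rename_homogeneous:
  assumes "f \<in> polys W" "homogeneous n f" "\<And>v. v \<in> W \<Longrightarrow> (\<sigma> v = 0) = (v = 0)"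
  shows "homogeneous n (rename \<sigma> f)"
proof -
  have *: "homogeneous (pdeg \<mu>) (\<Prod>i\<in>Poly_Mapping.keys \<mu>. Var (\<sigma> i) ^ Poly_Mapping.lookup \<mu> i)"
    if "Poly_Mapping.keys \<mu> \<subseteq> W" for \<mu>
  proof -
    have p: "homogeneous (d * int n) (g ^ n)" if "homogeneous d g" for d n g
      by (induction n) (auto simp: algebra_simps intro: homogeneous_mult'[OF that])
    have "homogeneous (\<Sum>i\<in>A. (if i = 0 then 4 else 2) * int (Poly_Mapping.lookup \<mu> i))
      (\<Prod>i\<in>A. Var (\<sigma> i) ^ Poly_Mapping.lookup \<mu> i)" if "finite A" "A \<subseteq> W" for A
      using that
    proof (induction A rule: finite_induct)
      case (insert i A)
      have "homogeneous ((if i = 0 then 4 else 2) * int (Poly_Mapping.lookup \<mu> i)) (Var (\<sigma> i) ^ Poly_Mapping.lookup \<mu> i)"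
        using p[OF homogeneous_Var[of "\<sigma> i"]] assms(3)[of i] insert.prems by simp
      moreover have "homogeneous (\<Sum>i\<in>A. (if i = 0 then 4 else 2) * int (Poly_Mapping.lookup \<mu> i))
        (\<Prod>i\<in>A. Var (\<sigma> i) ^ Poly_Mapping.lookup \<mu> i)" using insert by simp
      ultimately show ?case using homogeneous_mult insert.hyps
        by (simp only: sum.insert[OF insert.hyps] prod.insert[OF insert.hyps])
    qed simp
    from this[OF finite_keys that] show ?thesis by (simp only: mon_deg_def)
  qed
  show ?thesis
    unfolding rename_def
  proof (rule homogeneous_sum)
    fix \<mu> assume \<mu>: "\<mu> \<in> Poly_Mapping.keys f"
    then have "Poly_Mapping.keys \<mu> \<subseteq> W" using assms(1) by (simp add: polys_def)
    from homogeneous_mult[OF homogeneous_Const *[OF this]] homogeneousD[OF assms(2) \<mu>]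
    show "homogeneous n (Const (Poly_Mapping.lookup f \<mu>) * (\<Prod>i\<in>Poly_Mapping.keys \<mu>. Var (\<sigma> i) ^ Poly_Mapping.lookup \<mu> i))"
      by simp
  qed
qed

lemma crossing_subst_image:
  assumes "vars_in m (Crossing pos p q i j)"
  shows "crossing_subst p q i j ` {0..4} \<subseteq> {0..m}" "v \<in> {0..4} \<Longrightarrow> (crossing_subst p q i j v = 0) = (v = 0)"
proof -
  have *: "p \<in> {1..m}" "q \<in> {1..m}" "i \<in> {1..m}" "j \<in> {1..m}" using assms by (auto simp: vars_in_def)
  have e: "{0..4::nat} = {0,1,2,3,4}" by auto
  show "crossing_subst p q i j ` {0..4} \<subseteq> {0..m}" using * unfolding e by (auto simp: crossing_subst_def)
  show "v \<in> {0..4} \<Longrightarrow> (crossing_subst p q i j v = 0) = (v = 0)" using * unfolding e by (auto simp: crossing_subst_def)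
qed

lemma cell_dchi_polys_homogeneous:
  assumes "is_chi False \<chi>0" "is_chi True \<chi>1" "vars_in m pc" "c \<in> cells pc" "c0 \<in> cells pc"
  shows "cell_dchi \<chi>0 \<chi>1 pc c c0 \<in> polys {0..m}"
    "homogeneous (cell_qdeg pc c - cell_qdeg pc c0) (cell_dchi \<chi>0 \<chi>1 pc c c0)"
proof -
  have "cell_dchi \<chi>0 \<chi>1 pc c c0 \<in> polys {0..m} \<and>
    homogeneous (cell_qdeg pc c - cell_qdeg pc c0) (cell_dchi \<chi>0 \<chi>1 pc c c0)"
  proof (cases pc)
    case (Crossing pos p q i j)
    obtain w0 t where c0: "c0 = (w0, t)" "t \<in> bits2" using assms(5) by (cases c0) (auto simp: Crossing cells_Crossing)
    obtain w s where c: "c = (w, s)" "s \<in> bits2" using assms(4) by (cases c) (auto simp: Crossing cells_Crossing)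
    have ld: "mf_deg (Crossing pos p q i j) w s = local_deg w s" for w s
      by (cases w) (simp_all add: local_deg_def mf_deg_def koszul_deg_def lessThan_Suc numeral_2_eq_2)
    have *: "rename (crossing_subst p q i j) (\<chi> s t) \<in> polys {0..m} \<and>
      homogeneous (local_deg w s + 1 - local_deg (\<not> w) t) (rename (crossing_subst p q i j) (\<chi> s t))"
      if "is_chi w \<chi>" for w \<chi>
    proof -
      have p: "\<chi> s t \<in> polys {0..4}" using is_chi_mf_hom[OF that] c c0 by (auto simp: mf_hom_def local_map_def)
      have h: "homogeneous (local_deg w s + 1 - local_deg (\<not> w) t) (\<chi> s t)"
        using that c(2) c0(2) unfolding is_chi_def by blast
      show ?thesis
        using rename_polys[OF p crossing_subst_image(1)[OF assms(3)[unfolded Crossing]]]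
          rename_homogeneous[OF p h crossing_subst_image(2)[OF assms(3)[unfolded Crossing]]] by blast
    qed
    show ?thesis
      unfolding Crossing c c0 cell_qdeg_def fst_conv snd_conv ld
      by (cases pos) (use *[OF assms(1)] *[OF assms(2)] in \<open>auto simp: algebra_simps\<close>)
  qed simp
  then show "cell_dchi \<chi>0 \<chi>1 pc c c0 \<in> polys {0..m}"
    "homogeneous (cell_qdeg pc c - cell_qdeg pc c0) (cell_dchi \<chi>0 \<chi>1 pc c c0)" by auto
qed

section \<open>Projections onto the bidegrees\<close>

definition bicomp :: "piece list \<Rightarrow> int \<Rightarrow> int \<Rightarrow> chain \<Rightarrow> chain"
  where "bicomp D i j v = (\<lambda>g. if total_deg cell_hdeg D g = i then hcomp (j - total_deg cell_qdeg D g) (v g) else 0)"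

lemma bicomp_eq_iff: "bicomp D i j v = v \<longleftrightarrow> v \<in> hom_part D i \<inter> pol_part D j"
proof
  assume *: "bicomp D i j v = v"
  have "v g \<noteq> 0 \<Longrightarrow> total_deg cell_hdeg D g = i" for g
    using fun_cong[OF *, of g] by (auto simp: bicomp_def split: if_splits)
  moreover have "homogeneous (j - total_deg cell_qdeg D g) (v g)" for g
    using fun_cong[OF *, of g] homogeneous_hcomp[of "j - total_deg cell_qdeg D g" "v g"] by (auto simp: bicomp_def split: if_splits)
  ultimately show "v \<in> hom_part D i \<inter> pol_part D j" by (auto simp: hom_part_def pol_part_def)
next
  assume "v \<in> hom_part D i \<inter> pol_part D j"
  then show "bicomp D i j v = v"
    by (auto simp: bicomp_def fun_eq_iff hom_part_def pol_part_def hcomp_eq_iff)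
qed

lemma bicomp_tensor_d:
  assumes "\<And>pc c c0. pc \<in> set D \<Longrightarrow> c \<in> cells pc \<Longrightarrow> c0 \<in> cells pc \<Longrightarrow>
      \<delta> pc c c0 = 0 \<or> cell_hdeg pc c0 = cell_hdeg pc c + k"
    "\<And>pc c c0. pc \<in> set D \<Longrightarrow> c \<in> cells pc \<Longrightarrow> c0 \<in> cells pc \<Longrightarrow>
      homogeneous (cell_qdeg pc c + n - cell_qdeg pc c0) (\<delta> pc c c0)"
  shows "tensor_d e \<delta> D (bicomp D i j v) = bicomp D (i + k) (j + n) (tensor_d e \<delta> D v)"
proof
  fix g
  show "tensor_d e \<delta> D (bicomp D i j v) g = bicomp D (i + k) (j + n) (tensor_d e \<delta> D v) g"
  proof (cases "g \<in> gens D")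
    case True
    let ?f = "\<lambda>r c v. sgn_pow (total_deg e (take r D) (take r g)) * \<delta> (D ! r) c (g ! r) * v (g[r := c])"
    have *: "?f r c (bicomp D i j v) = (if total_deg cell_hdeg D g = i + k
      then hcomp (j + n - total_deg cell_qdeg D g) (?f r c v) else 0)" if "r < length D" "c \<in> cells (D ! r)" for r c
    proof (cases "\<delta> (D ! r) c (g ! r) = 0")
      case False
      have td: "total_deg e' D (g[r := c]) = total_deg e' D g + e' (D ! r) c - e' (D ! r) (g ! r)" for e'
        by (rule total_deg_update) (use that gens_length[OF True] in auto)
      have gr: "g ! r \<in> cells (D ! r)" "D ! r \<in> set D" using gens_nth[OF True that(1)] that by auto
      have h: "total_deg cell_hdeg D (g[r := c]) = i \<longleftrightarrow> total_deg cell_hdeg D g = i + k"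
        using assms(1)[OF gr(2) that(2) gr(1)] False unfolding td by auto
      have "homogeneous (cell_qdeg (D ! r) c + n - cell_qdeg (D ! r) (g ! r))
        (sgn_pow (total_deg e (take r D) (take r g)) * \<delta> (D ! r) c (g ! r))"
        using homogeneous_mult[OF homogeneous_sgn_pow assms(2)[OF gr(2) that(2) gr(1)]] by simp
      from hcomp_mult[OF this] show ?thesis
        unfolding bicomp_def h unfolding td by (simp add: algebra_simps)
    qed simp
    have "tensor_d e \<delta> D (bicomp D i j v) g = (\<Sum>r<length D. \<Sum>c\<in>cells (D ! r). ?f r c (bicomp D i j v))"
      using True by (simp add: tensor_d_def)
    also have "\<dots> = (\<Sum>r<length D. \<Sum>c\<in>cells (D ! r). if total_deg cell_hdeg D g = i + k
      then hcomp (j + n - total_deg cell_qdeg D g) (?f r c v) else 0)"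
      using * by (intro sum.cong) auto
    also have "\<dots> = bicomp D (i + k) (j + n) (tensor_d e \<delta> D v) g"
      using True by (simp add: bicomp_def tensor_d_def hcomp_sum)
    finally show ?thesis .
  qed (simp add: tensor_d_outside bicomp_def)
qed

section \<open>Elimination in Koszul factorizations\<close>

lemma scaleC_zero_left: "0 *\<^sub>C (v :: 'a :: complex_space) = 0"
  using scaleC_add_left[of 0 0 v] by simp

lemma scaleC_minus_left: "(- c) *\<^sub>C (v :: 'a :: complex_space) = - (c *\<^sub>C v)"
  using scaleC_add_left[of c "- c" v] by (simp add: scaleC_zero_left minus_unique)

lemma scaleC_minus_right: "c *\<^sub>C (- v :: 'a :: complex_space) = - (c *\<^sub>C v)"
  using scaleC_add_right[of c v "- v"] by (simp add: scaleC_zero_right minus_unique)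

lemma scaleC_minus_one: "(- 1) *\<^sub>C (v :: 'a :: complex_space) = - v"
  by (simp add: scaleC_minus_left scaleC_one)

lemma scaleC_diff_right: "c *\<^sub>C (u - v :: 'a :: complex_space) = c *\<^sub>C u - c *\<^sub>C v"
  using scaleC_add_right[of c u "- v"] by (simp add: scaleC_minus_right)

lemma scaleC_diff_left: "(c - d) *\<^sub>C (v :: 'a :: complex_space) = c *\<^sub>C v - d *\<^sub>C v"
  using scaleC_add_left[of c "- d" v] by (simp add: scaleC_minus_left)

lemma scaleC_sum_right: "c *\<^sub>C (\<Sum>x\<in>A. f x :: 'a :: complex_space) = (\<Sum>x\<in>A. c *\<^sub>C f x)"
  by (induction A rule: infinite_finite_induct) (simp_all add: scaleC_zero_right scaleC_add_right)

definition csub :: "'v::complex_space set \<Rightarrow> bool"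
  where "csub S \<longleftrightarrow> 0 \<in> S \<and> (\<forall>u\<in>S. \<forall>v\<in>S. u + v \<in> S) \<and> (\<forall>c. \<forall>v\<in>S. c *\<^sub>C v \<in> S)"

lemma csubI: "0 \<in> S \<Longrightarrow> (\<And>u v. u \<in> S \<Longrightarrow> v \<in> S \<Longrightarrow> u + v \<in> S) \<Longrightarrow> (\<And>c v. v \<in> S \<Longrightarrow> c *\<^sub>C v \<in> S) \<Longrightarrow> csub S"
  by (simp add: csub_def)

lemma csub_zero: "csub S \<Longrightarrow> 0 \<in> S"
  and csub_add: "csub S \<Longrightarrow> u \<in> S \<Longrightarrow> v \<in> S \<Longrightarrow> u + v \<in> S"
  and csub_scale: "csub S \<Longrightarrow> v \<in> S \<Longrightarrow> c *\<^sub>C v \<in> S"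
  by (simp_all add: csub_def)

lemma csub_minus: "csub S \<Longrightarrow> v \<in> S \<Longrightarrow> - v \<in> S"
  using csub_scale[of S v "- 1"] by (simp add: scaleC_minus_one)

lemma csub_diff: "csub S \<Longrightarrow> u \<in> S \<Longrightarrow> v \<in> S \<Longrightarrow> u - v \<in> S"
  using csub_add[of S u "- v"] csub_minus[of S v] by simp

lemma csub_sum: "csub S \<Longrightarrow> (\<And>x. x \<in> A \<Longrightarrow> f x \<in> S) \<Longrightarrow> sum f A \<in> S"
  by (induction A rule: infinite_finite_induct) (auto intro: csub_zero csub_add)

lemma csub_cong: "csub S \<Longrightarrow> u - v \<in> S \<Longrightarrow> v \<in> S \<Longrightarrow> u \<in> S"
  using csub_add[of S "u - v" v] by simp

lemma csub_Times: "csub S \<Longrightarrow> csub T \<Longrightarrow> csub (S \<times> T)"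
  by (auto simp: csub_def scaleC_prod_def zero_prod_def)

lemma csub_Int: "csub S \<Longrightarrow> csub T \<Longrightarrow> csub (S \<inter> T)"
  by (auto simp: csub_def)

definition clin :: "('v::complex_space \<Rightarrow> 'w::complex_space) \<Rightarrow> bool"
  where "clin f \<longleftrightarrow> (\<forall>u v. f (u + v) = f u + f v) \<and> (\<forall>c v. f (c *\<^sub>C v) = c *\<^sub>C f v)"

lemma clinI: "(\<And>u v. f (u + v) = f u + f v) \<Longrightarrow> (\<And>c v. f (c *\<^sub>C v) = c *\<^sub>C f v) \<Longrightarrow> clin f"
  by (simp add: clin_def)

lemma clin_add: "clin f \<Longrightarrow> f (u + v) = f u + f v"
  and clin_scale: "clin f \<Longrightarrow> f (c *\<^sub>C v) = c *\<^sub>C f v"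
  by (simp_all add: clin_def)

lemma clin_zero: "clin f \<Longrightarrow> f 0 = 0"
  using clin_scale[of f 0 0] by (simp add: scaleC_zero_left)

lemma clin_minus: "clin f \<Longrightarrow> f (- v) = - f v"
  using clin_scale[of f "- 1" v] by (simp add: scaleC_minus_one)

lemma clin_diff: "clin f \<Longrightarrow> f (u - v) = f u - f v"
  using clin_add[of f u "- v"] by (simp add: clin_minus)

lemma clin_sum: "clin f \<Longrightarrow> f (\<Sum>x\<in>A. g x) = (\<Sum>x\<in>A. f (g x))"
  by (induction A rule: infinite_finite_induct) (simp_all add: clin_zero clin_add)

text \<open>
  The homology of \<open>d\<close> on \<open>M / B\<close> has no \<open>a\<close>-torsion and is generated modulo \<open>a\<close> by finitely many
  classes; \<open>fa\<close> is multiplication by \<open>a\<close>.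
\<close>

definition tf_fin :: "('v::complex_space \<Rightarrow> 'v) \<Rightarrow> 'v set \<Rightarrow> 'v set \<Rightarrow> ('v \<Rightarrow> 'v) \<Rightarrow> bool"
  where "tf_fin fa M B d \<longleftrightarrow>
    (\<forall>v\<in>M. \<forall>w\<in>M. d v \<in> B \<longrightarrow> fa v - d w \<in> B \<longrightarrow> (\<exists>u\<in>M. v - d u \<in> B)) \<and>
    (\<exists>n f. (\<forall>k<n::nat. f k \<in> M \<and> d (f k) \<in> B) \<and>
      (\<forall>v\<in>M. d v \<in> B \<longrightarrow> (\<exists>l. \<exists>u\<in>M. \<exists>w\<in>M. d u \<in> B \<and>
        v - ((\<Sum>k<n. l k *\<^sub>C f k) + fa u + d w) \<in> B)))"

lemma tf_finI:
  assumes "\<And>v w. v \<in> M \<Longrightarrow> w \<in> M \<Longrightarrow> d v \<in> B \<Longrightarrow> fa v - d w \<in> B \<Longrightarrow> \<exists>u\<in>M. v - d u \<in> B"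
    "\<And>k::nat. k < n \<Longrightarrow> f k \<in> M \<and> d (f k) \<in> B"
    "\<And>v. v \<in> M \<Longrightarrow> d v \<in> B \<Longrightarrow> \<exists>l. \<exists>u\<in>M. \<exists>w\<in>M. d u \<in> B \<and>
        v - ((\<Sum>k<n. l k *\<^sub>C f k) + fa u + d w) \<in> B"
  shows "tf_fin fa M B d"
  unfolding tf_fin_def
proof (intro conjI ballI impI)
  show "\<exists>n f. (\<forall>k<n::nat. f k \<in> M \<and> d (f k) \<in> B) \<and>
      (\<forall>v\<in>M. d v \<in> B \<longrightarrow> (\<exists>l. \<exists>u\<in>M. \<exists>w\<in>M. d u \<in> B \<and>
        v - ((\<Sum>k<n. l k *\<^sub>C f k) + fa u + d w) \<in> B))"
    by (rule exI[of _ n], rule exI[of _ f]) (use assms(2,3) in simp)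
qed (rule assms(1))

lemma tf_finD1:
  "tf_fin fa M B d \<Longrightarrow> v \<in> M \<Longrightarrow> w \<in> M \<Longrightarrow> d v \<in> B \<Longrightarrow> fa v - d w \<in> B \<Longrightarrow> \<exists>u\<in>M. v - d u \<in> B"
  unfolding tf_fin_def by (elim conjE) blast

lemma tf_finD2:
  assumes "tf_fin fa M B d"
  obtains n :: nat and f where "\<And>k. k < n \<Longrightarrow> f k \<in> M" "\<And>k. k < n \<Longrightarrow> d (f k) \<in> B"
    "\<And>v. v \<in> M \<Longrightarrow> d v \<in> B \<Longrightarrow> \<exists>l. \<exists>u\<in>M. \<exists>w\<in>M. d u \<in> B \<and>
        v - ((\<Sum>k<n. l k *\<^sub>C f k) + fa u + d w) \<in> B"
  using assms unfolding tf_fin_def by blast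

text \<open>\<open>\<phi>\<close> induces an isomorphism of \<open>M / B\<close> onto
  \<open>M' / B'\<close> that commutes with the differentials and with \<open>a\<close>; both
  properties are pulled back through chosen preimages under \<open>\<phi>\<close>.\<close>

lemma tf_fin_transfer:
  assumes P: "tf_fin fa' M' B' d'" and \<phi>: "clin \<phi>"
    and M: "csub M" "\<And>v. v \<in> M \<Longrightarrow> d v \<in> M" "\<And>v. v \<in> M \<Longrightarrow> fa v \<in> M"
    and maps: "\<And>v. v \<in> M \<Longrightarrow> \<phi> v \<in> M'" and surj: "\<And>x. x \<in> M' \<Longrightarrow> \<exists>v\<in>M. \<phi> v = x"
    and B: "\<And>v. v \<in> M \<Longrightarrow> v \<in> B \<longleftrightarrow> \<phi> v \<in> B'"
    and d: "\<And>v. v \<in> M \<Longrightarrow> \<phi> (d v) = d' (\<phi> v)" and fa: "\<And>v. v \<in> M \<Longrightarrow> \<phi> (fa v) = fa' (\<phi> v)"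
  shows "tf_fin fa M B d"
proof -
  obtain n and f :: "nat \<Rightarrow> _" where f: "\<And>k. k < n \<Longrightarrow> f k \<in> M'" "\<And>k. k < n \<Longrightarrow> d' (f k) \<in> B'"
    "\<And>v. v \<in> M' \<Longrightarrow> d' v \<in> B' \<Longrightarrow> \<exists>l. \<exists>u\<in>M'. \<exists>w\<in>M'. d' u \<in> B' \<and>
        v - ((\<Sum>k<n. l k *\<^sub>C f k) + fa' u + d' w) \<in> B'"
    using tf_finD2[OF P] by metis
  obtain \<psi> where \<psi>: "\<And>x. x \<in> M' \<Longrightarrow> \<psi> x \<in> M \<and> \<phi> (\<psi> x) = x" using surj by metis
  note Mi = csub_diff[OF M(1)] csub_add[OF M(1)] csub_sum[OF M(1)] csub_scale[OF M(1)] M(2,3)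
  show ?thesis
  proof (rule tf_finI)
    fix v w assume v: "v \<in> M" "w \<in> M" "d v \<in> B" "fa v - d w \<in> B"
    have 1: "d' (\<phi> v) \<in> B'" using B[of "d v"] v M d by auto
    have "\<phi> (fa v - d w) \<in> B'" using B[of "fa v - d w"] v Mi by auto
    then have "fa' (\<phi> v) - d' (\<phi> w) \<in> B'" using v by (simp add: clin_diff[OF \<phi>] d fa)
    from tf_finD1[OF P maps[OF v(1)] maps[OF v(2)] 1 this]
    obtain u where u: "u \<in> M'" "\<phi> v - d' u \<in> B'" by blast
    have "\<phi> (v - d (\<psi> u)) \<in> B'" using u \<psi>[OF u(1)] by (simp add: clin_diff[OF \<phi>] d)
    then have "v - d (\<psi> u) \<in> B" using B[of "v - d (\<psi> u)"] v \<psi>[OF u(1)] Mi by auto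
    then show "\<exists>u\<in>M. v - d u \<in> B" using \<psi>[OF u(1)] by blast
  next
    fix k assume k: "k < n"
    have "d (\<psi> (f k)) \<in> M" using M \<psi>[OF f(1)[OF k]] by blast
    then show "\<psi> (f k) \<in> M \<and> d (\<psi> (f k)) \<in> B"
      using \<psi>[OF f(1)[OF k]] f(2)[OF k] B[of "d (\<psi> (f k))"] d by auto
  next
    fix v assume v: "v \<in> M" "d v \<in> B"
    have "d' (\<phi> v) \<in> B'" using B[of "d v"] v M d by auto
    from f(3)[OF maps[OF v(1)] this] obtain l u w where u: "u \<in> M'" "w \<in> M'" "d' u \<in> B'"
      "\<phi> v - ((\<Sum>k<n. l k *\<^sub>C f k) + fa' u + d' w) \<in> B'" by blast
    have s: "(\<Sum>k<n. l k *\<^sub>C \<psi> (f k)) \<in> M" using \<psi> f(1) by (intro Mi) auto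
    have "\<phi> (\<Sum>k<n. l k *\<^sub>C \<psi> (f k)) = (\<Sum>k<n. l k *\<^sub>C f k)"
      unfolding clin_sum[OF \<phi>] by (rule sum.cong) (use \<psi> f(1) in \<open>auto simp: clin_scale[OF \<phi>]\<close>)
    then have "\<phi> (v - ((\<Sum>k<n. l k *\<^sub>C \<psi> (f k)) + fa (\<psi> u) + d (\<psi> w))) \<in> B'"
      using u \<psi>[OF u(1)] \<psi>[OF u(2)] by (simp add: clin_diff[OF \<phi>] clin_add[OF \<phi>] d fa)
    moreover have "v - ((\<Sum>k<n. l k *\<^sub>C \<psi> (f k)) + fa (\<psi> u) + d (\<psi> w)) \<in> M"
      using s v \<psi>[OF u(1)] \<psi>[OF u(2)] Mi by auto
    ultimately have "v - ((\<Sum>k<n. l k *\<^sub>C \<psi> (f k)) + fa (\<psi> u) + d (\<psi> w)) \<in> B" using B by blast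
    moreover have "d (\<psi> u) \<in> B" using B[of "d (\<psi> u)"] \<psi>[OF u(1)] M d u by auto
    ultimately show "\<exists>l. \<exists>u\<in>M. \<exists>w\<in>M. d u \<in> B \<and> v - ((\<Sum>k<n. l k *\<^sub>C \<psi> (f k)) + fa u + d w) \<in> B"
      using \<psi>[OF u(1)] \<psi>[OF u(2)] by blast
  qed
qed

text \<open>Serves for the two resolutions of a crossing, which \<open>d_mf\<close> does not
  mix.\<close>

lemma tf_fin_prod:
  assumes P1: "tf_fin fa1 M1 B1 d1" and P2: "tf_fin fa2 M2 B2 d2"
    and z: "csub M1" "csub M2" "csub B1" "csub B2" "clin d1" "clin d2"
  shows "tf_fin (map_prod fa1 fa2) (M1 \<times> M2) (B1 \<times> B2) (map_prod d1 d2)"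
proof -
  obtain n1 and f1 :: "nat \<Rightarrow> _" where f1: "\<And>k. k < n1 \<Longrightarrow> f1 k \<in> M1" "\<And>k. k < n1 \<Longrightarrow> d1 (f1 k) \<in> B1"
    "\<And>v. v \<in> M1 \<Longrightarrow> d1 v \<in> B1 \<Longrightarrow> \<exists>l. \<exists>u\<in>M1. \<exists>w\<in>M1. d1 u \<in> B1 \<and>
        v - ((\<Sum>k<n1. l k *\<^sub>C f1 k) + fa1 u + d1 w) \<in> B1"
    using tf_finD2[OF P1] by metis
  obtain n2 and f2 :: "nat \<Rightarrow> _" where f2: "\<And>k. k < n2 \<Longrightarrow> f2 k \<in> M2" "\<And>k. k < n2 \<Longrightarrow> d2 (f2 k) \<in> B2"
    "\<And>v. v \<in> M2 \<Longrightarrow> d2 v \<in> B2 \<Longrightarrow> \<exists>l. \<exists>u\<in>M2. \<exists>w\<in>M2. d2 u \<in> B2 \<and>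
        v - ((\<Sum>k<n2. l k *\<^sub>C f2 k) + fa2 u + d2 w) \<in> B2"
    using tf_finD2[OF P2] by metis
  \<comment> \<open>The generators of the two factors are listed one after the other, each padded by
    0 in the other factor.\<close>
  let ?f = "\<lambda>k. if k < n1 then (f1 k, 0) else (0, f2 (k - n1))"
  have split': "(\<Sum>k<n1 + m. l k *\<^sub>C ?f k) = (\<Sum>k<n1. l k *\<^sub>C f1 k, \<Sum>k<m. l (k + n1) *\<^sub>C f2 k)" for l m
  proof (induction m)
    case 0
    have "(\<Sum>k<n1. l k *\<^sub>C ?f k) = (\<Sum>k<n1. (l k *\<^sub>C f1 k, 0))"
      by (rule sum.cong) (auto simp: scaleC_prod_def scaleC_zero_right)
    then show ?case by (simp add: prod_eq_iff fst_sum snd_sum)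
  next
    case (Suc m)
    then show ?case by (simp add: scaleC_prod_def scaleC_zero_right add.commute)
  qed
  note split = split'[of _ n2]
  show ?thesis
  proof (rule tf_finI[where f = ?f and n = "n1 + n2"], goal_cases)
    case (1 v w)
    then obtain u1 u2 where "u1 \<in> M1" "fst v - d1 u1 \<in> B1" "u2 \<in> M2" "snd v - d2 u2 \<in> B2"
      using tf_finD1[OF P1, of "fst v" "fst w"] tf_finD1[OF P2, of "snd v" "snd w"]
      by (cases v; cases w) auto
    then show ?case by (intro bexI[of _ "(u1, u2)"]) (cases v, auto)
  next
    case (2 k)
    then show ?case using f1 f2 z by (auto simp: csub_zero clin_zero)
  next
    case (3 v)
    then obtain l1 u1 w1 l2 u2 w2 where *: "u1 \<in> M1" "w1 \<in> M1" "d1 u1 \<in> B1" "u2 \<in> M2" "w2 \<in> M2" "d2 u2 \<in> B2"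
      "fst v - ((\<Sum>k<n1. l1 k *\<^sub>C f1 k) + fa1 u1 + d1 w1) \<in> B1"
      "snd v - ((\<Sum>k<n2. l2 k *\<^sub>C f2 k) + fa2 u2 + d2 w2) \<in> B2"
      using f1(3)[of "fst v"] f2(3)[of "snd v"] by (cases v) fastforce
    let ?l = "\<lambda>k. if k < n1 then l1 k else l2 (k - n1)"
    show ?case
      by (rule exI[of _ ?l], rule bexI[of _ "(u1, u2)"], rule bexI[of _ "(w1, w2)"])
        (use * in \<open>cases v, auto simp: split\<close>)
  qed
qed

text \<open>The differential of the tensor product of the Koszul factorization \<open>(b, c)\<close>
  with a factorization with differential \<open>d\<close>. The first component belongs to the even
  generator; the sign of \<open>d\<close> on the second one is the Koszul sign of the odd
  generator.\<close>

definition kz :: "('v::complex_space \<Rightarrow> 'v) \<Rightarrow> ('v \<Rightarrow> 'v) \<Rightarrow> ('v \<Rightarrow> 'v) \<Rightarrow> 'v \<times> 'v \<Rightarrow> 'v \<times> 'v"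
  where "kz fb fc d v = (d (fst v) + fc (snd v), fb (fst v) - d (snd v))"

text \<open>\<open>d\<^sup>2\<close> is multiplication by \<open>w\<close> modulo \<open>B\<close>; the scalars range over \<open>R\<close>.\<close>

locale kmodule =
  fixes R :: "pring set" and act :: "pring \<Rightarrow> 'v::complex_space \<Rightarrow> 'v" and M B :: "'v set"
    and d :: "'v \<Rightarrow> 'v" and w :: pring
  assumes M: "csub M" and B: "csub B" and BM: "B \<subseteq> M"
    and d_lin: "clin d" and dM: "v \<in> M \<Longrightarrow> d v \<in> M" and dB: "v \<in> B \<Longrightarrow> d v \<in> B"
    and act_lin: "clin (act r)" and actM: "r \<in> R \<Longrightarrow> v \<in> M \<Longrightarrow> act r v \<in> M"
    and actB: "r \<in> R \<Longrightarrow> v \<in> B \<Longrightarrow> act r v \<in> B"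
    and act_act: "act r (act s v) = act (r * s) v" and act_add: "act (r + s) v = act r v + act s v"
    and d_act: "d (act r v) = act r (d v)"
    and square: "v \<in> M \<Longrightarrow> d (d v) - act w v \<in> B" and wR: "w \<in> R"
begin

lemma kz_lin: "clin (kz (act b) (act c) d)"
  by (rule clinI)
    (auto simp: kz_def clin_add[OF d_lin] clin_add[OF act_lin] clin_scale[OF d_lin] clin_scale[OF act_lin]
      scaleC_prod_def scaleC_add_right scaleC_diff_right)

text \<open>The potential of a tensor product is the sum of the potentials: in the square of
  \<open>kz\<close> the mixed terms cancel by the sign, and \<open>b * c\<close> is what the row
  contributes.\<close>

lemma kmodule_prod:
  assumes "b \<in> R" "c \<in> R" "w + b * c \<in> R"
  shows "kmodule R (\<lambda>r. map_prod (act r) (act r)) (M \<times> M) (B \<times> B) (kz (act b) (act c) d) (w + b * c)"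
proof
  show "csub (M \<times> M)" "csub (B \<times> B)" using M B csub_Times by auto
  show "clin (kz (act b) (act c) d)" by (rule kz_lin)
  show "clin (map_prod (act r) (act r))" for r
    by (rule clinI) (auto simp: scaleC_prod_def clin_add[OF act_lin] clin_scale[OF act_lin])
  fix v :: "'v \<times> 'v"
  obtain v0 v1 where v: "v = (v0, v1)" by (cases v)
  show "kz (act b) (act c) d v \<in> M \<times> M" if "v \<in> M \<times> M"
    using that assms dM actM csub_add[OF M] csub_diff[OF M] by (auto simp: v kz_def)
  show "kz (act b) (act c) d v \<in> B \<times> B" if "v \<in> B \<times> B"
    using that assms dB actB csub_add[OF B] csub_diff[OF B] by (auto simp: v kz_def)
  show "kz (act b) (act c) d (map_prod (act r) (act r) v) = map_prod (act r) (act r) (kz (act b) (act c) d v)" for r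
    by (simp add: v kz_def d_act act_act clin_add[OF act_lin] clin_diff[OF act_lin] mult.commute)
  show "kz (act b) (act c) d (kz (act b) (act c) d v) - map_prod (act (w + b * c)) (act (w + b * c)) v \<in> B \<times> B"
    if "v \<in> M \<times> M"
  proof -
    have "kz (act b) (act c) d (kz (act b) (act c) d v) - map_prod (act (w + b * c)) (act (w + b * c)) v =
      (d (d v0) - act w v0, d (d v1) - act w v1)"
      by (simp add: v kz_def d_act act_act act_add clin_add[OF act_lin] clin_diff[OF act_lin] clin_add[OF d_lin] clin_diff[OF d_lin] mult.commute)
    then show ?thesis using that square by (simp add: v)
  qed
qed (use BM assms actM actB in \<open>auto simp: act_act act_add\<close>)

text \<open>
  \<open>M \<times> M\<close> with the differential of \<open>(b, c) \<otimes> M\<close> is quasi-isomorphic to \<open>M / c M\<close> via the first component,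
  as \<open>c\<close> is a nonzerodivisor modulo \<open>B\<close>.
\<close>

lemma tf_fin_eliminate_c:
  assumes b: "b \<in> R" and c: "c \<in> R" and a: "a \<in> R" and wbc: "\<And>v. v \<in> M \<Longrightarrow> act (w + b * c) v \<in> B"
    and nzd: "\<And>v. v \<in> M \<Longrightarrow> act c v \<in> B \<Longrightarrow> v \<in> B"
    and B': "B' = {x + act c y | x y. x \<in> B \<and> y \<in> M}"
    and P: "tf_fin (act a) M B' d"
  shows "tf_fin (map_prod (act a) (act a)) (M \<times> M) (B \<times> B) (kz (act b) (act c) d)"
proof -
  let ?D = "kz (act b) (act c) d" and ?a = "map_prod (act a) (act a)"
  note Mi = csub_diff[OF M] csub_add[OF M] csub_zero[OF M] csub_minus[OF M]
  note Bi = csub_diff[OF B] csub_add[OF B] csub_zero[OF B] csub_minus[OF B]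
  have D_lin: "clin ?D" by (rule kz_lin)
  have DM: "?D v \<in> M \<times> M" if "v \<in> M \<times> M" for v using that b c dM actM Mi by (auto simp: kz_def)
  \<comment> \<open>The total potential acts as zero modulo \<open>B\<close>, so \<open>?D\<close>
    is a genuine differential on the quotient.\<close>
  have DD: "?D (?D v) \<in> B \<times> B" if "v \<in> M \<times> M" for v
  proof -
    obtain v0 v1 where v: "v = (v0, v1)" by (cases v)
    have 1: "?D (?D v) = ((d (d v0) - act w v0) + act (w + b * c) v0, (d (d v1) - act w v1) + act (w + b * c) v1)"
      by (simp add: v kz_def d_act act_act act_add clin_add[OF act_lin] clin_diff[OF act_lin] clin_add[OF d_lin] clin_diff[OF d_lin] mult.commute)
    show ?thesis unfolding 1 using that square wbc Bi by (auto simp: v)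
  qed
  have B'I: "x \<in> B \<Longrightarrow> x \<in> B'" "y \<in> M \<Longrightarrow> act c y \<in> B'" for x y
  proof -
    show "x \<in> B'" if "x \<in> B" unfolding B' using that csub_zero[OF M] clin_zero[OF act_lin, of c]
      by (intro CollectI exI[of _ x] exI[of _ 0]) simp
    show "act c y \<in> B'" if "y \<in> M" unfolding B' using that csub_zero[OF B]
      by (intro CollectI exI[of _ 0] exI[of _ y]) simp
  qed
  have B'sub: "csub B'"
  proof (rule csubI)
    show "0 \<in> B'" using B'I(1) Bi by auto
    fix u v assume "u \<in> B'" "v \<in> B'"
    then obtain x y x' y' where "u = x + act c y" "v = x' + act c y'" "x \<in> B" "x' \<in> B" "y \<in> M" "y' \<in> M"
      unfolding B' by blast
    then show "u + v \<in> B'" unfolding B'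
      by (intro CollectI exI[of _ "x + x'"] exI[of _ "y + y'"]) (auto simp: clin_add[OF act_lin] Bi Mi)
  next
    fix r v assume "v \<in> B'"
    then obtain x y where "v = x + act c y" "x \<in> B" "y \<in> M" unfolding B' by blast
    then show "r *\<^sub>C v \<in> B'" unfolding B'
      by (intro CollectI exI[of _ "r *\<^sub>C x"] exI[of _ "r *\<^sub>C y"])
        (auto simp: clin_scale[OF act_lin] scaleC_add_right csub_scale[OF B] csub_scale[OF M])
  qed
  have project: "d (fst v) \<in> B'" if "v \<in> M \<times> M" "?D v \<in> B \<times> B" for v
  proof -
    have "d (fst v) = fst (?D v) - act c (snd v)" by (simp add: kz_def)
    then show ?thesis using that B'I csub_diff[OF B'sub] by (metis mem_Times_iff)
  qed
  \<comment> \<open>A cycle modulo \<open>c M\<close> lifts: from \<open>d v0 = x + c y\<close> the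
    second component \<open>- y\<close> makes the first component of \<open>?D\<close> vanish modulo
    \<open>B\<close>. As \<open>?D\<close> squares to zero, \<open>c\<close> then kills the second
    component, which lies in \<open>B\<close> because \<open>c\<close> is a nonzerodivisor.\<close>
  have lift: "\<exists>v1\<in>M. ?D (v0, v1) \<in> B \<times> B" if "v0 \<in> M" "d v0 \<in> B'" for v0
  proof -
    obtain x y where xy: "d v0 = x + act c y" "x \<in> B" "y \<in> M" using \<open>d v0 \<in> B'\<close> unfolding B' by blast
    have y: "- y \<in> M" using xy Mi by blast
    have "fst (?D (v0, - y)) \<in> B" using xy by (simp add: kz_def clin_minus[OF act_lin])
    moreover have "snd (?D (v0, - y)) \<in> B"
    proof -
      have "fst (?D (?D (v0, - y))) \<in> B" using DD[of "(v0, - y)"] that y by auto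
      moreover have "d (fst (?D (v0, - y))) \<in> B" using dB calculation \<open>fst (?D (v0, - y)) \<in> B\<close> by blast
      ultimately have "act c (snd (?D (v0, - y))) \<in> B"
        using Bi(1)[of "fst (?D (?D (v0, - y)))" "d (fst (?D (v0, - y)))"] by (simp add: kz_def)
      then show ?thesis using nzd DM[of "(v0, - y)"] that y by (metis mem_Times_iff fst_conv snd_conv)
    qed
    ultimately show ?thesis using y by (metis mem_Times_iff)
  qed
  \<comment> \<open>Subtracting \<open>?D (u0, y)\<close> moves the first component of the cycle
    into \<open>B\<close>. The cycle condition then says that \<open>c\<close> times the second
    component lies in \<open>B\<close>, so the second component does too.\<close>
  have bound: "\<exists>u\<in>M \<times> M. v - ?D u \<in> B \<times> B" if v: "v \<in> M \<times> M" "?D v \<in> B \<times> B" and u: "u0 \<in> M" "fst v - d u0 \<in> B'" for v u0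
  proof -
    obtain x y where xy: "fst v - d u0 = x + act c y" "x \<in> B" "y \<in> M" using u(2) unfolding B' by blast
    define z where "z = v - ?D (u0, y)"
    have uM: "(u0, y) \<in> M \<times> M" using u xy by simp
    have zM: "z \<in> M \<times> M" unfolding z_def by (rule csub_diff[OF csub_Times[OF M M] v(1) DM[OF uM]])
    have "fst z = x" using xy(1) by (simp add: z_def kz_def algebra_simps)
    then have z0: "fst z \<in> B" using xy by simp
    have "?D z \<in> B \<times> B" unfolding z_def clin_diff[OF D_lin]
      using csub_diff[OF csub_Times[OF B B] v(2) DD[OF uM]] .
    then have "fst (?D z) - d (fst z) \<in> B" using dB[OF z0] Bi by (auto simp: mem_Times_iff)
    then have "act c (snd z) \<in> B" by (simp add: kz_def)
    then have "snd z \<in> B" using nzd zM by (auto simp: mem_Times_iff)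
    then show ?thesis using z0 uM by (intro bexI[of _ "(u0, y)"]) (auto simp: z_def mem_Times_iff)
  qed
  obtain n and f :: "nat \<Rightarrow> _" where f: "\<And>k. k < n \<Longrightarrow> f k \<in> M" "\<And>k. k < n \<Longrightarrow> d (f k) \<in> B'"
    "\<And>v. v \<in> M \<Longrightarrow> d v \<in> B' \<Longrightarrow> \<exists>l. \<exists>u\<in>M. \<exists>w\<in>M. d u \<in> B' \<and>
        v - ((\<Sum>k<n. l k *\<^sub>C f k) + act a u + d w) \<in> B'"
    using tf_finD2[OF P] by metis
  have "\<forall>k. \<exists>v1. k < n \<longrightarrow> v1 \<in> M \<and> ?D (f k, v1) \<in> B \<times> B" using lift f by metis
  then obtain f1 where f1: "\<And>k. k < n \<Longrightarrow> f1 k \<in> M" "\<And>k. k < n \<Longrightarrow> ?D (f k, f1 k) \<in> B \<times> B" by metis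
  show ?thesis
  proof (rule tf_finI[where f = "\<lambda>k. (f k, f1 k)" and n = n], goal_cases)
    case (1 v w)
    have fB: "fst (?a v - ?D w) \<in> B" using 1(4) by (simp only: mem_Times_iff)
    have sw: "snd w \<in> M" using 1(2) by (simp only: mem_Times_iff)
    have "act a (fst v) - d (fst w) = fst (?a v - ?D w) + act c (snd w)"
      by (simp add: kz_def)
    then have "act a (fst v) - d (fst w) \<in> B'"
      using csub_add[OF B'sub B'I(1)[OF fB] B'I(2)[OF sw]] by (simp only:)
    then obtain u0 where "u0 \<in> M" "fst v - d u0 \<in> B'"
      using tf_finD1[OF P, of "fst v" "fst w"] project[OF 1(1,3)] 1 by auto
    then show ?case by (rule bound[OF 1(1,3)])
  next
    case (2 k)
    then show ?case using f f1 by simp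
  next
    case (3 v)
    then obtain l u0 w0 where u: "u0 \<in> M" "w0 \<in> M" "d u0 \<in> B'"
      "fst v - ((\<Sum>k<n. l k *\<^sub>C f k) + act a u0 + d w0) \<in> B'"
      using f(3)[OF _ project[OF 3]] 3(1) unfolding mem_Times_iff by blast
    from lift[OF u(1,3)] obtain u1 where u1: "u1 \<in> M" "?D (u0, u1) \<in> B \<times> B" by (rule bexE)
    \<comment> \<open>\<open>z\<close> is a cycle because the generators and \<open>u0\<close> have
      been lifted to cycles; its first component is a boundary modulo \<open>B'\<close>, so
      \<open>bound\<close> applies.\<close>
    define z where "z = v - ((\<Sum>k<n. l k *\<^sub>C (f k, f1 k)) + ?a (u0, u1))"
    have sM: "(\<Sum>k<n. l k *\<^sub>C (f k, f1 k)) \<in> M \<times> M"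
      by (intro csub_sum csub_scale csub_Times M) (simp add: f(1) f1(1))
    have aM: "?a (u0, u1) \<in> M \<times> M" using actM[OF a u(1)] actM[OF a u1(1)] by simp
    have zM: "z \<in> M \<times> M" unfolding z_def
      by (intro csub_diff[OF csub_Times[OF M M]] csub_add[OF csub_Times[OF M M]] 3(1) sM aM)
    have Ds: "?D (\<Sum>k<n. l k *\<^sub>C (f k, f1 k)) \<in> B \<times> B"
      unfolding clin_sum[OF D_lin] clin_scale[OF D_lin]
      by (intro csub_sum csub_scale csub_Times B) (simp only: f1(2) lessThan_iff)
    have "?D (?a (u0, u1)) = ?a (?D (u0, u1))"
      by (simp add: kz_def d_act act_act clin_add[OF act_lin] clin_diff[OF act_lin] mult.commute)
    then have Da: "?D (?a (u0, u1)) \<in> B \<times> B" using u1(2) actB[OF a] by (cases "?D (u0, u1)") simp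
    have Dz: "?D z \<in> B \<times> B" unfolding z_def clin_diff[OF D_lin] clin_add[OF D_lin]
      by (intro csub_diff[OF csub_Times[OF B B]] csub_add[OF csub_Times[OF B B]] 3(2) Ds Da)
    have "fst z - d w0 = fst v - ((\<Sum>k<n. l k *\<^sub>C f k) + act a u0 + d w0)"
      by (simp add: z_def fst_sum scaleC_prod_def)
    then have "fst z - d w0 \<in> B'" using u(4) by (simp only:)
    from bound[OF zM Dz u(2) this] obtain w' where w': "w' \<in> M \<times> M" "z - ?D w' \<in> B \<times> B" by (rule bexE)
    show ?case
      by (rule exI[of _ l], rule bexI[of _ "(u0, u1)"], rule bexI[of _ w'])
        (use u(1) u1 w' in \<open>simp_all add: z_def diff_diff_add\<close>)
  qed
qed

lemma tf_fin_uminus: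
  assumes "tf_fin fa M B' d" "csub B'" "csub M"
  shows "tf_fin fa M B' (\<lambda>v. - d v)"
proof -
  have neg: "- d v = d (- v)" for v by (simp add: clin_minus[OF d_lin])
  have m: "- v \<in> M \<longleftrightarrow> v \<in> M" for v using csub_minus[OF M, of v] csub_minus[OF M, of "- v"] by auto
  have m': "- v \<in> B' \<longleftrightarrow> v \<in> B'" for v using csub_minus[OF assms(2), of v] csub_minus[OF assms(2), of "- v"] by auto
  obtain n and f :: "nat \<Rightarrow> _" where f: "\<And>k. k < n \<Longrightarrow> f k \<in> M" "\<And>k. k < n \<Longrightarrow> d (f k) \<in> B'"
    "\<And>v. v \<in> M \<Longrightarrow> d v \<in> B' \<Longrightarrow> \<exists>l. \<exists>u\<in>M. \<exists>w\<in>M. d u \<in> B' \<and>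
        v - ((\<Sum>k<n. l k *\<^sub>C f k) + fa u + d w) \<in> B'"
    using tf_finD2[OF assms(1)] by metis
  show ?thesis
  proof (rule tf_finI[where f = f and n = n], goal_cases)
    case (1 v w)
    then show ?case using tf_finD1[OF assms(1), of v "- w"] m m' neg by (metis minus_minus)
  next
    case (2 k) then show ?case using f m' by auto
  next
    case (3 v)
    then obtain l u w where "u \<in> M" "w \<in> M" "d u \<in> B'" "v - ((\<Sum>k<n. l k *\<^sub>C f k) + fa u + d w) \<in> B'"
      using f(3)[of v] m' by auto
    then show ?case
      by (intro exI[of _ l], rule_tac bexI[of _ u], rule_tac bexI[of _ "- w"]) (simp_all add: m m' clin_minus[OF d_lin])
  qed
qed

text \<open>Exchanging the even and the odd generator swaps \<open>b\<close> and \<open>c\<close>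
  and replaces \<open>d\<close> by \<open>- d\<close>, which changes neither cycles nor boundaries.
  This reduces the claim to the elimination of the other entry.\<close>

lemma tf_fin_eliminate_b:
  assumes b: "b \<in> R" and c: "c \<in> R" and a: "a \<in> R" and wbc: "\<And>v. v \<in> M \<Longrightarrow> act (w + b * c) v \<in> B"
    and nzd: "\<And>v. v \<in> M \<Longrightarrow> act b v \<in> B \<Longrightarrow> v \<in> B"
    and B': "B' = {x + act b y | x y. x \<in> B \<and> y \<in> M}" "csub B'"
    and P: "tf_fin (act a) M B' d"
  shows "tf_fin (map_prod (act a) (act a)) (M \<times> M) (B \<times> B) (kz (act b) (act c) d)"
proof -
  interpret neg: kmodule R act M B "\<lambda>v. - d v" w
    by standard (use M B BM d_lin dM dB act_lin actM actB act_act act_add d_act square wR in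
      \<open>auto simp: clin_minus intro: csub_minus intro!: clinI simp: clin_add clin_scale scaleC_minus_right\<close>)
  have "tf_fin (map_prod (act a) (act a)) (M \<times> M) (B \<times> B) (kz (act c) (act b) (\<lambda>v. - d v))"
    using neg.tf_fin_eliminate_c[OF c b a, of B'] wbc nzd B' tf_fin_uminus[OF P B'(2) M]
    by (simp add: mult.commute)
  then show ?thesis
  proof (rule tf_fin_transfer[where \<phi> = prod.swap])
    show "clin (prod.swap :: 'v \<times> 'v \<Rightarrow> _)" by (rule clinI) (auto simp: scaleC_prod_def)
    show "csub (M \<times> M)" using M csub_Times by blast
    show "kz (act b) (act c) d v \<in> M \<times> M" if "v \<in> M \<times> M" for v
      using that b c dM actM csub_add[OF M] csub_diff[OF M] by (auto simp: kz_def)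
    show "prod.swap (kz (act b) (act c) d v) = kz (act c) (act b) (\<lambda>v. - d v) (prod.swap v)" for v
      by (simp add: kz_def)
  qed (use a actM in \<open>auto\<close>)
qed

end

section \<open>Elimination of variables\<close>

text \<open>
  \<open>\<Psi>\<close> computes normal forms modulo an ideal, its kernel, in which the variables in \<open>X\<close> and \<open>a\<close>
  remain free.
\<close>

locale reduction =
  fixes m :: nat and X :: "nat set" and \<Psi> :: "pring \<Rightarrow> pring"
  assumes add: "\<Psi> (f + g) = \<Psi> f + \<Psi> g"
    and polys: "f \<in> polys {0..m} \<Longrightarrow> \<Psi> f \<in> polys {0..m}"
    and mult: "g \<in> polys (insert 0 X) \<Longrightarrow> \<Psi> (g * f) = g * \<Psi> f"
    and X: "X \<subseteq> {1..m}"
    and ideal: "f \<in> polys {0..m} \<Longrightarrow> g \<in> polys {0..m} \<Longrightarrow> \<Psi> f = 0 \<Longrightarrow> \<Psi> (g * f) = 0"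
    and congr: "f \<in> polys {0..m} \<Longrightarrow> \<Psi> (f - \<Psi> f) = 0"
    and one: "\<Psi> 1 = 1"
begin

lemma zero [simp]: "\<Psi> 0 = 0" using add[of 0 0] by simp
lemma uminus: "\<Psi> (- f) = - \<Psi> f" using add[of f "- f"] by (simp add: minus_unique)
lemma diff: "\<Psi> (f - g) = \<Psi> f - \<Psi> g" using add[of f "- g"] by (simp add: uminus)
lemma fixed: "g \<in> polys (insert 0 X) \<Longrightarrow> \<Psi> g = g" using mult[of g 1] by (simp add: one)
lemma Const_mult: "\<Psi> (Const c * f) = Const c * \<Psi> f" by (rule mult) simp
lemma numeral_mult: "\<Psi> (numeral k * f) = numeral k * \<Psi> f" by (rule mult) simp
lemma subset: "f \<in> polys (insert 0 X) \<Longrightarrow> f \<in> polys {0..m}" by (rule polys_mono[rotated]) (use X in auto)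

text \<open>A normal form map is not multiplicative in general. If the normal form of one factor
  involves only free variables, that factor may be replaced by it modulo the kernel and then pulled
  out.\<close>

lemma mult_value:
  assumes "e \<in> polys {0..m}" "f \<in> polys {0..m}" "\<Psi> e \<in> polys (insert 0 X)"
  shows "\<Psi> (e * f) = \<Psi> e * \<Psi> f"
proof -
  have "\<Psi> (f * (e - \<Psi> e)) = 0"
    using ideal[of "e - \<Psi> e" f] congr[OF assms(1)] assms(1,2) polys polys_diff by blast
  then have "\<Psi> (e * f) - \<Psi> (\<Psi> e * f) = 0" by (simp add: diff[symmetric] algebra_simps)
  then show ?thesis using mult[OF assms(3), of f] by simp
qed

end

text \<open>Passing from \<open>\<Psi>\<close> to \<open>\<Psi>'\<close> adjoins \<open>e\<close> to
  the ideal: the second clause makes \<open>e\<close> a nonzerodivisor modulo the old kernel, the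
  third describes the new one.\<close>

definition good_step :: "nat \<Rightarrow> (pring \<Rightarrow> pring) \<Rightarrow> (pring \<Rightarrow> pring) \<Rightarrow> pring \<Rightarrow> bool"
  where "good_step m \<Psi> \<Psi>' e \<longleftrightarrow> e \<in> polys {0..m} \<and>
    (\<forall>f\<in>polys {0..m}. \<Psi> (e * f) = 0 \<longrightarrow> \<Psi> f = 0) \<and>
    (\<forall>f\<in>polys {0..m}. \<Psi>' f = 0 \<longleftrightarrow> (\<exists>g\<in>polys {0..m}. \<Psi> (f - e * g) = 0))"

text \<open>The normal form of \<open>e\<close> lies in the free variables, so on normal forms
  \<open>e\<close> acts as multiplication by a nonzero multiple of \<open>x^k - t\<close>. This is
  injective on a domain, and reducing modulo \<open>x^k - t\<close> gives normal forms for the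
  enlarged ideal.\<close>

lemma (in reduction) reduct_step:
  assumes x: "x \<in> X" and t: "t \<in> polys (insert 0 (X - {x}))" and k: "k > 0" and u: "u \<noteq> 0"
    and e: "e \<in> polys {0..m}" "\<Psi> e = Const u * (Var x ^ k - t)"
  shows "reduction m (X - {x}) (reduct x k t \<circ> \<Psi>)" "good_step m \<Psi> (reduct x k t \<circ> \<Psi>) e"
proof -
  let ?R = "polys {0..m}" and ?\<Psi> = "reduct x k t \<circ> \<Psi>"
  let ?g = "Var x ^ k - t"
  have xm: "x \<in> {0..m}" "x \<noteq> 0" using x X by auto
  have tX: "t \<in> polys (insert 0 X)" by (rule polys_mono[OF _ t]) auto
  have tR: "t \<in> ?R" using subset[OF tX] .
  have gX: "?g \<in> polys (insert 0 X)" using x tX by (intro polys_diff polys_power) auto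
  have gR: "?g \<in> ?R" using subset[OF gX] .
  have g0: "?g \<noteq> 0" by (rule Var_power_minus_nonzero[OF t]) (use k xm in auto)
  have eX: "\<Psi> e \<in> polys (insert 0 X)" unfolding e by (intro polys_mult polys_Const gX)
  have kill: "reduct x k t (?g * f) = 0" for f
  proof -
    have "reduct x k t (?g * f + t * f) = t * reduct x k t f"
      using reduct_power[OF k, of x t f] by (simp add: left_diff_distrib)
    then show ?thesis using reduct_mult[OF t, of x k t f] xm by (simp add: reduct_add)
  qed
  have \<Psi>e: "\<Psi> (e * f) = Const u * (?g * \<Psi> f)" if "f \<in> ?R" for f
    using mult_value[OF e(1) that eX] by (simp add: e mult.assoc)
  have r0: "reduct x k t 0 = 0" using reduct_add[of x k t 0 0] by simp
  have key: "?\<Psi> f = 0 \<longleftrightarrow> (\<exists>g\<in>?R. \<Psi> (f - e * g) = 0)" if f: "f \<in> ?R" for f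
  proof
    assume "?\<Psi> f = 0"
    moreover obtain h where h: "h \<in> ?R" "\<Psi> f - reduct x k t (\<Psi> f) = ?g * h"
      using reduct_congruent[OF polys[OF f] tR xm(1)] by blast
    ultimately have 1: "\<Psi> f = ?g * h" by simp
    have c: "Const (inverse u) * h \<in> ?R" using h by (intro polys_mult) auto
    have "\<Psi> (e * (Const (inverse u) * h)) = (Const u * Const (inverse u)) * (?g * \<Psi> h)"
      unfolding \<Psi>e[OF c] Const_mult by (simp only: mult_ac)
    also have "\<dots> = \<Psi> (?g * h)" using u by (simp add: Defs.Const_def mult_single mult[OF gX])
    also have "\<dots> = \<Psi> f" using congr[OF f] by (simp add: diff 1)
    finally have "\<Psi> (f - e * (Const (inverse u) * h)) = 0" by (simp add: diff)
    then show "\<exists>g\<in>?R. \<Psi> (f - e * g) = 0" using c by blast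
  next
    assume "\<exists>g\<in>?R. \<Psi> (f - e * g) = 0"
    then obtain h where "h \<in> ?R" "\<Psi> f = \<Psi> (e * h)" by (auto simp: diff)
    then have "\<Psi> f = Const u * (?g * \<Psi> h)" using \<Psi>e by simp
    then show "?\<Psi> f = 0" by (simp add: reduct_Const kill)
  qed
  have nzd: "\<Psi> f = 0" if "f \<in> ?R" "\<Psi> (e * f) = 0" for f
    using that(2) g0 u unfolding \<Psi>e[OF that(1)] by simp
  show "good_step m \<Psi> ?\<Psi> e" unfolding good_step_def using key nzd e by blast
  have rR: "reduct x k t f \<in> ?R" if "f \<in> ?R" for f by (rule reduct_polys[OF that tR xm(1)])
  show "reduction m (X - {x}) ?\<Psi>"
  proof
    fix f g
    show "?\<Psi> (f + g) = ?\<Psi> f + ?\<Psi> g" by (simp add: add reduct_add)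
    show "X - {x} \<subseteq> {1..m}" using X by auto
    show "?\<Psi> 1 = 1" using reduct_mult[of 1 "{}" x k t 1]
      by (simp add: one reduct_def lin_ext_def)
        (metis (mono_tags, lifting) div_0 lookup_zero mod_0 mult.right_neutral power_0 poly_mapping_eqI lookup_update single_one)
    show "?\<Psi> (g * f) = g * ?\<Psi> f" if "g \<in> polys (insert 0 (X - {x}))"
    proof -
      have "g \<in> polys (insert 0 X)" by (rule polys_mono[OF _ that]) auto
      then show ?thesis using mult reduct_mult[OF that, of x k t] xm by simp
    qed
    show "?\<Psi> f \<in> ?R" if "f \<in> ?R" using that polys rR by simp
    show "?\<Psi> (g * f) = 0" if fg: "f \<in> ?R" "g \<in> ?R" "?\<Psi> f = 0"
    proof -
      obtain h where h: "h \<in> ?R" "\<Psi> (f - e * h) = 0" using fg(3) key[OF fg(1)] by blast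
      have "\<Psi> (g * (f - e * h)) = 0" using ideal[OF _ fg(2) h(2)] fg(1) e(1) h(1) polys_diff polys_mult by blast
      then have "\<Psi> (g * f - e * (g * h)) = 0" by (simp add: algebra_simps)
      then show ?thesis using key[OF polys_mult[OF fg(2,1)]] polys_mult[OF fg(2) h(1)] by blast
    qed
    show "?\<Psi> (f - ?\<Psi> f) = 0" if f: "f \<in> ?R"
    proof -
      obtain h where h: "h \<in> ?R" "\<Psi> f - reduct x k t (\<Psi> f) = ?g * h"
        using reduct_congruent[OF polys[OF f] tR xm(1)] by blast
      have "f - ?\<Psi> f = (f - \<Psi> f) + ?g * h" unfolding h(2)[symmetric] by simp
      then have "\<Psi> (f - ?\<Psi> f) = \<Psi> (f - \<Psi> f) + \<Psi> (?g * h)" by (simp only: add)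
      then have "\<Psi> (f - ?\<Psi> f) = ?g * \<Psi> h" using congr[OF f] mult[OF gX, of h] by simp
      then show ?thesis by (simp add: kill)
    qed
  qed
qed

text \<open>The sign orients half-edges. An arc imposes \<open>x_i - x_p = 0\<close>, joining two
  incoming ends imposes \<open>x_p + x_q = 0\<close> and joining two outgoing ones
  \<open>x_i + x_j = 0\<close>; with this sign all three read
  \<open>hvar h + hvar h' = 0\<close>.\<close>

definition hvar :: "dart \<Rightarrow> pring"
  where "hvar h = (if snd h then Var (fst h) else - Var (fst h))"

text \<open>
  The relations left to be imposed identify the half-edges in \<open>H\<close> in pairs, with \<open>y\<^sub>h + y\<^sub>k = 0\<close> for a
  pair \<open>h, k\<close> and \<open>y = hvar\<close>. Modulo the relations imposed so far, each remaining variable in \<open>X\<close>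
  represents an open strand, whose two ends correspond under \<open>\<theta>\<close> to two half-edges in \<open>H\<close>; on a
  closed strand \<open>3 x\<^sup>2 = a\<close>, or \<open>x\<^sup>2\<close> is the square of an open variable.
\<close>

definition matched :: "nat \<Rightarrow> nat set \<Rightarrow> (pring \<Rightarrow> pring) \<Rightarrow> dart set \<Rightarrow> (dart \<Rightarrow> dart) \<Rightarrow> bool"
  where "matched m X \<Psi> H \<theta> \<longleftrightarrow> reduction m X \<Psi> \<and> H \<subseteq> {1..m} \<times> UNIV \<and> bij_betw \<theta> H (X \<times> UNIV) \<and>
    (\<forall>h\<in>H. \<Psi> (hvar h) = hvar (\<theta> h)) \<and>
    (\<forall>i\<in>{1..m}. \<Psi> (3 * Var i ^ 2 - a_var) = 0 \<or> (\<exists>x\<in>X. \<Psi> (Var i ^ 2 - Var x ^ 2) = 0))"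

lemma three_thirds: "3 * Const (1 / 3) = 1"
  using Const_mult[of 3 "1 / 3"] by (simp add: Const_numeral)

lemma matchedD:
  assumes "matched m X \<Psi> H \<theta>"
  shows "h \<in> H \<Longrightarrow> \<Psi> (hvar h) = hvar (\<theta> h)"
    "i \<in> {1..m} \<Longrightarrow> \<Psi> (3 * Var i ^ 2 - a_var) = 0 \<or> (\<exists>x\<in>X. \<Psi> (Var i ^ 2 - Var x ^ 2) = 0)"
  using assms unfolding matched_def by simp_all

lemma hvar_polys: "fst h \<in> W \<Longrightarrow> hvar h \<in> polys W"
  by (auto simp: hvar_def intro: polys_uminus)

text \<open>Two different strands are joined at \<open>h\<close> and \<open>h'\<close>, which turns
  \<open>x\<close> into plus or minus \<open>x'\<close>. The far end \<open>(x, \<not> s)\<close> of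
  the first strand takes over the place \<open>(x', s')\<close> that \<open>h'\<close> had on the
  second one.\<close>

lemma linear_step:
  assumes M: "matched m X \<Psi> H \<theta>" and h: "h \<in> H" "h' \<in> H" "\<theta> h = (x, s)" "\<theta> h' = (x', s')" "x \<noteq> x'"
    and e: "e \<in> polys {0..m}" "u \<noteq> 0" "\<Psi> e = Const u * (hvar (\<theta> h) + hvar (\<theta> h'))"
  shows "matched m (X - {x}) (reduct x 1 (hvar (x', s \<noteq> s')) \<circ> \<Psi>) (H - {h, h'})
      (\<lambda>k. if \<theta> k = (x, \<not> s) then (x', s') else \<theta> k)"
    "good_step m \<Psi> (reduct x 1 (hvar (x', s \<noteq> s')) \<circ> \<Psi>) e"
proof -
  let ?t = "hvar (x', s \<noteq> s')" and ?\<theta> = "\<lambda>k. if \<theta> k = (x, \<not> s) then (x', s') else \<theta> k"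
  define r where "r = reduct x 1 ?t"
  let ?\<Psi> = "r \<circ> \<Psi>"
  interpret reduction m X \<Psi> using M by (simp add: matched_def)
  have bij: "inj_on \<theta> H" "\<theta> ` H = X \<times> UNIV" using M by (auto simp: matched_def bij_betw_def)
  have xX: "x \<in> X" "x' \<in> X" using bij h by force+
  then have x0: "x \<noteq> 0" using X by auto
  have tP: "?t \<in> polys (insert 0 (X - {x}))" using xX h by (intro hvar_polys) auto
  have e': "\<Psi> e = Const (if s then u else - u) * (Var x ^ 1 - ?t)"
    by (auto simp: e h hvar_def Const_uminus algebra_simps)
  have u': "(if s then u else - u) \<noteq> 0" using e by simp
  note step = reduct_step[OF xX(1) tP zero_less_one u' e(1) e', folded r_def]
  show "good_step m \<Psi> (reduct x 1 ?t \<circ> \<Psi>) e" unfolding r_def[symmetric] by (rule step)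
  interpret n: reduction m "X - {x}" ?\<Psi> by (rule step)
  have red_fix: "r g = g" if "g \<in> polys (insert 0 (X - {x}))" for g
  proof -
    have "g \<in> polys (insert 0 X)" by (rule polys_mono[OF _ that]) auto
    then show ?thesis using n.fixed[OF that] fixed[of g] by simp
  qed
  have red_x: "r (Var x * f) = ?t * r f" for f
    using reduct_power[of 1 x ?t f, folded r_def] by simp
  have red_1: "r 1 = 1" by (rule red_fix) simp
  have red_Vx: "r (Var x) = ?t" using red_x[of 1] red_1 by simp
  have red_uminus: "r (- f) = - r f" for f
    using reduct_mult[of "- 1" "{}" x 1 ?t f, folded r_def] by (simp add: polys_uminus)
  have red_0: "r 0 = 0" by (rule red_fix) simp
  have inj': "k \<noteq> h \<Longrightarrow> k \<noteq> h' \<Longrightarrow> k \<in> H \<Longrightarrow> \<theta> k \<noteq> (x, s) \<and> \<theta> k \<noteq> (x', s')" for k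
    using bij(1) h by (metis inj_onD)
  have hv: "?\<Psi> (hvar k) = hvar (?\<theta> k)" if k: "k \<in> H - {h, h'}" for k
  proof (cases "\<theta> k = (x, \<not> s)")
    case True
    have "?\<Psi> (hvar k) = r (hvar (x, \<not> s))" using matchedD(1)[OF M] k by (simp add: True)
    also have "hvar (x, \<not> s) = (if s then - Var x else Var x)" by (simp add: hvar_def)
    also have "r \<dots> = (if s then - ?t else ?t)"
      by (simp only: if_distrib[of "r"] red_uminus red_Vx)
    also have "\<dots> = hvar (x', s')" by (cases s; cases s') (simp_all add: hvar_def)
    finally show ?thesis by (simp add: True)
  next
    case False
    have "\<theta> k \<noteq> (x, s)" using inj'[of k] k by simp
    then have "fst (\<theta> k) \<noteq> x" using False by (cases "\<theta> k") auto
    moreover have "\<theta> k \<in> X \<times> UNIV" using bij k by blast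
    ultimately have "hvar (\<theta> k) \<in> polys (insert 0 (X - {x}))" by (intro hvar_polys) auto
    then have "r (hvar (\<theta> k)) = hvar (\<theta> k)" by (rule red_fix)
    then show ?thesis using matchedD(1)[OF M] k False by simp
  qed
  have bij': "bij_betw ?\<theta> (H - {h, h'}) ((X - {x}) \<times> UNIV)"
    unfolding bij_betw_def
  proof
    show "inj_on ?\<theta> (H - {h, h'})"
    proof (rule inj_onI)
      fix k l assume kl: "k \<in> H - {h, h'}" "l \<in> H - {h, h'}" "?\<theta> k = ?\<theta> l"
      have "\<theta> k \<noteq> (x', s')" "\<theta> l \<noteq> (x', s')" using inj' kl by auto
      then have "\<theta> k = \<theta> l" using kl(3) by (auto split: if_splits)
      then show "k = l" using kl bij(1) by (auto dest: inj_onD)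
    qed
    show "?\<theta> ` (H - {h, h'}) = (X - {x}) \<times> UNIV"
    proof
      show "?\<theta> ` (H - {h, h'}) \<subseteq> (X - {x}) \<times> UNIV"
      proof
        fix z assume "z \<in> ?\<theta> ` (H - {h, h'})"
        then obtain k where zk: "z = ?\<theta> k" and kH: "k \<in> H - {h, h'}" by (rule imageE)
        then have k: "k \<in> H" "k \<noteq> h" "k \<noteq> h'" "z = ?\<theta> k" by simp_all
        have "\<theta> k \<in> X \<times> UNIV" using bij k by blast
        moreover have "\<theta> k \<noteq> (x, s)" using inj' k by auto
        ultimately show "z \<in> (X - {x}) \<times> UNIV" using k(4) xX h(5) by (cases "\<theta> k") auto
      qed
      show "(X - {x}) \<times> UNIV \<subseteq> ?\<theta> ` (H - {h, h'})"
      proof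
        fix z :: dart assume z: "z \<in> (X - {x}) \<times> UNIV"
        show "z \<in> ?\<theta> ` (H - {h, h'})"
        proof (cases "z = (x', s')")
          case True
          have "(x, \<not> s) \<in> \<theta> ` H" using bij xX by auto
          then obtain k where k: "(x, \<not> s) = \<theta> k" "k \<in> H" by (rule imageE)
          then have "k \<in> H - {h, h'}" using h by auto
          moreover have "z = ?\<theta> k" using k True by simp
          ultimately show ?thesis by (rule rev_image_eqI)
        next
          case False
          have "z \<in> \<theta> ` H" using bij z by auto
          then obtain k where k: "z = \<theta> k" "k \<in> H" by (rule imageE)
          then have "k \<in> H - {h, h'}" using h z False by auto
          moreover have "z = ?\<theta> k" using k z by auto
          ultimately show ?thesis by (rule rev_image_eqI)
        qed
      qed
    qed
  qed
  \<comment> \<open>The eliminated variable agrees with \<open>x'\<close> up to sign, so a square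
    that was tied to \<open>x\<close> is now tied to \<open>x'\<close>.\<close>
  have cl: "?\<Psi> (3 * Var i ^ 2 - a_var) = 0 \<or> (\<exists>y\<in>X - {x}. ?\<Psi> (Var i ^ 2 - Var y ^ 2) = 0)" if i: "i \<in> {1..m}" for i
  proof -
    consider "\<Psi> (3 * Var i ^ 2 - a_var) = 0" | y where "y \<in> X" "\<Psi> (Var i ^ 2 - Var y ^ 2) = 0"
      using matchedD(2)[OF M i] by blast
    then show ?thesis
    proof cases
      case 1 then show ?thesis by (simp add: red_0)
    next
      case (2 y)
      show ?thesis
      proof (cases "y = x")
        case True
        have v: "Var x ^ 2 - Var x' ^ 2 \<in> polys (insert 0 X)" using xX by (intro polys_diff polys_power) auto
        have v': "- (Var x' ^ 2) \<in> polys (insert 0 (X - {x}))" using xX h(5) by (intro polys_uminus polys_power) auto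
        have rx: "r (Var x ^ 2) = ?t * ?t"
          by (simp add: power2_eq_square red_x red_Vx)
        have "r (Var x ^ 2 + - (Var x' ^ 2)) = ?t * ?t + - (Var x' ^ 2)"
          by (simp only: r_def reduct_add) (simp only: r_def[symmetric] rx red_fix[OF v'])
        then have "r (Var x ^ 2 - Var x' ^ 2) = ?t * ?t - Var x' ^ 2" by (simp only: diff_conv_add_uminus)
        also have "\<dots> = 0" by (simp add: hvar_def power2_eq_square)
        finally have "?\<Psi> (Var x ^ 2 - Var x' ^ 2) = 0" using fixed[OF v] by simp
        moreover have "?\<Psi> (Var i ^ 2 - Var x ^ 2) = 0" using 2 True by (simp add: red_0)
        moreover have "Var i ^ 2 - Var x' ^ 2 = (Var i ^ 2 - Var x ^ 2) + (Var x ^ 2 - Var x' ^ 2)" by simp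
        ultimately have "?\<Psi> (Var i ^ 2 - Var x' ^ 2) = 0" by (simp only: n.add) simp
        then show ?thesis using xX h(5) by blast
      next
        case False
        have "?\<Psi> (Var i ^ 2 - Var y ^ 2) = 0" using 2 by (simp add: red_0)
        then show ?thesis using 2 False by blast
      qed
    qed
  qed
  have "H - {h, h'} \<subseteq> {1..m} \<times> UNIV" using M by (auto simp: matched_def)
  then show "matched m (X - {x}) (reduct x 1 ?t \<circ> \<Psi>) (H - {h, h'}) ?\<theta>"
    unfolding r_def[symmetric] matched_def using n.reduction_axioms bij' hv cl by blast
qed

text \<open>The two ends of one strand are joined. Their linear relation holds already, so a
  quadratic one is imposed: \<open>t\<close> is \<open>a / 3\<close> when it comes from
  \<open>3 x^2 = a\<close>, and \<open>y^2\<close> when a wide edge ties the closed strand to one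
  that is still open.\<close>

lemma closing_step:
  assumes M: "matched m X \<Psi> H \<theta>" and h: "h \<in> H" "h' \<in> H" "\<theta> h = (x, s)" "\<theta> h' = (x, \<not> s)"
    and e: "e \<in> polys {0..m}" "u \<noteq> 0" "\<Psi> e = Const u * (Var x ^ 2 - t)"
    and t: "t = Const (1 / 3) * a_var \<or> (\<exists>y\<in>X - {x}. t = Var y ^ 2)"
  shows "matched m (X - {x}) (reduct x 2 t \<circ> \<Psi>) (H - {h, h'}) \<theta>"
    "good_step m \<Psi> (reduct x 2 t \<circ> \<Psi>) e"
proof -
  let ?\<Psi> = "reduct x 2 t \<circ> \<Psi>"
  interpret reduction m X \<Psi> using M by (simp add: matched_def)
  have bij: "inj_on \<theta> H" "\<theta> ` H = X \<times> UNIV" using M by (auto simp: matched_def bij_betw_def)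
  have xX: "x \<in> X" using bij h by force
  then have x0: "x \<noteq> 0" using X by auto
  have tP: "t \<in> polys (insert 0 (X - {x}))" using t by (auto intro!: polys_mult polys_power)
  have two: "(0::nat) < 2" by simp
  note step = reduct_step[OF xX(1) tP two e(2) e(1,3)]
  show "good_step m \<Psi> ?\<Psi> e" by (rule step)
  interpret n: reduction m "X - {x}" ?\<Psi> by (rule step)
  have red_fix: "reduct x 2 t g = g" if "g \<in> polys (insert 0 (X - {x}))" for g
  proof -
    have "g \<in> polys (insert 0 X)" by (rule polys_mono[OF _ that]) auto
    then show ?thesis using n.fixed[OF that] fixed[of g] by simp
  qed
  have red_x: "reduct x 2 t (Var x ^ 2) = t"
    using reduct_power[of 2 x t 1] red_fix[of 1] by simp
  have red_0: "reduct x 2 t 0 = 0" by (rule red_fix) simp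
  have rest: "\<theta> ` (H - {h, h'}) = (X - {x}) \<times> UNIV"
  proof -
    have "\<theta> ` (H - {h, h'}) = \<theta> ` H - \<theta> ` {h, h'}" using bij(1) h by (intro inj_on_image_set_diff) auto
    also have "\<dots> = (X - {x}) \<times> UNIV" using bij(2) h by (cases s) auto
    finally show ?thesis .
  qed
  have hv: "?\<Psi> (hvar k) = hvar (\<theta> k)" if k: "k \<in> H - {h, h'}" for k
  proof -
    have "\<theta> k \<in> (X - {x}) \<times> UNIV" using rest k by blast
    then have "hvar (\<theta> k) \<in> polys (insert 0 (X - {x}))" by (intro hvar_polys) auto
    then show ?thesis using matchedD(1)[OF M] k by (simp add: red_fix)
  qed
  have cl: "?\<Psi> (3 * Var i ^ 2 - a_var) = 0 \<or> (\<exists>y\<in>X - {x}. ?\<Psi> (Var i ^ 2 - Var y ^ 2) = 0)" if i: "i \<in> {1..m}" for i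
  proof -
    consider "\<Psi> (3 * Var i ^ 2 - a_var) = 0" | y where "y \<in> X" "\<Psi> (Var i ^ 2 - Var y ^ 2) = 0"
      using matchedD(2)[OF M i] by blast
    then show ?thesis
    proof cases
      case 1 then show ?thesis by (simp add: red_0)
    next
      case (2 y)
      show ?thesis
      proof (cases "y = x")
        case True
        have vx: "Var x ^ 2 \<in> polys (insert 0 X)" using xX by (intro polys_power) auto
        have i: "?\<Psi> (Var i ^ 2 - Var x ^ 2) = 0" using 2 True by (simp add: red_0)
        then have it: "?\<Psi> (Var i ^ 2) = t" unfolding n.diff using fixed[OF vx] red_x by simp
        from t show ?thesis
        proof
          assume t: "t = Const (1 / 3) * a_var"
          have "?\<Psi> (3 * Var i ^ 2 - a_var) = 3 * t - a_var"
            unfolding n.diff n.numeral_mult it using n.fixed[of a_var] by simp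
          also have "3 * t = a_var" unfolding t mult.assoc[symmetric] by (simp add: three_thirds)
          finally show ?thesis by simp
        next
          assume "\<exists>y\<in>X - {x}. t = Var y ^ 2"
          then obtain y where y: "y \<in> X - {x}" "t = Var y ^ 2" by blast
          have "?\<Psi> (Var i ^ 2 - Var y ^ 2) = 0"
            unfolding n.diff it using n.fixed[of "Var y ^ 2"] y polys_power by simp
          then show ?thesis using y by blast
        qed
      next
        case False
        have "?\<Psi> (Var i ^ 2 - Var y ^ 2) = 0" using 2 by (simp add: red_0)
        then show ?thesis using 2 False by blast
      qed
    qed
  qed
  have bij': "bij_betw \<theta> (H - {h, h'}) ((X - {x}) \<times> UNIV)"
    using rest bij(1) by (auto simp: bij_betw_def intro: inj_on_subset)
  have "H - {h, h'} \<subseteq> {1..m} \<times> UNIV" using M by (auto simp: matched_def)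
  then show "matched m (X - {x}) ?\<Psi> (H - {h, h'}) \<theta>"
    unfolding matched_def using n.reduction_axioms bij' hv cl by blast
qed

lemma matched_Var:
  assumes "matched m X \<Psi> H \<theta>"
  shows "(v, True) \<in> H \<Longrightarrow> \<Psi> (Var v) = hvar (\<theta> (v, True))"
    "(v, False) \<in> H \<Longrightarrow> \<Psi> (Var v) = - hvar (\<theta> (v, False))"
    "k \<in> H \<Longrightarrow> hvar (\<theta> k) \<in> polys (insert 0 X)" "k \<in> H \<Longrightarrow> Var (fst k) \<in> polys {0..m}"
proof -
  interpret reduction m X \<Psi> using assms by (simp add: matched_def)
  show "(v, True) \<in> H \<Longrightarrow> \<Psi> (Var v) = hvar (\<theta> (v, True))"
    using assms by (auto simp: matched_def hvar_def[of "(v, True)"])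
  show "(v, False) \<in> H \<Longrightarrow> \<Psi> (Var v) = - hvar (\<theta> (v, False))"
    using matchedD(1)[OF assms, of "(v, False)"] by (simp add: hvar_def[of "(v, False)"] uminus) (metis minus_minus)
  show "hvar (\<theta> k) \<in> polys (insert 0 X)" if "k \<in> H"
  proof -
    have "\<theta> k \<in> X \<times> UNIV" using assms that by (auto simp: matched_def bij_betw_def)
    then show ?thesis by (intro hvar_polys) auto
  qed
  show "k \<in> H \<Longrightarrow> Var (fst k) \<in> polys {0..m}" using assms by (auto simp: matched_def)
qed

lemma hvar_opposite: "hvar (x, \<not> s) = - hvar (x, s)" "hvar (x, s) * hvar (x, s) = Var x ^ 2"
  "hvar (x, s) ^ 2 = Var x ^ 2"
  by (auto simp: hvar_def power2_eq_square)

text \<open>If the ends lie on different strands, \<open>x_i - x_p\<close> is linear in the free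
  variables and joins them. If they lie on the same strand, \<open>x_i\<close> and
  \<open>x_p\<close> agree already and \<open>arc_v\<close> becomes
  \<open>3 x^2 - a\<close>.\<close>

lemma arc_step:
  assumes M: "matched m X \<Psi> H \<theta>" and H: "(p, False) \<in> H" "(i, True) \<in> H"
  shows "\<exists>X' \<Psi>' \<theta>' e. matched m X' \<Psi>' (H - {(p, False), (i, True)}) \<theta>' \<and> good_step m \<Psi> \<Psi>' e \<and>
    e \<in> {arc_v (Var i) (Var p), Var i - Var p}"
proof -
  interpret reduction m X \<Psi> using M by (simp add: matched_def)
  obtain x s where h: "\<theta> (p, False) = (x, s)" by fastforce
  obtain x' s' where h': "\<theta> (i, True) = (x', s')" by fastforce
  note V = matched_Var(2)[OF M H(1)] matched_Var(1)[OF M H(2)]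
  note R = matched_Var(4)[OF M H(1)] matched_Var(4)[OF M H(2)]
  show ?thesis
  proof (cases "x = x'")
    case False
    have "\<Psi> (Var i - Var p) = Const 1 * (hvar (\<theta> (p, False)) + hvar (\<theta> (i, True)))" by (simp add: diff V)
    moreover have "Var i - Var p \<in> polys {0..m}" using R by (intro polys_diff) auto
    ultimately have L: "matched m (X - {x}) (reduct x 1 (hvar (x', s \<noteq> s')) \<circ> \<Psi>) (H - {(p, False), (i, True)})
        (\<lambda>k. if \<theta> k = (x, \<not> s) then (x', s') else \<theta> k)"
      "good_step m \<Psi> (reduct x 1 (hvar (x', s \<noteq> s')) \<circ> \<Psi>) (Var i - Var p)"
      using linear_step[OF M H h h' False, of "Var i - Var p" 1] by simp_all
    show ?thesis by (intro exI conjI, rule L(1), rule L(2), simp)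
  next
    case True
    have "inj_on \<theta> H" using M by (auto simp: matched_def bij_betw_def)
    from inj_onD[OF this _ H] have "s' = (\<not> s)" using True h h' by auto
    then have i: "\<Psi> (Var i) = hvar (x, \<not> s)" and p: "\<Psi> (Var p) = hvar (x, \<not> s)"
      using V h h' True by (simp_all add: hvar_opposite)
    have P: "hvar (x, \<not> s) \<in> polys (insert 0 X)" using matched_Var(3)[OF M H(2)] h' \<open>s' = _\<close> True by simp
    have m2: "\<Psi> (f * g) = Var x ^ 2" if "f \<in> {Var i, Var p}" "g \<in> {Var i, Var p}" for f g
      using mult_value[of f g] that R i p P hvar_opposite(2)[of x "\<not> s"] by auto
    have "\<Psi> (arc_v (Var i) (Var p)) = Const 3 * (Var x ^ 2 - Const (1 / 3) * a_var)"
      using fixed[of a_var]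
      by (simp add: arc_v_def power2_eq_square[of "Var i"] power2_eq_square[of "Var p"] diff add m2
        right_diff_distrib mult.assoc[symmetric] three_thirds Const_numeral)
    moreover have "arc_v (Var i) (Var p) \<in> polys {0..m}"
      using R unfolding arc_v_def by (intro polys_intros) auto
    ultimately have L: "matched m (X - {x}) (reduct x 2 (Const (1 / 3) * a_var) \<circ> \<Psi>) (H - {(p, False), (i, True)}) \<theta>"
      "good_step m \<Psi> (reduct x 2 (Const (1 / 3) * a_var) \<circ> \<Psi>) (arc_v (Var i) (Var p))"
      using closing_step[OF M H h h'[folded True, unfolded \<open>s' = _\<close>], of "arc_v (Var i) (Var p)" 3 "Const (1 / 3) * a_var"]
      by simp_all
    show ?thesis by (intro exI conjI, rule L(1), rule L(2), simp)
  qed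
qed

lemma good_step_kernel:
  assumes "reduction m X \<Psi>" "good_step m \<Psi> \<Psi>' e"
  shows "f \<in> polys {0..m} \<Longrightarrow> \<Psi> f = 0 \<Longrightarrow> \<Psi>' f = 0" "\<Psi>' e = 0"
proof -
  interpret reduction m X \<Psi> by fact
  have *: "\<And>f. f \<in> polys {0..m} \<Longrightarrow> \<Psi>' f = 0 \<longleftrightarrow> (\<exists>g\<in>polys {0..m}. \<Psi> (f - e * g) = 0)"
    using assms(2) unfolding good_step_def by blast
  show "\<Psi>' f = 0" if "f \<in> polys {0..m}" "\<Psi> f = 0"
    unfolding *[OF that(1)] using that(2) by (intro bexI[of _ 0]) simp_all
  have e: "e \<in> polys {0..m}" using assms(2) by (simp add: good_step_def)
  show "\<Psi>' e = 0" unfolding *[OF e] by (intro bexI[of _ 1]) simp_all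
qed

text \<open>A normal form that avoids the eliminated variable is not affected by the new
  relation.\<close>

lemma good_step_value:
  assumes "reduction m X \<Psi>" "good_step m \<Psi> \<Psi>' e" "reduction m X' \<Psi>'" "X' \<subseteq> X"
    "f \<in> polys {0..m}" "\<Psi> f = g" "g \<in> polys (insert 0 X')"
  shows "\<Psi>' f = g"
proof -
  interpret reduction m X \<Psi> by fact
  interpret n: reduction m X' \<Psi>' by fact
  have g: "g \<in> polys (insert 0 X)" by (rule polys_mono[OF _ assms(7)]) (use assms(4) in auto)
  have "\<Psi> (f - g) = 0" using fixed[OF g] assms(6) by (simp add: diff)
  then have "\<Psi>' (f - g) = 0"
    using good_step_kernel(1)[OF assms(1,2)] polys_diff[OF assms(5) subset[OF g]] by blast
  then show ?thesis using n.fixed[OF assms(7)] by (simp add: n.diff)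
qed

text \<open>Once both sums vanish only \<open>- 3 x_i x_j - a\<close> is left of
  \<open>wide_u1\<close>.\<close>

lemma (in reduction) wide_u1_value:
  assumes "Var i \<in> polys {0..m}" "Var j \<in> polys {0..m}" "Var p \<in> polys {0..m}" "Var q \<in> polys {0..m}"
    "\<Psi> (Var i + Var j) = 0" "\<Psi> (Var p + Var q) = 0" "\<Psi> (Var i * Var j) = - (Var x ^ 2)"
  shows "\<Psi> (wide_u1 (Var i) (Var j) (Var p) (Var q)) = Const 3 * (Var x ^ 2 - Const (1 / 3) * a_var)"
proof -
  have I: "\<Psi> (g * (Var i + Var j)) = 0" "\<Psi> (g * (Var p + Var q)) = 0" if "g \<in> polys {0..m}" for g
    using ideal[OF polys_add[OF assms(1,2)] that assms(5)] ideal[OF polys_add[OF assms(3,4)] that assms(6)] by blast+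
  have "wide_u1 (Var i) (Var j) (Var p) (Var q) = (Var i + Var j) * (Var i + Var j) + (Var i + Var j) * (Var p + Var q)
    + (Var p + Var q) * (Var p + Var q) - 3 * (Var i * Var j) - a_var"
    unfolding wide_u1_def power2_eq_square ..
  then have "\<Psi> (wide_u1 (Var i) (Var j) (Var p) (Var q)) = 3 * Var x ^ 2 - a_var"
    using I[OF polys_add[OF assms(1,2)]] I[OF polys_add[OF assms(3,4)]] assms(7) fixed[of a_var]
    by (simp only: add diff numeral_mult) simp
  also have "\<dots> = Const 3 * (Var x ^ 2 - Const (1 / 3) * a_var)"
    by (simp add: right_diff_distrib mult.assoc[symmetric] three_thirds Const_numeral)
  finally show ?thesis .
qed

text \<open>One relation joins \<open>p\<close> with \<open>q\<close>, the other joins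
  \<open>i\<close> with \<open>j\<close>, and each row has to supply one of them. The rows are used
  in an order that depends on whether \<open>p\<close> and \<open>q\<close> end the same strand,
  because the later relation takes a usable form only after the earlier one has been
  imposed.\<close>

lemma wide_step:
  fixes p q i j :: nat
  defines "b1 \<equiv> wide_u1 (Var i) (Var j) (Var p) (Var q)" and "c1 \<equiv> Var i + Var j - Var p - Var q"
    and "b2 \<equiv> wide_u2 (Var i) (Var j) (Var p) (Var q)" and "c2 \<equiv> Var i * Var j - Var p * Var q"
  assumes M: "matched m X \<Psi> H \<theta>"
    and H: "(p, False) \<in> H" "(q, False) \<in> H" "(i, True) \<in> H" "(j, True) \<in> H" "p \<noteq> q" "i \<noteq> j"
  shows "\<exists>X1 \<Psi>1 X' \<Psi>' \<theta>' e1 e2. reduction m X1 \<Psi>1 \<and>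
    matched m X' \<Psi>' (H - {(p, False), (q, False), (i, True), (j, True)}) \<theta>' \<and>
    good_step m \<Psi> \<Psi>1 e1 \<and> good_step m \<Psi>1 \<Psi>' e2 \<and>
    (e1 \<in> {b2, c2} \<and> e2 \<in> {b1, c1} \<or> e1 \<in> {b1, c1} \<and> e2 \<in> {b2, c2})"
proof -
  have red: "reduction m X \<Psi>" using M by (simp add: matched_def)
  interpret reduction m X \<Psi> by (rule red)
  have inj: "inj_on \<theta> H" using M by (auto simp: matched_def bij_betw_def)
  note R = matched_Var(4)[OF M H(1), simplified] matched_Var(4)[OF M H(2), simplified]
    matched_Var(4)[OF M H(3), simplified] matched_Var(4)[OF M H(4), simplified]
  have eR: "b1 \<in> polys {0..m}" "c1 \<in> polys {0..m}" "b2 \<in> polys {0..m}" "c2 \<in> polys {0..m}"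
  proof -
    have V: "Var p \<in> polys {0..m}" "Var q \<in> polys {0..m}" "Var i \<in> polys {0..m}" "Var j \<in> polys {0..m}"
      using R by simp_all
    show "c1 \<in> polys {0..m}" "c2 \<in> polys {0..m}" unfolding c1_def c2_def by (intro polys_intros V)+
    show "b1 \<in> polys {0..m}" unfolding b1_def wide_u1_def
      by (intro polys_intros V polys_numeral) simp
    have "b2 = - (3 * (Var p + Var q))" unfolding b2_def wide_u2_def by simp
    then show "b2 \<in> polys {0..m}" by (simp only:) (intro polys_intros V polys_numeral)
  qed
  have VR: "Var p \<in> polys {0..m}" "Var q \<in> polys {0..m}" "Var i \<in> polys {0..m}" "Var j \<in> polys {0..m}"
    using R by simp_all
  obtain xp sp where hp: "\<theta> (p, False) = (xp, sp)" by fastforce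
  obtain xq sq where hq: "\<theta> (q, False) = (xq, sq)" by fastforce
  obtain xi si where hi: "\<theta> (i, True) = (xi, si)" by fastforce
  obtain xj sj where hj: "\<theta> (j, True) = (xj, sj)" by fastforce
  note Vp = matched_Var(2)[OF M H(1), unfolded hp] and Vq = matched_Var(2)[OF M H(2), unfolded hq]
    and Vi = matched_Var(1)[OF M H(3), unfolded hi] and Vj = matched_Var(1)[OF M H(4), unfolded hj]
  have xX: "xp \<in> X" "xq \<in> X" "xi \<in> X" "xj \<in> X"
  proof -
    have th: "\<theta> k \<in> X \<times> UNIV" if "k \<in> H" for k using M that by (auto simp: matched_def bij_betw_def)
    show "xp \<in> X" "xq \<in> X" "xi \<in> X" "xj \<in> X"
      using th[OF H(1)] th[OF H(2)] th[OF H(3)] th[OF H(4)] hp hq hi hj by simp_all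
  qed
  have dist: "\<theta> k = \<theta> l \<Longrightarrow> k \<in> H \<Longrightarrow> l \<in> H \<Longrightarrow> k = l" for k l using inj by (rule inj_onD)
  show ?thesis
  proof (cases "xp = xq")
    case False
    \<comment> \<open>Different strands at \<open>p\<close> and \<open>q\<close>: \<open>b2\<close>
      is linear and joins them. Afterwards \<open>c1\<close> is just \<open>x_i + x_j\<close>, which
      joins \<open>i\<close> and \<open>j\<close>; if these now end the same strand,
      \<open>b1\<close> closes it.\<close>
    have b2v: "\<Psi> b2 = Const 3 * (hvar (\<theta> (p, False)) + hvar (\<theta> (q, False)))"
    proof -
      have "b2 = - (3 * (Var p + Var q))" unfolding b2_def wide_u2_def by simp
      then show ?thesis by (simp only: uminus numeral_mult add Vp Vq hp hq Const_numeral) (simp add: algebra_simps)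
    qed
    have n3: "(3::complex) \<noteq> 0" by simp
    obtain X1 \<Psi>1 \<theta>1 where M1: "matched m X1 \<Psi>1 (H - {(p, False), (q, False)}) \<theta>1" and g1: "good_step m \<Psi> \<Psi>1 b2"
      using linear_step[OF M H(1,2) hp hq False eR(3) n3 b2v] by blast
    have red1: "reduction m X1 \<Psi>1" using M1 by (simp add: matched_def)
    interpret n: reduction m X1 \<Psi>1 by (rule red1)
    have cup: "\<Psi>1 (Var p + Var q) = 0"
    proof -
      have "b2 = - (3 * (Var p + Var q))" unfolding b2_def wide_u2_def by simp
      then have "\<Psi>1 b2 = - (3 * \<Psi>1 (Var p + Var q))" by (simp only: n.uminus n.numeral_mult)
      then show ?thesis using good_step_kernel(2)[OF red g1] by simp
    qed
    have H1: "(i, True) \<in> H - {(p, False), (q, False)}" "(j, True) \<in> H - {(p, False), (q, False)}"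
      using H by auto
    obtain x s where ki: "\<theta>1 (i, True) = (x, s)" by fastforce
    obtain x' s' where kj: "\<theta>1 (j, True) = (x', s')" by fastforce
    note Wi = matched_Var(1)[OF M1 H1(1), unfolded ki] and Wj = matched_Var(1)[OF M1 H1(2), unfolded kj]
    have HH: "H - {(p, False), (q, False)} - {(i, True), (j, True)} = H - {(p, False), (q, False), (i, True), (j, True)}"
      by auto
    have "\<exists>X' \<Psi>' \<theta>' e2. matched m X' \<Psi>' (H - {(p, False), (q, False), (i, True), (j, True)}) \<theta>' \<and>
      good_step m \<Psi>1 \<Psi>' e2 \<and> e2 \<in> {b1, c1}"
    proof (cases "x = x'")
      case False
      have "c1 = (Var i + Var j) - (Var p + Var q)" unfolding c1_def by simp
      then have "\<Psi>1 c1 = \<Psi>1 (Var i + Var j)" by (simp only: n.diff cup diff_0_right)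
      then have "\<Psi>1 c1 = Const 1 * (hvar (\<theta>1 (i, True)) + hvar (\<theta>1 (j, True)))"
        by (simp only: n.add Wi Wj ki kj) simp
      note L = linear_step[OF M1 H1 ki kj False eR(2) one_neq_zero this, unfolded HH]
      show ?thesis by (intro exI conjI, rule L(1), rule L(2), simp)
    next
      case True
      have s': "s' = (\<not> s)"
      proof (rule ccontr)
        assume "s' \<noteq> (\<not> s)"
        then have "\<theta>1 (i, True) = \<theta>1 (j, True)" using ki kj True by simp
        moreover have "inj_on \<theta>1 (H - {(p, False), (q, False)})" using M1 by (auto simp: matched_def bij_betw_def)
        ultimately show False using H1 H(6) by (auto dest: inj_onD)
      qed
      have P: "hvar (x, s) \<in> polys (insert 0 X1)" using matched_Var(3)[OF M1 H1(1)] ki by simp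
      have sum0: "\<Psi>1 (Var i + Var j) = 0" using Wi Wj by (simp add: n.add s' True hvar_opposite)
      have "\<Psi>1 (Var i * Var j) = \<Psi>1 (Var i) * \<Psi>1 (Var j)"
        by (rule n.mult_value[OF VR(3,4)]) (simp only: Wi P)
      also have "\<dots> = - (Var x ^ 2)" unfolding Wi Wj using hvar_opposite[of x s] s' True by simp
      finally have "\<Psi>1 b1 = Const 3 * (Var x ^ 2 - Const (1 / 3) * a_var)"
        unfolding b1_def by (rule n.wide_u1_value[OF VR(3,4,1,2) sum0 cup])
      note L = closing_step[OF M1 H1 ki kj[folded True, unfolded s'] eR(1) _ this disjI1[OF refl], unfolded HH]
      show ?thesis by (intro exI conjI, rule L(1), simp, rule L(2), simp_all)
    qed
    then obtain X' \<Psi>' \<theta>' e2 where "matched m X' \<Psi>' (H - {(p, False), (q, False), (i, True), (j, True)}) \<theta>'"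
      "good_step m \<Psi>1 \<Psi>' e2" "e2 \<in> {b1, c1}" by blast
    with red1 g1 show ?thesis by blast
  next
    case True
    have sq: "sq = (\<not> sp)"
    proof (rule ccontr)
      assume "sq \<noteq> (\<not> sp)"
      then have "\<theta> (p, False) = \<theta> (q, False)" using hp hq True by simp
      then show False using dist H by blast
    qed
    note hq' = hq[folded True, unfolded sq]
    \<comment> \<open>The strand of \<open>p\<close> and \<open>q\<close> has only these two ends,
      so \<open>i\<close> and \<open>j\<close> lie on other strands and joining them leaves
      \<open>xp\<close> free.\<close>
    have ne: "xi \<noteq> xp" "xj \<noteq> xp"
    proof -
      have "xk \<noteq> xp" if k: "k \<in> H" "\<theta> k = (xk, sk)" "snd k" for k xk sk
      proof
        assume "xk = xp"
        then have "\<theta> k = \<theta> (p, False) \<or> \<theta> k = \<theta> (q, False)" using k hp hq' by (cases sk; cases sp) auto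
        then have "k = (p, False) \<or> k = (q, False)" using dist k(1) H(1,2) by blast
        then show False using k(3) by auto
      qed
      from this[OF H(3) hi] this[OF H(4) hj] show "xi \<noteq> xp" "xj \<noteq> xp" by simp_all
    qed
    have P: "hvar (xp, s) \<in> polys (insert 0 X)" for s using xX by (intro hvar_polys) simp
    have cup: "\<Psi> (Var p + Var q) = 0" using Vp Vq by (simp add: add True[symmetric] sq hvar_opposite)
    have pq: "\<Psi> (Var p * Var q) = - (Var xp ^ 2)"
    proof -
      have "\<Psi> (Var p * Var q) = \<Psi> (Var p) * \<Psi> (Var q)"
        by (rule mult_value[OF VR(1,2)]) (simp only: Vp P polys_uminus)
      also have "\<dots> = - (Var xp ^ 2)" unfolding Vp Vq using hvar_opposite[of xp sp] sq True by simp
      finally show ?thesis .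
    qed
    have HH: "H - {(i, True), (j, True)} - {(p, False), (q, False)} = H - {(p, False), (q, False), (i, True), (j, True)}"
      by auto
    have H1: "(p, False) \<in> H - {(i, True), (j, True)}" "(q, False) \<in> H - {(i, True), (j, True)}"
      using H by auto
    show ?thesis
    proof (cases "xi = xj")
      case ij: False
      \<comment> \<open>Since \<open>x_p + x_q\<close> vanishes already, \<open>c1\<close> joins
        \<open>i\<close> and \<open>j\<close>. After that \<open>x_i x_j\<close> is
        \<open>- x_j^2\<close>, so \<open>c2\<close> becomes \<open>xp^2 - xj^2\<close>: the strand
        of \<open>p\<close> and \<open>q\<close> closes with its square tied to the open variable
        \<open>xj\<close>.\<close>
      have "c1 = (Var i + Var j) - (Var p + Var q)" unfolding c1_def by simp
      then have "\<Psi> c1 = \<Psi> (Var i + Var j)" by (simp only: diff cup diff_0_right)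
      then have c1v: "\<Psi> c1 = Const 1 * (hvar (\<theta> (i, True)) + hvar (\<theta> (j, True)))"
        by (simp only: add Vi Vj hi hj) simp
      note L = linear_step[OF M H(3,4) hi hj ij eR(2) one_neq_zero c1v]
      define \<Psi>1 where "\<Psi>1 = reduct xi 1 (hvar (xj, si \<noteq> sj)) \<circ> \<Psi>"
      define \<theta>1 where "\<theta>1 = (\<lambda>k. if \<theta> k = (xi, \<not> si) then (xj, sj) else \<theta> k)"
      have M1: "matched m (X - {xi}) \<Psi>1 (H - {(i, True), (j, True)}) \<theta>1" and g1: "good_step m \<Psi> \<Psi>1 c1"
        unfolding \<Psi>1_def \<theta>1_def by (rule L)+
      have k: "\<theta>1 (p, False) = (xp, sp)" "\<theta>1 (q, False) = (xp, \<not> sp)"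
        using ne hp hq' by (simp_all add: \<theta>1_def)
      have red1: "reduction m (X - {xi}) \<Psi>1" using M1 by (simp add: matched_def)
      interpret n: reduction m "X - {xi}" \<Psi>1 by (rule red1)
      have Pj: "hvar (xj, sj) \<in> polys (insert 0 (X - {xi}))" using xX ij by (intro hvar_polys) auto
      have Vj1: "\<Psi>1 (Var j) = hvar (xj, sj)"
        by (rule good_step_value[OF red g1 red1 _ VR(4) Vj Pj]) auto
      have cup1: "\<Psi>1 (Var p + Var q) = 0"
        by (rule good_step_kernel(1)[OF red g1 polys_add[OF VR(1,2)] cup])
      have "\<Psi>1 ((Var i + Var j) - (Var p + Var q)) = 0" using good_step_kernel(2)[OF red g1] unfolding c1_def
        by (simp only: diff_diff_add)
      then have "\<Psi>1 (Var i + Var j) = 0" using cup1 by (simp add: n.diff)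
      then have "\<Psi>1 (Var j * (Var i + Var j)) = 0" by (rule n.ideal[OF polys_add[OF VR(3,4)] VR(4)])
      then have "\<Psi>1 (Var i * Var j) = - \<Psi>1 (Var j * Var j)"
        by (simp add: distrib_left n.add mult.commute eq_neg_iff_add_eq_0)
      also have "\<Psi>1 (Var j * Var j) = \<Psi>1 (Var j) * \<Psi>1 (Var j)"
        by (rule n.mult_value[OF VR(4,4)]) (simp only: Vj1 Pj)
      finally have ij1: "\<Psi>1 (Var i * Var j) = - (Var xj ^ 2)" by (simp only: Vj1 hvar_opposite)
      have pq1: "\<Psi>1 (Var p * Var q) = - (Var xp ^ 2)"
        by (rule good_step_value[OF red g1 red1 _ polys_mult[OF VR(1,2)] pq])
          (use xX ne in \<open>auto intro!: polys_uminus polys_power\<close>)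
      have "\<Psi>1 c2 = Const 1 * (Var xp ^ 2 - Var xj ^ 2)"
        unfolding c2_def by (simp add: n.diff ij1 pq1)
      note L2 = closing_step[OF M1 H1 k eR(4) one_neq_zero this, unfolded HH]
      have "Var xj ^ 2 = Const (1 / 3) * a_var \<or> (\<exists>y\<in>X - {xi} - {xp}. Var xj ^ 2 = Var y ^ 2)"
        using xX ne ij by blast
      note L3 = L2[OF this]
      show ?thesis by (intro exI conjI, rule red1, rule L3(1), rule g1, rule L3(2), simp)
    next
      case ij: True
      have sj: "sj = (\<not> si)"
      proof (rule ccontr)
        assume "sj \<noteq> (\<not> si)"
        then have "\<theta> (i, True) = \<theta> (j, True)" using hi hj ij by simp
        then show False using dist H by blast
      qed
      have P': "hvar (xi, s) \<in> polys (insert 0 X)" for s using xX by (intro hvar_polys) simp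
      have sum0: "\<Psi> (Var i + Var j) = 0" using Vi Vj by (simp add: add sj ij hvar_opposite)
      have "\<Psi> (Var i * Var j) = \<Psi> (Var i) * \<Psi> (Var j)"
        by (rule mult_value[OF VR(3,4)]) (simp only: Vi P')
      also have "\<dots> = - (Var xi ^ 2)" unfolding Vi Vj using hvar_opposite[of xi si] sj ij by simp
      finally have prod: "\<Psi> (Var i * Var j) = - (Var xi ^ 2)" .
      \<comment> \<open>Both pairs end a common strand: \<open>b1\<close> closes the one of
        \<open>i\<close> and \<open>j\<close> with square \<open>a / 3\<close>, which turns
        \<open>c2\<close> into \<open>xp^2 - a / 3\<close>.\<close>
      have b1v: "\<Psi> b1 = Const 3 * (Var xi ^ 2 - Const (1 / 3) * a_var)"
        unfolding b1_def by (rule wide_u1_value[OF VR(3,4,1,2) sum0 cup prod])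
      have n3: "(3::complex) \<noteq> 0" by simp
      note L = closing_step[OF M H(3,4) hi hj[folded ij, unfolded sj] eR(1) n3 b1v disjI1[OF refl]]
      define \<Psi>1 where "\<Psi>1 = reduct xi 2 (Const (1 / 3) * a_var) \<circ> \<Psi>"
      have M1: "matched m (X - {xi}) \<Psi>1 (H - {(i, True), (j, True)}) \<theta>" and g1: "good_step m \<Psi> \<Psi>1 b1"
        unfolding \<Psi>1_def by (rule L)+
      have red1: "reduction m (X - {xi}) \<Psi>1" using M1 by (simp add: matched_def)
      interpret n: reduction m "X - {xi}" \<Psi>1 by (rule red1)
      have pq1: "\<Psi>1 (Var p * Var q) = - (Var xp ^ 2)"
        by (rule good_step_value[OF red g1 red1 _ polys_mult[OF VR(1,2)] pq])
          (use xX ne in \<open>auto intro!: polys_uminus polys_power\<close>)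
      have a0: "a_var \<in> polys {0..m}" by simp
      have xiR: "Var xi ^ 2 \<in> polys {0..m}" using xX X by (intro polys_power) auto
      have "\<Psi> (b1 - Const 3 * (Var xi ^ 2 - Const (1 / 3) * a_var)) = 0"
        using fixed[of "Const 3 * (Var xi ^ 2 - Const (1 / 3) * a_var)"] xX b1v
        by (simp add: diff polys_mult polys_diff polys_power)
      then have "\<Psi>1 (b1 - Const 3 * (Var xi ^ 2 - Const (1 / 3) * a_var)) = 0"
        by (rule good_step_kernel(1)[OF red g1, rotated])
          (intro polys_diff polys_mult polys_Const eR xiR a0)
      then have "\<Psi>1 (Var xi ^ 2 - Const (1 / 3) * a_var) = 0"
        using good_step_kernel(2)[OF red g1] unfolding n.diff[of b1] n.Const_mult[of 3] by simp
      then have xi1: "\<Psi>1 (Var xi ^ 2) = Const (1 / 3) * a_var"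
        using n.fixed[of a_var] by (simp add: n.diff n.Const_mult)
      have "\<Psi> (Var i * Var j + Var xi ^ 2) = 0"
        using fixed[of "Var xi ^ 2"] xX prod by (simp add: add polys_power)
      then have "\<Psi>1 (Var i * Var j + Var xi ^ 2) = 0"
        by (rule good_step_kernel(1)[OF red g1, rotated]) (intro polys_add polys_mult VR xiR)
      then have ij1: "\<Psi>1 (Var i * Var j) = - (Const (1 / 3) * a_var)"
        using xi1 by (simp add: n.add eq_neg_iff_add_eq_0)
      have "\<Psi>1 c2 = Const 1 * (Var xp ^ 2 - Const (1 / 3) * a_var)"
        unfolding c2_def by (simp add: n.diff ij1 pq1)
      note L2 = closing_step[OF M1 H1 hp hq' eR(4) one_neq_zero this disjI1[OF refl], unfolded HH]
      show ?thesis by (intro exI conjI, rule red1, rule L2(1), rule g1, rule L2(2), simp)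
    qed
  qed
qed

section \<open>Matrix factorization homology of a diagram\<close>

definition ker_chains :: "nat \<Rightarrow> piece list \<Rightarrow> (pring \<Rightarrow> pring) \<Rightarrow> chain set"
  where "ker_chains m D \<Psi> = {v \<in> chains m D. \<forall>g. \<Psi> (v g) = 0}"

lemma scaleC_chain: "(c *\<^sub>C v) g = Const c * v g" for v :: chain
  by (simp add: scaleC_fun_def scaleC_eq_Const)

lemma chains_polys: "v \<in> chains m D \<Longrightarrow> v g \<in> polys {0..m}"
  and chains_outside: "v \<in> chains m D \<Longrightarrow> g \<notin> gens D \<Longrightarrow> v g = 0"
  by (simp_all add: chains_def)

lemma csub_chains: "csub (chains m D)"
  by (rule csubI) (auto simp: chains_def scaleC_chain intro: polys_add polys_mult)

lemma smul_lin: "clin (smul r)"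
  by (rule clinI) (auto simp: smul_def fun_eq_iff scaleC_chain algebra_simps)

lemma smul_chains: "r \<in> polys {0..m} \<Longrightarrow> v \<in> chains m D \<Longrightarrow> smul r v \<in> chains m D"
  by (auto simp: chains_def smul_def intro: polys_mult)

lemma smul_smul: "smul r (smul s v) = smul (r * s) v"
  by (simp add: smul_def mult.assoc)

lemma smul_add_left: "smul (r + s) v = smul r v + smul s v"
  by (auto simp: smul_def fun_eq_iff algebra_simps)

lemma tensor_d_lin: "clin (tensor_d e \<delta> D)"
proof (rule clinI)
  show "tensor_d e \<delta> D (u + v) = tensor_d e \<delta> D u + tensor_d e \<delta> D v" for u v
    using tensor_d_add[of e \<delta> D u v] by (auto simp: fun_eq_iff plus_fun_def)
  show "tensor_d e \<delta> D (c *\<^sub>C v) = c *\<^sub>C tensor_d e \<delta> D v" for c v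
    using tensor_d_smul[of e \<delta> D "Const c" v] by (auto simp: fun_eq_iff scaleC_chain scaleC_fun_def scaleC_eq_Const)
qed

lemma tensor_d_smul': "tensor_d e \<delta> D (smul r v) = smul r (tensor_d e \<delta> D v)"
  using tensor_d_smul[of e \<delta> D r v] by (auto simp: fun_eq_iff smul_def)

lemma d_mf_chains:
  assumes "\<And>pc. pc \<in> set D \<Longrightarrow> vars_in m pc" "v \<in> chains m D" shows "d_mf D v \<in> chains m D"
  using assms unfolding d_mf_def chains_def
  by (auto intro!: tensor_d_polys cell_dmf_polys simp: tensor_d_outside)

lemma piece_pot_polys: "vars_in m pc \<Longrightarrow> piece_pot pc \<in> polys {0..m}"
  by (cases pc) (auto simp: vars_in_def pot_def intro!: polys_intros)

lemma sum_list_polys: "(\<And>x. x \<in> set xs \<Longrightarrow> f x \<in> polys W) \<Longrightarrow> (\<Sum>x\<leftarrow>xs. f x) \<in> polys W"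
  by (induction xs) (auto intro: polys_add)

lemma csub_ker_chains:
  assumes "reduction m X \<Psi>" shows "csub (ker_chains m D \<Psi>)"
proof -
  interpret reduction m X \<Psi> by fact
  show ?thesis
    by (rule csubI) (auto simp: ker_chains_def csub_zero csub_add csub_scale csub_chains add Const_mult scaleC_chain)
qed

lemma kmodule_chains:
  assumes red: "reduction m X \<Psi>" and D: "\<And>pc. pc \<in> set D \<Longrightarrow> vars_in m pc"
  shows "kmodule (polys {0..m}) smul (chains m D) (ker_chains m D \<Psi>) (d_mf D) (\<Sum>pc\<leftarrow>D. piece_pot pc)"
proof
  interpret reduction m X \<Psi> by fact
  show "csub (chains m D)" by (rule csub_chains)
  show "csub (ker_chains m D \<Psi>)" by (rule csub_ker_chains[OF red])
  show "ker_chains m D \<Psi> \<subseteq> chains m D" by (auto simp: ker_chains_def)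
  show "clin (d_mf D)" unfolding d_mf_def by (rule tensor_d_lin)
  show "(\<Sum>pc\<leftarrow>D. piece_pot pc) \<in> polys {0..m}" by (intro sum_list_polys piece_pot_polys D)
  fix r s :: pring and v
  show "clin (smul r)" by (rule smul_lin)
  show "smul r (smul s v) = smul (r * s) v" by (rule smul_smul)
  show "smul (r + s) v = smul r v + smul s v" by (rule smul_add_left)
  show "d_mf D (smul r v) = smul r (d_mf D v)" unfolding d_mf_def by (rule tensor_d_smul')
  show dM: "d_mf D v \<in> chains m D" if "v \<in> chains m D" by (rule d_mf_chains[OF D that])
  show "smul r v \<in> chains m D" if "r \<in> polys {0..m}" "v \<in> chains m D" by (rule smul_chains[OF that])
  show "smul r v \<in> ker_chains m D \<Psi>" if "r \<in> polys {0..m}" "v \<in> ker_chains m D \<Psi>"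
    using that smul_chains[OF that(1), of v D] ideal[of "v _" r] by (auto simp: ker_chains_def smul_def chains_polys)
  show "d_mf D v \<in> ker_chains m D \<Psi>" if v: "v \<in> ker_chains m D \<Psi>"
  proof -
    have vc: "v \<in> chains m D" using v by (simp add: ker_chains_def)
    have S: "\<Psi> (sum f A) = 0" if "\<And>x. x \<in> A \<Longrightarrow> \<Psi> (f x) = 0" for f and A :: "'z set"
      using that by (induction A rule: infinite_finite_induct) (auto simp: add)
    have "\<Psi> (d_mf D v g) = 0" for g
    proof (cases "g \<in> gens D")
      case True
      show ?thesis
        unfolding d_mf_def tensor_d_def if_P[OF True]
      proof (intro S ideal)
        fix k c assume k: "k \<in> {..<length D}" "c \<in> cells (D ! k)"
        then have "cell_dmf (D ! k) c (g ! k) \<in> polys {0..m}" using D True by (intro cell_dmf_polys gens_nth) auto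
        then show "sgn_pow (total_deg cell_parity (take k D) (take k g)) * cell_dmf (D ! k) c (g ! k) \<in> polys {0..m}"
          by (intro polys_mult) auto
      qed (use v vc in \<open>auto simp: ker_chains_def chains_polys\<close>)
    qed (simp add: d_mf_def tensor_d_outside)
    then show ?thesis using d_mf_chains[OF D vc] by (simp add: ker_chains_def)
  qed
  show "d_mf D (d_mf D v) - smul (\<Sum>pc\<leftarrow>D. piece_pot pc) v \<in> ker_chains m D \<Psi>" if v: "v \<in> chains m D"
  proof -
    have "d_mf D (d_mf D v) g = smul (\<Sum>pc\<leftarrow>D. piece_pot pc) v g" for g
      using d_mf_square[of g D v] chains_outside[OF v, of g]
      by (cases "g \<in> gens D") (auto simp: smul_def d_mf_def tensor_d_outside)
    then have "d_mf D (d_mf D v) - smul (\<Sum>pc\<leftarrow>D. piece_pot pc) v = 0" by (auto simp: fun_eq_iff)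
    then show ?thesis using csub_zero[OF csub_ker_chains[OF red]] by simp
  qed
qed

text \<open>\<open>good_step\<close>, applied to each coefficient of a chain, yields the denominator
  and the injectivity that \<open>tf_fin_eliminate\<close> asks for.\<close>

lemma ker_chains_step:
  assumes red: "reduction m X \<Psi>" and g: "good_step m \<Psi> \<Psi>' e"
  shows "ker_chains m D \<Psi>' = {x + smul e y | x y. x \<in> ker_chains m D \<Psi> \<and> y \<in> chains m D}"
    "v \<in> chains m D \<Longrightarrow> smul e v \<in> ker_chains m D \<Psi> \<Longrightarrow> v \<in> ker_chains m D \<Psi>"
proof -
  interpret reduction m X \<Psi> by fact
  have e: "e \<in> polys {0..m}" and nzd: "\<And>f. f \<in> polys {0..m} \<Longrightarrow> \<Psi> (e * f) = 0 \<Longrightarrow> \<Psi> f = 0"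
    and k: "\<And>f. f \<in> polys {0..m} \<Longrightarrow> \<Psi>' f = 0 \<longleftrightarrow> (\<exists>g\<in>polys {0..m}. \<Psi> (f - e * g) = 0)"
    using g unfolding good_step_def by blast+
  show "v \<in> ker_chains m D \<Psi>" if v: "v \<in> chains m D" "smul e v \<in> ker_chains m D \<Psi>"
  proof -
    have "\<Psi> (v g) = 0" for g
      by (rule nzd[OF chains_polys[OF v(1)]]) (use v(2) in \<open>simp add: ker_chains_def smul_def\<close>)
    then show ?thesis using v(1) by (simp add: ker_chains_def)
  qed
  show "ker_chains m D \<Psi>' = {x + smul e y | x y. x \<in> ker_chains m D \<Psi> \<and> y \<in> chains m D}"
  proof (intro set_eqI iffI)
    fix v assume v: "v \<in> ker_chains m D \<Psi>'"
    then have vc: "v \<in> chains m D" by (simp add: ker_chains_def)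
    have "\<exists>h\<in>polys {0..m}. \<Psi> (v g - e * h) = 0" for g
    proof -
      have "\<Psi>' (v g) = 0" using v by (simp add: ker_chains_def)
      then show ?thesis using k[OF chains_polys[OF vc, of g]] by blast
    qed
    then obtain y where y: "\<And>g. y g \<in> polys {0..m}" "\<And>g. \<Psi> (v g - e * y g) = 0" by metis
    \<comment> \<open>The quotient chosen for a coefficient outside \<open>gens D\<close> is
      arbitrary; it is reset to 0 so that \<open>y'\<close> is a chain.\<close>
    define y' where "y' = (\<lambda>g. if g \<in> gens D then y g else 0)"
    have y'c: "y' \<in> chains m D" by (simp add: y'_def chains_def y)
    have "v - smul e y' \<in> chains m D" using csub_diff[OF csub_chains vc smul_chains[OF e y'c]] .
    moreover have "\<Psi> ((v - smul e y') g) = 0" for g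
      using y(2)[of g] chains_outside[OF vc, of g] by (auto simp: smul_def y'_def)
    ultimately have "v - smul e y' \<in> ker_chains m D \<Psi>" by (simp add: ker_chains_def)
    then show "v \<in> {x + smul e y | x y. x \<in> ker_chains m D \<Psi> \<and> y \<in> chains m D}"
      using y'c by (intro CollectI exI[of _ "v - smul e y'"] exI[of _ y']) simp
  next
    fix v assume "v \<in> {x + smul e y | x y. x \<in> ker_chains m D \<Psi> \<and> y \<in> chains m D}"
    then obtain x y where v: "v = x + smul e y" "x \<in> ker_chains m D \<Psi>" "y \<in> chains m D" by blast
    then have xc: "x \<in> chains m D" by (simp add: ker_chains_def)
    have vc: "v \<in> chains m D" unfolding v(1) by (rule csub_add[OF csub_chains xc smul_chains[OF e v(3)]])
    have "\<Psi>' (v g) = 0" for g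
      unfolding k[OF chains_polys[OF vc]]
      by (rule bexI[of _ "y g"]) (use v chains_polys[OF v(3)] in \<open>simp_all add: smul_def ker_chains_def\<close>)
    then show "v \<in> ker_chains m D \<Psi>'" using vc by (simp add: ker_chains_def)
  qed
qed

lemma (in kmodule) tf_fin_eliminate:
  assumes bca: "b \<in> R" "c \<in> R" "a \<in> R" and wbc: "\<And>v. v \<in> M \<Longrightarrow> act (w + b * c) v \<in> B"
    and e: "e \<in> {b, c}" and nzd: "\<And>v. v \<in> M \<Longrightarrow> act e v \<in> B \<Longrightarrow> v \<in> B"
    and B': "B' = {x + act e y | x y. x \<in> B \<and> y \<in> M}" "csub B'"
    and P: "tf_fin (act a) M B' d"
  shows "tf_fin (map_prod (act a) (act a)) (M \<times> M) (B \<times> B) (kz (act b) (act c) d)"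
proof (cases "e = c")
  case True
  show ?thesis by (rule tf_fin_eliminate_c[OF bca wbc nzd[unfolded True] B'(1)[unfolded True] P])
next
  case False
  then have e: "e = b" using e by simp
  show ?thesis by (rule tf_fin_eliminate_b[OF bca wbc nzd[unfolded e] B'(1)[unfolded e] B'(2) P])
qed

lemma row_elimination:
  assumes red: "reduction m X \<Psi>" "reduction m X' \<Psi>'" and g: "good_step m \<Psi> \<Psi>' e" and e: "e \<in> {b, c}"
    and bc: "b \<in> polys {0..m}" "c \<in> polys {0..m}" and D: "\<And>pc. pc \<in> set D \<Longrightarrow> vars_in m pc"
    and w: "\<Psi> ((\<Sum>pc\<leftarrow>D. piece_pot pc) + b * c) = 0"
    and P: "tf_fin (smul a_var) (chains m D) (ker_chains m D \<Psi>') (d_mf D)"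
  shows "tf_fin (map_prod (smul a_var) (smul a_var)) (chains m D \<times> chains m D) (ker_chains m D \<Psi> \<times> ker_chains m D \<Psi>)
    (kz (smul b) (smul c) (d_mf D))"
proof -
  interpret reduction m X \<Psi> by (rule red)
  interpret k: kmodule "polys {0..m}" smul "chains m D" "ker_chains m D \<Psi>" "d_mf D" "\<Sum>pc\<leftarrow>D. piece_pot pc"
    by (rule kmodule_chains[OF red(1) D])
  show ?thesis
  proof (rule k.tf_fin_eliminate[OF bc _ _ e _ ker_chains_step(1)[OF red(1) g] csub_ker_chains[OF red(2)] P])
    show "a_var \<in> polys {0..m}" by simp
    show "smul ((\<Sum>pc\<leftarrow>D. piece_pot pc) + b * c) v \<in> ker_chains m D \<Psi>" if v: "v \<in> chains m D" for v
    proof -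
      have wR: "(\<Sum>pc\<leftarrow>D. piece_pot pc) + b * c \<in> polys {0..m}" by (intro polys_add polys_mult bc k.wR)
      have "\<Psi> (v g * ((\<Sum>pc\<leftarrow>D. piece_pot pc) + b * c)) = 0" for g
        by (rule ideal[OF wR chains_polys[OF v] w])
      then have "\<Psi> (smul ((\<Sum>pc\<leftarrow>D. piece_pot pc) + b * c) v g) = 0" for g
        by (simp only: smul_def mult.commute[of "v _"])
      then show ?thesis using smul_chains[OF wR v] by (simp add: ker_chains_def)
    qed
  qed (rule ker_chains_step(2)[OF red(1) g])
qed

text \<open>The outer row is traded for its entry \<open>e1\<close> while the inner row is kept as
  part of the module; then the inner row is treated modulo the enlarged kernel.\<close>

lemma two_row_elimination:
  assumes red: "reduction m X \<Psi>" "reduction m X1 \<Psi>1" "reduction m X2 \<Psi>2"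
    and g: "good_step m \<Psi> \<Psi>1 e1" "good_step m \<Psi>1 \<Psi>2 e2" and e: "e1 \<in> {b1, c1}" "e2 \<in> {b2, c2}"
    and bc: "b1 \<in> polys {0..m}" "c1 \<in> polys {0..m}" "b2 \<in> polys {0..m}" "c2 \<in> polys {0..m}"
    and D: "\<And>pc. pc \<in> set D \<Longrightarrow> vars_in m pc"
    and w: "\<Psi> ((\<Sum>pc\<leftarrow>D. piece_pot pc) + (b1 * c1 + b2 * c2)) = 0"
    and P: "tf_fin (smul a_var) (chains m D) (ker_chains m D \<Psi>2) (d_mf D)"
  shows "tf_fin (map_prod (map_prod (smul a_var) (smul a_var)) (map_prod (smul a_var) (smul a_var)))
    ((chains m D \<times> chains m D) \<times> (chains m D \<times> chains m D))
    ((ker_chains m D \<Psi> \<times> ker_chains m D \<Psi>) \<times> (ker_chains m D \<Psi> \<times> ker_chains m D \<Psi>))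
    (kz (map_prod (smul b1) (smul b1)) (map_prod (smul c1) (smul c1)) (kz (smul b2) (smul c2) (d_mf D)))"
proof -
  interpret reduction m X \<Psi> by (rule red)
  interpret n: reduction m X1 \<Psi>1 by (rule red)
  let ?W = "\<Sum>pc\<leftarrow>D. piece_pot pc" and ?M = "chains m D" and ?B = "ker_chains m D \<Psi>" and ?B1 = "ker_chains m D \<Psi>1"
  interpret k: kmodule "polys {0..m}" smul ?M ?B "d_mf D" ?W by (rule kmodule_chains[OF red(1) D])
  have wR: "?W + b2 * c2 \<in> polys {0..m}" by (intro polys_add polys_mult bc k.wR)
  have wR': "?W + b2 * c2 + b1 * c1 \<in> polys {0..m}" by (intro polys_add polys_mult bc k.wR)
  interpret k2: kmodule "polys {0..m}" "\<lambda>r. map_prod (smul r) (smul r)" "?M \<times> ?M" "?B \<times> ?B"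
    "kz (smul b2) (smul c2) (d_mf D)" "?W + b2 * c2"
    by (rule k.kmodule_prod[OF bc(3,4) wR])
  have w': "\<Psi> (?W + b2 * c2 + b1 * c1) = 0" using w by (simp only: ac_simps)
  \<comment> \<open>The inner elimination needs its own vanishing potential: \<open>e1\<close> is in
    the kernel of \<open>\<Psi>1\<close>, so the product \<open>b1 * c1\<close> drops out.\<close>
  have w1: "\<Psi>1 (?W + b2 * c2) = 0"
  proof -
    have 1: "\<Psi>1 (?W + b2 * c2 + b1 * c1) = 0" by (rule good_step_kernel(1)[OF red(1) g(1) wR' w'])
    have "\<Psi>1 e1 = 0" by (rule good_step_kernel(2)[OF red(1) g(1)])
    then have "\<Psi>1 (b1 * c1) = 0" using e(1) n.ideal[of c1 b1] n.ideal[of b1 c1] bc by (auto simp: mult.commute)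
    then show ?thesis using 1 by (simp add: n.add)
  qed
  have P1: "tf_fin (map_prod (smul a_var) (smul a_var)) (?M \<times> ?M) (?B1 \<times> ?B1) (kz (smul b2) (smul c2) (d_mf D))"
    by (rule row_elimination[OF red(2,3) g(2) e(2) bc(3,4) D w1 P])
  have kill: "smul (?W + b2 * c2 + b1 * c1) v \<in> ?B" if v: "v \<in> ?M" for v
  proof -
    have "\<Psi> (v g * (?W + b2 * c2 + b1 * c1)) = 0" for g by (rule ideal[OF wR' chains_polys[OF v] w'])
    then have "\<Psi> (smul (?W + b2 * c2 + b1 * c1) v g) = 0" for g
      by (simp only: smul_def mult.commute[of "v _"])
    then show ?thesis using smul_chains[OF wR' v] by (simp add: ker_chains_def)
  qed
  show ?thesis
  proof (rule k2.tf_fin_eliminate[OF bc(1,2) _ _ e(1) _ _ _ P1])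
    show "a_var \<in> polys {0..m}" by simp
    show "csub (?B1 \<times> ?B1)" by (intro csub_Times csub_ker_chains[OF red(2)])
    show "?B1 \<times> ?B1 = {x + map_prod (smul e1) (smul e1) y | x y. x \<in> ?B \<times> ?B \<and> y \<in> ?M \<times> ?M}"
    proof (intro set_eqI iffI)
      fix z assume z: "z \<in> ?B1 \<times> ?B1"
      then have "fst z \<in> ?B1" "snd z \<in> ?B1" by auto
      then obtain x0 y0 x1 y1 where *: "fst z = x0 + smul e1 y0" "x0 \<in> ?B" "y0 \<in> ?M"
        "snd z = x1 + smul e1 y1" "x1 \<in> ?B" "y1 \<in> ?M"
        unfolding ker_chains_step(1)[OF red(1) g(1)] by blast
      show "z \<in> {x + map_prod (smul e1) (smul e1) y | x y. x \<in> ?B \<times> ?B \<and> y \<in> ?M \<times> ?M}"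
        by (intro CollectI exI[of _ "(x0, x1)"] exI[of _ "(y0, y1)"]) (use * in \<open>simp add: prod_eq_iff\<close>)
    next
      fix z assume "z \<in> {x + map_prod (smul e1) (smul e1) y | x y. x \<in> ?B \<times> ?B \<and> y \<in> ?M \<times> ?M}"
      then obtain x0 x1 y0 y1 where *: "z = (x0, x1) + map_prod (smul e1) (smul e1) (y0, y1)"
        "x0 \<in> ?B" "x1 \<in> ?B" "y0 \<in> ?M" "y1 \<in> ?M" by auto
      then show "z \<in> ?B1 \<times> ?B1" unfolding ker_chains_step(1)[OF red(1) g(1)] by auto
    qed
    show "map_prod (smul (?W + b2 * c2 + b1 * c1)) (smul (?W + b2 * c2 + b1 * c1)) v \<in> ?B \<times> ?B"
      if "v \<in> ?M \<times> ?M" for v using that kill by (cases v) auto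
    show "v \<in> ?B \<times> ?B" if "v \<in> ?M \<times> ?M" "map_prod (smul e1) (smul e1) v \<in> ?B \<times> ?B" for v
      using that ker_chains_step(2)[OF red(1) g(1)] by (cases v) auto
  qed
qed

section \<open>Splitting off the first piece of a diagram\<close>

definition slice :: "cell \<Rightarrow> chain \<Rightarrow> chain"
  where "slice c v = (\<lambda>h. v (c # h))"

definition glue :: "piece \<Rightarrow> (cell \<Rightarrow> chain) \<Rightarrow> chain"
  where "glue pc F = (\<lambda>g. case g of [] \<Rightarrow> 0 | c # h \<Rightarrow> if c \<in> cells pc then F c h else 0)"

lemma slice_glue: "c \<in> cells pc \<Longrightarrow> slice c (glue pc F) = F c"
  by (simp add: slice_def glue_def)

lemma glue_chains: "(\<And>c. F c \<in> chains m D) \<Longrightarrow> glue pc F \<in> chains m (pc # D)"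
  by (auto simp: glue_def chains_def split: list.splits)

lemma slice_chains: "v \<in> chains m (pc # D) \<Longrightarrow> slice c v \<in> chains m D"
  by (auto simp: slice_def chains_def)

lemma ker_chains_Cons:
  assumes "v \<in> chains m (pc # D)" "\<Psi> 0 = 0"
  shows "v \<in> ker_chains m (pc # D) \<Psi> \<longleftrightarrow> (\<forall>c\<in>cells pc. slice c v \<in> ker_chains m D \<Psi>)"
proof
  assume "v \<in> ker_chains m (pc # D) \<Psi>"
  then show "\<forall>c\<in>cells pc. slice c v \<in> ker_chains m D \<Psi>"
    using slice_chains[OF assms(1)] by (auto simp: ker_chains_def slice_def)
next
  assume *: "\<forall>c\<in>cells pc. slice c v \<in> ker_chains m D \<Psi>"
  have "\<Psi> (v g) = 0" for g
  proof (cases "g \<in> gens (pc # D)")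
    case True
    then obtain c h where "g = c # h" "c \<in> cells pc" unfolding gens_Cons by blast
    with * show ?thesis by (auto simp: ker_chains_def slice_def)
  next
    case False
    then show ?thesis using chains_outside[OF assms(1)] assms(2) by simp
  qed
  then show "v \<in> ker_chains m (pc # D) \<Psi>" using assms(1) by (simp add: ker_chains_def)
qed

lemma slice_lin: "clin (slice c)"
  by (rule clinI) (auto simp: slice_def fun_eq_iff scaleC_chain)

lemma slice_smul: "slice c (smul r v) = smul r (slice c v)"
  by (simp add: slice_def smul_def)

lemma slice_d_mf:
  assumes "c0 \<in> cells pc" "v \<in> chains m (pc # D)"
  shows "slice c0 (d_mf (pc # D) v) h =
    (\<Sum>c\<in>cells pc. cell_dmf pc c c0 * slice c v h) + sgn_pow (cell_parity pc c0) * d_mf D (slice c0 v) h"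
proof (cases "h \<in> gens D")
  case True
  then show ?thesis using tensor_d_Cons[OF assms(1) True] by (simp add: d_mf_def slice_def)
next
  case False
  then have "v (c # h) = 0" for c using chains_outside[OF assms(2)] by simp
  then show ?thesis using False by (simp add: slice_def d_mf_def tensor_d_outside)
qed

lemma tf_fin_Arc:
  assumes red: "reduction m X \<Psi>" "reduction m X' \<Psi>'"
    and g: "good_step m \<Psi> \<Psi>' e" "e \<in> {arc_v (Var i) (Var p), Var i - Var p}"
    and D: "\<And>pc. pc \<in> set (Arc p i # D) \<Longrightarrow> vars_in m pc"
    and w: "\<Psi> (\<Sum>pc\<leftarrow>Arc p i # D. piece_pot pc) = 0"
    and P: "tf_fin (smul a_var) (chains m D) (ker_chains m D \<Psi>') (d_mf D)"
  shows "tf_fin (smul a_var) (chains m (Arc p i # D)) (ker_chains m (Arc p i # D) \<Psi>) (d_mf (Arc p i # D))"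
proof -
  interpret reduction m X \<Psi> by (rule red)
  let ?pc = "Arc p i" and ?b = "arc_v (Var i) (Var p)" and ?c = "Var i - Var p"
  have bc: "?b \<in> polys {0..m}" "?c \<in> polys {0..m}"
    using homogeneous_rows(3,4)[OF D[of ?pc], of ?b ?c 4 False] by simp_all
  have w': "\<Psi> ((\<Sum>pc\<leftarrow>D. piece_pot pc) + ?b * ?c) = 0"
    using w unfolding arc_v_eq by (simp add: add.commute)
  have "tf_fin (map_prod (smul a_var) (smul a_var)) (chains m D \<times> chains m D)
    (ker_chains m D \<Psi> \<times> ker_chains m D \<Psi>) (kz (smul ?b) (smul ?c) (d_mf D))"
    by (rule row_elimination[OF red g(1) g(2) bc _ w' P]) (use D in auto)
  then show ?thesis
  proof (rule tf_fin_transfer[where \<phi> = "\<lambda>v. (slice (False, [False]) v, slice (False, [True]) v)"])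
    show "clin (\<lambda>v. (slice (False, [False]) v, slice (False, [True]) v))"
      by (rule clinI) (auto simp: scaleC_prod_def clin_add[OF slice_lin] clin_scale[OF slice_lin])
    show "csub (chains m (?pc # D))" by (rule csub_chains)
    fix v assume v: "v \<in> chains m (?pc # D)"
    show "d_mf (?pc # D) v \<in> chains m (?pc # D)" by (rule d_mf_chains[OF D v])
    show "smul a_var v \<in> chains m (?pc # D)" by (rule smul_chains[OF _ v]) simp
    show "(slice (False, [False]) v, slice (False, [True]) v) \<in> chains m D \<times> chains m D"
      using slice_chains[OF v] by simp
    show "v \<in> ker_chains m (?pc # D) \<Psi> \<longleftrightarrow>
        (slice (False, [False]) v, slice (False, [True]) v) \<in> ker_chains m D \<Psi> \<times> ker_chains m D \<Psi>"
      using ker_chains_Cons[OF v] by (simp add: cells_Arc)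
    show "(slice (False, [False]) (d_mf (?pc # D) v), slice (False, [True]) (d_mf (?pc # D) v)) =
        kz (smul ?b) (smul ?c) (d_mf D) (slice (False, [False]) v, slice (False, [True]) v)"
      using slice_d_mf[OF _ v]
      by (auto simp: kz_def fun_eq_iff cells_Arc cell_dmf_def koszul_d_1 cell_parity_def odd_count_def sgn_pow_def smul_def)
    show "(slice (False, [False]) (smul a_var v), slice (False, [True]) (smul a_var v)) =
        map_prod (smul a_var) (smul a_var) (slice (False, [False]) v, slice (False, [True]) v)"
      by (simp add: slice_smul)
  next
    fix x assume x: "x \<in> chains m D \<times> chains m D"
    let ?F = "\<lambda>c::cell. if snd c = [False] then fst x else snd x"
    have "glue ?pc ?F \<in> chains m (?pc # D)" by (rule glue_chains) (use x in auto)
    moreover have "(slice (False, [False]) (glue ?pc ?F), slice (False, [True]) (glue ?pc ?F)) = x"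
      by (simp add: slice_glue cells_Arc)
    ultimately show "\<exists>v\<in>chains m (?pc # D). (slice (False, [False]) v, slice (False, [True]) v) = x" by (intro bexI[of _ "glue ?pc ?F"])
  qed
qed

definition block :: "bool \<Rightarrow> chain \<Rightarrow> (chain \<times> chain) \<times> (chain \<times> chain)"
  where "block w v = ((slice (w, [False, False]) v, slice (w, [False, True]) v),
    (slice (w, [True, False]) v, slice (w, [True, True]) v))"

text \<open>The sign makes the exchange of the two rows a chain map.\<close>

definition swap_rows :: "(chain \<times> chain) \<times> (chain \<times> chain) \<Rightarrow> (chain \<times> chain) \<times> (chain \<times> chain)"
  where "swap_rows x = ((fst (fst x), fst (snd x)), (snd (fst x), - snd (snd x)))"

lemma block_lin: "clin (block w)"
  by (rule clinI) (auto simp: block_def scaleC_prod_def clin_add[OF slice_lin] clin_scale[OF slice_lin])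

lemma swap_rows_lin: "clin swap_rows"
  by (rule clinI) (auto simp: swap_rows_def scaleC_prod_def scaleC_minus_right)

lemma swap_rows_kz:
  assumes "clin d"
  shows "swap_rows (kz (map_prod (smul b1) (smul b1)) (map_prod (smul c1) (smul c1)) (kz (smul b2) (smul c2) d) x) =
    kz (map_prod (smul b2) (smul b2)) (map_prod (smul c2) (smul c2)) (kz (smul b1) (smul c1) d) (swap_rows x)"
  by (cases x) (auto simp: swap_rows_def kz_def clin_minus[OF assms] clin_minus[OF smul_lin])

lemma block_d_mf:
  assumes pc: "pc = Crossing pos p q i j" and rs: "rows pc w = [(b1, c1, n1), (b2, c2, n2)]"
    and v: "v \<in> chains m (pc # D)"
  shows "block w (d_mf (pc # D) v) =
    kz (map_prod (smul b1) (smul b1)) (map_prod (smul c1) (smul c1)) (kz (smul b2) (smul c2) (d_mf D)) (block w v)"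
proof -
  have c: "(w, [x, y]) \<in> cells pc" for x y by (simp add: pc cells_Crossing bits2_def)
  have S: "(\<Sum>c\<in>cells pc. cell_dmf pc c (w, s) * slice c v h) = (\<Sum>u\<in>bits2. koszul_d (rows pc w) u s * slice (w, u) v h)" for s h
  proof -
    have "(\<Sum>c\<in>cells pc. cell_dmf pc c (w, s) * slice c v h) =
      (\<Sum>w'\<in>UNIV. \<Sum>u\<in>bits2. cell_dmf pc (w', u) (w, s) * slice (w', u) v h)"
      unfolding pc by (rule sum_cells_Crossing)
    also have "\<dots> = (\<Sum>w'\<in>UNIV. if w' = w then \<Sum>u\<in>bits2. koszul_d (rows pc w) u s * slice (w, u) v h else 0)"
      by (rule sum.cong) (auto simp: cell_dmf_def)
    finally show ?thesis by simp
  qed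
  show ?thesis
    unfolding block_def prod_eq_iff fun_eq_iff kz_def
    by (simp add: slice_d_mf[OF c v] S rs)
      (simp add: bits2_eq koszul_d_2 cell_parity_def odd_count_def sgn_pow_def smul_def)
qed

text \<open>If the inner row has to be used first, \<open>swap_rows\<close> exchanges the two
  rows.\<close>

lemma tf_fin_block:
  assumes red: "reduction m X \<Psi>" "reduction m X1 \<Psi>1" "reduction m X2 \<Psi>2"
    and g: "good_step m \<Psi> \<Psi>1 e1" "good_step m \<Psi>1 \<Psi>2 e2"
    and e: "e1 \<in> {b1, c1} \<and> e2 \<in> {b2, c2} \<or> e1 \<in> {b2, c2} \<and> e2 \<in> {b1, c1}"
    and bc: "b1 \<in> polys {0..m}" "c1 \<in> polys {0..m}" "b2 \<in> polys {0..m}" "c2 \<in> polys {0..m}"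
    and D: "\<And>pc. pc \<in> set D \<Longrightarrow> vars_in m pc"
    and w: "\<Psi> ((\<Sum>pc\<leftarrow>D. piece_pot pc) + (b1 * c1 + b2 * c2)) = 0"
    and P: "tf_fin (smul a_var) (chains m D) (ker_chains m D \<Psi>2) (d_mf D)"
  shows "tf_fin (map_prod (map_prod (smul a_var) (smul a_var)) (map_prod (smul a_var) (smul a_var)))
    ((chains m D \<times> chains m D) \<times> (chains m D \<times> chains m D))
    ((ker_chains m D \<Psi> \<times> ker_chains m D \<Psi>) \<times> (ker_chains m D \<Psi> \<times> ker_chains m D \<Psi>))
    (kz (map_prod (smul b1) (smul b1)) (map_prod (smul c1) (smul c1)) (kz (smul b2) (smul c2) (d_mf D)))"
  using e
proof
  assume e: "e1 \<in> {b1, c1} \<and> e2 \<in> {b2, c2}"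
  show ?thesis by (rule two_row_elimination[OF red g conjunct1[OF e] conjunct2[OF e] bc D w P])
next
  assume e: "e1 \<in> {b2, c2} \<and> e2 \<in> {b1, c1}"
  have w': "\<Psi> ((\<Sum>pc\<leftarrow>D. piece_pot pc) + (b2 * c2 + b1 * c1)) = 0" using w by (simp only: add.commute)
  have dl: "clin (d_mf D)" unfolding d_mf_def by (rule tensor_d_lin)
  let ?M = "chains m D" and ?B = "ker_chains m D \<Psi>"
  note Mi = csub_minus[OF csub_chains] and Bi = csub_minus[OF csub_ker_chains[OF red(1)]]
  have neg: "- x \<in> ?M \<longleftrightarrow> x \<in> ?M" "- x \<in> ?B \<longleftrightarrow> x \<in> ?B" for x
    using Mi[of x] Mi[of "- x"] Bi[of x] Bi[of "- x"] by auto
  interpret k: kmodule "polys {0..m}" smul ?M ?B "d_mf D" "\<Sum>pc\<leftarrow>D. piece_pot pc"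
    by (rule kmodule_chains[OF red(1) D])
  have wR: "(\<Sum>pc\<leftarrow>D. piece_pot pc) + b2 * c2 \<in> polys {0..m}" "(\<Sum>pc\<leftarrow>D. piece_pot pc) + b2 * c2 + b1 * c1 \<in> polys {0..m}"
    by (intro polys_add polys_mult bc k.wR)+
  interpret k2: kmodule "polys {0..m}" "\<lambda>r. map_prod (smul r) (smul r)" "?M \<times> ?M" "?B \<times> ?B"
    "kz (smul b2) (smul c2) (d_mf D)" "(\<Sum>pc\<leftarrow>D. piece_pot pc) + b2 * c2"
    by (rule k.kmodule_prod[OF bc(3,4) wR(1)])
  interpret k4: kmodule "polys {0..m}" "\<lambda>r. map_prod (map_prod (smul r) (smul r)) (map_prod (smul r) (smul r))"
    "(?M \<times> ?M) \<times> (?M \<times> ?M)" "(?B \<times> ?B) \<times> (?B \<times> ?B)"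
    "kz (map_prod (smul b1) (smul b1)) (map_prod (smul c1) (smul c1)) (kz (smul b2) (smul c2) (d_mf D))"
    "(\<Sum>pc\<leftarrow>D. piece_pot pc) + b2 * c2 + b1 * c1"
    by (rule k2.kmodule_prod[OF bc(1,2) wR(2)])
  show ?thesis
  proof (rule tf_fin_transfer[OF two_row_elimination[OF red g conjunct1[OF e] conjunct2[OF e] bc(3,4,1,2) D w' P] swap_rows_lin])
    show "csub ((?M \<times> ?M) \<times> (?M \<times> ?M))" by (rule k4.M)
    fix v assume v: "v \<in> (?M \<times> ?M) \<times> (?M \<times> ?M)"
    show "kz (map_prod (smul b1) (smul b1)) (map_prod (smul c1) (smul c1)) (kz (smul b2) (smul c2) (d_mf D)) v \<in> (?M \<times> ?M) \<times> (?M \<times> ?M)"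
      by (rule k4.dM[OF v])
    show "map_prod (map_prod (smul a_var) (smul a_var)) (map_prod (smul a_var) (smul a_var)) v \<in> (?M \<times> ?M) \<times> (?M \<times> ?M)"
      by (rule k4.actM[OF _ v]) simp
    show "swap_rows v \<in> (?M \<times> ?M) \<times> (?M \<times> ?M)" using v neg by (auto simp: swap_rows_def)
    show "v \<in> (?B \<times> ?B) \<times> (?B \<times> ?B) \<longleftrightarrow> swap_rows v \<in> (?B \<times> ?B) \<times> (?B \<times> ?B)"
      using neg by (cases v) (auto simp: swap_rows_def)
    show "swap_rows (kz (map_prod (smul b1) (smul b1)) (map_prod (smul c1) (smul c1)) (kz (smul b2) (smul c2) (d_mf D)) v) =
      kz (map_prod (smul b2) (smul b2)) (map_prod (smul c2) (smul c2)) (kz (smul b1) (smul c1) (d_mf D)) (swap_rows v)"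
      by (rule swap_rows_kz[OF dl])
    show "swap_rows (map_prod (map_prod (smul a_var) (smul a_var)) (map_prod (smul a_var) (smul a_var)) v) =
      map_prod (map_prod (smul a_var) (smul a_var)) (map_prod (smul a_var) (smul a_var)) (swap_rows v)"
      by (cases v) (auto simp: swap_rows_def clin_minus[OF smul_lin])
  next
    fix x assume x: "x \<in> (?M \<times> ?M) \<times> (?M \<times> ?M)"
    have "swap_rows (swap_rows x) = x" by (cases x) (auto simp: swap_rows_def)
    moreover have "swap_rows x \<in> (?M \<times> ?M) \<times> (?M \<times> ?M)" using x neg by (auto simp: swap_rows_def)
    ultimately show "\<exists>v\<in>(?M \<times> ?M) \<times> (?M \<times> ?M). swap_rows v = x" by (intro bexI[of _ "swap_rows x"])
  qed
qed

text \<open>\<open>d_mf\<close> preserves the resolution of each crossing, so the complex is the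
  direct sum of the two blocks for the first crossing.\<close>

lemma tf_fin_Crossing:
  fixes p q i j :: nat and pos
  defines "pc \<equiv> Crossing pos p q i j"
  assumes red: "reduction m X \<Psi>" and D: "\<And>pc'. pc' \<in> set (pc # D) \<Longrightarrow> vars_in m pc'"
    and blocks: "\<And>w b1 c1 n1 b2 c2 n2. rows pc w = [(b1, c1, n1), (b2, c2, n2)] \<Longrightarrow>
      tf_fin (map_prod (map_prod (smul a_var) (smul a_var)) (map_prod (smul a_var) (smul a_var)))
    ((chains m D \<times> chains m D) \<times> (chains m D \<times> chains m D))
    ((ker_chains m D \<Psi> \<times> ker_chains m D \<Psi>) \<times> (ker_chains m D \<Psi> \<times> ker_chains m D \<Psi>))
    (kz (map_prod (smul b1) (smul b1)) (map_prod (smul c1) (smul c1)) (kz (smul b2) (smul c2) (d_mf D)))"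
  shows "tf_fin (smul a_var) (chains m (pc # D)) (ker_chains m (pc # D) \<Psi>) (d_mf (pc # D))"
proof -
  interpret reduction m X \<Psi> by (rule red)
  let ?M = "chains m D" and ?B = "ker_chains m D \<Psi>"
  obtain b1 c1 n1 b2 c2 n2 where rF: "rows pc False = [(b1, c1, n1), (b2, c2, n2)]" by (simp add: pc_def)
  obtain b1' c1' n1' b2' c2' n2' where rT: "rows pc True = [(b1', c1', n1'), (b2', c2', n2')]" by (simp add: pc_def)
  let ?dF = "kz (map_prod (smul b1) (smul b1)) (map_prod (smul c1) (smul c1)) (kz (smul b2) (smul c2) (d_mf D))"
  let ?dT = "kz (map_prod (smul b1') (smul b1')) (map_prod (smul c1') (smul c1')) (kz (smul b2') (smul c2') (d_mf D))"
  let ?M4 = "(?M \<times> ?M) \<times> (?M \<times> ?M)" and ?B4 = "(?B \<times> ?B) \<times> (?B \<times> ?B)"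
  let ?a = "map_prod (map_prod (smul a_var) (smul a_var)) (map_prod (smul a_var) (smul a_var))"
  have dl: "clin (d_mf D)" unfolding d_mf_def by (rule tensor_d_lin)
  have kl: "clin (kz (map_prod (smul r) (smul r)) (map_prod (smul s) (smul s)) (kz (smul r') (smul s') (d_mf D)))" for r s r' s'
    by (rule clinI) (auto simp: kz_def prod_eq_iff clin_add[OF dl] clin_scale[OF dl] clin_add[OF smul_lin] clin_scale[OF smul_lin]
        scaleC_prod_def scaleC_add_right scaleC_diff_right)
  have "tf_fin (map_prod ?a ?a) (?M4 \<times> ?M4) (?B4 \<times> ?B4) (map_prod ?dF ?dT)"
    by (rule tf_fin_prod[OF blocks[OF rF] blocks[OF rT]])
      (intro csub_Times csub_chains csub_ker_chains[OF red] kl)+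
  then show ?thesis
  proof (rule tf_fin_transfer[where \<phi> = "\<lambda>v. (block False v, block True v)"])
    show "clin (\<lambda>v. (block False v, block True v))"
      by (rule clinI) (auto simp: scaleC_prod_def[of _ "(block False _, block True _)"] clin_add[OF block_lin] clin_scale[OF block_lin])
    show "csub (chains m (pc # D))" by (rule csub_chains)
    fix v assume v: "v \<in> chains m (pc # D)"
    show "d_mf (pc # D) v \<in> chains m (pc # D)" by (rule d_mf_chains[OF D v])
    show "smul a_var v \<in> chains m (pc # D)" by (rule smul_chains[OF _ v]) simp
    show "(block False v, block True v) \<in> ?M4 \<times> ?M4"
      using slice_chains[OF v] by (simp add: block_def)
    show "v \<in> ker_chains m (pc # D) \<Psi> \<longleftrightarrow> (block False v, block True v) \<in> ?B4 \<times> ?B4"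
      using ker_chains_Cons[OF v] by (auto simp: pc_def cells_Crossing block_def UNIV_bool bits2_eq)
    show "(block False (d_mf (pc # D) v), block True (d_mf (pc # D) v)) = map_prod ?dF ?dT (block False v, block True v)"
      using block_d_mf[OF pc_def[THEN meta_eq_to_obj_eq] rF v] block_d_mf[OF pc_def[THEN meta_eq_to_obj_eq] rT v] by simp
    show "(block False (smul a_var v), block True (smul a_var v)) = map_prod ?a ?a (block False v, block True v)"
      by (simp add: slice_smul block_def)
  next
    fix x assume x: "x \<in> ?M4 \<times> ?M4"
    obtain f00 f01 f10 f11 t00 t01 t10 t11 where xe: "x = (((f00, f01), (f10, f11)), ((t00, t01), (t10, t11)))"
      by (metis surj_pair)
    let ?F = "\<lambda>c::cell. if fst c then (if snd c = [False, False] then t00 else if snd c = [False, True] then t01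
        else if snd c = [True, False] then t10 else t11)
      else (if snd c = [False, False] then f00 else if snd c = [False, True] then f01
        else if snd c = [True, False] then f10 else f11)"
    have "glue pc ?F \<in> chains m (pc # D)" by (rule glue_chains) (use x in \<open>simp add: xe\<close>)
    moreover have "(block False (glue pc ?F), block True (glue pc ?F)) = x"
      by (simp add: slice_glue block_def xe pc_def cells_Crossing bits2_def)
    ultimately show "\<exists>v\<in>chains m (pc # D). (block False v, block True v) = x" by (intro bexI[of _ "glue pc ?F"])
  qed
qed

lemma sum_fun_apply: "(\<Sum>x\<in>A. f x) g = (\<Sum>x\<in>A. f x g)"
  for f :: "'x \<Rightarrow> 'y \<Rightarrow> 'z::comm_monoid_add"
  by (induction A rule: infinite_finite_induct) simp_all

text \<open>No pieces are left, so the differential is zero and every chain is a cycle.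
  \<open>\<Psi>\<close> commutes with \<open>a\<close> and takes values in a domain, hence there is
  no torsion; \<open>3 x_i^2 = a\<close> leaves the squarefree monomials as generators modulo
  \<open>a\<close>.\<close>

lemma tf_fin_Nil:
  assumes red: "reduction m {} \<Psi>" and sq: "\<And>i. i \<in> {1..m} \<Longrightarrow> \<Psi> (3 * Var i ^ 2 - a_var) = 0"
  shows "tf_fin (smul a_var) (chains m []) (ker_chains m [] \<Psi>) (d_mf [])"
proof -
  interpret reduction m "{}" \<Psi> by (rule red)
  have d0: "d_mf [] v = 0" for v by (auto simp: d_mf_def fun_eq_iff)
  have aP: "\<Psi> (a_var * f) = a_var * \<Psi> f" for f by (rule mult) simp
  have a0: "a_var \<noteq> 0" using Var_power_minus_nonzero[of 0 "{}" 0 1] by simp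
  let ?R = "polys {0..m}"
  define mon where "mon S = (\<Prod>i\<in>S. Var i)" for S :: "nat set"
  let ?P = "Pow {1..m}"
  have monR: "mon S \<in> ?R" if "S \<in> ?P" for S using that unfolding mon_def by (intro polys_prod) auto
  \<comment> \<open>\<open>Q p\<close>: modulo the kernel, \<open>p\<close> is a complex combination
    of squarefree monomials plus a multiple of \<open>a\<close>.\<close>
  define Q where "Q p \<longleftrightarrow> (\<exists>l::nat set \<Rightarrow> complex. \<exists>u\<in>?R. \<Psi> (p - ((\<Sum>S\<in>?P. Const (l S) * mon S) + a_var * u)) = 0)" for p
  have Qadd: "Q (f + g)" if fg: "Q f" "Q g" for f g
  proof -
    from fg(1) obtain l u where 1: "u \<in> ?R" "\<Psi> (f - ((\<Sum>S\<in>?P. Const (l S) * mon S) + a_var * u)) = 0" unfolding Q_def by blast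
    from fg(2) obtain l' u' where 2: "u' \<in> ?R" "\<Psi> (g - ((\<Sum>S\<in>?P. Const (l' S) * mon S) + a_var * u')) = 0" unfolding Q_def by blast
    have eq: "f + g - ((\<Sum>S\<in>?P. Const (l S + l' S) * mon S) + a_var * (u + u')) =
      (f - ((\<Sum>S\<in>?P. Const (l S) * mon S) + a_var * u)) + (g - ((\<Sum>S\<in>?P. Const (l' S) * mon S) + a_var * u'))"
      by (simp add: Const_add distrib_right distrib_left sum.distrib)
    show ?thesis unfolding Q_def
      by (rule exI[of _ "\<lambda>S. l S + l' S"], rule bexI[of _ "u + u'"]) (use 1 2 in \<open>simp_all only: eq add add_0 polys_add\<close>)
  qed
  have Qconst: "Q (Const c * f)" if f: "Q f" for c f
  proof -
    from f obtain l u where 1: "u \<in> ?R" "\<Psi> (f - ((\<Sum>S\<in>?P. Const (l S) * mon S) + a_var * u)) = 0" unfolding Q_def by blast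
    have eq: "Const c * f - ((\<Sum>S\<in>?P. Const (c * l S) * mon S) + a_var * (Const c * u)) =
      Const c * (f - ((\<Sum>S\<in>?P. Const (l S) * mon S) + a_var * u))"
      by (simp add: Submission.Const_mult right_diff_distrib distrib_left sum_distrib_left mult.assoc mult.left_commute)
    show ?thesis unfolding Q_def
      by (rule exI[of _ "\<lambda>S. c * l S"], rule bexI[of _ "Const c * u"])
        (use 1 in \<open>simp_all only: eq Const_mult mult_zero_right polys_mult polys_Const\<close>)
  qed
  have Qmon: "Q (mon S)" if S: "S \<in> ?P" for S
  proof -
    have "(\<Sum>T\<in>?P. Const (if T = S then 1 else 0) * mon T) = (\<Sum>T\<in>?P. if T = S then mon S else 0)"
      by (rule sum.cong) auto
    also have "\<dots> = mon S" using S by simp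
    finally show ?thesis unfolding Q_def
      by (intro exI[of _ "\<lambda>T. if T = S then 1 else 0"] bexI[of _ 0]) simp_all
  qed
  have Qa: "Q (a_var * u)" if "u \<in> ?R" for u
    unfolding Q_def using that by (intro exI[of _ "\<lambda>T. 0"] bexI[of _ u]) simp_all
  have Qcong: "Q f" if fg: "Q g" "\<Psi> (f - g) = 0" for f g
  proof -
    from fg(1) obtain l u where 1: "u \<in> ?R" "\<Psi> (g - ((\<Sum>S\<in>?P. Const (l S) * mon S) + a_var * u)) = 0" unfolding Q_def by blast
    have "f - ((\<Sum>S\<in>?P. Const (l S) * mon S) + a_var * u) = (f - g) + (g - ((\<Sum>S\<in>?P. Const (l S) * mon S) + a_var * u))" by simp
    then have "\<Psi> (f - ((\<Sum>S\<in>?P. Const (l S) * mon S) + a_var * u)) = 0" by (simp only: add 1 fg add_0)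
    then show ?thesis unfolding Q_def using 1 by blast
  qed
  have Qsum: "Q (\<Sum>x\<in>A. f x)" if "\<And>x. x \<in> A \<Longrightarrow> Q (f x)" for f and A :: "nat set set"
    using that Qa[of 0] by (induction A rule: infinite_finite_induct) (auto intro: Qadd)
  have QVar: "Q (Var i * mon S)" if iS: "i \<in> {1..m}" "S \<in> ?P" for i S
  proof (cases "i \<in> S")
    case False
    have "finite S" using iS finite_subset by auto
    then have "Var i * mon S = mon (insert i S)" using False by (simp add: mon_def)
    then show ?thesis using Qmon[of "insert i S"] iS by simp
  next
    case True
    let ?T = "S - {i}"
    have T: "mon ?T \<in> ?R" by (rule monR) (use iS in auto)
    have "finite S" using iS finite_subset by auto
    then have "mon S = Var i * mon ?T" using True by (simp add: mon_def prod.remove)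
    \<comment> \<open>A repeated variable is removed by the relation \<open>3 x_i^2 = a\<close>,
      which leaves a multiple of \<open>a\<close>.\<close>
    then have "3 * (Var i * mon S) - a_var * mon ?T = mon ?T * (3 * Var i ^ 2 - a_var)"
      by (simp add: power2_eq_square algebra_simps)
    moreover have "\<Psi> (mon ?T * (3 * Var i ^ 2 - a_var)) = 0"
      by (rule ideal[OF _ T sq[OF iS(1)]]) (use iS in \<open>auto intro!: polys_intros\<close>)
    ultimately have "\<Psi> (3 * (Var i * mon S) - a_var * mon ?T) = 0" by simp
    then have "Q (3 * (Var i * mon S))" by (rule Qcong[OF Qa[OF T]])
    then have "Q (Const (1 / 3) * (3 * (Var i * mon S)))" by (rule Qconst)
    moreover have "Const (1 / 3) * (3 * (Var i * mon S)) = Var i * mon S"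
      unfolding mult.assoc[symmetric] mult.commute[of "Const (1 / 3)" 3] three_thirds by simp
    ultimately show ?thesis by (simp only:)
  qed
  have Q: "Q f" if f: "f \<in> ?R" for f
  proof -
    have "f \<in> ?R \<and> Q f" using f
    proof (induction f rule: polys_induct)
      case (Const c)
      have "mon {} = 1" by (simp add: mon_def)
      then show ?case using Qconst[OF Qmon[of "{}"], of c] by simp
    next
      case (add f g) then show ?case using Qadd polys_add by blast
    next
      case (Var f i)
      then have fR: "f \<in> ?R" and iR: "Var i \<in> ?R" by auto
      have "Q (Var i * f)"
      proof (cases "i = 0")
        case True then show ?thesis using Qa[OF fR] by simp
      next
        case False
        then have i: "i \<in> {1..m}" using Var by auto
        from Var obtain l u where 1: "u \<in> ?R" "\<Psi> (f - ((\<Sum>S\<in>?P. Const (l S) * mon S) + a_var * u)) = 0" unfolding Q_def by blast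
        have sR: "(\<Sum>S\<in>?P. Const (l S) * mon S) \<in> ?R" by (intro polys_sum polys_mult polys_Const monR)
        have "\<Psi> (Var i * (f - ((\<Sum>S\<in>?P. Const (l S) * mon S) + a_var * u))) = 0"
          by (rule ideal[OF _ iR 1(2)]) (intro polys_diff polys_add polys_mult fR sR 1(1), simp)
        moreover have "Var i * (f - ((\<Sum>S\<in>?P. Const (l S) * mon S) + a_var * u)) =
          Var i * f - ((\<Sum>S\<in>?P. Const (l S) * (Var i * mon S)) + a_var * (Var i * u))"
          by (simp add: right_diff_distrib distrib_left sum_distrib_left mult.left_commute)
        moreover have "Q ((\<Sum>S\<in>?P. Const (l S) * (Var i * mon S)) + a_var * (Var i * u))"
          by (intro Qadd Qsum Qconst QVar i Qa polys_mult iR 1(1))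
        ultimately show ?thesis using Qcong by simp
      qed
      then show ?case using polys_mult[OF iR fR] by simp
    qed
    then show ?thesis by simp
  qed
  obtain n :: nat and h where h: "bij_betw h {..<n} ?P"
    using ex_bij_betw_nat_finite[of ?P] by (auto simp: lessThan_atLeast0)
  let ?at = "\<lambda>f (g::cell list). if g = [] then f else (0::pring)"
  have atc: "?at f \<in> chains m []" if "f \<in> ?R" for f using that by (simp add: chains_def)
  show ?thesis
  proof (rule tf_finI[where n = n and f = "\<lambda>k. ?at (mon (h k))"])
    fix v w assume v: "v \<in> chains m []" "smul a_var v - d_mf [] w \<in> ker_chains m [] \<Psi>"
    then have "a_var * \<Psi> (v g) = 0" for g by (simp add: d0 ker_chains_def smul_def aP[symmetric])
    then have "v \<in> ker_chains m [] \<Psi>" using v(1) a0 by (simp add: ker_chains_def)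
    then show "\<exists>u\<in>chains m []. v - d_mf [] u \<in> ker_chains m [] \<Psi>" using v(1) by (intro bexI[of _ v]) (simp_all add: d0)
  next
    fix k assume "k < n"
    then have "h k \<in> ?P" using h by (auto simp: bij_betw_def)
    then show "?at (mon (h k)) \<in> chains m [] \<and> d_mf [] (?at (mon (h k))) \<in> ker_chains m [] \<Psi>"
      using atc[OF monR] csub_zero[OF csub_ker_chains[OF red]] by (simp add: d0)
  next
    fix v assume v: "v \<in> chains m []"
    have "Q (v [])" by (rule Q[OF chains_polys[OF v]])
    then obtain l u where 1: "u \<in> ?R" "\<Psi> (v [] - ((\<Sum>S\<in>?P. Const (l S) * mon S) + a_var * u)) = 0" unfolding Q_def by blast
    have s: "(\<Sum>S\<in>?P. Const (l S) * mon S) = (\<Sum>k<n. Const (l (h k)) * mon (h k))"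
      by (rule sum.reindex_bij_betw[OF h, symmetric])
    let ?x = "v - ((\<Sum>k<n. l (h k) *\<^sub>C ?at (mon (h k))) + smul a_var (?at u) + d_mf [] 0)"
    have sc: "(\<Sum>k<n. l (h k) *\<^sub>C ?at (mon (h k))) \<in> chains m []"
      using h by (intro csub_sum csub_scale csub_chains atc monR) (auto simp: bij_betw_def)
    have xc: "?x \<in> chains m []"
      unfolding d0 by (intro csub_diff csub_add csub_chains v sc smul_chains atc 1 csub_zero) simp
    have sum_at: "(\<Sum>k<n. l (h k) *\<^sub>C ?at (mon (h k))) [] = (\<Sum>k<n. Const (l (h k)) * mon (h k))"
      by (simp add: sum_fun_apply scaleC_chain)
    have "\<Psi> (?x g) = 0" for g
    proof (cases "g = []")
      case True
      have "?x [] = v [] - ((\<Sum>S\<in>?P. Const (l S) * mon S) + a_var * u)"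
        unfolding s sum_at[symmetric] by (simp add: d0 smul_def)
      then show ?thesis unfolding True using 1(2) by (simp only:)
    next
      case False
      then show ?thesis using chains_outside[OF xc, of g] by simp
    qed
    then have "?x \<in> ker_chains m [] \<Psi>" using xc by (simp add: ker_chains_def)
    then show "\<exists>l. \<exists>u\<in>chains m []. \<exists>w\<in>chains m []. d_mf [] u \<in> ker_chains m [] \<Psi> \<and>
        v - ((\<Sum>k<n. l k *\<^sub>C ?at (mon (h k))) + smul a_var u + d_mf [] w) \<in> ker_chains m [] \<Psi>"
      using csub_zero[OF csub_chains] csub_zero[OF csub_ker_chains[OF red]] atc[OF 1(1)]
      by (intro exI[of _ "\<lambda>k. l (h k)"], rule_tac bexI[of _ "?at u"], rule_tac bexI[of _ 0]) (simp_all add: d0)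
  qed
qed

text \<open>Imposing one entry of a row kills the product \<open>b * c\<close>. This hands the
  vanishing of the potential on to the remaining pieces.\<close>

lemma good_step_residue:
  assumes red: "reduction m X \<Psi>" "reduction m X' \<Psi>'" and g: "good_step m \<Psi> \<Psi>' e" "e \<in> {b, c}"
    and R: "w \<in> polys {0..m}" "b \<in> polys {0..m}" "c \<in> polys {0..m}" and z: "\<Psi> (w + b * c) = 0"
  shows "\<Psi>' w = 0"
proof -
  interpret n: reduction m X' \<Psi>' by (rule red)
  have "\<Psi>' (w + b * c) = 0"
    by (rule good_step_kernel(1)[OF red(1) g(1) _ z]) (intro polys_add polys_mult R)
  moreover have "\<Psi>' e = 0" by (rule good_step_kernel(2)[OF red(1) g(1)])
  then have "\<Psi>' (b * c) = 0" using g(2) n.ideal[OF R(2,3)] n.ideal[OF R(3,2)] by (auto simp: mult.commute)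
  ultimately show ?thesis by (simp add: n.add)
qed

definition half_edges :: "piece list \<Rightarrow> dart set"
  where "half_edges D = (\<lambda>v. (v, False)) ` set (concat (map ins D)) \<union> (\<lambda>v. (v, True)) ` set (concat (map outs D))"

text \<open>The head of the list is traded for relations, which enlarge the kernel seen by the tail.
  Distinctness of the endpoints makes the half-edges that are left exactly those of the tail, and
  the condition on the potential makes \<open>d_mf\<close> square to zero modulo the kernel.\<close>

theorem tf_fin_diagram:
  assumes "matched m X \<Psi> (half_edges D) \<theta>" "distinct (concat (map ins D))" "distinct (concat (map outs D))"
    "\<And>pc. pc \<in> set D \<Longrightarrow> vars_in m pc" "\<Psi> (\<Sum>pc\<leftarrow>D. piece_pot pc) = 0"
  shows "tf_fin (smul a_var) (chains m D) (ker_chains m D \<Psi>) (d_mf D)"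
  using assms
proof (induction D arbitrary: X \<Psi> \<theta>)
  case Nil
  have "bij_betw \<theta> {} (X \<times> UNIV)" using Nil(1) by (simp add: matched_def half_edges_def)
  then have "X = {}" by (auto simp: bij_betw_def)
  then have red: "reduction m {} \<Psi>" and M: "matched m {} \<Psi> (half_edges []) \<theta>" using Nil(1) by (auto simp: matched_def)
  show ?case by (rule tf_fin_Nil[OF red]) (use matchedD(2)[OF M] in auto)
next
  case (Cons pc D)
  note M = Cons.prems(1)
  have red: "reduction m X \<Psi>" using M by (simp add: matched_def)
  have D: "\<And>pc'. pc' \<in> set D \<Longrightarrow> vars_in m pc'" using Cons.prems(4) by simp
  have WR: "(\<Sum>pc\<leftarrow>D. piece_pot pc) \<in> polys {0..m}" by (intro sum_list_polys piece_pot_polys D)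
  have dist: "distinct (concat (map ins D))" "distinct (concat (map outs D))" using Cons.prems(2,3) by simp_all
  show ?case
  proof (cases pc)
    case (Arc p i)
    let ?b = "arc_v (Var i) (Var p)" and ?c = "Var i - Var p"
    have H: "(p, False) \<in> half_edges (pc # D)" "(i, True) \<in> half_edges (pc # D)"
      by (simp_all add: half_edges_def Arc)
    have rest: "half_edges (pc # D) - {(p, False), (i, True)} = half_edges D"
      using Cons.prems(2,3) by (auto simp: half_edges_def Arc)
    obtain X' \<Psi>' \<theta>' e where s: "matched m X' \<Psi>' (half_edges D) \<theta>'" "good_step m \<Psi> \<Psi>' e" "e \<in> {?b, ?c}"
      using arc_step[OF M H] unfolding rest by blast
    have red': "reduction m X' \<Psi>'" using s(1) by (simp add: matched_def)
    have bc: "?b \<in> polys {0..m}" "?c \<in> polys {0..m}"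
      using homogeneous_rows(3,4)[OF Cons.prems(4)[of pc], of ?b ?c 4 False] by (simp_all add: Arc)
    have "\<Psi> ((\<Sum>pc\<leftarrow>D. piece_pot pc) + ?b * ?c) = 0"
      using Cons.prems(5) unfolding arc_v_eq by (simp add: Arc add.commute)
    then have pot0: "\<Psi>' (\<Sum>pc\<leftarrow>D. piece_pot pc) = 0" by (rule good_step_residue[OF red red' s(2,3) WR bc])
    have "tf_fin (smul a_var) (chains m D) (ker_chains m D \<Psi>') (d_mf D)"
      by (rule Cons.IH[OF s(1) dist _ pot0]) (rule D)
    then show ?thesis
      using Cons.prems(4,5) unfolding Arc by (intro tf_fin_Arc[OF red red' s(2,3)])
  next
    case (Crossing pos p q i j)
    have H: "(p, False) \<in> half_edges (pc # D)" "(q, False) \<in> half_edges (pc # D)"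
      "(i, True) \<in> half_edges (pc # D)" "(j, True) \<in> half_edges (pc # D)"
      by (simp_all add: half_edges_def Crossing)
    have ne: "p \<noteq> q" "i \<noteq> j" using Cons.prems(2,3) by (auto simp: Crossing)
    have rest: "half_edges (pc # D) - {(p, False), (q, False), (i, True), (j, True)} = half_edges D"
      using Cons.prems(2,3) by (auto simp: half_edges_def Crossing)
    have rest': "half_edges (pc # D) - {(p, False), (i, True)} - {(q, False), (j, True)} = half_edges D"
      using rest by auto
    show ?thesis
      unfolding Crossing
    proof (rule tf_fin_Crossing[OF red])
      show "\<And>pc'. pc' \<in> set (Crossing pos p q i j # D) \<Longrightarrow> vars_in m pc'" using Cons.prems(4) by (simp add: Crossing)
      fix w b1 c1 n1 b2 c2 n2
      assume rs: "rows (Crossing pos p q i j) w = [(b1, c1, n1), (b2, c2, n2)]"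
      have ex: "\<exists>pos' p' q' i' j'. pc = Crossing pos' p' q' i' j'" by (simp add: Crossing)
      have mem: "(b1, c1, n1) \<in> set (rows pc w)" "(b2, c2, n2) \<in> set (rows pc w)" by (simp_all add: Crossing rs)
      have bc: "b1 \<in> polys {0..m}" "c1 \<in> polys {0..m}" "b2 \<in> polys {0..m}" "c2 \<in> polys {0..m}"
        using homogeneous_rows(3,4)[OF Cons.prems(4)[of pc] mem(1) ex] homogeneous_rows(3,4)[OF Cons.prems(4)[of pc] mem(2) ex]
        by simp_all
      have pot: "b1 * c1 + b2 * c2 = piece_pot pc"
        using rs row_pot(1)[of i p j q pos] row_pot(2)[of i j p q pos] unfolding Crossing by (cases w) auto
      have w0: "\<Psi> ((\<Sum>pc\<leftarrow>D. piece_pot pc) + (b1 * c1 + b2 * c2)) = 0"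
        unfolding pot using Cons.prems(5) by (simp add: add.commute)
      have "\<exists>X1 \<Psi>1 X' \<Psi>' \<theta>' e1 e2. reduction m X1 \<Psi>1 \<and> matched m X' \<Psi>' (half_edges D) \<theta>' \<and>
        good_step m \<Psi> \<Psi>1 e1 \<and> good_step m \<Psi>1 \<Psi>' e2 \<and>
        (e1 \<in> {b1, c1} \<and> e2 \<in> {b2, c2} \<or> e1 \<in> {b2, c2} \<and> e2 \<in> {b1, c1})"
      proof (cases w)
        case True
        then have "b1 = wide_u1 (Var i) (Var j) (Var p) (Var q)" "c1 = Var i + Var j - Var p - Var q"
          "b2 = wide_u2 (Var i) (Var j) (Var p) (Var q)" "c2 = Var i * Var j - Var p * Var q" using rs by simp_all
        then show ?thesis using wide_step[OF M H ne] unfolding rest by blast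
      next
        case False
        then have r: "b1 = arc_v (Var i) (Var p)" "c1 = Var i - Var p" "b2 = arc_v (Var j) (Var q)" "c2 = Var j - Var q"
          using rs by simp_all
        obtain X1 \<Psi>1 \<theta>1 e1 where 1: "matched m X1 \<Psi>1 (half_edges (pc # D) - {(p, False), (i, True)}) \<theta>1"
          "good_step m \<Psi> \<Psi>1 e1" "e1 \<in> {b1, c1}" using arc_step[OF M H(1,3)] unfolding r by blast
        have H': "(q, False) \<in> half_edges (pc # D) - {(p, False), (i, True)}"
          "(j, True) \<in> half_edges (pc # D) - {(p, False), (i, True)}" using H ne by auto
        obtain X2 \<Psi>2 \<theta>2 e2 where 2: "matched m X2 \<Psi>2 (half_edges D) \<theta>2"
          "good_step m \<Psi>1 \<Psi>2 e2" "e2 \<in> {b2, c2}" using arc_step[OF 1(1) H'] unfolding rest' r by blast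
        have "reduction m X1 \<Psi>1" using 1(1) by (simp add: matched_def)
        then show ?thesis using 1 2 by blast
      qed
      then obtain X1 \<Psi>1 X' \<Psi>' \<theta>' e1 e2 where s: "reduction m X1 \<Psi>1" "matched m X' \<Psi>' (half_edges D) \<theta>'"
        "good_step m \<Psi> \<Psi>1 e1" "good_step m \<Psi>1 \<Psi>' e2"
        "e1 \<in> {b1, c1} \<and> e2 \<in> {b2, c2} \<or> e1 \<in> {b2, c2} \<and> e2 \<in> {b1, c1}" by blast
      have red': "reduction m X' \<Psi>'" using s(2) by (simp add: matched_def)
      have pot0: "\<Psi>' (\<Sum>pc\<leftarrow>D. piece_pot pc) = 0"
        using s(5)
      proof
        assume e: "e1 \<in> {b1, c1} \<and> e2 \<in> {b2, c2}"
        have "\<Psi> (((\<Sum>pc\<leftarrow>D. piece_pot pc) + b2 * c2) + b1 * c1) = 0" using w0 by (simp only: ac_simps)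
        then have "\<Psi>1 ((\<Sum>pc\<leftarrow>D. piece_pot pc) + b2 * c2) = 0"
          by (rule good_step_residue[OF red s(1,3) conjunct1[OF e] polys_add[OF WR polys_mult[OF bc(3,4)]] bc(1,2)])
        then show ?thesis by (rule good_step_residue[OF s(1) red' s(4) conjunct2[OF e] WR bc(3,4)])
      next
        assume e: "e1 \<in> {b2, c2} \<and> e2 \<in> {b1, c1}"
        have "\<Psi> (((\<Sum>pc\<leftarrow>D. piece_pot pc) + b1 * c1) + b2 * c2) = 0" using w0 by (simp only: ac_simps)
        then have "\<Psi>1 ((\<Sum>pc\<leftarrow>D. piece_pot pc) + b1 * c1) = 0"
          by (rule good_step_residue[OF red s(1,3) conjunct1[OF e] polys_add[OF WR polys_mult[OF bc(1,2)]] bc(3,4)])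
        then show ?thesis by (rule good_step_residue[OF s(1) red' s(4) conjunct2[OF e] WR bc(1,2)])
      qed
      have P: "tf_fin (smul a_var) (chains m D) (ker_chains m D \<Psi>') (d_mf D)"
        by (rule Cons.IH[OF s(2) dist _ pot0]) (rule D)
      show "tf_fin (map_prod (map_prod (smul a_var) (smul a_var)) (map_prod (smul a_var) (smul a_var)))
        ((chains m D \<times> chains m D) \<times> (chains m D \<times> chains m D))
        ((ker_chains m D \<Psi> \<times> ker_chains m D \<Psi>) \<times> (ker_chains m D \<Psi> \<times> ker_chains m D \<Psi>))
        (kz (map_prod (smul b1) (smul b1)) (map_prod (smul c1) (smul c1)) (kz (smul b2) (smul c2) (d_mf D)))"
        by (rule tf_fin_block[OF red s(1) red' s(3,4,5) bc D w0 P])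
    qed
  qed
qed

lemma sum_piece_pot:
  "(\<Sum>pc\<leftarrow>D. piece_pot pc) = (\<Sum>v\<leftarrow>concat (map outs D). pot (Var v)) - (\<Sum>v\<leftarrow>concat (map ins D). pot (Var v))"
proof (induction D)
  case (Cons pc D)
  then show ?case by (cases pc) auto
qed simp

lemma marked_diagram_vars_in: "marked_diagram m D \<Longrightarrow> pc \<in> set D \<Longrightarrow> vars_in m pc"
  unfolding marked_diagram_def vars_in_def set_concat set_map by blast

lemma marked_diagram_pot:
  assumes "marked_diagram m D" shows "(\<Sum>pc\<leftarrow>D. piece_pot pc) = 0"
  unfolding sum_piece_pot using assms
  by (simp add: marked_diagram_def sum_list_distinct_conv_sum_set)

text \<open>No relation is imposed at the start: every marked point is an open strand of its own,
  with both half-edges still to be joined, and the kernel of the identity is zero.\<close>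

theorem tf_fin_marked_diagram:
  assumes "marked_diagram m D"
  shows "tf_fin (smul a_var) (chains m D) {0} (d_mf D)"
proof -
  have red: "reduction m {1..m} (\<lambda>f. f)" by standard auto
  have H: "half_edges D = {1..m} \<times> UNIV"
    using assms by (auto simp: half_edges_def marked_diagram_def image_def)
  have M: "matched m {1..m} (\<lambda>f. f) (half_edges D) (\<lambda>h. h)"
    unfolding H matched_def using red by (auto simp: bij_betw_def)
  have "tf_fin (smul a_var) (chains m D) (ker_chains m D (\<lambda>f. f)) (d_mf D)"
    using assms by (intro tf_fin_diagram[OF M] marked_diagram_vars_in marked_diagram_pot) (auto simp: marked_diagram_def)
  moreover have "ker_chains m D (\<lambda>f. f) = {0}"
    using csub_zero[OF csub_chains] by (auto simp: ker_chains_def fun_eq_iff)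
  ultimately show ?thesis by simp
qed

section \<open>Dimensions of subquotients\<close>

definition has_dim :: "'v::complex_space set \<Rightarrow> 'v set \<Rightarrow> nat \<Rightarrow> bool"
  where "has_dim Z B n \<longleftrightarrow> (\<exists>b. (\<forall>k<n. b k \<in> Z) \<and> (\<forall>z\<in>Z. \<exists>l. z - (\<Sum>k<n. l k *\<^sub>C b k) \<in> B) \<and>
    (\<forall>l. (\<Sum>k<n. l k *\<^sub>C b k) \<in> B \<longrightarrow> (\<forall>k<n. l k = 0)))"

lemma has_dimI:
  assumes "\<And>k. k < n \<Longrightarrow> b k \<in> Z" "\<And>z. z \<in> Z \<Longrightarrow> \<exists>l. z - (\<Sum>k<n. l k *\<^sub>C b k) \<in> B"
    "\<And>l k. (\<Sum>k<n. l k *\<^sub>C b k) \<in> B \<Longrightarrow> k < n \<Longrightarrow> l k = 0"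
  shows "has_dim Z B n"
  unfolding has_dim_def using assms by (intro exI[of _ b]) simp

lemma has_dimE:
  assumes "has_dim Z B n"
  obtains b where "\<And>k. k < n \<Longrightarrow> b k \<in> Z" "\<And>z. z \<in> Z \<Longrightarrow> \<exists>l. z - (\<Sum>k<n. l k *\<^sub>C b k) \<in> B"
    "\<And>l k. (\<Sum>k<n. l k *\<^sub>C b k) \<in> B \<Longrightarrow> k < n \<Longrightarrow> l k = 0"
  using assms unfolding has_dim_def by blast

text \<open>The two bases are concatenated, the one of the lower quotient first. For independence, a
  relation is read modulo \<open>Y\<close> to remove the last \<open>p\<close> coefficients and then
  modulo \<open>B\<close>.\<close>

lemma has_dim_extend:
  assumes Z: "csub Z" "csub Y" "csub B" "B \<subseteq> Y" "Y \<subseteq> Z"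
    and p: "has_dim Z Y p" and q: "has_dim Y B q"
  shows "has_dim Z B (q + p)"
proof -
  obtain b where b: "\<And>k. k < p \<Longrightarrow> b k \<in> Z" "\<And>z. z \<in> Z \<Longrightarrow> \<exists>l. z - (\<Sum>k<p. l k *\<^sub>C b k) \<in> Y"
    "\<And>l k. (\<Sum>k<p. l k *\<^sub>C b k) \<in> Y \<Longrightarrow> k < p \<Longrightarrow> l k = 0" using p by (rule has_dimE) blast
  obtain c where c: "\<And>k. k < q \<Longrightarrow> c k \<in> Y" "\<And>z. z \<in> Y \<Longrightarrow> \<exists>l. z - (\<Sum>k<q. l k *\<^sub>C c k) \<in> B"
    "\<And>l k. (\<Sum>k<q. l k *\<^sub>C c k) \<in> B \<Longrightarrow> k < q \<Longrightarrow> l k = 0" using q by (rule has_dimE) blast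
  let ?d = "\<lambda>k. if k < q then c k else b (k - q)"
  have split: "(\<Sum>k<q + p. l k *\<^sub>C ?d k) = (\<Sum>k<q. l k *\<^sub>C c k) + (\<Sum>k<p. l (q + k) *\<^sub>C b k)" for l
    by (induction p) (simp_all add: add.assoc)
  have cY: "(\<Sum>k<q. l k *\<^sub>C c k) \<in> Y" for l by (intro csub_sum[OF Z(2)] csub_scale[OF Z(2)]) (simp add: c)
  show ?thesis
  proof (rule has_dimI[where b = ?d])
    show "?d k \<in> Z" if "k < q + p" for k using that b(1) c(1) Z(5) by auto
    show "\<exists>l. z - (\<Sum>k<q + p. l k *\<^sub>C ?d k) \<in> B" if z: "z \<in> Z" for z
    proof -
      obtain l where l: "z - (\<Sum>k<p. l k *\<^sub>C b k) \<in> Y" using b(2)[OF z] by blast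
      obtain l' where l': "z - (\<Sum>k<p. l k *\<^sub>C b k) - (\<Sum>k<q. l' k *\<^sub>C c k) \<in> B" using c(2)[OF l] by blast
      let ?l = "\<lambda>k. if k < q then l' k else l (k - q)"
      have "(\<Sum>k<q + p. ?l k *\<^sub>C ?d k) = (\<Sum>k<q. l' k *\<^sub>C c k) + (\<Sum>k<p. l k *\<^sub>C b k)"
        unfolding split by simp
      then show ?thesis using l' by (intro exI[of _ ?l]) (simp only: diff_diff_add add.commute)
    qed
    show "l k = 0" if l: "(\<Sum>k<q + p. l k *\<^sub>C ?d k) \<in> B" and k: "k < q + p" for l k
    proof -
      have "(\<Sum>k<q. l k *\<^sub>C c k) + (\<Sum>k<p. l (q + k) *\<^sub>C b k) \<in> B" using l unfolding split .
      then have "(\<Sum>k<p. l (q + k) *\<^sub>C b k) \<in> Y"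
        using csub_diff[OF Z(2) _ cY[of l]] Z(4) by (metis add_diff_cancel_left' subsetD)
      then have lb: "l (q + k) = 0" if "k < p" for k using b(3)[of "\<lambda>k. l (q + k)"] that by blast
      then have "(\<Sum>k<p. l (q + k) *\<^sub>C b k) = 0" by (simp add: scaleC_zero_left)
      then have "(\<Sum>k<q. l k *\<^sub>C c k) \<in> B" using l unfolding split by simp
      then have "l k = 0" if "k < q" for k using c(3) that by blast
      then show ?thesis using lb[of "k - q"] k by (cases "k < q") auto
    qed
  qed
qed

lemma has_dim_0: "csub B \<Longrightarrow> Z \<subseteq> B \<Longrightarrow> has_dim Z B 0"
  by (rule has_dimI) auto

lemma has_dim_1:
  assumes "csub Z" "csub B" "b \<in> Z" "b \<notin> B" "\<And>z. z \<in> Z \<Longrightarrow> \<exists>l. z - l *\<^sub>C b \<in> B"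
  shows "has_dim Z B 1"
proof (rule has_dimI[where b = "\<lambda>_. b"])
  show "\<exists>l. z - (\<Sum>k<1::nat. l k *\<^sub>C b) \<in> B" if "z \<in> Z" for z
  proof -
    obtain l where "z - l *\<^sub>C b \<in> B" using assms(5) \<open>z \<in> Z\<close> by blast
    then show ?thesis by (intro exI[of _ "\<lambda>_. l"]) simp
  qed
  show "l k = 0" if "(\<Sum>k<1::nat. l k *\<^sub>C b) \<in> B" "k < 1" for l :: "nat \<Rightarrow> complex" and k
  proof (rule ccontr)
    assume "l k \<noteq> 0"
    then have "b = inverse (l 0) *\<^sub>C l 0 *\<^sub>C b" using that by (simp add: scaleC_scaleC scaleC_one)
    also have "\<dots> \<in> B" by (rule csub_scale[OF assms(2)]) (use that in simp)
    finally show False using assms(4) by simp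
  qed
qed (use assms in auto)

text \<open>The spanning vectors need not lie in \<open>Z\<close>, so they cannot be thinned out to
  a basis. Instead each spanning vector contributes a step of codimension at most 1.\<close>

lemma has_dim_exists:
  assumes "csub Z" "csub B" "\<And>z. z \<in> Z \<Longrightarrow> \<exists>l. z - (\<Sum>k<n::nat. l k *\<^sub>C f k) \<in> B"
  shows "\<exists>n'. has_dim Z (Z \<inter> B) n'"
  using assms
proof (induction n arbitrary: Z)
  case 0
  then have "Z \<subseteq> Z \<inter> B" by auto
  then show ?case using has_dim_0[OF csub_Int[OF 0(1,2)]] by blast
next
  case (Suc n)
  \<comment> \<open>The elements that need no multiple of the last spanning vector. If some
    \<open>b\<close> in \<open>Z\<close> does need one, comparing last coefficients brings any other
    element into \<open>Y\<close> by a multiple of \<open>b\<close>.\<close>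
  define Y where "Y = {z \<in> Z. \<exists>l. z - (\<Sum>k<n. l k *\<^sub>C f k) \<in> B}"
  have Y: "csub Y"
  proof (rule csubI)
    show "0 \<in> Y" unfolding Y_def using csub_zero[OF Suc.prems(1)] csub_zero[OF Suc.prems(2)]
      by (auto intro!: exI[of _ "\<lambda>_. 0"] simp: scaleC_zero_left)
    fix u v assume "u \<in> Y" "v \<in> Y"
    then obtain l l' where *: "u \<in> Z" "v \<in> Z" "u - (\<Sum>k<n. l k *\<^sub>C f k) \<in> B" "v - (\<Sum>k<n. l' k *\<^sub>C f k) \<in> B"
      unfolding Y_def by blast
    have "u + v - (\<Sum>k<n. (l k + l' k) *\<^sub>C f k) = (u - (\<Sum>k<n. l k *\<^sub>C f k)) + (v - (\<Sum>k<n. l' k *\<^sub>C f k))"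
      by (simp add: scaleC_add_left sum.distrib)
    also have "\<dots> \<in> B" by (rule csub_add[OF Suc.prems(2) *(3,4)])
    finally show "u + v \<in> Y" unfolding Y_def using csub_add[OF Suc.prems(1) *(1,2)]
      by (intro CollectI conjI exI[of _ "\<lambda>k. l k + l' k"])
  next
    fix c v assume "v \<in> Y"
    then obtain l where *: "v \<in> Z" "v - (\<Sum>k<n. l k *\<^sub>C f k) \<in> B" unfolding Y_def by blast
    have "c *\<^sub>C v - (\<Sum>k<n. (c * l k) *\<^sub>C f k) = c *\<^sub>C (v - (\<Sum>k<n. l k *\<^sub>C f k))"
      by (simp add: scaleC_diff_right scaleC_sum_right scaleC_scaleC)
    also have "\<dots> \<in> B" by (rule csub_scale[OF Suc.prems(2) *(2)])
    finally show "c *\<^sub>C v \<in> Y" unfolding Y_def using csub_scale[OF Suc.prems(1) *(1)]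
      by (intro CollectI conjI exI[of _ "\<lambda>k. c * l k"])
  qed
  have YZ: "Y \<subseteq> Z" by (auto simp: Y_def)
  have BY: "Z \<inter> B = Y \<inter> B"
    by (auto simp: Y_def intro!: exI[of _ "\<lambda>_. 0"] simp: scaleC_zero_left)
  obtain q where q: "has_dim Y (Y \<inter> B) q" using Suc.IH[OF Y Suc.prems(2)] by (auto simp: Y_def)
  have "\<exists>p. has_dim Z Y p"
  proof (cases "Z \<subseteq> Y")
    case True then show ?thesis using has_dim_0[OF Y] by blast
  next
    case False
    then obtain b where b: "b \<in> Z" "b \<notin> Y" by blast
    obtain l where l: "b - (\<Sum>k<Suc n. l k *\<^sub>C f k) \<in> B" using Suc.prems(3)[OF b(1)] by blast
    have ln: "l n \<noteq> 0"
    proof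
      assume "l n = 0"
      then have "b \<in> Y" using l b unfolding Y_def by (auto simp: scaleC_zero_left)
      with b show False by simp
    qed
    have "has_dim Z Y 1"
    proof (rule has_dim_1[OF Suc.prems(1) Y b])
      fix z assume z: "z \<in> Z"
      obtain l' where l': "z - (\<Sum>k<Suc n. l' k *\<^sub>C f k) \<in> B" using Suc.prems(3)[OF z] by blast
      let ?r = "l' n / l n"
      have "z - ?r *\<^sub>C b - (\<Sum>k<n. (l' k - ?r * l k) *\<^sub>C f k) =
        (z - (\<Sum>k<Suc n. l' k *\<^sub>C f k)) - ?r *\<^sub>C (b - (\<Sum>k<Suc n. l k *\<^sub>C f k))"
        using ln by (simp add: scaleC_diff_left scaleC_diff_right sum_subtractf scaleC_sum_right scaleC_scaleC scaleC_add_right)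
      also have "\<dots> \<in> B" by (rule csub_diff[OF Suc.prems(2) l' csub_scale[OF Suc.prems(2) l]])
      finally have "z - ?r *\<^sub>C b \<in> Y" unfolding Y_def
        using csub_diff[OF Suc.prems(1) z csub_scale[OF Suc.prems(1) b(1)]]
        by (intro CollectI conjI exI[of _ "\<lambda>k. l' k - ?r * l k"])
      then show "\<exists>r. z - r *\<^sub>C b \<in> Y" by blast
    qed
    then show ?thesis by blast
  qed
  then obtain p where "has_dim Z Y p" by blast
  from has_dim_extend[OF Suc.prems(1) Y csub_Int[OF Y Suc.prems(2)] _ YZ this q] show ?case
    unfolding BY by blast
qed

text \<open>Coordinates in one basis are used as coefficients in the other; their uniqueness makes
  the map linear. Through this lemma a dimension count suffices for the decomposition.\<close>

lemma sq_iso_of_has_dim: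
  assumes Z: "csub Z" "csub B" "csub Z'" "csub B'"
    and d: "has_dim Z B n" "has_dim Z' B' n" and BZ: "B' \<subseteq> Z'"
  shows "sq_iso (Z, B) (Z', B')"
proof -
  obtain b where b: "\<And>k. k < n \<Longrightarrow> b k \<in> Z" "\<And>z. z \<in> Z \<Longrightarrow> \<exists>l. z - (\<Sum>k<n. l k *\<^sub>C b k) \<in> B"
    "\<And>l k. (\<Sum>k<n. l k *\<^sub>C b k) \<in> B \<Longrightarrow> k < n \<Longrightarrow> l k = 0" using d(1) by (rule has_dimE) blast
  obtain c where c: "\<And>k. k < n \<Longrightarrow> c k \<in> Z'" "\<And>z. z \<in> Z' \<Longrightarrow> \<exists>l. z - (\<Sum>k<n. l k *\<^sub>C c k) \<in> B'"
    "\<And>l k. (\<Sum>k<n. l k *\<^sub>C c k) \<in> B' \<Longrightarrow> k < n \<Longrightarrow> l k = 0" using d(2) by (rule has_dimE) blast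
  obtain L where L: "\<And>z. z \<in> Z \<Longrightarrow> z - (\<Sum>k<n. L z k *\<^sub>C b k) \<in> B" using b(2) by metis
  have uniq: "L z k = l k" if z: "z \<in> Z" "z - (\<Sum>k<n. l k *\<^sub>C b k) \<in> B" "k < n" for z l k
  proof -
    have "(z - (\<Sum>k<n. l k *\<^sub>C b k)) - (z - (\<Sum>k<n. L z k *\<^sub>C b k)) \<in> B"
      by (rule csub_diff[OF Z(2) z(2) L[OF z(1)]])
    then have "(\<Sum>k<n. (L z k - l k) *\<^sub>C b k) \<in> B"
      by (simp add: scaleC_diff_left sum_subtractf)
    then show ?thesis using b(3)[of "\<lambda>k. L z k - l k" k] z(3) by simp
  qed
  let ?\<phi> = "\<lambda>z. \<Sum>k<n. L z k *\<^sub>C c k"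
  have "?\<phi> (u + v) = ?\<phi> u + ?\<phi> v" if uv: "u \<in> Z" "v \<in> Z" for u v
  proof -
    have "u + v - (\<Sum>k<n. (L u k + L v k) *\<^sub>C b k) = (u - (\<Sum>k<n. L u k *\<^sub>C b k)) + (v - (\<Sum>k<n. L v k *\<^sub>C b k))"
      by (simp add: scaleC_add_left sum.distrib)
    also have "\<dots> \<in> B" by (rule csub_add[OF Z(2) L[OF uv(1)] L[OF uv(2)]])
    finally have "L (u + v) k = L u k + L v k" if "k < n" for k
      by (rule uniq[OF csub_add[OF Z(1) uv] _ that])
    then show ?thesis by (simp add: scaleC_add_left sum.distrib)
  qed
  moreover have "?\<phi> (r *\<^sub>C v) = r *\<^sub>C ?\<phi> v" if v: "v \<in> Z" for r v
  proof -
    have "r *\<^sub>C v - (\<Sum>k<n. (r * L v k) *\<^sub>C b k) = r *\<^sub>C (v - (\<Sum>k<n. L v k *\<^sub>C b k))"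
      by (simp add: scaleC_diff_right scaleC_sum_right scaleC_scaleC)
    also have "\<dots> \<in> B" by (rule csub_scale[OF Z(2) L[OF v]])
    finally have "L (r *\<^sub>C v) k = r * L v k" if "k < n" for k
      by (rule uniq[OF csub_scale[OF Z(1) v] _ that])
    then show ?thesis by (simp add: scaleC_sum_right scaleC_scaleC)
  qed
  moreover have "?\<phi> v \<in> B' \<longleftrightarrow> v \<in> B" if v: "v \<in> Z" for v
  proof
    assume "?\<phi> v \<in> B'"
    then have "(\<Sum>k<n. L v k *\<^sub>C b k) = 0" using c(3)[of "L v"] by (simp add: scaleC_zero_left)
    then show "v \<in> B" using L[OF v] by simp
  next
    assume vB: "v \<in> B"
    have "L v k = 0" if "k < n" for k
      by (rule uniq[OF v _ that]) (use vB in \<open>simp add: scaleC_zero_left\<close>)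
    then show "?\<phi> v \<in> B'" using csub_zero[OF Z(4)] by (simp add: scaleC_zero_left)
  qed
  moreover have "\<exists>v\<in>Z. w - ?\<phi> v \<in> B'" if w: "w \<in> Z'" for w
  proof -
    obtain l where l: "w - (\<Sum>k<n. l k *\<^sub>C c k) \<in> B'" using c(2)[OF w] by blast
    have v: "(\<Sum>k<n. l k *\<^sub>C b k) \<in> Z" by (intro csub_sum[OF Z(1)] csub_scale[OF Z(1)]) (simp add: b)
    have "L (\<Sum>k<n. l k *\<^sub>C b k) k = l k" if "k < n" for k
      by (rule uniq[OF v _ that]) (use csub_zero[OF Z(2)] in simp)
    then have "?\<phi> (\<Sum>k<n. l k *\<^sub>C b k) = (\<Sum>k<n. l k *\<^sub>C c k)" by simp
    then show ?thesis using l v by (intro bexI[of _ "\<Sum>k<n. l k *\<^sub>C b k"]) simp_all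
  qed
  moreover have "?\<phi> ` Z \<subseteq> Z'"
    using c(1) by (auto intro!: csub_sum[OF Z(3)] csub_scale[OF Z(3)])
  ultimately show ?thesis
    unfolding sq_iso_def fst_conv snd_conv
    using csub_zero[OF Z(4)] by (intro exI[of _ ?\<phi>]) simp
qed

text \<open>Linearity is required only modulo the target denominator, so that \<open>\<phi>\<close>
  may be built from arbitrary choices, such as preimages under a connecting homomorphism.\<close>

lemma has_dim_iso:
  assumes Z: "csub Z" "csub B" "csub Z'" "csub B'" and n: "has_dim Z B n"
    and maps: "\<And>v. v \<in> Z \<Longrightarrow> \<phi> v \<in> Z'"
    and add: "\<And>u v. u \<in> Z \<Longrightarrow> v \<in> Z \<Longrightarrow> \<phi> (u + v) - (\<phi> u + \<phi> v) \<in> B'"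
    and scale: "\<And>c v. v \<in> Z \<Longrightarrow> \<phi> (c *\<^sub>C v) - c *\<^sub>C \<phi> v \<in> B'"
    and ker: "\<And>v. v \<in> Z \<Longrightarrow> \<phi> v \<in> B' \<longleftrightarrow> v \<in> B"
    and surj: "\<And>w. w \<in> Z' \<Longrightarrow> \<exists>v\<in>Z. w - \<phi> v \<in> B'"
  shows "has_dim Z' B' n"
proof -
  obtain b where b: "\<And>k. k < n \<Longrightarrow> b k \<in> Z" "\<And>z. z \<in> Z \<Longrightarrow> \<exists>l. z - (\<Sum>k<n. l k *\<^sub>C b k) \<in> B"
    "\<And>l k. (\<Sum>k<n. l k *\<^sub>C b k) \<in> B \<Longrightarrow> k < n \<Longrightarrow> l k = 0" using n by (rule has_dimE) blast
  have sZ: "(\<Sum>k<m. l k *\<^sub>C b k) \<in> Z" if "m \<le> n" for l m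
    by (intro csub_sum[OF Z(1)] csub_scale[OF Z(1)]) (use b(1) that in auto)
  have "\<phi> 0 \<in> B'" using ker[OF csub_zero[OF Z(1)]] csub_zero[OF Z(2)] by simp
  then have sum: "\<phi> (\<Sum>k<m. l k *\<^sub>C b k) - (\<Sum>k<m. l k *\<^sub>C \<phi> (b k)) \<in> B'" if "m \<le> n" for l m
    using that
  proof (induction m)
    case (Suc m)
    let ?s = "\<Sum>k<m. l k *\<^sub>C b k"
    have bZ: "l m *\<^sub>C b m \<in> Z" using Suc.prems b(1) by (intro csub_scale[OF Z(1)]) simp
    have sm: "?s \<in> Z" using Suc.prems by (intro sZ) simp
    have 1: "\<phi> (?s + l m *\<^sub>C b m) - (\<phi> ?s + \<phi> (l m *\<^sub>C b m)) \<in> B'" by (rule add[OF sm bZ])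
    have 2: "\<phi> (l m *\<^sub>C b m) - l m *\<^sub>C \<phi> (b m) \<in> B'" by (rule scale) (use Suc.prems b(1) in simp)
    have 3: "\<phi> ?s - (\<Sum>k<m. l k *\<^sub>C \<phi> (b k)) \<in> B'" using Suc by simp
    have "\<phi> (\<Sum>k<Suc m. l k *\<^sub>C b k) - (\<Sum>k<Suc m. l k *\<^sub>C \<phi> (b k)) =
      (\<phi> (?s + l m *\<^sub>C b m) - (\<phi> ?s + \<phi> (l m *\<^sub>C b m))) + (\<phi> (l m *\<^sub>C b m) - l m *\<^sub>C \<phi> (b m))
        + (\<phi> ?s - (\<Sum>k<m. l k *\<^sub>C \<phi> (b k)))" by simp
    also have "\<dots> \<in> B'" by (rule csub_add[OF Z(4) csub_add[OF Z(4) 1 2] 3])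
    finally show ?case .
  qed simp
  show ?thesis
  proof (rule has_dimI[where b = "\<lambda>k. \<phi> (b k)"])
    show "\<phi> (b k) \<in> Z'" if "k < n" for k using maps b(1) that by blast
    show "\<exists>l. w - (\<Sum>k<n. l k *\<^sub>C \<phi> (b k)) \<in> B'" if w: "w \<in> Z'" for w
    proof -
      obtain v where v: "v \<in> Z" "w - \<phi> v \<in> B'" using surj[OF w] by blast
      obtain l where l: "v - (\<Sum>k<n. l k *\<^sub>C b k) \<in> B" using b(2)[OF v(1)] by blast
      let ?s = "\<Sum>k<n. l k *\<^sub>C b k"
      have s: "?s \<in> Z" by (rule sZ) simp
      have vs: "v - ?s \<in> Z" by (rule csub_diff[OF Z(1) v(1) s])
      have 1: "\<phi> (v - ?s) \<in> B'" using ker[OF vs] l by simp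
      have 2: "\<phi> (v - ?s + ?s) - (\<phi> (v - ?s) + \<phi> ?s) \<in> B'" by (rule add[OF vs s])
      have 3: "\<phi> ?s - (\<Sum>k<n. l k *\<^sub>C \<phi> (b k)) \<in> B'" by (rule sum) simp
      have "w - (\<Sum>k<n. l k *\<^sub>C \<phi> (b k)) = (w - \<phi> v) + (\<phi> (v - ?s + ?s) - (\<phi> (v - ?s) + \<phi> ?s)) + \<phi> (v - ?s)
         + (\<phi> ?s - (\<Sum>k<n. l k *\<^sub>C \<phi> (b k)))" by simp
      also have "\<dots> \<in> B'"
        by (rule csub_add[OF Z(4) csub_add[OF Z(4) csub_add[OF Z(4) v(2) 2] 1] 3])
      finally show ?thesis by (rule exI[of _ l])
    qed
    show "l k = 0" if l: "(\<Sum>k<n. l k *\<^sub>C \<phi> (b k)) \<in> B'" and k: "k < n" for l k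
    proof -
      let ?s = "\<Sum>k<n. l k *\<^sub>C b k"
      have "\<phi> ?s \<in> B'" by (rule csub_cong[OF Z(4) sum[OF order_refl] l])
      then have "?s \<in> B" using ker[OF sZ[OF order_refl]] by simp
      then show ?thesis using b(3) k by blast
    qed
  qed
qed

lemma has_dim_prod:
  assumes "csub Z" "csub B" "csub Z'" "csub B'" "B \<subseteq> Z" "B' \<subseteq> Z'" "has_dim Z B n" "has_dim Z' B' n'"
  shows "has_dim (Z \<times> Z') (B \<times> B') (n + n')"
proof (rule has_dim_extend[where Y = "Z \<times> B'"])
  show "has_dim (Z \<times> Z') (Z \<times> B') n'"
  proof (rule has_dim_iso[where \<phi> = "\<lambda>v. (0, v)", OF assms(3,4) _ _ assms(8)])
    show "\<exists>v\<in>Z'. w - (0, v) \<in> Z \<times> B'" if "w \<in> Z \<times> Z'" for w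
      using that csub_zero[OF assms(4)] by (intro bexI[of _ "snd w"]) (auto simp: prod_eq_iff minus_prod_def)
  qed (use assms csub_zero[OF assms(1)] csub_zero[OF assms(4)] in
      \<open>auto simp: csub_Times scaleC_prod_def scaleC_zero_right minus_prod_def zero_prod_def\<close>)
  show "has_dim (Z \<times> B') (B \<times> B') n"
  proof (rule has_dim_iso[where \<phi> = "\<lambda>v. (v, 0)", OF assms(1,2) _ _ assms(7)])
    show "\<exists>v\<in>Z. w - (v, 0) \<in> B \<times> B'" if "w \<in> Z \<times> B'" for w
      using that csub_zero[OF assms(2)] by (intro bexI[of _ "fst w"]) (auto simp: minus_prod_def)
  qed (use assms csub_zero[OF assms(2)] csub_zero[OF assms(4)] in
      \<open>auto simp: csub_Times scaleC_prod_def scaleC_zero_right minus_prod_def zero_prod_def\<close>)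
qed (use assms in \<open>auto simp: csub_Times\<close>)

section \<open>Bigraded complexes with torsion-free first homology\<close>

text \<open>The abstract form of the complex of a diagram: \<open>dm\<close> and \<open>dc\<close>
  stand for \<open>d_mf\<close> and \<open>d_chi\<close>, \<open>pr i j\<close> projects onto a
  bidegree, \<open>F\<close> is the x-filtration and \<open>hp i\<close> the part of homological
  degree \<open>i\<close>. The shifts 3, 0 and 4 are the polynomial degrees of \<open>dm\<close>,
  \<open>dc\<close> and \<open>a\<close>. Degrees are bounded below uniformly, which later allows
  induction on the degree.\<close>

locale bicomplex =
  fixes C :: "'v::complex_space set" and a dm dc :: "'v \<Rightarrow> 'v"
    and pr :: "int \<Rightarrow> int \<Rightarrow> 'v \<Rightarrow> 'v" and F hp :: "int \<Rightarrow> 'v set"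
  assumes C: "csub C"
    and a_lin: "clin a" and dm_lin: "clin dm" and dc_lin: "clin dc" and pr_lin: "clin (pr i j)"
    and aC: "v \<in> C \<Longrightarrow> a v \<in> C" and dmC: "v \<in> C \<Longrightarrow> dm v \<in> C" and dcC: "v \<in> C \<Longrightarrow> dc v \<in> C"
    and prC: "v \<in> C \<Longrightarrow> pr i j v \<in> C"
    and a_inj: "v \<in> C \<Longrightarrow> a v = 0 \<Longrightarrow> v = 0"
    and dm_dm: "v \<in> C \<Longrightarrow> dm (dm v) = 0" and dc_dc: "v \<in> C \<Longrightarrow> dc (dc v) = 0"
    and dm_dc: "dm (dc v) = dc (dm v)" and dm_a: "dm (a v) = a (dm v)" and dc_a: "dc (a v) = a (dc v)"
    and pr_pr: "pr i j (pr i' j' v) = (if i = i' \<and> j = j' then pr i j v else 0)"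
    and pr_sum: "v \<in> C \<Longrightarrow> \<exists>J. finite J \<and> (\<forall>x. x \<notin> J \<longrightarrow> pr (fst x) (snd x) v = 0) \<and> v = (\<Sum>x\<in>J. pr (fst x) (snd x) v)"
    and pr_bound: "\<exists>j0. \<forall>v\<in>C. \<forall>i. \<forall>j<j0. pr i j v = 0"
    and pr_dm: "dm (pr i j v) = pr i (j + 3) (dm v)"
    and pr_dc: "dc (pr i j v) = pr (i + 1) j (dc v)"
    and pr_a: "a (pr i j v) = pr i (j + 4) (a v)"
    and torsion_free: "tf_fin a C {0} dm"
    and F_sub: "csub (F j)" and F_pr: "v \<in> F j \<Longrightarrow> pr i k v \<in> F j"
    and F_homogeneous: "pr i k v = v \<Longrightarrow> k \<le> j \<Longrightarrow> v \<in> F j"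
    and F_divide: "v \<in> C \<Longrightarrow> pr i k v = v \<Longrightarrow> v \<in> F j \<Longrightarrow> j < k \<Longrightarrow>
      \<exists>u\<in>C. v = a u \<and> u \<in> F j \<and> pr i (k - 4) u = u"
    and hp_sub: "csub (hp i)" and hp_iff: "v \<in> C \<Longrightarrow> v \<in> hp i \<longleftrightarrow> (\<forall>i' k. i' \<noteq> i \<longrightarrow> pr i' k v = 0)"
begin

lemmas lin_simps = clin_add[OF a_lin] clin_add[OF dm_lin] clin_add[OF dc_lin] clin_add[OF pr_lin]
  clin_diff[OF a_lin] clin_diff[OF dm_lin] clin_diff[OF dc_lin] clin_diff[OF pr_lin]
  clin_minus[OF a_lin] clin_minus[OF dm_lin] clin_minus[OF dc_lin] clin_minus[OF pr_lin]
  clin_scale[OF a_lin] clin_scale[OF dm_lin] clin_scale[OF dc_lin] clin_scale[OF pr_lin]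
  clin_zero[OF a_lin] clin_zero[OF dm_lin] clin_zero[OF dc_lin] clin_zero[OF pr_lin]

text \<open>Representatives of cycles and boundaries: \<open>Z / Bm\<close>, \<open>Zp / Bp\<close>, \<open>Zn / Bn\<close> are the homology for \<open>dm\<close> and
  the iterated homologies over \<open>\<complex>[a]\<close> and modulo \<open>a\<close>; \<open>Tz / Bp\<close> is the \<open>a\<close>-torsion annihilated by \<open>a\<close>.\<close>

definition Z where "Z = {z \<in> C. dm z = 0}"
definition Bm where "Bm = dm ` C"
definition Zp where "Zp = {z \<in> Z. dc z \<in> Bm}"
definition Bp where "Bp = {dc y + b | y b. y \<in> Z \<and> b \<in> Bm}"
definition Zn where "Zn = {z \<in> C. dm z \<in> a ` C \<and> (\<exists>b\<in>Bm. \<exists>w\<in>C. dc z = b + a w)}"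
definition Bn where "Bn = {b + a w | b w. b \<in> Bp \<and> w \<in> C}"
definition Tz where "Tz = {z \<in> Zp. a z \<in> Bp}"
definition Ip where "Ip = {a z + b | z b. z \<in> Zp \<and> b \<in> Bp}"
definition It where "It = {a z + t | z t. z \<in> Zp \<and> t \<in> Tz}"
definition G where "G i j = {v. pr i j v = v}"

lemma csub_image:
  assumes f: "clin f" and S: "csub S" shows "csub (f ` S)"
proof (rule csubI)
  show "0 \<in> f ` S" using clin_zero[OF f] csub_zero[OF S] by (metis imageI)
  show "u + v \<in> f ` S" if "u \<in> f ` S" "v \<in> f ` S" for u v
    using that by (elim imageE) (simp add: clin_add[OF f, symmetric] csub_add[OF S])
  show "c *\<^sub>C v \<in> f ` S" if "v \<in> f ` S" for c v
    using that by (elim imageE) (simp add: clin_scale[OF f, symmetric] csub_scale[OF S])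
qed

lemma csub_vimage: "clin f \<Longrightarrow> csub S \<Longrightarrow> csub {v. f v \<in> S}"
  by (rule csubI) (simp_all add: clin_zero clin_add clin_scale csub_zero csub_add csub_scale)

lemma csub_sum_sets: "csub S \<Longrightarrow> csub T \<Longrightarrow> csub {s + t | s t. s \<in> S \<and> t \<in> T}"
proof (rule csubI)
  assume S: "csub S" and T: "csub T"
  show "0 \<in> {s + t | s t. s \<in> S \<and> t \<in> T}"
    using csub_zero[OF S] csub_zero[OF T] by (intro CollectI exI[of _ 0] exI[of _ 0]) simp
  fix u v assume "u \<in> {s + t | s t. s \<in> S \<and> t \<in> T}" "v \<in> {s + t | s t. s \<in> S \<and> t \<in> T}"
  then obtain s t s' t' where "u = s + t" "v = s' + t'" "s \<in> S" "t \<in> T" "s' \<in> S" "t' \<in> T" by blast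
  then show "u + v \<in> {s + t | s t. s \<in> S \<and> t \<in> T}"
    by (intro CollectI exI[of _ "s + s'"] exI[of _ "t + t'"]) (simp add: csub_add[OF S] csub_add[OF T])
next
  fix c v assume S: "csub S" and T: "csub T" and "v \<in> {s + t | s t. s \<in> S \<and> t \<in> T}"
  then obtain s t where "v = s + t" "s \<in> S" "t \<in> T" by blast
  then show "c *\<^sub>C v \<in> {s + t | s t. s \<in> S \<and> t \<in> T}"
    by (intro CollectI exI[of _ "c *\<^sub>C s"] exI[of _ "c *\<^sub>C t"])
      (simp add: csub_scale[OF S] csub_scale[OF T] scaleC_add_right)
qed

lemma Z_sub: "csub Z"
  unfolding Z_def by (rule csubI) (auto simp: csub_zero[OF C] csub_add[OF C] csub_scale[OF C] lin_simps scaleC_zero_right)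

lemma Bm_sub: "csub Bm" unfolding Bm_def by (rule csub_image[OF dm_lin C])

lemma Zp_sub: "csub Zp"
  unfolding Zp_def by (rule csubI)
    (auto simp: csub_zero[OF Z_sub] csub_add[OF Z_sub] csub_scale[OF Z_sub] csub_zero[OF Bm_sub] csub_add[OF Bm_sub] csub_scale[OF Bm_sub] lin_simps)

lemma Bp_sub: "csub Bp"
proof -
  have "Bp = {s + t | s t. s \<in> dc ` Z \<and> t \<in> Bm}" unfolding Bp_def by blast
  then show ?thesis using csub_sum_sets[OF csub_image[OF dc_lin Z_sub] Bm_sub] by simp
qed

lemma aC_sub: "csub (a ` C)" by (rule csub_image[OF a_lin C])

lemma Bn_sub: "csub Bn"
proof -
  have "Bn = {s + t | s t. s \<in> Bp \<and> t \<in> a ` C}" unfolding Bn_def by blast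
  then show ?thesis using csub_sum_sets[OF Bp_sub aC_sub] by simp
qed

lemma Zn_sub: "csub Zn"
proof -
  have "Zn = C \<inter> ({z. dm z \<in> a ` C} \<inter> {z. dc z \<in> {s + t | s t. s \<in> Bm \<and> t \<in> a ` C}})"
    unfolding Zn_def by blast
  then show ?thesis
    by (simp only:) (intro csub_Int C csub_vimage dm_lin dc_lin aC_sub csub_sum_sets Bm_sub)
qed

lemma Tz_sub: "csub Tz"
  unfolding Tz_def by (rule csubI)
    (auto simp: csub_zero[OF Zp_sub] csub_add[OF Zp_sub] csub_scale[OF Zp_sub] csub_zero[OF Bp_sub] csub_add[OF Bp_sub] csub_scale[OF Bp_sub] lin_simps)

lemma aZp_sub: "csub (a ` Zp)" by (rule csub_image[OF a_lin Zp_sub])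

lemma Ip_sub: "csub Ip"
proof -
  have "Ip = {s + t | s t. s \<in> a ` Zp \<and> t \<in> Bp}" unfolding Ip_def by blast
  then show ?thesis using csub_sum_sets[OF aZp_sub Bp_sub] by simp
qed

lemma It_sub: "csub It"
proof -
  have "It = {s + t | s t. s \<in> a ` Zp \<and> t \<in> Tz}" unfolding It_def by blast
  then show ?thesis using csub_sum_sets[OF aZp_sub Tz_sub] by simp
qed

lemma G_sub: "csub (G i j)"
  unfolding G_def by (rule csubI) (auto simp: lin_simps)

lemma Z_C: "z \<in> Z \<Longrightarrow> z \<in> C" by (simp add: Z_def)
lemma Zp_Z: "z \<in> Zp \<Longrightarrow> z \<in> Z" by (simp add: Zp_def)
lemma Zp_C: "z \<in> Zp \<Longrightarrow> z \<in> C" using Z_C Zp_Z by blast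
lemma Bm_Z: "z \<in> Bm \<Longrightarrow> z \<in> Z" by (auto simp: Z_def Bm_def dm_dm dmC)
lemma dcZ: "z \<in> Z \<Longrightarrow> dc z \<in> Z" by (simp add: Z_def dcC dm_dc lin_simps)
lemma dcBm: "z \<in> Bm \<Longrightarrow> dc z \<in> Bm" unfolding Bm_def using dm_dc dcC by (metis imageE imageI)
lemma aZ: "z \<in> Z \<Longrightarrow> a z \<in> Z" by (simp add: Z_def aC dm_a lin_simps)
lemma aBm: "z \<in> Bm \<Longrightarrow> a z \<in> Bm" unfolding Bm_def using dm_a aC by (metis imageE imageI)
lemma aZp: "z \<in> Zp \<Longrightarrow> a z \<in> Zp" by (simp add: Zp_def aZ dc_a aBm)
lemma BmBp: "b \<in> Bm \<Longrightarrow> b \<in> Bp"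
  unfolding Bp_def using csub_zero[OF Z_sub] by (intro CollectI exI[of _ 0] exI[of _ b]) (simp add: lin_simps)
lemma dcBp: "y \<in> Z \<Longrightarrow> dc y \<in> Bp"
  unfolding Bp_def using csub_zero[OF Bm_sub] by (intro CollectI exI[of _ y] exI[of _ 0]) simp
lemma BpI: "y \<in> Z \<Longrightarrow> b \<in> Bm \<Longrightarrow> dc y + b \<in> Bp" unfolding Bp_def by blast
lemma BpE: "x \<in> Bp \<Longrightarrow> (\<And>y b. x = dc y + b \<Longrightarrow> y \<in> Z \<Longrightarrow> b \<in> Bm \<Longrightarrow> P) \<Longrightarrow> P" unfolding Bp_def by blast
lemma BmZp: "b \<in> Bm \<Longrightarrow> b \<in> Zp" by (simp add: Zp_def Bm_Z dcBm)

lemma Bp_Zp: "z \<in> Bp \<Longrightarrow> z \<in> Zp"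
proof (elim BpE)
  fix y b assume *: "z = dc y + b" "y \<in> Z" "b \<in> Bm"
  have "dc y \<in> Zp" using *(2) csub_zero[OF Bm_sub] by (simp add: Zp_def dcZ dc_dc Z_C)
  then show "z \<in> Zp" using * BmZp csub_add[OF Zp_sub] by simp
qed

lemma aBp: "z \<in> Bp \<Longrightarrow> a z \<in> Bp"
proof (elim BpE)
  fix y b assume *: "z = dc y + b" "y \<in> Z" "b \<in> Bm"
  then have "a z = dc (a y) + a b" by (simp add: lin_simps dc_a)
  then show "a z \<in> Bp" using BpI[OF aZ[OF *(2)] aBm[OF *(3)]] by simp
qed

lemma BpTz: "b \<in> Bp \<Longrightarrow> b \<in> Tz" by (simp add: Tz_def Bp_Zp aBp)

lemma Bn_memI: "b \<in> Bp \<Longrightarrow> w \<in> C \<Longrightarrow> b + a w \<in> Bn" unfolding Bn_def by blast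
lemma BpBn: "b \<in> Bp \<Longrightarrow> b \<in> Bn" using Bn_memI[of b 0] csub_zero[OF C] by (simp add: lin_simps)
lemma aCBn: "w \<in> C \<Longrightarrow> a w \<in> Bn" using Bn_memI[of 0 w] csub_zero[OF Bp_sub] by simp

section \<open>The long exact sequence of multiplication by \<open>a\<close>\<close>

lemma torsion_free_Bm: "z \<in> Z \<Longrightarrow> a z \<in> Bm \<Longrightarrow> z \<in> Bm"
  using tf_finD1[OF torsion_free, of z] by (auto simp: Z_def Bm_def)

lemma Z_of_aZ: "z \<in> C \<Longrightarrow> a z \<in> Z \<Longrightarrow> z \<in> Z"
  using a_inj[of "dm z"] by (auto simp: Z_def dm_a dmC)

lemma Zp_of_aZp: "z \<in> Z \<Longrightarrow> dc (a z) \<in> Bm \<Longrightarrow> z \<in> Zp"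
  using torsion_free_Bm[OF dcZ] by (simp add: Zp_def dc_a)

lemma ZnI: "z \<in> C \<Longrightarrow> q \<in> C \<Longrightarrow> dm z = a q \<Longrightarrow> b \<in> Bm \<Longrightarrow> w \<in> C \<Longrightarrow> dc z = b + a w \<Longrightarrow> z \<in> Zn"
  unfolding Zn_def by blast

lemma Zp_Zn: assumes "z \<in> Zp" shows "z \<in> Zn"
proof -
  have "dm z = 0" "dc z \<in> Bm" using assms by (simp_all add: Zp_def Z_def)
  then show ?thesis
    by (intro ZnI[of z 0 "dc z" 0] Zp_C[OF assms] csub_zero[OF C]) (simp_all add: lin_simps)
qed

lemma Bn_Zn: "z \<in> Bn \<Longrightarrow> z \<in> Zn"
proof -
  assume "z \<in> Bn"
  then obtain b w where z: "z = b + a w" "b \<in> Bp" "w \<in> C" unfolding Bn_def by blast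
  have "a w \<in> Zn"
    by (rule ZnI[of _ "dm w" 0 "dc w"]) (simp_all add: z(3) aC dmC dcC dm_a dc_a csub_zero[OF Bm_sub])
  then show "z \<in> Zn" using z Zp_Zn[OF Bp_Zp] csub_add[OF Zn_sub] by simp
qed

lemma Zp_Bn: "z \<in> Zp \<Longrightarrow> z \<in> Bn \<Longrightarrow> \<exists>w\<in>Zp. \<exists>b\<in>Bp. z = a w + b"
proof -
  assume z: "z \<in> Zp" "z \<in> Bn"
  then obtain b w where bw: "z = b + a w" "b \<in> Bp" "w \<in> C" unfolding Bn_def by blast
  have "a w = z - b" using bw by simp
  then have "a w \<in> Zp" using csub_diff[OF Zp_sub z(1) Bp_Zp[OF bw(2)]] by simp
  then have "w \<in> Zp" using Zp_of_aZp[OF Z_of_aZ[OF bw(3)]] by (simp add: Zp_def)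
  then show ?thesis using bw by (intro bexI[of _ w] bexI[of _ b]) (simp_all add: add.commute)
qed

text \<open>If \<open>dm z = a q\<close>, then \<open>a q\<close> is a boundary and absence of
  torsion gives \<open>q = dm u\<close>, so \<open>z - a u\<close> is a true cycle. Thus homology
  classes for \<open>dm\<close> modulo \<open>a\<close> lift, and \<open>w\<close> represents the
  connecting homomorphism on \<open>z\<close>.\<close>

lemma Zn_decompose: "z \<in> Zn \<Longrightarrow> \<exists>y\<in>Z. \<exists>w\<in>Zp. \<exists>u\<in>C. z = y + a u \<and> dc y - a w \<in> Bm"
proof -
  assume "z \<in> Zn"
  then obtain q b w where *: "z \<in> C" "dm z = a q" "q \<in> C" "dc z = b + a w" "b \<in> Bm" "w \<in> C"
    unfolding Zn_def by blast
  have "a (dm q) = 0" using dm_dm[OF *(1)] by (simp add: *(2) dm_a)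
  then have qZ: "q \<in> Z" using a_inj[OF dmC[OF *(3)]] *(3) by (simp add: Z_def)
  have "a q \<in> Bm" using *(1,2) by (metis Bm_def imageI)
  then have "q \<in> Bm" by (rule torsion_free_Bm[OF qZ])
  then obtain u where u: "u \<in> C" "q = dm u" by (auto simp: Bm_def)
  define y where "y = z - a u"
  have yZ: "y \<in> Z" using * u by (simp add: y_def Z_def csub_diff[OF C] aC lin_simps dm_a)
  have dcy: "dc y - a (w - dc u) = b" by (simp add: y_def lin_simps dc_a *(4))
  have wC: "w - dc u \<in> C" by (rule csub_diff[OF C *(6) dcC[OF u(1)]])
  have "a (w - dc u) = dc y - b" using dcy by (simp add: algebra_simps)
  then have "a (w - dc u) \<in> Z" using csub_diff[OF Z_sub dcZ[OF yZ] Bm_Z[OF *(5)]] by simp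
  then have wZ: "w - dc u \<in> Z" by (rule Z_of_aZ[OF wC])
  have "dc (a (w - dc u)) = - dc b" unfolding \<open>a (w - dc u) = dc y - b\<close>
    using dc_dc[OF Z_C[OF yZ]] by (simp add: lin_simps)
  then have "dc (a (w - dc u)) \<in> Bm" using csub_minus[OF Bm_sub dcBm[OF *(5)]] by simp
  then have "w - dc u \<in> Zp" by (rule Zp_of_aZp[OF wZ])
  then show ?thesis using yZ u(1) dcy *(5)
    by (intro bexI[of _ y] bexI[of _ "w - dc u"] bexI[of _ u]) (simp_all add: y_def)
qed

text \<open>Exactness at the homology modulo \<open>a\<close>: if \<open>w\<close> bounds
  \<open>p\<close>, then \<open>y - a p\<close> is a cycle for \<open>dc\<close> in the homology of
  \<open>dm\<close>.\<close>

lemma connecting_zero: "y \<in> Z \<Longrightarrow> w \<in> Bp \<Longrightarrow> dc y - a w \<in> Bm \<Longrightarrow> \<exists>z\<in>Zp. \<exists>u\<in>C. y = z + a u"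
proof -
  assume y: "y \<in> Z" and w: "w \<in> Bp" and d: "dc y - a w \<in> Bm"
  obtain p b where p: "w = dc p + b" "p \<in> Z" "b \<in> Bm" using w by (rule BpE)
  have zZ: "y - a p \<in> Z" by (rule csub_diff[OF Z_sub y aZ[OF p(2)]])
  have "dc (y - a p) = (dc y - a w) + a b" by (simp add: lin_simps dc_a p(1))
  then have "y - a p \<in> Zp" using zZ csub_add[OF Bm_sub d aBm[OF p(3)]] by (simp add: Zp_def)
  then show ?thesis using Z_C[OF p(2)] by (intro bexI[of _ "y - a p"] bexI[of _ p]) simp_all
qed

lemma connecting_surj: "a w \<in> Bp \<Longrightarrow> \<exists>y\<in>Z. dc y - a w \<in> Bm"
proof -
  assume "a w \<in> Bp"
  then obtain y b where "a w = dc y + b" "y \<in> Z" "b \<in> Bm" by (rule BpE)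
  then show ?thesis using csub_minus[OF Bm_sub] by (intro bexI[of _ y]) simp_all
qed

text \<open>Writing \<open>y\<close> as a boundary plus \<open>a u\<close>, the difference
  \<open>dc u - w\<close> becomes a \<open>dm\<close>-boundary after multiplication by
  \<open>a\<close>, hence is one itself.\<close>

lemma connecting_well_defined: "y \<in> Z \<Longrightarrow> y \<in> Bn \<Longrightarrow> w \<in> Z \<Longrightarrow> dc y - a w \<in> Bm \<Longrightarrow> w \<in> Bp"
proof -
  assume y: "y \<in> Z" "y \<in> Bn" and w: "w \<in> Z" and d: "dc y - a w \<in> Bm"
  obtain b u where bu: "y = b + a u" "b \<in> Bp" "u \<in> C" using y(2) unfolding Bn_def by blast
  have "a u = y - b" using bu by simp
  then have "a u \<in> Z" using csub_diff[OF Z_sub y(1) Zp_Z[OF Bp_Zp[OF bu(2)]]] by simp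
  then have uZ: "u \<in> Z" by (rule Z_of_aZ[OF bu(3)])
  have db: "dc b \<in> Bm" using Bp_Zp[OF bu(2)] by (simp add: Zp_def)
  have "a (dc u - w) = (dc y - a w) - dc b" by (simp add: bu(1) lin_simps dc_a)
  then have "a (dc u - w) \<in> Bm" using csub_diff[OF Bm_sub d db] by simp
  then have "dc u - w \<in> Bm" by (rule torsion_free_Bm[OF csub_diff[OF Z_sub dcZ[OF uZ] w]])
  then have "dc u - (dc u - w) \<in> Bp" by (intro csub_diff[OF Bp_sub] dcBp uZ BmBp)
  then show ?thesis by simp
qed

lemma connecting_Zn: "y \<in> Z \<Longrightarrow> w \<in> C \<Longrightarrow> dc y - a w \<in> Bm \<Longrightarrow> y \<in> Zn"
  by (rule ZnI[of y 0 "dc y - a w" w]) (simp_all add: csub_zero[OF C] lin_simps Z_def)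

subsection \<open>Homogeneous components\<close>

definition graded :: "'v set \<Rightarrow> bool"
  where "graded S \<longleftrightarrow> (\<forall>i j. \<forall>v\<in>S. pr i j v \<in> S)"

lemma gradedD: "graded S \<Longrightarrow> v \<in> S \<Longrightarrow> pr i j v \<in> S" by (simp add: graded_def)

lemma graded_sum_sets: "graded S \<Longrightarrow> graded T \<Longrightarrow> graded {s + t | s t. s \<in> S \<and> t \<in> T}"
  unfolding graded_def by (auto simp: lin_simps) blast

lemma pr_dm': "pr i j (dm v) = dm (pr i (j - 3) v)" by (simp add: pr_dm)
lemma pr_dc': "pr i j (dc v) = dc (pr (i - 1) j v)" by (simp add: pr_dc)
lemma pr_a': "pr i j (a v) = a (pr i (j - 4) v)" by (simp add: pr_a)

lemma graded_Z: "graded Z" by (simp add: graded_def Z_def prC pr_dm lin_simps)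
lemma graded_Bm: "graded Bm" by (auto simp: graded_def Bm_def pr_dm' prC)
lemma graded_Zp: "graded Zp"
  using graded_Z graded_Bm by (simp add: graded_def Zp_def pr_dc)
lemma graded_aC: "graded (a ` C)" by (auto simp: graded_def pr_a' prC)
lemma graded_aZp: "graded (a ` Zp)" using graded_Zp by (auto simp: graded_def pr_a')
lemma graded_Bp: "graded Bp"
proof -
  have "graded (dc ` Z)" using graded_Z by (auto simp: graded_def pr_dc')
  moreover have "Bp = {s + t | s t. s \<in> dc ` Z \<and> t \<in> Bm}" unfolding Bp_def by blast
  ultimately show ?thesis using graded_sum_sets[OF _ graded_Bm] by simp
qed
lemma graded_Bn: "graded Bn"
proof -
  have "Bn = {s + t | s t. s \<in> Bp \<and> t \<in> a ` C}" unfolding Bn_def by blast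
  then show ?thesis using graded_sum_sets[OF graded_Bp graded_aC] by simp
qed
lemma graded_Tz: "graded Tz"
  using graded_Zp graded_Bp by (simp add: graded_def Tz_def pr_a)

lemma G_pr: "pr i j v \<in> G i j" by (simp add: G_def pr_pr)
lemma GD: "v \<in> G i j \<Longrightarrow> pr i j v = v" by (simp add: G_def)
lemma G_a: "v \<in> G i j \<Longrightarrow> a v \<in> G i (j + 4)" by (simp add: G_def pr_a[symmetric])
lemma G_other: "v \<in> G i j \<Longrightarrow> (i', j') \<noteq> (i, j) \<Longrightarrow> pr i' j' v = 0"
  using pr_pr[of i' j' i j v] by (auto simp: G_def)

lemma mem_by_components:
  assumes "csub S" "v \<in> C" "\<And>i j. pr i j v \<in> S" shows "v \<in> S"
proof -
  obtain J where "v = (\<Sum>x\<in>J. pr (fst x) (snd x) v)" using pr_sum[OF assms(2)] by blast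
  then show ?thesis using csub_sum[OF assms(1), of J "\<lambda>x. pr (fst x) (snd x) v"] assms(3) by simp
qed

lemma component_vanishes: "v \<in> C \<Longrightarrow> \<exists>n. \<forall>j\<ge>n. pr i j v = 0"
proof -
  assume "v \<in> C"
  then obtain J where J: "finite J" "\<And>x. x \<notin> J \<Longrightarrow> pr (fst x) (snd x) v = 0" using pr_sum by blast
  define n where "n = Max (insert 0 (snd ` J)) + 1"
  have n: "snd x < n" if "x \<in> J" for x
    using Max_ge[of "insert 0 (snd ` J)" "snd x"] J(1) that by (simp add: n_def)
  have "pr i j v = 0" if "j \<ge> n" for j
    using J(2)[of "(i, j)"] n[of "(i, j)"] that by fastforce
  then show ?thesis by blast
qed

section \<open>Powers of \<open>a\<close>, and comparison with the specialization at 1\<close>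

lemma apow_lin: "clin ((a ^^ n))"
proof (induction n)
  case (Suc n)
  then show ?case using a_lin by (auto simp: clin_def)
qed (auto intro: clinI)

lemma apow_C: "v \<in> C \<Longrightarrow> (a ^^ n) v \<in> C"
  and apow_Z: "v \<in> Z \<Longrightarrow> (a ^^ n) v \<in> Z"
  and apow_Zp: "v \<in> Zp \<Longrightarrow> (a ^^ n) v \<in> Zp"
  and apow_Bp: "v \<in> Bp \<Longrightarrow> (a ^^ n) v \<in> Bp"
  by (induction n) (simp_all add: aC aZ aZp aBp)

lemma apow_G: "v \<in> G i j \<Longrightarrow> (a ^^ n) v \<in> G i (j + 4 * int n)"
proof (induction n)
  case (Suc n)
  then show ?case using G_a[of "(a ^^ n) v" i "j + 4 * int n"] by (simp add: algebra_simps)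
qed simp

lemma apow_inj: "v \<in> C \<Longrightarrow> (a ^^ n) v = 0 \<Longrightarrow> v = 0"
  by (induction n) (auto dest: a_inj[OF apow_C])

lemma apow_Bm: "v \<in> Z \<Longrightarrow> (a ^^ n) v \<in> Bm \<Longrightarrow> v \<in> Bm"
  by (induction n) (auto dest: torsion_free_Bm[OF apow_Z])

text \<open>
  In degrees congruent to \<open>j\<close> modulo 4, an element of \<open>B + (a - 1) C\<close> whose only component outside \<open>B\<close> is the one of
  degree \<open>j\<close>: the components of \<open>c\<close> lie in \<open>B\<close> below \<open>j\<close>, and from \<open>j\<close> on they are \<open>- a\<^sup>n x\<close> modulo \<open>B\<close>.
\<close>

lemma shift_component:
  assumes B: "csub B" "graded B" "\<And>v. v \<in> B \<Longrightarrow> a v \<in> B" "B \<subseteq> C"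
    and x: "x - (a c - c) \<in> B" "c \<in> C" "\<And>l. l \<noteq> 0 \<Longrightarrow> pr i (j + 4 * l) x \<in> B"
  shows "\<exists>n. (a ^^ n) (pr i j x) \<in> B" and "(\<And>l. pr i (j + 4 * l) x \<in> B) \<Longrightarrow> pr i (j + 4 * l) c \<in> B"
proof -
  let ?c = "\<lambda>l. pr i (j + 4 * l) c"
  \<comment> \<open>The component of each degree of \<open>x = a c - c\<close> relates neighbouring
    components of \<open>c\<close> in the same residue class modulo 4.\<close>
  have rec: "pr i (j + 4 * l) x - (a (?c (l - 1)) - ?c l) \<in> B" for l
  proof -
    have "pr i (j + 4 * l) (x - (a c - c)) \<in> B" by (rule gradedD[OF B(2) x(1)])
    then show ?thesis by (simp add: lin_simps pr_a' algebra_simps)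
  qed
  obtain j0 where j0: "\<And>v i j. v \<in> C \<Longrightarrow> j < j0 \<Longrightarrow> pr i j v = 0" using pr_bound by blast
  have low: "?c (int n + l0) \<in> B" if h: "\<And>l. l < L \<Longrightarrow> pr i (j + 4 * l) x \<in> B" and l0: "j + 4 * l0 < j0" and L: "int n + l0 < L" for n l0 L
    using L
  proof (induction n)
    case 0
    then show ?case using j0[OF x(2) l0] csub_zero[OF B(1)] by simp
  next
    case (Suc n)
    have 1: "a (?c (int n + l0)) \<in> B" by (rule B(3)) (use Suc in simp)
    have 2: "pr i (j + 4 * (int n + l0 + 1)) x - (a (?c (int n + l0)) - ?c (int n + l0 + 1)) \<in> B"
      using rec[of "int n + l0 + 1"] by simp
    have 3: "pr i (j + 4 * (int n + l0 + 1)) x \<in> B" by (rule h) (use Suc.prems in simp)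
    have "?c (int n + l0 + 1) = (pr i (j + 4 * (int n + l0 + 1)) x - (a (?c (int n + l0)) - ?c (int n + l0 + 1)))
      - pr i (j + 4 * (int n + l0 + 1)) x + a (?c (int n + l0))" by simp
    also have "\<dots> \<in> B" by (rule csub_add[OF B(1) csub_diff[OF B(1) 2 3] 1])
    finally show ?case by (simp add: algebra_simps)
  qed
  have below: "?c l \<in> B" if h: "\<And>l'. l' \<le> l \<Longrightarrow> pr i (j + 4 * l') x \<in> B" for l
  proof -
    \<comment> \<open>A starting index at most \<open>l\<close> whose degree lies below the bound
      \<open>j0\<close>, where \<open>c\<close> has no components; from there the recursion climbs
      to \<open>l\<close>.\<close>
    define l0 where "l0 = min l ((j0 - j) div 4 - 1)"
    have "4 * ((j0 - j) div 4) \<le> j0 - j" by presburger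
    moreover have "l0 \<le> (j0 - j) div 4 - 1" by (simp add: l0_def)
    ultimately have "j + 4 * l0 < j0" by linarith
    moreover have "l = int (nat (l - l0)) + l0" by (simp add: l0_def)
    ultimately show ?thesis using low[of "l + 1" l0 "nat (l - l0)"] h by simp
  qed
  show "?c l \<in> B" if "\<And>l. pr i (j + 4 * l) x \<in> B" by (rule below[OF that])
  have c_neg: "?c (- 1) \<in> B" by (rule below) (use x(3) in force)
  \<comment> \<open>Beyond degree \<open>j\<close> the components of \<open>x\<close> lie in
    \<open>B\<close>, so multiplication by \<open>a\<close> carries the congruence between
    \<open>c\<close> and \<open>- x\<close> upwards.\<close>
  have up: "?c (int n) + (a ^^ n) (pr i j x) \<in> B" for n
  proof (induction n)
    case 0
    have "?c 0 + pr i j x = (pr i (j + 4 * 0) x - (a (?c (0 - 1)) - ?c 0)) + a (?c (- 1))" by simp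
    also have "\<dots> \<in> B" by (rule csub_add[OF B(1) rec B(3)[OF c_neg]])
    finally show ?case by simp
  next
    case (Suc n)
    have 1: "pr i (j + 4 * (int n + 1)) x - (a (?c (int n)) - ?c (int n + 1)) \<in> B" using rec[of "int n + 1"] by simp
    have 2: "pr i (j + 4 * (int n + 1)) x \<in> B" by (rule x(3)) simp
    have "?c (int n + 1) + (a ^^ Suc n) (pr i j x) = (pr i (j + 4 * (int n + 1)) x - (a (?c (int n)) - ?c (int n + 1)))
       - pr i (j + 4 * (int n + 1)) x + a (?c (int n) + (a ^^ n) (pr i j x))" by (simp add: lin_simps)
    also have "\<dots> \<in> B" by (rule csub_add[OF B(1) csub_diff[OF B(1) 1 2] B(3)[OF Suc]])
    finally show ?case by (simp add: add.commute)
  qed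
  \<comment> \<open>\<open>c\<close> has only finitely many components, so far enough up only
    \<open>a^n\<close> times the component of \<open>x\<close> is left.\<close>
  obtain N where N: "\<And>k. k \<ge> N \<Longrightarrow> pr i k c = 0" using component_vanishes[OF x(2)] by blast
  have "?c (int (nat (N - j))) = 0" by (rule N) (cases "N \<le> j"; simp)
  then show "\<exists>n. (a ^^ n) (pr i j x) \<in> B" using up[of "nat (N - j)"] by auto
qed

text \<open>The case \<open>x = a c - c\<close>: all components of \<open>x\<close> lie in
  \<open>B\<close>, hence those of \<open>c\<close> do.\<close>

lemma shift_injective:
  assumes B: "csub B" "graded B" "\<And>v. v \<in> B \<Longrightarrow> a v \<in> B" "B \<subseteq> C" and c: "c \<in> C" "a c - c \<in> B"
  shows "c \<in> B"
proof (rule mem_by_components[OF B(1) c(1)])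
  fix i j
  have "(a c - c) - (a c - c) \<in> B" using csub_zero[OF B(1)] by simp
  from shift_component(2)[OF B this c(1), of i j 0] gradedD[OF B(2) c(2)] show "pr i j c \<in> B" by simp
qed

end

section \<open>Torsion, multiples of \<open>a\<close> and finite dimension modulo
  \<open>a\<close>\<close>

context bicomplex
begin

lemma Ip_Zp: "z \<in> Ip \<Longrightarrow> z \<in> Zp"
  unfolding Ip_def using csub_add[OF Zp_sub] aZp Bp_Zp by blast

lemma It_Zp: "z \<in> It \<Longrightarrow> z \<in> Zp"
  unfolding It_def Tz_def using csub_add[OF Zp_sub] aZp by blast

lemma Ip_It: "z \<in> Ip \<Longrightarrow> z \<in> It"
  unfolding Ip_def It_def using BpTz by blast

lemma ItI: "z \<in> Zp \<Longrightarrow> t \<in> Tz \<Longrightarrow> a z + t \<in> It" unfolding It_def by blast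
lemma IpI: "z \<in> Zp \<Longrightarrow> b \<in> Bp \<Longrightarrow> a z + b \<in> Ip" unfolding Ip_def by blast
lemma Tz_It: "t \<in> Tz \<Longrightarrow> t \<in> It" using ItI[OF csub_zero[OF Zp_sub], of t] by (simp add: lin_simps)
lemma Tz_Zp: "t \<in> Tz \<Longrightarrow> t \<in> Zp" by (simp add: Tz_def)

lemma Zp_Bn_iff: "z \<in> Zp \<Longrightarrow> z \<in> Bn \<longleftrightarrow> z \<in> Ip"
proof
  assume z: "z \<in> Zp" "z \<in> Bn"
  then obtain w b where "w \<in> Zp" "b \<in> Bp" "z = a w + b" using Zp_Bn by blast
  then show "z \<in> Ip" using IpI by simp
next
  assume "z \<in> Zp" "z \<in> Ip"
  then obtain w b where "z = a w + b" "w \<in> Zp" "b \<in> Bp" unfolding Ip_def by blast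
  then show "z \<in> Bn" using Bn_memI[of b w] Zp_C by (simp add: add.commute)
qed

lemma It_homogeneous:
  assumes "z \<in> It" "z \<in> G i j"
  obtains w t where "w \<in> Zp" "w \<in> G i (j - 4)" "t \<in> Tz" "t \<in> G i j" "z = a w + t"
proof -
  obtain w t where w: "z = a w + t" "w \<in> Zp" "t \<in> Tz" using assms(1) unfolding It_def by blast
  have "z = a (pr i (j - 4) w) + pr i j t" using GD[OF assms(2)] by (simp add: w(1) lin_simps pr_a')
  with that[of "pr i (j - 4) w" "pr i j t"] show thesis
    using gradedD[OF graded_Zp w(2)] gradedD[OF graded_Tz w(3)] G_pr by blast
qed

text \<open>By \<open>Zn_decompose\<close> every cycle modulo \<open>a\<close> is a
  \<open>dm\<close>-cycle up to multiples of \<open>a\<close>, so the finitely many generators from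
  \<open>tf_fin\<close> span. They need not be cycles for \<open>dc\<close>.\<close>

lemma Zn_span: "\<exists>(n::nat) f. (\<forall>k<n. f k \<in> C) \<and> (\<forall>z\<in>Zn. \<exists>l. z - (\<Sum>k<n. l k *\<^sub>C f k) \<in> Bn)"
proof -
  obtain n and f :: "nat \<Rightarrow> 'v" where f: "\<And>k. k < n \<Longrightarrow> f k \<in> C"
      "\<And>v. v \<in> C \<Longrightarrow> dm v \<in> {0} \<Longrightarrow> \<exists>l. \<exists>u\<in>C. \<exists>w\<in>C. dm u \<in> {0} \<and>
        v - ((\<Sum>k<n. l k *\<^sub>C f k) + a u + dm w) \<in> {0}"
    using tf_finD2[OF torsion_free] by metis
  have "\<exists>l. z - (\<Sum>k<n. l k *\<^sub>C f k) \<in> Bn" if z: "z \<in> Zn" for z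
  proof -
    obtain y u0 where y: "y \<in> Z" "u0 \<in> C" "z = y + a u0" using Zn_decompose[OF z] by blast
    obtain l u w where l: "u \<in> C" "w \<in> C" "y - ((\<Sum>k<n. l k *\<^sub>C f k) + a u + dm w) = 0"
      using f(2)[of y] y(1) by (auto simp: Z_def)
    have "y = (\<Sum>k<n. l k *\<^sub>C f k) + a u + dm w" using l(3) by simp
    then have "z - (\<Sum>k<n. l k *\<^sub>C f k) = dm w + a (u + u0)" by (simp add: y(3) lin_simps)
    also have "\<dots> \<in> Bn"
      by (rule Bn_memI[OF BmBp csub_add[OF C l(1) y(2)]]) (simp add: Bm_def l(2))
    finally show ?thesis by blast
  qed
  then show ?thesis using f(1) by blast
qed

lemma homogeneous_span:
  assumes l: "z - (\<Sum>k<n::nat. l k *\<^sub>C f k) \<in> Bn" and z: "z \<in> G i j"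
  shows "z - (\<Sum>k<n. l k *\<^sub>C pr i j (f k)) \<in> Bn \<inter> G i j"
proof -
  have "pr i j (z - (\<Sum>k<n. l k *\<^sub>C f k)) = z - (\<Sum>k<n. l k *\<^sub>C pr i j (f k))"
    by (simp add: lin_simps GD[OF z] clin_sum[OF pr_lin])
  then show ?thesis using gradedD[OF graded_Bn l, of i j] G_pr[of i j "z - (\<Sum>k<n. l k *\<^sub>C f k)"] by simp
qed

lemma has_dim_homogeneous:
  assumes "csub S" "S \<subseteq> Zn"
  shows "\<exists>n. has_dim (S \<inter> G i j) (S \<inter> Bn \<inter> G i j) n"
proof -
  obtain n :: nat and f where f: "\<And>z. z \<in> Zn \<Longrightarrow> \<exists>l. z - (\<Sum>k<n. l k *\<^sub>C f k) \<in> Bn" using Zn_span by blast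
  have "\<exists>l. z - (\<Sum>k<n. l k *\<^sub>C pr i j (f k)) \<in> Bn \<inter> G i j" if "z \<in> S \<inter> G i j" for z
    using f[of z] homogeneous_span[where z = z and f = f and i = i and j = j] assms(2) that by blast
  then have "\<exists>n. has_dim (S \<inter> G i j) ((S \<inter> G i j) \<inter> (Bn \<inter> G i j)) n"
    by (rule has_dim_exists[OF csub_Int[OF assms(1) G_sub] csub_Int[OF Bn_sub G_sub]])
  moreover have "(S \<inter> G i j) \<inter> (Bn \<inter> G i j) = S \<inter> Bn \<inter> G i j" by blast
  ultimately show ?thesis by simp
qed

text \<open>A bidegree with nonzero homology must occur as a component of one of the finitely many
  spanning chains.\<close>

lemma finite_homology_support: "finite {(i, j). \<not> Zn \<inter> G i j \<subseteq> Bn}"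
proof -
  have fin: "finite {x. pr (fst x) (snd x) v \<noteq> 0}" if v: "v \<in> C" for v
  proof -
    obtain J where "finite J" "\<forall>x. x \<notin> J \<longrightarrow> pr (fst x) (snd x) v = 0" using pr_sum[OF v] by blast
    moreover from this have "{x. pr (fst x) (snd x) v \<noteq> 0} \<subseteq> J" by blast
    ultimately show ?thesis using finite_subset by blast
  qed
  obtain n :: nat and f where f: "\<And>k. k < n \<Longrightarrow> f k \<in> C" "\<And>z. z \<in> Zn \<Longrightarrow> \<exists>l. z - (\<Sum>k<n. l k *\<^sub>C f k) \<in> Bn"
    using Zn_span by blast
  have "{(i, j). \<not> Zn \<inter> G i j \<subseteq> Bn} \<subseteq> (\<Union>k<n. {x. pr (fst x) (snd x) (f k) \<noteq> 0})"
  proof (rule subsetI)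
    fix x assume "x \<in> {(i, j). \<not> Zn \<inter> G i j \<subseteq> Bn}"
    then obtain i j z where x: "x = (i, j)" and z: "z \<in> Zn" "z \<in> G i j" "z \<notin> Bn" by blast
    obtain l where "z - (\<Sum>k<n. l k *\<^sub>C f k) \<in> Bn" using f(2)[OF z(1)] by blast
    from homogeneous_span[OF this z(2)] have "(\<Sum>k<n. l k *\<^sub>C pr i j (f k)) \<noteq> 0" using z(3) by auto
    then have "\<exists>k\<in>{..<n}. l k *\<^sub>C pr i j (f k) \<noteq> 0" by (meson sum.not_neutral_contains_not_neutral)
    then obtain k where "k < n" "pr i j (f k) \<noteq> 0" by (metis lessThan_iff scaleC_zero_right)
    then show "x \<in> (\<Union>k<n. {x. pr (fst x) (snd x) (f k) \<noteq> 0})" by (auto simp: x)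
  qed
  moreover have "finite (\<Union>k<n. {x. pr (fst x) (snd x) (f k) \<noteq> 0})" using fin f(1) by simp
  ultimately show ?thesis by (rule finite_subset)
qed

end

text \<open>The number 6 is twice the bound on \<open>lht_N\<close>. Torsion of order
  \<open>a^2\<close> would produce a difference of at least 8.\<close>

locale thin_bicomplex = bicomplex C a dm dc pr F hp
  for C :: "'v::complex_space set" and a dm dc pr F hp +
  assumes thin: "z \<in> Zn \<Longrightarrow> z \<in> G i j \<Longrightarrow> z \<notin> Bn \<Longrightarrow> z' \<in> Zn \<Longrightarrow> z' \<in> G (i + 1) j' \<Longrightarrow> z' \<notin> Bn \<Longrightarrow> j - j' \<le> 6"
begin

text \<open>
  If \<open>\<alpha> = a\<^sup>k z\<close> is not a boundary but \<open>a \<alpha>\<close> is, then \<open>\<alpha>\<close> comes from a class modulo \<open>a\<close> of degree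
  \<open>deg z + 4 k + 4\<close>; dividing \<open>z\<close> by \<open>a\<close> as often as possible gives a class modulo \<open>a\<close> of degree at most
  \<open>deg z\<close>. So thinness forces \<open>k = 0\<close>.
\<close>

lemma torsion_homogeneous:
  assumes "z \<in> Zp" "z \<in> G i s" "(a ^^ Suc k) z \<in> Bp" "k \<ge> 1"
  shows "(a ^^ k) z \<in> Bp"
proof -
  obtain j0 where j0: "\<And>v i j. v \<in> C \<Longrightarrow> j < j0 \<Longrightarrow> pr i j v = 0" using pr_bound by blast
  show ?thesis
    using assms
  \<comment> \<open>The summand 4 keeps the measure decreasing when \<open>s - 4\<close> falls below
    \<open>j0\<close>, where all components vanish.\<close>
  proof (induction "nat (s - j0 + 4)" arbitrary: s z k rule: less_induct)
    case less
    show ?case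
    proof (cases "s < j0")
      case True
      then have "z = 0" using j0[OF Zp_C[OF less.prems(1)]] GD[OF less.prems(2)] by simp
      then show ?thesis using csub_zero[OF Bp_sub] clin_zero[OF apow_lin] by simp
    next
      case False
      show ?thesis
      proof (rule ccontr)
        assume nb: "(a ^^ k) z \<notin> Bp"
        let ?b = "(a ^^ k) z"
        have bG: "?b \<in> G i (s + 4 * int k)" by (rule apow_G[OF less.prems(2)])
        have "a ?b \<in> Bp" using less.prems(3) by simp
        then obtain y0 where y0: "y0 \<in> Z" "dc y0 - a ?b \<in> Bm" using connecting_surj by blast
        \<comment> \<open>The component of \<open>y0\<close> in the only bidegree that
          \<open>dc\<close> can map to that of \<open>a ?b\<close>.\<close>
        define y where "y = pr (i - 1) (s + 4 * int k + 4) y0"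
        have yZ: "y \<in> Z" unfolding y_def by (rule gradedD[OF graded_Z y0(1)])
        have yG: "y \<in> G (i - 1) (s + 4 * int k + 4)" unfolding y_def by (rule G_pr)
        have "dc y - a ?b = pr i (s + 4 * int k + 4) (dc y0 - a ?b)"
          using GD[OF G_a[OF bG]] by (simp add: y_def lin_simps pr_dc')
        then have d: "dc y - a ?b \<in> Bm" using gradedD[OF graded_Bm y0(2)] by simp
        have bZ: "?b \<in> Z" by (rule Zp_Z[OF apow_Zp[OF less.prems(1)]])
        have yn: "y \<in> Zn" by (rule connecting_Zn[OF yZ Z_C[OF bZ] d])
        have yb: "y \<notin> Bn" using connecting_well_defined[OF yZ _ bZ d] nb by blast
        show False
        proof (cases "z \<in> Bn")
          case False
          have "z \<in> G (i - 1 + 1) s" using less.prems(2) by simp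
          \<comment> \<open>The degrees of \<open>y\<close> and \<open>z\<close> differ by
            \<open>4 k + 4\<close>, which is at least 8 because \<open>k \<ge> 1\<close>.\<close>
          from thin[OF yn yG yb Zp_Zn[OF less.prems(1)] this False] less.prems(4) show False by simp
        next
          case True
          \<comment> \<open>\<open>z\<close> vanishes modulo \<open>a\<close>, so up to boundaries
            it is \<open>a w\<close>; the induction hypothesis for \<open>w\<close>, of degree
            \<open>s - 4\<close>, is used with exponent \<open>k + 1\<close>.\<close>
          then obtain w b where w: "w \<in> Zp" "b \<in> Bp" "z = a w + b" using Zp_Bn[OF less.prems(1)] by blast
          let ?w = "pr i (s - 4) w" and ?b = "pr i s b"
          have wZ: "?w \<in> Zp" by (rule gradedD[OF graded_Zp w(1)])
          have bB: "?b \<in> Bp" by (rule gradedD[OF graded_Bp w(2)])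
          have z: "z = a ?w + ?b" using GD[OF less.prems(2)] by (simp add: w(3) lin_simps pr_a')
          have pow: "(a ^^ n) z = (a ^^ Suc n) ?w + (a ^^ n) ?b" for n
            by (subst z) (simp add: clin_add[OF apow_lin] funpow_swap1)
          have "(a ^^ Suc (Suc k)) ?w = (a ^^ Suc k) z - (a ^^ Suc k) ?b" unfolding pow[of "Suc k"] by simp
          then have "(a ^^ Suc (Suc k)) ?w \<in> Bp" using csub_diff[OF Bp_sub less.prems(3) apow_Bp[OF bB, of "Suc k"]] by (simp only:)
          then have "(a ^^ Suc k) ?w \<in> Bp"
            using less.hyps[OF _ wZ G_pr, of "Suc k"] False less.prems(4) by simp
          then have "(a ^^ k) z \<in> Bp" unfolding pow by (rule csub_add[OF Bp_sub _ apow_Bp[OF bB]])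
          then show False using nb by simp
        qed
      qed
    qed
  qed
qed

text \<open>The case \<open>k = 1\<close> of \<open>torsion_homogeneous\<close>, applied to each
  component.\<close>

lemma torsion_twice: "z \<in> Zp \<Longrightarrow> a (a z) \<in> Bp \<Longrightarrow> a z \<in> Bp"
proof -
  assume z: "z \<in> Zp" "a (a z) \<in> Bp"
  show "a z \<in> Bp"
  proof (rule mem_by_components[OF Bp_sub aC[OF Zp_C[OF z(1)]]])
    fix i j
    have "a (a (pr i (j - 4) z)) = pr i (j + 4) (a (a z))" by (simp add: pr_a)
    then have "a (a (pr i (j - 4) z)) \<in> Bp" using gradedD[OF graded_Bp z(2)] by simp
    then have "a (pr i (j - 4) z) \<in> Bp"
      using torsion_homogeneous[where k = 1, OF gradedD[OF graded_Zp z(1)] G_pr] by simp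
    then show "pr i j (a z) \<in> Bp" by (simp add: pr_a)
  qed
qed

lemma torsion: "z \<in> Zp \<Longrightarrow> (a ^^ n) z \<in> Bp \<Longrightarrow> z \<in> Tz"
proof (induction n)
  case 0
  then show ?case by (simp add: BpTz)
next
  case (Suc n)
  show ?case
  proof (cases n)
    case 0
    then show ?thesis using Suc.prems by (simp add: Tz_def)
  next
    case (Suc m)
    have "a (a ((a ^^ m) z)) \<in> Bp" using Suc.prems Suc by simp
    then have "(a ^^ n) z \<in> Bp" using torsion_twice[OF apow_Zp[OF Suc.prems(1)]] Suc by simp
    then show ?thesis using Suc.IH Suc.prems(1) by blast
  qed
qed

text \<open>Torsion stays visible modulo \<open>a\<close>: a torsion class of the form
  \<open>a w\<close> satisfies \<open>a (a w) = 0\<close> in homology, so it is zero by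
  \<open>torsion_twice\<close>.\<close>

lemma Tz_Bn: "z \<in> Tz \<Longrightarrow> z \<in> Bn \<longleftrightarrow> z \<in> Bp"
proof
  assume z: "z \<in> Tz" "z \<in> Bn"
  then obtain w b where w: "w \<in> Zp" "b \<in> Bp" "z = a w + b" using Zp_Bn[OF Tz_Zp] by blast
  have "a (a w) = a z - a b" by (simp add: w(3) lin_simps)
  then have "a (a w) \<in> Bp" using csub_diff[OF Bp_sub _ aBp[OF w(2)], of "a z"] z(1) by (simp add: Tz_def)
  then have "a w \<in> Bp" by (rule torsion_twice[OF w(1)])
  then show "z \<in> Bp" using w csub_add[OF Bp_sub] by simp
qed (rule BpBn)

text \<open>The number of torsion summands C[a]/a with generator in this bidegree.\<close>

definition t :: "int \<Rightarrow> int \<Rightarrow> nat" where "t i j = (SOME n. has_dim (Tz \<inter> G i j) (Bp \<inter> G i j) n)"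
text \<open>The number of free generators in this bidegree: the dimension of the homology over C[a]
  modulo torsion and multiples of \<open>a\<close>.\<close>

definition g :: "int \<Rightarrow> int \<Rightarrow> nat" where "g i j = (SOME n. has_dim (Zp \<inter> G i j) (It \<inter> G i j) n)"

lemma has_dim_t: "has_dim (Tz \<inter> G i j) (Bp \<inter> G i j) (t i j)"
proof -
  have "Tz \<subseteq> Zn" using Zp_Zn Tz_Zp by blast
  moreover have "Tz \<inter> Bn \<inter> G i j = Bp \<inter> G i j" using Tz_Bn BpTz by blast
  ultimately have "\<exists>n. has_dim (Tz \<inter> G i j) (Bp \<inter> G i j) n" using has_dim_homogeneous[OF Tz_sub, of i j] by simp
  then show ?thesis unfolding t_def by (rule someI_ex)
qed

lemma has_dim_g: "has_dim (Zp \<inter> G i j) (It \<inter> G i j) (g i j)"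
proof -
  have "Zp \<subseteq> Zn" using Zp_Zn by blast
  moreover have "Zp \<inter> Bn \<inter> G i j = Ip \<inter> G i j" using Zp_Bn_iff Ip_Zp by blast
  ultimately obtain n where "has_dim (Zp \<inter> G i j) (Ip \<inter> G i j) n" using has_dim_homogeneous[OF Zp_sub, of i j] by auto
  then obtain b where b: "\<And>z. z \<in> Zp \<inter> G i j \<Longrightarrow> \<exists>l. z - (\<Sum>k<n. l k *\<^sub>C b k) \<in> Ip \<inter> G i j"
    by (rule has_dimE) blast
  have "\<exists>n. has_dim (Zp \<inter> G i j) ((Zp \<inter> G i j) \<inter> (It \<inter> G i j)) n"
  proof (rule has_dim_exists[OF csub_Int[OF Zp_sub G_sub] csub_Int[OF It_sub G_sub]])
    show "\<exists>l. z - (\<Sum>k<n. l k *\<^sub>C b k) \<in> It \<inter> G i j" if "z \<in> Zp \<inter> G i j" for z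
      using b[OF that] Ip_It by blast
  qed
  moreover have "(Zp \<inter> G i j) \<inter> (It \<inter> G i j) = It \<inter> G i j" using It_Zp by blast
  ultimately have "\<exists>n. has_dim (Zp \<inter> G i j) (It \<inter> G i j) n" by simp
  then show ?thesis unfolding g_def by (rule someI_ex)
qed

lemma finite_t: "finite {(i, j). t i j \<noteq> 0}"
proof (rule finite_subset[OF _ finite_homology_support], clarify)
  fix i j assume s: "Zn \<inter> G i j \<subseteq> Bn" and t: "0 < t i j"
  obtain b where b: "\<And>k. k < t i j \<Longrightarrow> b k \<in> Tz \<inter> G i j"
    "\<And>l k. (\<Sum>k<t i j. l k *\<^sub>C b k) \<in> Bp \<inter> G i j \<Longrightarrow> k < t i j \<Longrightarrow> l k = 0"
    using has_dim_t[of i j] by (rule has_dimE) blast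
  have "b k \<in> Bp \<inter> G i j" if "k < t i j" for k
    using b(1)[OF that] s Tz_Bn Zp_Zn Tz_Zp by blast
  then have "(\<Sum>k<t i j. 1 *\<^sub>C b k) \<in> Bp \<inter> G i j"
    by (intro csub_sum csub_scale csub_Int Bp_sub G_sub) simp
  then have "(1::complex) = 0" by (rule b(2)[OF _ t])
  then show False by simp
qed

text \<open>\<open>Y\<close> consists of the classes modulo \<open>a\<close> that lift to the
  homology over C[a]. Below it lies that homology modulo multiples of \<open>a\<close>, with
  \<open>t i j\<close> torsion and \<open>g i j\<close> free generators; above it lies the torsion
  of the next homological degree, four degrees lower because \<open>a\<close> has degree 4.\<close>

lemma has_dim_homology: "has_dim (Zn \<inter> G i j) (Bn \<inter> G i j) ((t i j + g i j) + t (i + 1) (j - 4))"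
proof -
  define Y where "Y = {z \<in> Zn. \<exists>p\<in>Zp. z - p \<in> Bn}"
  have Y_sub: "csub Y"
  proof -
    have "Y = {s + t | s t. s \<in> Zp \<and> t \<in> Bn}"
    proof (intro set_eqI iffI)
      fix z assume "z \<in> Y"
      then obtain p where "p \<in> Zp" "z - p \<in> Bn" unfolding Y_def by blast
      then show "z \<in> {s + t | s t. s \<in> Zp \<and> t \<in> Bn}" by (intro CollectI exI[of _ p] exI[of _ "z - p"]) simp
    next
      fix z assume "z \<in> {s + t | s t. s \<in> Zp \<and> t \<in> Bn}"
      then obtain s t where *: "z = s + t" "s \<in> Zp" "t \<in> Bn" by blast
      then have "z \<in> Zn" using csub_add[OF Zn_sub Zp_Zn Bn_Zn] by simp
      then show "z \<in> Y" unfolding Y_def using * by (auto intro!: bexI[of _ s])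
    qed
    then show ?thesis using csub_sum_sets[OF Zp_sub Bn_sub] by simp
  qed
  have YZn: "Y \<subseteq> Zn" by (auto simp: Y_def)
  have ZpY: "z \<in> Y" if "z \<in> Zp" for z
    using that Zp_Zn csub_zero[OF Bn_sub] unfolding Y_def by (intro CollectI conjI bexI[of _ z]) simp_all
  have BnY: "z \<in> Y" if "z \<in> Bn" for z
    using that Bn_Zn csub_zero[OF Zp_sub] unfolding Y_def by (intro CollectI conjI bexI[of _ 0]) simp_all
  note sub = csub_Int[OF _ G_sub]
  text \<open>The quotient by the image of \<open>\<pi>\<^sub>a\<close> is the kernel of \<open>a\<close> in the next homological degree.\<close>
  have 1: "has_dim (Zn \<inter> G i j) (Y \<inter> G i j) (t (i + 1) (j - 4))"
  proof -
    \<comment> \<open>Homogeneous preimages under the connecting homomorphism. Such a choice is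
      additive only modulo \<open>Y\<close>, which is what \<open>has_dim_iso\<close> asks
      for.\<close>
    have "\<exists>y. w \<in> Tz \<inter> G (i + 1) (j - 4) \<longrightarrow> y \<in> Z \<and> y \<in> G i j \<and> dc y - a w \<in> Bm" for w
    proof (cases "w \<in> Tz \<inter> G (i + 1) (j - 4)")
      case True
      then obtain y where y: "y \<in> Z" "dc y - a w \<in> Bm" using connecting_surj by (auto simp: Tz_def)
      have "a w \<in> G (i + 1) j" using G_a[of w "i + 1" "j - 4"] True by simp
      then have "dc (pr i j y) - a w = pr (i + 1) j (dc y - a w)" using GD by (simp add: lin_simps pr_dc)
      then have "dc (pr i j y) - a w \<in> Bm" using gradedD[OF graded_Bm y(2)] by simp
      then show ?thesis using gradedD[OF graded_Z y(1)] G_pr by blast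
    qed blast
    then obtain \<psi> where \<psi>: "\<And>w. w \<in> Tz \<inter> G (i + 1) (j - 4) \<Longrightarrow> \<psi> w \<in> Z \<and> \<psi> w \<in> G i j \<and> dc (\<psi> w) - a w \<in> Bm"
      by metis
    have \<psi>d: "dc (\<psi> w) - a w \<in> Bm" if "w \<in> Tz \<inter> G (i + 1) (j - 4)" for w using \<psi>[OF that] by blast
    have cyc: "y \<in> Y \<inter> G i j" if "y \<in> Z" "y \<in> G i j" "dc y \<in> Bm" for y
      using that ZpY by (simp add: Zp_def)
    show ?thesis
    proof (rule has_dim_iso[where \<phi> = \<psi>, OF sub[OF Tz_sub] sub[OF Bp_sub] sub[OF Zn_sub] sub[OF Y_sub] has_dim_t])
      fix u assume u: "u \<in> Tz \<inter> G (i + 1) (j - 4)"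
      note \<psi>u = \<psi>[OF u]
      have uZ: "u \<in> Z" using u Zp_Z Tz_Zp by blast
      show "\<psi> u \<in> Zn \<inter> G i j" using connecting_Zn[OF _ Z_C[OF uZ]] \<psi>u by blast
      show "\<psi> u \<in> Y \<inter> G i j \<longleftrightarrow> u \<in> Bp \<inter> G (i + 1) (j - 4)"
      proof
        assume "\<psi> u \<in> Y \<inter> G i j"
        then obtain p where p: "p \<in> Zp" "\<psi> u - p \<in> Bn" unfolding Y_def by blast
        have z: "\<psi> u - p \<in> Z" using csub_diff[OF Z_sub _ Zp_Z[OF p(1)]] \<psi>u by blast
        have "dc (\<psi> u - p) - a u = (dc (\<psi> u) - a u) - dc p" by (simp add: lin_simps)
        also have "\<dots> \<in> Bm" using csub_diff[OF Bm_sub] \<psi>u p(1) by (simp add: Zp_def)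
        finally show "u \<in> Bp \<inter> G (i + 1) (j - 4)"
          using connecting_well_defined[OF z p(2) uZ] u by blast
      next
        assume "u \<in> Bp \<inter> G (i + 1) (j - 4)"
        then obtain z w where z: "z \<in> Zp" "w \<in> C" "\<psi> u = z + a w" using connecting_zero[of "\<psi> u" u] \<psi>u by blast
        have "\<psi> u \<in> Y" unfolding z(3) by (rule csub_add[OF Y_sub ZpY[OF z(1)] BnY[OF aCBn[OF z(2)]]])
        then show "\<psi> u \<in> Y \<inter> G i j" using \<psi>u by blast
      qed
      fix v assume v: "v \<in> Tz \<inter> G (i + 1) (j - 4)"
      have uv: "u + v \<in> Tz \<inter> G (i + 1) (j - 4)" by (rule csub_add[OF sub[OF Tz_sub] u v])
      note \<psi>v = \<psi>[OF v] and \<psi>uv = \<psi>[OF uv]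
      show "\<psi> (u + v) - (\<psi> u + \<psi> v) \<in> Y \<inter> G i j"
      proof (rule cyc)
        show "\<psi> (u + v) - (\<psi> u + \<psi> v) \<in> Z" "\<psi> (u + v) - (\<psi> u + \<psi> v) \<in> G i j"
          using \<psi>u \<psi>v \<psi>uv csub_diff[OF Z_sub] csub_add[OF Z_sub] csub_diff[OF G_sub] csub_add[OF G_sub] by simp_all
        have "dc (\<psi> (u + v) - (\<psi> u + \<psi> v)) = (dc (\<psi> (u + v)) - a (u + v)) - ((dc (\<psi> u) - a u) + (dc (\<psi> v) - a v))"
          by (simp add: lin_simps)
        also have "\<dots> \<in> Bm" by (rule csub_diff[OF Bm_sub \<psi>d[OF uv] csub_add[OF Bm_sub \<psi>d[OF u] \<psi>d[OF v]]])
        finally show "dc (\<psi> (u + v) - (\<psi> u + \<psi> v)) \<in> Bm" .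
      qed
    next
      fix c u assume u: "u \<in> Tz \<inter> G (i + 1) (j - 4)"
      have cu: "c *\<^sub>C u \<in> Tz \<inter> G (i + 1) (j - 4)" by (rule csub_scale[OF sub[OF Tz_sub] u])
      note \<psi>u = \<psi>[OF u] and \<psi>cu = \<psi>[OF cu]
      show "\<psi> (c *\<^sub>C u) - c *\<^sub>C \<psi> u \<in> Y \<inter> G i j"
      proof (rule cyc)
        show "\<psi> (c *\<^sub>C u) - c *\<^sub>C \<psi> u \<in> Z" "\<psi> (c *\<^sub>C u) - c *\<^sub>C \<psi> u \<in> G i j"
          using \<psi>u \<psi>cu csub_diff[OF Z_sub] csub_scale[OF Z_sub] csub_diff[OF G_sub] csub_scale[OF G_sub] by simp_all
        have "dc (\<psi> (c *\<^sub>C u) - c *\<^sub>C \<psi> u) = (dc (\<psi> (c *\<^sub>C u)) - a (c *\<^sub>C u)) - c *\<^sub>C (dc (\<psi> u) - a u)"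
          by (simp add: lin_simps scaleC_diff_right)
        also have "\<dots> \<in> Bm" by (rule csub_diff[OF Bm_sub \<psi>d[OF cu] csub_scale[OF Bm_sub \<psi>d[OF u]]])
        finally show "dc (\<psi> (c *\<^sub>C u) - c *\<^sub>C \<psi> u) \<in> Bm" .
      qed
    next
      fix z assume z: "z \<in> Zn \<inter> G i j"
      obtain y w u where y: "y \<in> Z" "w \<in> Zp" "u \<in> C" "z = y + a u" "dc y - a w \<in> Bm" using Zn_decompose z by blast
      define y' where "y' = pr i j y"
      define w' where "w' = pr (i + 1) (j - 4) w"
      have y'Z: "y' \<in> Z" unfolding y'_def by (rule gradedD[OF graded_Z y(1)])
      have "dc y' - a w' = pr (i + 1) j (dc y - a w)" by (simp add: y'_def w'_def lin_simps pr_dc pr_a)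
      then have d: "dc y' - a w' \<in> Bm" using gradedD[OF graded_Bm y(5)] by simp
      have w'Z: "w' \<in> Zp" unfolding w'_def by (rule gradedD[OF graded_Zp y(2)])
      have "dc y' - (dc y' - a w') \<in> Bp" by (rule csub_diff[OF Bp_sub dcBp[OF y'Z] BmBp[OF d]])
      then have w'T: "w' \<in> Tz \<inter> G (i + 1) (j - 4)" using w'Z G_pr by (simp add: Tz_def w'_def)
      note \<psi>w = \<psi>[OF w'T]
      have yy: "y' - \<psi> w' \<in> Y \<inter> G i j"
      proof (rule cyc)
        show "y' - \<psi> w' \<in> Z" using csub_diff[OF Z_sub y'Z] \<psi>w by blast
        show "y' - \<psi> w' \<in> G i j" using csub_diff[OF G_sub G_pr] \<psi>w unfolding y'_def by blast
        have "dc (y' - \<psi> w') = (dc y' - a w') - (dc (\<psi> w') - a w')" by (simp add: lin_simps)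
        also have "\<dots> \<in> Bm" using csub_diff[OF Bm_sub d] \<psi>w by blast
        finally show "dc (y' - \<psi> w') \<in> Bm" .
      qed
      have "z = y' + a (pr i (j - 4) u)" using GD[of z i j] z y(4) by (simp add: y'_def lin_simps pr_a)
      then have "z - y' = a (pr i (j - 4) u)" by simp
      then have "z - y' \<in> Y" using BnY[OF aCBn[OF prC[OF y(3)]]] by simp
      moreover have "z - y' \<in> G i j" using csub_diff[OF G_sub _ G_pr] z unfolding y'_def by blast
      ultimately have "(z - y') + (y' - \<psi> w') \<in> Y \<inter> G i j" using csub_add[OF sub[OF Y_sub] _ yy] by blast
      then show "\<exists>v\<in>Tz \<inter> G (i + 1) (j - 4). z - \<psi> v \<in> Y \<inter> G i j"
        using w'T by (intro bexI[of _ w']) simp_all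
    qed
  qed
  \<comment> \<open>The torsion classes inject modulo multiples of \<open>a\<close> by
    \<open>Tz_Bn\<close>.\<close>
  have 2: "has_dim (It \<inter> G i j) (Ip \<inter> G i j) (t i j)"
  proof (rule has_dim_iso[where \<phi> = "\<lambda>v. v", OF sub[OF Tz_sub] sub[OF Bp_sub] sub[OF It_sub] sub[OF Ip_sub] has_dim_t])
    fix v assume v: "v \<in> Tz \<inter> G i j"
    show "v \<in> It \<inter> G i j" using v Tz_It by blast
    show "v \<in> Ip \<inter> G i j \<longleftrightarrow> v \<in> Bp \<inter> G i j"
      using v Zp_Bn_iff[OF Tz_Zp] Tz_Bn by blast
  next
    fix w assume w: "w \<in> It \<inter> G i j"
    then obtain z s where z: "z \<in> Zp" "s \<in> Tz" "s \<in> G i j" "w = a z + s" using It_homogeneous[of w i j] by blast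
    have "w - s = a z + 0" using z by simp
    also have "\<dots> \<in> Ip" by (rule IpI[OF z(1) csub_zero[OF Bp_sub]])
    finally show "\<exists>v\<in>Tz \<inter> G i j. w - v \<in> Ip \<inter> G i j"
      using z w csub_diff[OF G_sub] by blast
  qed (use csub_zero[OF sub[OF Ip_sub]] in auto)
  have 3: "has_dim (Zp \<inter> G i j) (Ip \<inter> G i j) (t i j + g i j)"
    by (rule has_dim_extend[OF sub[OF Zp_sub] sub[OF It_sub] sub[OF Ip_sub] _ _ has_dim_g 2]) (use Ip_It It_Zp in blast)+
  have 4: "has_dim (Y \<inter> G i j) (Bn \<inter> G i j) (t i j + g i j)"
  proof (rule has_dim_iso[where \<phi> = "\<lambda>v. v", OF sub[OF Zp_sub] sub[OF Ip_sub] sub[OF Y_sub] sub[OF Bn_sub] 3])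
    fix v assume v: "v \<in> Zp \<inter> G i j"
    show "v \<in> Y \<inter> G i j" using v ZpY by blast
    show "v \<in> Bn \<inter> G i j \<longleftrightarrow> v \<in> Ip \<inter> G i j" using v Zp_Bn_iff by blast
  next
    fix w assume w: "w \<in> Y \<inter> G i j"
    then obtain p where p: "p \<in> Zp" "w - p \<in> Bn" unfolding Y_def by blast
    have "w - pr i j p = pr i j (w - p)" using GD w by (simp add: lin_simps)
    then have "w - pr i j p \<in> Bn \<inter> G i j" using gradedD[OF graded_Bn p(2)] G_pr by (metis IntI)
    then show "\<exists>v\<in>Zp \<inter> G i j. w - v \<in> Bn \<inter> G i j"
      using gradedD[OF graded_Zp p(1)] G_pr by blast
  qed (use csub_zero[OF sub[OF Bn_sub]] in auto)
  show ?thesis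
    by (rule has_dim_extend[OF sub[OF Zn_sub] sub[OF Y_sub] sub[OF Bn_sub] _ _ 1 4]) (use BnY YZn in blast)+
qed

end

context bicomplex
begin

subsection \<open>The specialization \<open>a = 1\<close>\<close>

definition sh :: "'v \<Rightarrow> 'v" where "sh v = a v - v"
definition Zh where "Zh = {z \<in> C. dm z \<in> sh ` C \<and> (\<exists>b\<in>Bm. \<exists>w\<in>C. dc z = b + sh w)}"
definition Bh where "Bh = {b + sh w | b w. b \<in> Bp \<and> w \<in> C}"
text \<open>Filtration level \<open>j\<close> of the homology \<open>Zh / Bh\<close> at
  \<open>a = 1\<close>, as a set of representatives in homological degree \<open>i\<close>.\<close>

definition Fh where "Fh i j = {z + b | z b. z \<in> Zh \<inter> hp i \<inter> F j \<and> b \<in> Bh \<inter> hp i}"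

lemma sh_lin: "clin sh"
  by (rule clinI) (simp_all add: sh_def lin_simps scaleC_diff_right)

lemma sh_C: "v \<in> C \<Longrightarrow> sh v \<in> C" by (simp add: sh_def aC csub_diff[OF C])

lemma shC_sub: "csub (sh ` C)" by (rule csub_image[OF sh_lin C])

lemma dm_sh: "dm (sh v) = sh (dm v)" and dc_sh: "dc (sh v) = sh (dc v)"
  by (simp_all add: sh_def lin_simps dm_a dc_a)

lemma Bh_sub: "csub Bh"
proof -
  have "Bh = {s + t | s t. s \<in> Bp \<and> t \<in> sh ` C}" unfolding Bh_def by blast
  then show ?thesis using csub_sum_sets[OF Bp_sub shC_sub] by simp
qed

lemma Zh_sub: "csub Zh"
proof -
  have "Zh = C \<inter> ({z. dm z \<in> sh ` C} \<inter> {z. dc z \<in> {s + t | s t. s \<in> Bm \<and> t \<in> sh ` C}})"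
    unfolding Zh_def by blast
  then show ?thesis
    by (simp only:) (intro csub_Int C csub_vimage dm_lin dc_lin shC_sub csub_sum_sets Bm_sub)
qed

lemma Fh_sub: "csub (Fh i j)"
proof -
  have "Fh i j = {s + t | s t. s \<in> Zh \<inter> hp i \<inter> F j \<and> t \<in> Bh \<inter> hp i}" unfolding Fh_def by blast
  then show ?thesis
    by (simp only:) (intro csub_sum_sets csub_Int Zh_sub Bh_sub hp_sub F_sub)
qed

lemma Zp_Zh: assumes "z \<in> Zp" shows "z \<in> Zh"
proof -
  have "dm z = sh 0" "dc z = dc z + sh 0" using assms by (simp_all add: Zp_def Z_def sh_def lin_simps)
  moreover have "dc z \<in> Bm" using assms by (simp add: Zp_def)
  ultimately show ?thesis unfolding Zh_def using Zp_C[OF assms] csub_zero[OF C] by blast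
qed

lemma Bh_memI: "b \<in> Bp \<Longrightarrow> w \<in> C \<Longrightarrow> b + sh w \<in> Bh" unfolding Bh_def by blast
lemma shC_Bh: "w \<in> C \<Longrightarrow> sh w \<in> Bh" using Bh_memI[OF csub_zero[OF Bp_sub]] by simp
lemma Bp_Bh: "b \<in> Bp \<Longrightarrow> b \<in> Bh" using Bh_memI[of b 0] csub_zero[OF C] by (simp add: sh_def lin_simps)

lemma Bm_C: "Bm \<subseteq> C" using Bm_Z Z_C by blast
lemma Bp_C: "Bp \<subseteq> C" using Bp_Zp Zp_C by blast
lemma zero_sub: "csub {0}" by (rule csubI) (simp_all add: scaleC_zero_right)
lemma graded_zero: "graded {0}" by (simp add: graded_def lin_simps)

text \<open>The right side is the denominator as it arises from iterated homology, where
  \<open>y\<close> is a cycle only modulo \<open>a - 1\<close>. From \<open>dm y = sh q\<close>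
  follows that \<open>q\<close> is a boundary \<open>dm u\<close>, and \<open>y - sh u\<close> is a
  true cycle.\<close>

lemma Bh_alt:
  "Bh = {dc y + b | y b. y \<in> C \<and> dm y \<in> sh ` C \<and> b \<in> {b + sh w | b w. b \<in> Bm \<and> w \<in> C}}"
proof (intro set_eqI iffI)
  fix x assume "x \<in> Bh"
  then obtain b w where "x = b + sh w" "b \<in> Bp" "w \<in> C" unfolding Bh_def by blast
  moreover from this obtain y b' where y: "b = dc y + b'" "y \<in> Z" "b' \<in> Bm" by (elim BpE)
  ultimately have "x = dc y + (b' + sh w)" by (simp add: add.assoc)
  moreover have "dm y = sh 0" using y(2) by (simp add: Z_def sh_def lin_simps)
  ultimately show "x \<in> {dc y + b | y b. y \<in> C \<and> dm y \<in> sh ` C \<and> b \<in> {b + sh w | b w. b \<in> Bm \<and> w \<in> C}}"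
    using Z_C[OF y(2)] csub_zero[OF C] y(3) \<open>w \<in> C\<close> by blast
next
  fix x assume "x \<in> {dc y + b | y b. y \<in> C \<and> dm y \<in> sh ` C \<and> b \<in> {b + sh w | b w. b \<in> Bm \<and> w \<in> C}}"
  then obtain y q b w where y: "y \<in> C" "dm y = sh q" "q \<in> C" "b \<in> Bm" "w \<in> C" "x = dc y + (b + sh w)" by blast
  have "sh q \<in> Bm" using y(1,2) by (metis Bm_def imageI)
  then have "q \<in> Bm" using shift_injective[OF Bm_sub graded_Bm aBm Bm_C y(3)] by (simp add: sh_def)
  then obtain u where u: "u \<in> C" "q = dm u" unfolding Bm_def by blast
  have z: "y - sh u \<in> Z" using y(1,2) u by (simp add: Z_def lin_simps dm_sh csub_diff[OF C] sh_C)
  have "x = (dc (y - sh u) + b) + sh (dc u + w)"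
    by (simp add: y(6) lin_simps dc_sh clin_add[OF sh_lin])
  also have "\<dots> \<in> Bh" by (rule Bh_memI[OF BpI[OF z y(4)] csub_add[OF C dcC[OF u(1)] y(5)]])
  finally show "x \<in> Bh" .
qed

lemma G_hp: "v \<in> C \<Longrightarrow> v \<in> G i j \<Longrightarrow> v \<in> hp i"
  unfolding hp_iff using G_other by blast

text \<open>At \<open>a = 1\<close> the elements \<open>u\<close> and \<open>a u\<close> agree, so
  the degree moves in steps of 4 into the window from \<open>j - 3\<close> to \<open>j\<close>.
  Moving down from above \<open>j\<close> requires division by \<open>a\<close>, which membership in
  \<open>F j\<close> permits.\<close>

lemma homogenize_component:
  assumes "u \<in> C" "u \<in> G i k" "u \<in> F j"
  shows "\<exists>r<4::nat. \<exists>z\<in>C. z \<in> G i (j - int r) \<and> u - z \<in> sh ` C"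
  using assms
proof (induction "nat \<bar>k - j\<bar>" arbitrary: u k rule: less_induct)
  case less
  consider "k > j" | "k \<le> j - 4" | "j - 3 \<le> k" "k \<le> j" by linarith
  then show ?case
  proof cases
    case 1
    obtain u' where u': "u' \<in> C" "u = a u'" "u' \<in> F j" "u' \<in> G i (k - 4)"
      using F_divide[OF less.prems(1) GD[OF less.prems(2)] less.prems(3)] 1 by (auto simp: G_def)
    show ?thesis
    proof (cases "k - 4 \<ge> j - 3")
      case True
      then have k: "k - 4 = j - int (nat (j - (k - 4)))" "nat (j - (k - 4)) < 4" if "k - 4 \<le> j" using that by auto
      show ?thesis
      proof (cases "k - 4 \<le> j")
        case True
        have "u - u' = sh u'" by (simp add: u'(2) sh_def)
        then show ?thesis using k[OF True] u' by (intro exI[of _ "nat (j - (k - 4))"] conjI bexI[of _ u']) auto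
      next
        case False
        then have "nat \<bar>k - 4 - j\<bar> < nat \<bar>k - j\<bar>" by linarith
        from less.hyps[OF this u'(1,4,3)] obtain r z where z: "r < 4" "z \<in> C" "z \<in> G i (j - int r)" "u' - z \<in> sh ` C" by blast
        have "u - z = sh u' + (u' - z)" by (simp add: u'(2) sh_def)
        then have "u - z \<in> sh ` C" using csub_add[OF shC_sub imageI[OF u'(1)] z(4)] by (simp only:)
        then show ?thesis using z by blast
      qed
    next
      case False
      then show ?thesis using 1 by linarith
    qed
  next
    case 2
    have au: "a u \<in> C" "a u \<in> G i (k + 4)" using aC[OF less.prems(1)] G_a[OF less.prems(2)] by auto
    have aF: "a u \<in> F j" by (rule F_homogeneous[OF GD[OF au(2)]]) (use 2 in simp)
    have "nat \<bar>k + 4 - j\<bar> < nat \<bar>k - j\<bar>" using 2 by linarith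
    from less.hyps[OF this au aF] obtain r z where z: "r < 4" "z \<in> C" "z \<in> G i (j - int r)" "a u - z \<in> sh ` C" by blast
    have "u - z = (a u - z) - sh u" by (simp add: sh_def)
    then have "u - z \<in> sh ` C" using csub_diff[OF shC_sub z(4) imageI[OF less.prems(1)]] by (simp only:)
    then show ?thesis using z by blast
  next
    case 3
    have "u - u \<in> sh ` C" using csub_zero[OF shC_sub] by simp
    then show ?thesis using 3 less.prems by (intro exI[of _ "nat (j - k)"] conjI bexI[of _ u]) auto
  qed
qed

lemma homogenize:
  assumes v: "v \<in> C" "v \<in> hp i" "v \<in> F j"
  shows "\<exists>z. (\<forall>k<4::nat. z k \<in> C \<inter> G i (j - int k)) \<and> v - (\<Sum>k<4. z k) \<in> sh ` C"
proof -
  define Q where "Q u \<longleftrightarrow> (\<exists>z. (\<forall>k<4::nat. z k \<in> C \<inter> G i (j - int k)) \<and> u - (\<Sum>k<4. z k) \<in> sh ` C)" for u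
  have Q0: "Q 0" unfolding Q_def using csub_zero[OF C] csub_zero[OF G_sub] csub_zero[OF shC_sub]
    by (intro exI[of _ "\<lambda>_. 0"]) simp
  have Qadd: "Q (u + v)" if uv: "Q u" "Q v" for u v
  proof -
    obtain z where z: "\<forall>k<4::nat. z k \<in> C \<inter> G i (j - int k)" "u - (\<Sum>k<4. z k) \<in> sh ` C" using uv(1) unfolding Q_def by blast
    obtain y where y: "\<forall>k<4::nat. y k \<in> C \<inter> G i (j - int k)" "v - (\<Sum>k<4. y k) \<in> sh ` C" using uv(2) unfolding Q_def by blast
    have "u + v - (\<Sum>k<4. z k + y k) = (u - (\<Sum>k<4. z k)) + (v - (\<Sum>k<4. y k))" by (simp add: sum.distrib)
    then have "u + v - (\<Sum>k<4. z k + y k) \<in> sh ` C" using csub_add[OF shC_sub z(2) y(2)] by (simp only:)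
    then show ?thesis unfolding Q_def using z(1) y(1) csub_add[OF csub_Int[OF C G_sub]] by (intro exI[of _ "\<lambda>k. z k + y k"]) blast
  qed
  have Qpr: "Q (pr i' k v)" for i' k
  proof (cases "i' = i")
    case False
    then show ?thesis using v hp_iff[OF v(1)] Q0 by simp
  next
    case True
    obtain r z where z: "r < 4" "z \<in> C" "z \<in> G i (j - int r)" "pr i k v - z \<in> sh ` C"
      using homogenize_component[OF prC[OF v(1)] G_pr F_pr[OF v(3)]] by blast
    have "(\<Sum>k<4. if k = r then z else 0) = z" using z(1) by simp
    then show ?thesis unfolding Q_def True
      using z csub_zero[OF C] csub_zero[OF G_sub] by (intro exI[of _ "\<lambda>k. if k = r then z else 0"]) auto
  qed
  obtain J where "v = (\<Sum>x\<in>J. pr (fst x) (snd x) v)" using pr_sum[OF v(1)] by blast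
  moreover have "Q (\<Sum>x\<in>J. pr (fst x) (snd x) v)"
    by (induction J rule: infinite_finite_induct) (simp_all add: Q0 Qadd Qpr)
  ultimately show ?thesis unfolding Q_def by simp
qed

text \<open>The four degrees of the window are distinct modulo 4, so a residue class sees only one
  summand.\<close>

lemma pr_sum_four:
  assumes "\<And>k. k < 4 \<Longrightarrow> z k \<in> G i (j - int k)" "k0 < (4::nat)"
  shows "pr i (j - int k0 + 4 * l) (\<Sum>k<4. z k) = (if l = 0 then z k0 else 0)"
proof -
  have "pr i (j - int k0 + 4 * l) (z k) = (if k = k0 \<and> l = 0 then z k0 else 0)" if "k < 4" for k
  proof (cases "j - int k0 + 4 * l = j - int k")
    case True
    then have "k = k0 \<and> l = 0" using that assms(2) by presburger
    then show ?thesis using GD[OF assms(1)[OF that]] by auto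
  next
    case False
    then show ?thesis using G_other[OF assms(1)[OF that]] by auto
  qed
  then have "pr i (j - int k0 + 4 * l) (\<Sum>k<4. z k) = (\<Sum>k<4. if k = k0 \<and> l = 0 then z k0 else 0)"
    unfolding clin_sum[OF pr_lin] by (intro sum.cong) auto
  also have "\<dots> = (if l = 0 then z k0 else 0)" using assms(2) by (cases "l = 0") simp_all
  finally show ?thesis .
qed

text \<open>The summands from \<open>homogenize\<close> are cycles over C[a]: the sum of their
  differentials is trivial at \<open>a = 1\<close>, so by \<open>shift_component\<close> each single
  one is killed by a power of \<open>a\<close>, and there is no torsion for
  \<open>dm\<close>.\<close>

lemma homogenize_cycle:
  assumes v: "v \<in> Zh" "v \<in> hp i" "v \<in> F j"
  shows "\<exists>z. (\<forall>k<4::nat. z k \<in> Zp \<inter> G i (j - int k)) \<and> v - (\<Sum>k<4. z k) \<in> sh ` C"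
proof -
  have vC: "v \<in> C" using v(1) by (simp add: Zh_def)
  obtain q b w where q: "q \<in> C" "dm v = sh q" "b \<in> Bm" "w \<in> C" "dc v = b + sh w" using v(1) unfolding Zh_def by blast
  obtain z where z: "\<And>k. k < 4 \<Longrightarrow> z k \<in> C \<inter> G i (j - int k)" "v - (\<Sum>k<4::nat. z k) \<in> sh ` C"
    using homogenize[OF vC v(2,3)] by blast
  then obtain c where c: "c \<in> C" "v - (\<Sum>k<4. z k) = sh c" by blast
  have zs: "(\<Sum>k<4. z k) = v - sh c" using c(2) by (simp add: algebra_simps)
  have dmG: "dm (z k) \<in> G i (j + 3 - int k)" if "k < 4" for k
    using z(1)[OF that] by (simp add: G_def pr_dm' algebra_simps)
  have dcG: "dc (z k) \<in> G (i + 1) (j - int k)" if "k < 4" for k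
    using z(1)[OF that] by (simp add: G_def pr_dc')
  have zZ: "z k \<in> Z" if k: "k < 4" for k
  proof -
    let ?x = "\<Sum>k<4. dm (z k)"
    have "?x = dm (\<Sum>k<4. z k)" by (simp only: clin_sum[OF dm_lin])
    also have "\<dots> = a (q - dm c) - (q - dm c)" by (simp add: zs lin_simps q dm_sh) (simp add: sh_def lin_simps)
    finally have x: "?x - (a (q - dm c) - (q - dm c)) \<in> {0}" by simp
    note p = pr_sum_four[of "\<lambda>k. dm (z k)" i "j + 3", OF dmG k]
    have "\<exists>n. (a ^^ n) (pr i (j + 3 - int k) ?x) \<in> {0}"
      by (rule shift_component(1)[OF zero_sub graded_zero _ _ x csub_diff[OF C q(1) dmC[OF c(1)]]])
        (use p csub_zero[OF C] in \<open>auto simp: lin_simps\<close>)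
    then have "dm (z k) = 0" using p[of 0] apow_inj dmC z(1)[OF k] by auto
    then show ?thesis using z(1)[OF k] by (simp add: Z_def)
  qed
  have "z k \<in> Zp" if k: "k < 4" for k
  proof -
    let ?x = "\<Sum>k<4. dc (z k)"
    have "?x = dc (\<Sum>k<4. z k)" by (simp only: clin_sum[OF dc_lin])
    also have "\<dots> = b + (a (w - dc c) - (w - dc c))" by (simp add: zs lin_simps q dc_sh) (simp add: sh_def lin_simps)
    finally have x: "?x - (a (w - dc c) - (w - dc c)) \<in> Bm" using q(3) by simp
    note p = pr_sum_four[of "\<lambda>k. dc (z k)" "i + 1" j, OF dcG k]
    have "\<exists>n. (a ^^ n) (pr (i + 1) (j - int k) ?x) \<in> Bm"
      by (rule shift_component(1)[OF Bm_sub graded_Bm aBm Bm_C x csub_diff[OF C q(4) dcC[OF c(1)]]])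
        (use p csub_zero[OF Bm_sub] in auto)
    then have "dc (z k) \<in> Bm" using p[of 0] apow_Bm[OF dcZ[OF zZ[OF k]]] by auto
    then show ?thesis using zZ[OF k] by (simp add: Zp_def)
  qed
  then show ?thesis using z by blast
qed

lemma sum_four: "(\<Sum>k<4::nat. f k) = f 0 + f 1 + f 2 + f 3" for f :: "nat \<Rightarrow> 'v"
  by (simp add: eval_nat_numeral)

lemma Zp_Fh: "z \<in> Zp \<Longrightarrow> z \<in> G i k \<Longrightarrow> k \<le> j \<Longrightarrow> z \<in> Zh \<inter> hp i \<inter> F j"
  using Zp_Zh G_hp[OF Zp_C] F_homogeneous[OF GD] by blast

lemma FhI: "z \<in> Zh \<inter> hp i \<inter> F j \<Longrightarrow> b \<in> Bh \<inter> hp i \<Longrightarrow> z + b \<in> Fh i j" unfolding Fh_def by blast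

end

context thin_bicomplex
begin

text \<open>The map induced by the inclusion of homogeneous cycles of degree \<open>j\<close>
  identifies the graded piece at \<open>a = 1\<close> with the homology over C[a] modulo torsion and
  multiples of \<open>a\<close>.\<close>

lemma has_dim_Fh: "has_dim (Fh i j) (Fh i (j - 1)) (g i j)"
proof (rule has_dim_iso[where \<phi> = "\<lambda>v. v", OF csub_Int[OF Zp_sub G_sub] csub_Int[OF It_sub G_sub] Fh_sub Fh_sub has_dim_g])
  have Bh0: "0 \<in> Bh \<inter> hp i" using csub_zero[OF Bh_sub] csub_zero[OF hp_sub] by simp
  have Zh0: "0 \<in> Zh \<inter> hp i \<inter> F k" for k using csub_zero[OF Zh_sub] csub_zero[OF hp_sub] csub_zero[OF F_sub] by simp
  fix z assume z: "z \<in> Zp \<inter> G i j"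
  have zC: "z \<in> C" using z Zp_C by blast
  show "z \<in> Fh i j" using FhI[OF Zp_Fh[of z i j j] Bh0] z by simp
  show "z \<in> Fh i (j - 1) \<longleftrightarrow> z \<in> It \<inter> G i j"
  proof
    assume "z \<in> It \<inter> G i j"
    then obtain w s where w: "w \<in> Zp" "w \<in> G i (j - 4)" "s \<in> Tz" "s \<in> G i j" "z = a w + s" using It_homogeneous[of z i j] by blast
    have wC: "w \<in> C" and sC: "s \<in> C" using w Zp_C Tz_Zp by blast+
    \<comment> \<open>At \<open>a = 1\<close> the multiple \<open>a w\<close> equals
      \<open>w\<close>, whose degree \<open>j - 4\<close> puts it into a lower filtration
      level.\<close>
    have b1: "sh w \<in> Bh \<inter> hp i"
    proof -
      have "a w \<in> G i j" using G_a[OF w(2)] by simp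
      then have "sh w \<in> hp i" unfolding sh_def using csub_diff[OF hp_sub G_hp[OF aC[OF wC]] G_hp[OF wC w(2)]] by blast
      then show ?thesis using shC_Bh[OF wC] by blast
    qed
    \<comment> \<open>Torsion dies at \<open>a = 1\<close>: \<open>s\<close> is
      \<open>a s - sh s\<close>, and \<open>a s\<close> is a boundary.\<close>
    have b2: "s \<in> Bh \<inter> hp i"
    proof -
      have "a s \<in> Bh" using w(3) Bp_Bh by (simp add: Tz_def)
      then have "a s - sh s \<in> Bh" using csub_diff[OF Bh_sub] shC_Bh[OF sC] by blast
      then show ?thesis using G_hp[OF sC w(4)] by (simp add: sh_def)
    qed
    have "w + (sh w + s) \<in> Fh i (j - 1)"
      by (rule FhI[OF Zp_Fh[OF w(1,2)] csub_add[OF csub_Int[OF Bh_sub hp_sub] b1 b2]]) simp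
    then show "z \<in> Fh i (j - 1)" by (simp add: w(5) sh_def)
  next
    assume "z \<in> Fh i (j - 1)"
    then obtain v b where v: "z = v + b" "v \<in> Zh" "v \<in> hp i" "v \<in> F (j - 1)" "b \<in> Bh" unfolding Fh_def by blast
    obtain y where y: "\<And>k. k < 4 \<Longrightarrow> y k \<in> Zp \<inter> G i (j - 1 - int k)" "v - (\<Sum>k<4::nat. y k) \<in> sh ` C"
      using homogenize_cycle[OF v(2-4)] by blast
    obtain c where c: "c \<in> C" "v - (\<Sum>k<4. y k) = sh c" using y(2) by blast
    obtain p w where p: "b = p + sh w" "p \<in> Bp" "w \<in> C" using v(5) unfolding Bh_def by blast
    \<comment> \<open>Of the four homogeneous parts only \<open>y 3\<close>, of degree
      \<open>j - 4\<close>, has a degree congruent to \<open>j\<close> modulo 4.\<close>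
    have y3: "y 3 \<in> Zp" "y 3 \<in> G i (j - 4)" using y(1)[of 3] by simp_all
    have yC: "y 3 \<in> C" by (rule Zp_C[OF y3(1)])
    let ?c = "c + w - y 3"
    \<comment> \<open>Subtracting \<open>sh (y 3)\<close> replaces \<open>y 3\<close> by
      \<open>a (y 3)\<close>, which has degree \<open>j\<close> like \<open>z\<close>. So
      \<open>z - a (y 3)\<close> is the only component of \<open>?x\<close> in this residue class,
      and \<open>shift_component\<close> makes it torsion.\<close>
    let ?x = "z - (\<Sum>k<4. y k) - sh (y 3)"
    have "?x = p + sh ?c"
      using c(2) by (simp add: v(1) p(1) clin_add[OF sh_lin] clin_diff[OF sh_lin] algebra_simps)
    then have x: "?x - (a ?c - ?c) \<in> Bp" using p(2) by (simp add: sh_def)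
    have xe: "?x = (z - a (y 3)) - (y 0 + y 1 + y 2)" by (simp add: sum_four sh_def)
    have comp: "pr i (j + 4 * l) ?x = (if l = 0 then z - a (y 3) else 0)" for l
    proof -
      have "pr i (j + 4 * l) (y k) = 0" if "k < 3" for k
      proof (rule G_other[of _ i "j - 1 - int k"])
        show "y k \<in> G i (j - 1 - int k)" using y(1)[of k] that by simp
        have "j - 1 - int k \<noteq> j + 4 * l" using that by presburger
        then show "(i, j + 4 * l) \<noteq> (i, j - 1 - int k)" by auto
      qed
      then have "pr i (j + 4 * l) ?x = pr i (j + 4 * l) (z - a (y 3))" by (simp add: xe lin_simps)
      moreover have "z - a (y 3) \<in> G i j" using csub_diff[OF G_sub] z G_a[OF y3(2)] by simp
      ultimately show ?thesis using GD G_other[of "z - a (y 3)" i j i "j + 4 * l"] by simp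
    qed
    have "\<exists>n. (a ^^ n) (pr i j ?x) \<in> Bp"
      by (rule shift_component(1)[OF Bp_sub graded_Bp aBp Bp_C x]) (use comp c p yC csub_zero[OF Bp_sub] in \<open>auto simp: csub_add[OF C] csub_diff[OF C]\<close>)
    then obtain n where "(a ^^ n) (z - a (y 3)) \<in> Bp" using comp[of 0] by auto
    then have "z - a (y 3) \<in> Tz" by (rule torsion[OF csub_diff[OF Zp_sub _ aZp[OF y3(1)]], rotated]) (use z in blast)
    then have "a (y 3) + (z - a (y 3)) \<in> It" by (rule ItI[OF y3(1)])
    then show "z \<in> It \<inter> G i j" using z by simp
  qed
  show "u + v - (u + v) \<in> Fh i (j - 1)" for u v using csub_zero[OF Fh_sub] by simp
  show "c *\<^sub>C v - c *\<^sub>C v \<in> Fh i (j - 1)" for c v using csub_zero[OF Fh_sub] by simp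
next
  fix w assume "w \<in> Fh i j"
  then obtain v b where v: "w = v + b" "v \<in> Zh" "v \<in> hp i" "v \<in> F j" "b \<in> Bh" "b \<in> hp i" unfolding Fh_def by blast
  obtain y where y: "\<And>k. k < 4 \<Longrightarrow> y k \<in> Zp \<inter> G i (j - int k)" "v - (\<Sum>k<4::nat. y k) \<in> sh ` C"
    using homogenize_cycle[OF v(2-4)] by blast
  \<comment> \<open>Only \<open>y 0\<close> has degree \<open>j\<close>; the other three parts
    already lie in filtration level \<open>j - 1\<close>.\<close>
  have yh: "y k \<in> Zh \<inter> hp i \<inter> F (j - 1)" if "k \<in> {1, 2, 3}" for k
    using that y(1)[of k] by (intro Zp_Fh[of _ i "j - int k"]) auto
  have s: "y 1 + y 2 + y 3 \<in> Zh \<inter> hp i \<inter> F (j - 1)"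
    by (intro csub_add[OF csub_Int[OF csub_Int[OF Zh_sub hp_sub] F_sub]] yh) simp_all
  have "y k \<in> hp i" if "k < 4" for k using y(1)[OF that] G_hp[OF Zp_C] by blast
  then have "(\<Sum>k<4. y k) \<in> hp i" by (intro csub_sum[OF hp_sub]) simp
  from csub_diff[OF hp_sub v(3) this] have "v - (\<Sum>k<4. y k) \<in> Bh \<inter> hp i"
    using y(2) by (elim imageE) (simp add: shC_Bh)
  from csub_add[OF csub_Int[OF Bh_sub hp_sub] this IntI[OF v(5,6)]]
  have "(v - (\<Sum>k<4. y k)) + b \<in> Bh \<inter> hp i" .
  from FhI[OF s this] have "w - y 0 \<in> Fh i (j - 1)" by (simp add: v(1) sum_four algebra_simps)
  then show "\<exists>v\<in>Zp \<inter> G i j. w - v \<in> Fh i (j - 1)" using y(1)[of 0] by (intro bexI[of _ "y 0"]) simp_all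
qed

subsection \<open>A basis of \<open>a H\<^sub>P\<close>\<close>

definition basis :: "int \<Rightarrow> int \<Rightarrow> nat \<Rightarrow> 'v"
  where "basis i j = (SOME b. (\<forall>k<g i j. b k \<in> Zp \<inter> G i j) \<and>
    (\<forall>z\<in>Zp \<inter> G i j. \<exists>l. z - (\<Sum>k<g i j. l k *\<^sub>C b k) \<in> It \<inter> G i j) \<and>
    (\<forall>l. (\<Sum>k<g i j. l k *\<^sub>C b k) \<in> It \<inter> G i j \<longrightarrow> (\<forall>k<g i j. l k = 0)))"

lemma basis:
  "k < g i j \<Longrightarrow> basis i j k \<in> Zp \<inter> G i j"
  "z \<in> Zp \<inter> G i j \<Longrightarrow> \<exists>l. z - (\<Sum>k<g i j. l k *\<^sub>C basis i j k) \<in> It \<inter> G i j"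
  "(\<Sum>k<g i j. l k *\<^sub>C basis i j k) \<in> It \<inter> G i j \<Longrightarrow> k < g i j \<Longrightarrow> l k = 0"
  using someI_ex[OF has_dim_g[of i j, unfolded has_dim_def]] unfolding basis_def[symmetric] by blast+

definition index :: "(int \<times> int \<times> nat) set" where "index = {(i, j, k). k < g i j}"
definition bas :: "int \<times> int \<times> nat \<Rightarrow> 'v" where "bas x = basis (fst x) (fst (snd x)) (snd (snd x))"

lemma bas_Zp: "x \<in> index \<Longrightarrow> bas x \<in> Zp"
  using basis(1) by (auto simp: index_def bas_def)

text \<open>\<open>It\<close> is graded, so the relation may be projected to the bidegree of
  \<open>x\<close>, where only basis elements of this bidegree remain.\<close>

lemma bas_independent:
  assumes T: "finite T" "T \<subseteq> index" and l: "(\<Sum>x\<in>T. l x *\<^sub>C bas x) \<in> It" and x: "x \<in> T"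
  shows "l x = 0"
proof -
  obtain i j k where xe: "x = (i, j, k)" by (cases x)
  let ?l = "\<lambda>k. if (i, j, k) \<in> T then l (i, j, k) else 0"
  have "pr i j (\<Sum>x\<in>T. l x *\<^sub>C bas x) = (\<Sum>y\<in>T. l y *\<^sub>C pr i j (bas y))"
    by (simp add: clin_sum[OF pr_lin] lin_simps)
  also have "\<dots> = (\<Sum>y\<in>T. if fst y = i \<and> fst (snd y) = j then l y *\<^sub>C bas y else 0)"
  proof (rule sum.cong[OF refl])
    fix y assume "y \<in> T"
    then have "bas y \<in> G (fst y) (fst (snd y))" using basis(1) T(2) by (auto simp: index_def bas_def)
    then show "l y *\<^sub>C pr i j (bas y) = (if fst y = i \<and> fst (snd y) = j then l y *\<^sub>C bas y else 0)"
      using GD[of "bas y" i j] G_other[of "bas y" "fst y" "fst (snd y)" i j] by (auto simp: scaleC_zero_right)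
  qed
  also have "\<dots> = (\<Sum>y\<in>{y \<in> T. fst y = i \<and> fst (snd y) = j}. l y *\<^sub>C bas y)"
    by (rule sum.inter_filter[OF T(1), symmetric])
  also have "\<dots> = (\<Sum>k\<in>{k. (i, j, k) \<in> T}. l (i, j, k) *\<^sub>C bas (i, j, k))"
    by (rule sum.reindex_bij_witness[of _ "\<lambda>k. (i, j, k)" "\<lambda>y. snd (snd y)"]) auto
  also have "\<dots> = (\<Sum>k<g i j. ?l k *\<^sub>C basis i j k)"
    by (rule sum.mono_neutral_cong_left) (use T(2) in \<open>auto simp: index_def bas_def scaleC_zero_left\<close>)
  finally have e: "pr i j (\<Sum>x\<in>T. l x *\<^sub>C bas x) = (\<Sum>k<g i j. ?l k *\<^sub>C basis i j k)" .
  have "graded It"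
  proof -
    have "It = {s + t | s t. s \<in> a ` Zp \<and> t \<in> Tz}" unfolding It_def by blast
    then show ?thesis using graded_sum_sets[OF graded_aZp graded_Tz] by simp
  qed
  then have "(\<Sum>k<g i j. ?l k *\<^sub>C basis i j k) \<in> It \<inter> G i j"
    unfolding e[symmetric] using gradedD l G_pr by blast
  from basis(3)[OF this, of k] show ?thesis using x T(2) by (auto simp: xe index_def)
qed

text \<open>In each degree \<open>z\<close> is a combination of basis elements plus
  \<open>a w + s\<close> with \<open>s\<close> torsion. Multiplication by \<open>a\<close> turns
  \<open>s\<close> into a boundary, and \<open>w\<close> has smaller degree.\<close>

lemma basis_spans:
  assumes A: "csub A" "\<And>v. v \<in> A \<Longrightarrow> a v \<in> A" "Bp \<subseteq> A" "\<And>x. x \<in> index \<Longrightarrow> a (bas x) \<in> A" and z: "z \<in> Zp"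
  shows "a z \<in> A"
proof -
  obtain j0 where j0: "\<And>v i j. v \<in> C \<Longrightarrow> j < j0 \<Longrightarrow> pr i j v = 0" using pr_bound by blast
  have hom: "a z \<in> A" if "z \<in> Zp" "z \<in> G i j" for z i j
    using that
  proof (induction "nat (j - j0 + 4)" arbitrary: z j rule: less_induct)
    case less
    show ?case
    proof (cases "j < j0")
      case True
      then have "z = 0" using j0[OF Zp_C[OF less.prems(1)]] GD[OF less.prems(2)] by simp
      then show ?thesis using csub_zero[OF A(1)] by (simp add: lin_simps)
    next
      case False
      obtain l where l: "z - (\<Sum>k<g i j. l k *\<^sub>C basis i j k) \<in> It \<inter> G i j" using basis(2) less.prems by blast
      then obtain w s where w: "w \<in> Zp" "w \<in> G i (j - 4)" "s \<in> Tz" "z - (\<Sum>k<g i j. l k *\<^sub>C basis i j k) = a w + s"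
        using It_homogeneous[of "z - (\<Sum>k<g i j. l k *\<^sub>C basis i j k)" i j] by blast
      have "nat (j - 4 - j0 + 4) < nat (j - j0 + 4)" using False by linarith
      from less.hyps[OF this w(1,2)] have aw: "a (a w) \<in> A" by (rule A(2))
      have b: "(\<Sum>k<g i j. l k *\<^sub>C a (basis i j k)) \<in> A"
        using A(4)[of "(i, j, _)"] by (intro csub_sum[OF A(1)] csub_scale[OF A(1)]) (simp add: index_def bas_def)
      have as: "a s \<in> A" using w(3) A(3) by (auto simp: Tz_def)
      have "z = (\<Sum>k<g i j. l k *\<^sub>C basis i j k) + (a w + s)" using w(4) by (simp add: algebra_simps)
      then have "a z = (\<Sum>k<g i j. l k *\<^sub>C a (basis i j k)) + (a (a w) + a s)"
        by (simp add: lin_simps clin_sum[OF a_lin])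
      then show ?thesis using csub_add[OF A(1) b csub_add[OF A(1) aw as]] by simp
    qed
  qed
  have "a (pr i j z) \<in> A" for i j by (rule hom[OF gradedD[OF graded_Zp z] G_pr])
  moreover obtain J where J: "z = (\<Sum>x\<in>J. pr (fst x) (snd x) z)" using pr_sum[OF Zp_C[OF z]] by blast
  ultimately have "(\<Sum>x\<in>J. a (pr (fst x) (snd x) z)) \<in> A" by (intro csub_sum[OF A(1)])
  then show ?thesis by (subst J) (simp add: clin_sum[OF a_lin])
qed

text \<open>The constant coefficients form a relation modulo \<open>It\<close> and vanish by
  \<open>bas_independent\<close>. What remains is divisible by \<open>a\<close> once more, and
  \<open>torsion_twice\<close> cancels that factor.\<close>

lemma basis_independent:
  assumes "finite T" "T \<subseteq> index" "(\<Sum>x\<in>T. \<Sum>n<N::nat. c x n *\<^sub>C (a ^^ n) (a (bas x))) \<in> Bp" "x \<in> T" "n < N"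
  shows "c x n = 0"
  using assms(3,5)
proof (induction N arbitrary: c n)
  case (Suc N)
  let ?y = "\<Sum>x\<in>T. \<Sum>n<N. c x (Suc n) *\<^sub>C (a ^^ n) (bas x)"
  let ?u = "\<Sum>x\<in>T. c x 0 *\<^sub>C bas x"
  have bZ: "bas x \<in> Zp" if "x \<in> T" for x using bas_Zp that assms(2) by blast
  have yZ: "?y \<in> Zp" by (intro csub_sum[OF Zp_sub] csub_scale[OF Zp_sub] apow_Zp bZ)
  have y0Z: "?u \<in> Zp" by (intro csub_sum[OF Zp_sub] csub_scale[OF Zp_sub] bZ)
  have ay: "a ?y = (\<Sum>x\<in>T. \<Sum>n<N. c x (Suc n) *\<^sub>C (a ^^ n) (a (bas x)))"
    by (simp only: clin_sum[OF a_lin] clin_scale[OF a_lin] funpow_swap1[of a])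
  have ay0: "a ?u = (\<Sum>x\<in>T. c x 0 *\<^sub>C a (bas x))"
    by (simp only: clin_sum[OF a_lin] clin_scale[OF a_lin])
  have inner: "(\<Sum>n<Suc N. c x n *\<^sub>C (a ^^ n) (a (bas x))) =
    c x 0 *\<^sub>C a (bas x) + a (\<Sum>n<N. c x (Suc n) *\<^sub>C (a ^^ n) (a (bas x)))" for x
    by (simp add: sum.lessThan_Suc_shift clin_sum[OF a_lin] lin_simps del: sum.lessThan_Suc)
  have "(\<Sum>x\<in>T. \<Sum>n<Suc N. c x n *\<^sub>C (a ^^ n) (a (bas x))) =
    (\<Sum>x\<in>T. c x 0 *\<^sub>C a (bas x)) + (\<Sum>x\<in>T. a (\<Sum>n<N. c x (Suc n) *\<^sub>C (a ^^ n) (a (bas x))))"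
    unfolding inner by (rule sum.distrib)
  also have "\<dots> = a (?u + a ?y)"
    unfolding clin_add[OF a_lin] ay0 ay clin_sum[OF a_lin, symmetric] ..
  finally have "(\<Sum>x\<in>T. \<Sum>n<Suc N. c x n *\<^sub>C (a ^^ n) (a (bas x))) = a (?u + a ?y)" .
  then have aB: "a (?u + a ?y) \<in> Bp" using Suc.prems(1) by simp
  then have "?u + a ?y \<in> Tz" using csub_add[OF Zp_sub y0Z aZp[OF yZ]] unfolding Tz_def by blast
  moreover have "a ?y \<in> It" using ItI[OF yZ csub_zero[OF Tz_sub]] by (simp only: add_0_right)
  ultimately have "(?u + a ?y) - a ?y \<in> It" by (intro csub_diff[OF It_sub Tz_It])
  then have y0: "?u \<in> It" by (simp only: add_diff_cancel_right')
  have c0: "c x 0 = 0" if "x \<in> T" for x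
    by (rule bas_independent[OF assms(1,2) y0 that])
  then have "?u = 0" by (simp add: scaleC_zero_left)
  then have "a (a ?y) \<in> Bp" using aB by simp
  then have "a ?y \<in> Bp" by (rule torsion_twice[OF yZ])
  then have "(\<Sum>x\<in>T. \<Sum>n<N. c x (Suc n) *\<^sub>C (a ^^ n) (a (bas x))) \<in> Bp" unfolding ay .
  from Suc.IH[OF this] have "c x (Suc n) = 0" if "n < N" for n using that by blast
  then show ?case using c0[OF assms(4)] Suc.prems(2) by (cases n) auto
qed simp

end

section \<open>The bicomplex of a diagram\<close>

context bicomplex
begin

text \<open>Iterated homology admits \<open>y\<close> that are cycles only modulo \<open>a\<close>;
  absence of torsion corrects them to true cycles, as in \<open>Zn_decompose\<close>.\<close>

lemma Bn_alt:
  "Bn = {dc y + b | y b. y \<in> C \<and> dm y \<in> a ` C \<and> b \<in> {b + a w | b w. b \<in> Bm \<and> w \<in> C}}"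
proof (intro set_eqI iffI)
  fix x assume "x \<in> Bn"
  then obtain b w where "x = b + a w" "b \<in> Bp" "w \<in> C" unfolding Bn_def by blast
  moreover from this(2) obtain y c where "b = dc y + c" "y \<in> Z" "c \<in> Bm" by (rule BpE)
  moreover have "dm y = a 0" using \<open>y \<in> Z\<close> by (simp add: Z_def lin_simps)
  ultimately show "x \<in> {dc y + b | y b. y \<in> C \<and> dm y \<in> a ` C \<and> b \<in> {b + a w | b w. b \<in> Bm \<and> w \<in> C}}"
    using Z_C csub_zero[OF C] by (intro CollectI exI[of _ y] exI[of _ "c + a w"]) auto
next
  fix x assume "x \<in> {dc y + b | y b. y \<in> C \<and> dm y \<in> a ` C \<and> b \<in> {b + a w | b w. b \<in> Bm \<and> w \<in> C}}"
  then obtain y q b w where x: "x = dc y + (b + a w)" "y \<in> C" "dm y = a q" "q \<in> C" "b \<in> Bm" "w \<in> C" by blast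
  have "a (dm q) = 0" using dm_dm[OF x(2)] by (simp add: x(3) dm_a)
  then have "q \<in> Z" using a_inj[OF dmC[OF x(4)]] x(4) by (simp add: Z_def)
  moreover have "a q \<in> Bm" unfolding Bm_def using x(2,3) by (metis imageI)
  ultimately obtain u where u: "q = dm u" "u \<in> C" using torsion_free_Bm unfolding Bm_def by blast
  have "y - a u \<in> Z" using x u csub_diff[OF C] aC by (simp add: Z_def lin_simps dm_a)
  then have "dc (y - a u) + b \<in> Bp" using x(5) by (rule BpI)
  from Bn_memI[OF this csub_add[OF C dcC[OF u(2)] x(6)]] show "x \<in> Bn"
    by (simp add: x(1) lin_simps dc_a algebra_simps)
qed

end

section \<open>Verification of the bicomplex axioms for a diagram\<close>

lemma a_var_nonzero: "a_var \<noteq> 0"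
  by (metis Var_def lookup_single_eq lookup_zero zero_neq_one)

lemma homogeneous_a_var: "homogeneous 4 a_var" using homogeneous_Var[of 0] by simp

lemma bicomp_lin: "clin (bicomp D i j)"
  by (rule clinI) (auto simp: bicomp_def fun_eq_iff hcomp_add scaleC_fun_def hcomp_scaleC scaleC_zero_right)

lemma bicomp_bicomp: "bicomp D i j (bicomp D i' j' v) = (if i = i' \<and> j = j' then bicomp D i j v else 0)"
  by (auto simp: bicomp_def fun_eq_iff hcomp_hcomp)

lemma bicomp_smul_a: "smul a_var (bicomp D i j v) = bicomp D i (j + 4) (smul a_var v)"
  by (auto simp: bicomp_def smul_def fun_eq_iff hcomp_mult[OF homogeneous_a_var] algebra_simps)

lemma bicomp_chains: "v \<in> chains m D \<Longrightarrow> bicomp D i j v \<in> chains m D"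
  by (auto simp: chains_def bicomp_def hcomp_polys)

lemma bicomp_sum:
  assumes v: "v \<in> chains m D"
  shows "\<exists>J. finite J \<and> (\<forall>x. x \<notin> J \<longrightarrow> bicomp D (fst x) (snd x) v = 0) \<and> v = (\<Sum>x\<in>J. bicomp D (fst x) (snd x) v)"
proof -
  define h where "h = total_deg cell_hdeg D"
  define q where "q = total_deg cell_qdeg D"
  define I where "I = h ` gens D"
  define N where "N = (\<Union>g\<in>gens D. (\<lambda>n. n + q g) ` {n. hcomp n (v g) \<noteq> 0})"
  have b: "bicomp D i j v g = (if h g = i then hcomp (j - q g) (v g) else 0)" for i j g
    by (simp add: bicomp_def h_def q_def)
  have fin: "finite I" "finite N" by (simp_all add: I_def N_def finite_hcomp_support)
  have vN: "j \<in> N" if "g \<in> gens D" "hcomp (j - q g) (v g) \<noteq> 0" for g j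
    unfolding N_def using that by (intro UN_I[of g] image_eqI[of _ _ "j - q g"]) simp_all
  have z: "bicomp D i j v = 0" if "(i, j) \<notin> I \<times> N" for i j
  proof
    fix g
    show "bicomp D i j v g = 0 g"
      using that vN[of g j] chains_outside[OF v, of g] by (cases "g \<in> gens D") (auto simp: b I_def)
  qed
  have "v = (\<Sum>x\<in>I \<times> N. bicomp D (fst x) (snd x) v)"
  proof
    fix g
    have "(\<Sum>x\<in>I \<times> N. bicomp D (fst x) (snd x) v) g = (\<Sum>i\<in>I. \<Sum>j\<in>N. if h g = i then hcomp (j - q g) (v g) else 0)"
      by (simp add: sum_fun_apply b sum.cartesian_product case_prod_unfold)
    also have "\<dots> = v g"
    proof (cases "g \<in> gens D")
      case True
      have "(\<Sum>i\<in>I. \<Sum>j\<in>N. if h g = i then hcomp (j - q g) (v g) else 0) =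
        (\<Sum>i\<in>I. if h g = i then \<Sum>j\<in>N. hcomp (j - q g) (v g) else 0)" by (intro sum.cong) auto
      also have "\<dots> = (\<Sum>j\<in>N. hcomp (j - q g) (v g))" using True fin by (simp add: I_def)
      also have "\<dots> = (\<Sum>n\<in>(\<lambda>j. j - q g) ` N. hcomp n (v g))"
        by (subst sum.reindex) (simp_all add: inj_on_def)
      also have "\<dots> = v g"
      proof (rule sum_hcomp)
        show "{n. hcomp n (v g) \<noteq> 0} \<subseteq> (\<lambda>j. j - q g) ` N"
        proof clarify
          fix n assume "hcomp n (v g) \<noteq> 0"
          then show "n \<in> (\<lambda>j. j - q g) ` N" using vN[OF True, of "n + q g"] by (intro image_eqI[of _ _ "n + q g"]) simp_all
        qed
      qed (simp add: fin)
      finally show ?thesis .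
    qed (simp add: chains_outside[OF v] cong: if_cong)
    finally show "v g = (\<Sum>x\<in>I \<times> N. bicomp D (fst x) (snd x) v) g" by (rule sym)
  qed
  then show ?thesis using z fin by (intro exI[of _ "I \<times> N"]) auto
qed

lemma bicomp_bound: "\<exists>j0. \<forall>v\<in>chains m D. \<forall>i. \<forall>j<j0. bicomp D i j v = 0"
proof -
  \<comment> \<open>Polynomials have no components of negative degree, so degrees are bounded by
    those of the generators. Inserting 0 ensures a nonempty set for \<open>Min\<close>.\<close>
  define j0 where "j0 = Min (insert 0 (total_deg cell_qdeg D ` gens D))"
  have "bicomp D i j v = 0" if "v \<in> chains m D" "j < j0" for v i j
  proof
    fix g
    show "bicomp D i j v g = 0 g"
    proof (cases "g \<in> gens D")
      case True
      then have "j0 \<le> total_deg cell_qdeg D g" by (simp add: j0_def)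
      then show ?thesis using that(2) by (simp add: bicomp_def hcomp_neg)
    qed (simp add: bicomp_def chains_outside[OF that(1)])
  qed
  then show ?thesis by blast
qed

lemma x_filtration_csub: "csub (x_filtration D j)"
proof (rule csubI)
  show "c *\<^sub>C v \<in> x_filtration D j" if "v \<in> x_filtration D j" for c v
    using that by (auto simp: x_filtration_def xfilt_def in_keys_iff scaleC_chain lookup_Const_mult)
  show "0 \<in> x_filtration D j" by (simp add: x_filtration_def xfilt_def)
  show "u + v \<in> x_filtration D j" if "u \<in> x_filtration D j" "v \<in> x_filtration D j" for u v
    using that by (simp add: x_filtration_def xfilt_add)
qed

lemma x_filtration_divide:
  assumes "v \<in> chains m D" "bicomp D i k v = v" "v \<in> x_filtration D j" "j < k"
  shows "\<exists>u\<in>chains m D. v = smul a_var u \<and> u \<in> x_filtration D j \<and> bicomp D i (k - 4) u = u"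
proof -
  let ?q = "total_deg cell_qdeg D"
  have v: "v \<in> hom_part D i" "v \<in> pol_part D k" using assms(2) unfolding bicomp_eq_iff by auto
  \<comment> \<open>The quotient is required to vanish where \<open>v\<close> does, so that it is
    again a chain of the same homological degree.\<close>
  have "\<exists>h. h \<in> polys {0..m} \<and> homogeneous (k - ?q g - 4) h \<and> h \<in> xfilt (j - ?q g) \<and> v g = a_var * h \<and> (v g = 0 \<longrightarrow> h = 0)" for g
  proof (cases "v g = 0")
    case True
    then show ?thesis by (intro exI[of _ 0]) (simp add: xfilt_def)
  next
    case False
    then show ?thesis
      using homogeneous_xfilt_divide[of "k - ?q g" "v g" "j - ?q g" "{0..m}"] assms v
      by (auto simp: pol_part_def x_filtration_def chains_def)
  qed
  then obtain u where u: "\<And>g. u g \<in> polys {0..m} \<and> homogeneous (k - ?q g - 4) (u g) \<and> u g \<in> xfilt (j - ?q g) \<and> v g = a_var * u g \<and> (v g = 0 \<longrightarrow> u g = 0)"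
    by metis
  have "u \<in> chains m D" using u chains_outside[OF assms(1)] by (simp add: chains_def)
  moreover have "v = smul a_var u" using u by (auto simp: smul_def)
  moreover have "u \<in> x_filtration D j" using u by (simp add: x_filtration_def)
  moreover have "u \<in> hom_part D i" using u v(1) by (auto simp: hom_part_def)
  moreover have "u \<in> pol_part D (k - 4)" using u by (simp add: pol_part_def algebra_simps)
  ultimately show ?thesis unfolding bicomp_eq_iff by blast
qed

lemma hom_part_iff:
  "v \<in> hom_part D i \<longleftrightarrow> (\<forall>i' k. i' \<noteq> i \<longrightarrow> bicomp D i' k v = 0)"
proof
  assume "v \<in> hom_part D i"
  then show "\<forall>i' k. i' \<noteq> i \<longrightarrow> bicomp D i' k v = 0"
    by (simp add: hom_part_def bicomp_def fun_eq_iff) (metis hcomp_0)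
next
  assume *: "\<forall>i' k. i' \<noteq> i \<longrightarrow> bicomp D i' k v = 0"
  have "v g = 0" if "total_deg cell_hdeg D g \<noteq> i" for g
  proof -
    have "hcomp n (v g) = 0" for n
      using fun_cong[OF *[rule_format, OF that, of "n + total_deg cell_qdeg D g"], of g] by (simp add: bicomp_def)
    then show ?thesis using sum_hcomp[of "{}" "v g"] by simp
  qed
  then show "v \<in> hom_part D i" unfolding hom_part_def by blast
qed

locale KR_diagram =
  fixes m :: nat and D :: "piece list" and \<chi>0 \<chi>1 :: bmatrix
  assumes diagram: "marked_diagram m D" and chi: "is_chi False \<chi>0" "is_chi True \<chi>1"

sublocale KR_diagram \<subseteq> bicomplex "chains m D" "smul a_var" "d_mf D" "d_chi \<chi>0 \<chi>1 D" "bicomp D" "x_filtration D" "hom_part D"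
proof
  note vars = marked_diagram_vars_in[OF diagram]
  show "csub (chains m D)" by (rule csub_chains)
  show "clin (smul a_var)" by (rule smul_lin)
  show "clin (d_mf D)" "clin (d_chi \<chi>0 \<chi>1 D)" unfolding d_mf_def d_chi_def by (rule tensor_d_lin)+
  show "clin (bicomp D i j)" for i j by (rule bicomp_lin)
  show "csub (x_filtration D j)" for j by (rule x_filtration_csub)
  show "csub (hom_part D i)" for i
    by (rule csubI) (simp_all add: hom_part_def scaleC_chain, metis add_0)
  show "d_mf D (d_chi \<chi>0 \<chi>1 D v) = d_chi \<chi>0 \<chi>1 D (d_mf D v)" for v
    using d_mf_d_chi_commute[OF chi] by blast
  show "d_mf D (smul a_var v) = smul a_var (d_mf D v)" "d_chi \<chi>0 \<chi>1 D (smul a_var v) = smul a_var (d_chi \<chi>0 \<chi>1 D v)" for v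
    by (simp_all add: d_mf_def d_chi_def tensor_d_smul')
  show "bicomp D i j (bicomp D i' j' v) = (if i = i' \<and> j = j' then bicomp D i j v else 0)" for i j i' j' v
    by (rule bicomp_bicomp)
  show "\<exists>j0. \<forall>v\<in>chains m D. \<forall>i. \<forall>j<j0. bicomp D i j v = 0" by (rule bicomp_bound)
  show "smul a_var (bicomp D i j v) = bicomp D i (j + 4) (smul a_var v)" for i j v by (rule bicomp_smul_a)
  show "tf_fin (smul a_var) (chains m D) {0} (d_mf D)" by (rule tf_fin_marked_diagram[OF diagram])
  show "d_mf D (bicomp D i j v) = bicomp D i (j + 3) (d_mf D v)" for i j v
    unfolding d_mf_def using bicomp_tensor_d[of D cell_dmf 0 3 cell_parity i j v] cell_dmf_hdeg cell_dmf_homogeneous[OF vars] by simp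
  show "d_chi \<chi>0 \<chi>1 D (bicomp D i j v) = bicomp D (i + 1) j (d_chi \<chi>0 \<chi>1 D v)" for i j v
    unfolding d_chi_def using bicomp_tensor_d[of D "cell_dchi \<chi>0 \<chi>1" 1 0 cell_hdeg i j v] cell_dchi_hdeg
      cell_dchi_polys_homogeneous(2)[OF chi vars] by simp
  show "bicomp D i k v \<in> x_filtration D j" if "v \<in> x_filtration D j" for v i j k
    using that by (auto simp: x_filtration_def bicomp_def xfilt_hcomp) (simp add: xfilt_def)
  show "v \<in> x_filtration D j" if "bicomp D i k v = v" "k \<le> j" for v i j k
    using that unfolding bicomp_eq_iff x_filtration_def pol_part_def
    by (auto intro!: xfilt_homogeneous[of "k - total_deg cell_qdeg D g" for g])
  fix v assume v: "v \<in> chains m D"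
  show "smul a_var v \<in> chains m D" using v by (simp add: smul_chains)
  show "d_mf D v \<in> chains m D" by (rule d_mf_chains[OF vars v])
  show "d_chi \<chi>0 \<chi>1 D v \<in> chains m D"
    using v tensor_d_polys[of D "cell_dchi \<chi>0 \<chi>1" "{0..m}" v cell_hdeg, OF cell_dchi_polys_homogeneous(1)[OF chi vars]]
    by (simp add: chains_def d_chi_def tensor_d_outside)
  show "bicomp D i j v \<in> chains m D" for i j by (rule bicomp_chains[OF v])
  show "v = 0" if "smul a_var v = 0"
    using that a_var_nonzero by (auto simp: smul_def fun_eq_iff)
  show "d_mf D (d_mf D v) = 0"
  proof
    fix g show "d_mf D (d_mf D v) g = 0 g"
      using d_mf_square[of g D v] marked_diagram_pot[OF diagram]
      by (cases "g \<in> gens D") (simp_all add: d_mf_def tensor_d_outside)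
  qed
  show "d_chi \<chi>0 \<chi>1 D (d_chi \<chi>0 \<chi>1 D v) = 0" using d_chi_square by (auto simp: fun_eq_iff)
  show "\<exists>J. finite J \<and> (\<forall>x. x \<notin> J \<longrightarrow> bicomp D (fst x) (snd x) v = 0) \<and> v = (\<Sum>x\<in>J. bicomp D (fst x) (snd x) v)"
    by (rule bicomp_sum[OF v])
  show "\<exists>u\<in>chains m D. v = smul a_var u \<and> u \<in> x_filtration D j \<and> bicomp D i (k - 4) u = u"
    if "bicomp D i k v = v" "v \<in> x_filtration D j" "j < k" for i j k
    by (rule x_filtration_divide[OF v that])
  show "v \<in> hom_part D i \<longleftrightarrow> (\<forall>i' k. i' \<noteq> i \<longrightarrow> bicomp D i' k v = 0)" for i
    by (rule hom_part_iff)
qed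

context KR_diagram
begin

section \<open>The homologies of a diagram as the abstract subquotients\<close>

lemma sq_homology_d_mf: "sq_homology (d_mf D) (C_P m D) = (Z, Bm)"
  by (auto simp: sq_homology_def C_P_def Z_def Bm_def)

lemma H_P_eq: "H_P \<chi>0 \<chi>1 m D = (Zp, Bp)"
  unfolding H_P_def KR_homology_def sq_homology_d_mf by (auto simp: sq_homology_def Zp_def Bp_def)

lemma sq_homology_image: "sq_homology d (C, f ` C) =
  ({z \<in> C. d z \<in> f ` C}, {b + f w | b w. b \<in> d ` C \<and> w \<in> C})"
  unfolding sq_homology_def by auto

lemma H_N_eq: "H_N \<chi>0 \<chi>1 m D = (Zn, Bn)"
proof -
  have "Zn = {z \<in> {z \<in> chains m D. d_mf D z \<in> smul a_var ` chains m D}.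
    d_chi \<chi>0 \<chi>1 D z \<in> {b + smul a_var w | b w. b \<in> Bm \<and> w \<in> chains m D}}"
    unfolding Zn_def by blast
  moreover have "Bn = {d_chi \<chi>0 \<chi>1 D z + b | z b. z \<in> {z \<in> chains m D. d_mf D z \<in> smul a_var ` chains m D} \<and>
    b \<in> {b + smul a_var w | b w. b \<in> Bm \<and> w \<in> chains m D}}"
    unfolding Bn_alt by blast
  ultimately show ?thesis
    unfolding H_N_def KR_homology_def C_N_def sq_homology_image Bm_def[symmetric]
    by (simp only: sq_homology_def fst_conv snd_conv)
qed

lemma H_hat_eq: "H_hat \<chi>0 \<chi>1 m D = (Zh, Bh)"
proof -
  have s: "smul (a_var - 1) = sh" by (auto simp: fun_eq_iff smul_def sh_def algebra_simps)
  have "Zh = {z \<in> {z \<in> chains m D. d_mf D z \<in> sh ` chains m D}.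
    d_chi \<chi>0 \<chi>1 D z \<in> {b + sh w | b w. b \<in> Bm \<and> w \<in> chains m D}}"
    unfolding Zh_def by blast
  moreover have "Bh = {d_chi \<chi>0 \<chi>1 D z + b | z b. z \<in> {z \<in> chains m D. d_mf D z \<in> sh ` chains m D} \<and>
    b \<in> {b + sh w | b w. b \<in> Bm \<and> w \<in> chains m D}}"
    unfolding Bh_alt by blast
  ultimately show ?thesis
    unfolding H_hat_def KR_homology_def C_hat_def s sq_homology_image Bm_def[symmetric]
    by (simp only: sq_homology_def fst_conv snd_conv)
qed

lemma gr_hat_eq: "gr_hat \<chi>0 \<chi>1 m D i j = (Fh i j, Fh i (j - 1))"
  by (simp add: gr_hat_def H_hat_eq Let_def sq_filt_def Fh_def)

lemma bigrade_eq: "bigrade D Q i j = (fst Q \<inter> G i j, snd Q \<inter> G i j)"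
  by (auto simp: bigrade_def G_def bicomp_eq_iff)

text \<open>The bound 3 on half the degree difference becomes 6. \<open>Max\<close> bounds the
  elements only of a finite set, which \<open>finite_homology_support\<close> provides.\<close>

lemma thin_of_lht:
  assumes lht: "lht_N \<chi>0 \<chi>1 m D = Some t" "t \<le> 3"
    and z: "z \<in> Zn" "z \<in> G i j" "z \<notin> Bn" "z' \<in> Zn" "z' \<in> G (i + 1) j'" "z' \<notin> Bn"
  shows "j - j' \<le> 6"
proof -
  let ?H = "bigrade D (H_N \<chi>0 \<chi>1 m D)"
  define S where "S = {(rat_of_int j\<^sub>1 - of_int j\<^sub>2) / 2 | i j\<^sub>1 j\<^sub>2. \<not> sq_zero (?H i j\<^sub>1) \<and> \<not> sq_zero (?H (i + 1) j\<^sub>2)}"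
  let ?A = "{(i, j). \<not> Zn \<inter> G i j \<subseteq> Bn}"
  have nz: "\<not> sq_zero (?H i j) \<longleftrightarrow> (i, j) \<in> ?A" for i j
    by (auto simp: sq_zero_def bigrade_eq H_N_eq)
  have "S \<subseteq> (\<lambda>(x, y). (rat_of_int (snd x) - of_int (snd y)) / 2) ` (?A \<times> ?A)"
    unfolding S_def nz by force
  then have fin: "finite S" by (rule finite_subset) (intro finite_imageI finite_cartesian_product finite_homology_support)
  have "(rat_of_int j - of_int j') / 2 \<in> S" unfolding S_def nz using z by blast
  then have "S \<noteq> {}" "(rat_of_int j - of_int j') / 2 \<le> Max S" using Max_ge[OF fin] by (blast, blast)
  moreover have "Max S = t" using lht(1)[unfolded lht_N_def Let_def, folded S_def] \<open>S \<noteq> {}\<close> by (simp split: if_splits)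
  ultimately have "rat_of_int (j - j') \<le> of_int 6" using lht(2) by simp
  then show ?thesis by (simp only: of_int_le_iff)
qed

end

locale thin_KR_diagram = KR_diagram +
  assumes thin_lht: "\<exists>t. lht_N \<chi>0 \<chi>1 m D = Some t \<and> t \<le> 3"

sublocale thin_KR_diagram \<subseteq> thin_bicomplex "chains m D" "smul a_var" "d_mf D" "d_chi \<chi>0 \<chi>1 D" "bicomp D" "x_filtration D" "hom_part D"
  by unfold_locales (use thin_lht thin_of_lht in blast)

section \<open>The torsion width\<close>

lemma polys_0_expand:
  assumes "p \<in> polys {0}" "\<And>\<mu>. \<mu> \<in> Poly_Mapping.keys p \<Longrightarrow> Poly_Mapping.lookup \<mu> 0 < N"
  shows "p = (\<Sum>n<N. Const (Poly_Mapping.lookup p (Poly_Mapping.single 0 n)) * a_var ^ n)"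
proof (rule poly_mapping_eqI)
  fix \<mu>
  have e: "Poly_Mapping.lookup (\<Sum>n<N. Const (Poly_Mapping.lookup p (Poly_Mapping.single 0 n)) * a_var ^ n) \<mu> =
    (\<Sum>n<N. if Poly_Mapping.single 0 n = \<mu> then Poly_Mapping.lookup p \<mu> else 0)"
    by (auto simp: lookup_sum Var_power Const_mult_single lookup_single when_def intro!: sum.cong)
  show "Poly_Mapping.lookup p \<mu> = Poly_Mapping.lookup (\<Sum>n<N. Const (Poly_Mapping.lookup p (Poly_Mapping.single 0 n)) * a_var ^ n) \<mu>"
  proof (cases "\<mu> \<in> Poly_Mapping.keys p")
    case True
    then have k: "Poly_Mapping.keys \<mu> \<subseteq> {0}" using assms(1) by (simp add: polys_def)
    have m: "\<mu> = Poly_Mapping.single 0 (Poly_Mapping.lookup \<mu> 0)"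
    proof (rule poly_mapping_eqI)
      fix k show "Poly_Mapping.lookup \<mu> k = Poly_Mapping.lookup (Poly_Mapping.single 0 (Poly_Mapping.lookup \<mu> 0)) k"
        using k by (cases "k = 0") (auto simp: lookup_single in_keys_iff)
    qed
    have "Poly_Mapping.single 0 n = \<mu> \<longleftrightarrow> n = Poly_Mapping.lookup \<mu> 0" for n
      using m by (metis lookup_single_eq)
    then show ?thesis using assms(2)[OF True] by (simp add: e)
  qed (simp add: e in_keys_iff cong: if_cong)
qed

lemma smul_funpow: "(smul r ^^ n) v = smul (r ^ n) v"
  by (induction n) (simp_all add: smul_smul, simp add: smul_def)

lemma smul_Const_mult: "smul (Const c * r) v = c *\<^sub>C smul r v"
  by (rule ext) (simp add: scaleC_chain smul_def mult.assoc)

lemma smul_zero_left: "smul 0 v = 0"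
  by (rule ext) (simp add: smul_def)

lemma smul_sum_left: "smul (\<Sum>x\<in>A. r x) v = (\<Sum>x\<in>A. smul (r x) v)"
  by (rule ext) (simp add: sum_fun_apply smul_def sum_distrib_right)

context thin_KR_diagram
begin

text \<open>Multiplying the homology by \<open>a\<close> kills all torsion, and the elements
  \<open>a (bas x)\<close> form a basis of the image.\<close>

lemma free_Ip: "free_Ca (Ip, Bp)"
proof -
  define S where "S = (\<lambda>x. smul a_var (bas x)) ` index"
  \<comment> \<open>The coefficients are required to vanish outside \<open>T\<close>, so that two
    combinations can be added over the union of their supports.\<close>
  define P where "P T p v \<longleftrightarrow> finite T \<and> T \<subseteq> S \<and> (\<forall>s. p s \<in> polys {0}) \<and> (\<forall>s. s \<notin> T \<longrightarrow> p s = 0) \<and>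
    v - (\<Sum>s\<in>T. smul (p s) s) \<in> Bp" for T p v
  define A where "A = {v. \<exists>T p. P T p v}"
  have A_Bp: "v \<in> A" if "v \<in> Bp" for v
    unfolding A_def P_def using that by (intro CollectI exI[of _ "{}"] exI[of _ "\<lambda>_. 0"]) simp
  have A_sub: "csub A"
  proof (rule csubI)
    show "0 \<in> A" using A_Bp csub_zero[OF Bp_sub] by blast
    show "u + v \<in> A" if uv: "u \<in> A" "v \<in> A" for u v
    proof -
      obtain T p where p: "P T p u" using uv(1) unfolding A_def by blast
      obtain U q where q: "P U q v" using uv(2) unfolding A_def by blast
      have "(\<Sum>s\<in>T. smul (p s) s) = (\<Sum>s\<in>T \<union> U. smul (p s) s)" "(\<Sum>s\<in>U. smul (q s) s) = (\<Sum>s\<in>T \<union> U. smul (q s) s)"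
        using p q smul_zero_left by (auto simp: P_def intro!: sum.mono_neutral_left)
      then have "(u + v) - (\<Sum>s\<in>T \<union> U. smul (p s + q s) s) = (u - (\<Sum>s\<in>T. smul (p s) s)) + (v - (\<Sum>s\<in>U. smul (q s) s))"
        by (simp add: smul_add_left sum.distrib)
      then have "(u + v) - (\<Sum>s\<in>T \<union> U. smul (p s + q s) s) \<in> Bp"
        using p q csub_add[OF Bp_sub, of "u - (\<Sum>s\<in>T. smul (p s) s)" "v - (\<Sum>s\<in>U. smul (q s) s)"]
        unfolding P_def by (simp only:)
      then have "P (T \<union> U) (\<lambda>s. p s + q s) (u + v)"
        using p q by (simp add: P_def polys_add)
      then show ?thesis unfolding A_def by blast
    qed
    show "c *\<^sub>C v \<in> A" if v: "v \<in> A" for c v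
    proof -
      obtain T p where p: "P T p v" using v unfolding A_def by blast
      have "c *\<^sub>C v - (\<Sum>s\<in>T. smul (Const c * p s) s) = c *\<^sub>C (v - (\<Sum>s\<in>T. smul (p s) s))"
        by (simp add: smul_Const_mult scaleC_diff_right scaleC_sum_right)
      then have "P T (\<lambda>s. Const c * p s) (c *\<^sub>C v)"
        using p csub_scale[OF Bp_sub, of "v - (\<Sum>s\<in>T. smul (p s) s)" c] by (simp add: P_def polys_mult)
      then show ?thesis unfolding A_def by blast
    qed
  qed
  have A_a: "smul a_var v \<in> A" if "v \<in> A" for v
  proof -
    obtain T p where p: "P T p v" using \<open>v \<in> A\<close> unfolding A_def by blast
    have "smul a_var v - (\<Sum>s\<in>T. smul (a_var * p s) s) = smul a_var (v - (\<Sum>s\<in>T. smul (p s) s))"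
      by (simp add: smul_smul[symmetric] clin_sum[OF smul_lin] clin_diff[OF smul_lin])
    then have "P T (\<lambda>s. a_var * p s) (smul a_var v)"
      using p aBp[of "v - (\<Sum>s\<in>T. smul (p s) s)"] by (simp add: P_def polys_mult)
    then show ?thesis unfolding A_def by blast
  qed
  have A_bas: "smul a_var (bas x) \<in> A" if "x \<in> index" for x
  proof -
    have "P {smul a_var (bas x)} (\<lambda>s. if s = smul a_var (bas x) then 1 else 0) (smul a_var (bas x))"
      using that csub_zero[OF Bp_sub] by (auto simp: P_def S_def smul_smul)
    then show ?thesis unfolding A_def by blast
  qed
  have "\<exists>T p. finite T \<and> T \<subseteq> S \<and> (\<forall>s\<in>T. p s \<in> polys {0}) \<and> z - (\<Sum>s\<in>T. smul (p s) s) \<in> Bp" if "z \<in> Ip" for z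
  proof -
    obtain w b where w: "z = smul a_var w + b" "w \<in> Zp" "b \<in> Bp" using \<open>z \<in> Ip\<close> unfolding Ip_def by blast
    have "smul a_var w \<in> A" by (rule basis_spans[OF A_sub A_a subsetI[OF A_Bp] A_bas w(2)])
    then have "z \<in> A" using csub_add[OF A_sub _ A_Bp[OF w(3)]] w(1) by simp
    then show ?thesis unfolding A_def P_def by blast
  qed
  moreover have "p s = 0" if T: "finite T" "T \<subseteq> S" "\<And>s. s \<in> T \<Longrightarrow> p s \<in> polys {0}"
    "(\<Sum>s\<in>T. smul (p s) s) \<in> Bp" "s \<in> T" for T p s
  proof -
    \<comment> \<open>One index is chosen for each element of \<open>T\<close>, which turns a
      relation between elements into one between indices.\<close>
    obtain U where U: "U \<subseteq> index" "inj_on (\<lambda>x. smul a_var (bas x)) U" "T = (\<lambda>x. smul a_var (bas x)) ` U"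
      using T(2) unfolding S_def subset_image_inj by blast
    have fU: "finite U" using T(1) finite_imageD U(2) unfolding U(3) by blast
    \<comment> \<open>A common strict bound for the exponents of \<open>a\<close> in all
      coefficients, as \<open>basis_independent\<close> expects.\<close>
    define N where "N = Suc (Max (\<Union>s\<in>T. (\<lambda>\<mu>. Poly_Mapping.lookup \<mu> 0) ` Poly_Mapping.keys (p s)))"
    have N: "Poly_Mapping.lookup \<mu> 0 < N" if "s \<in> T" "\<mu> \<in> Poly_Mapping.keys (p s)" for s \<mu>
      unfolding N_def less_Suc_eq_le by (rule Max_ge) (use that T(1) in auto)
    have e: "p s = (\<Sum>n<N. Const (Poly_Mapping.lookup (p s) (Poly_Mapping.single 0 n)) * a_var ^ n)" if "s \<in> T" for s
      by (rule polys_0_expand[OF T(3) N]) (use that in auto)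
    define c where "c x n = Poly_Mapping.lookup (p (smul a_var (bas x))) (Poly_Mapping.single 0 n)" for x n
    have "smul (p (smul a_var (bas x))) v = (\<Sum>n<N. c x n *\<^sub>C (smul a_var ^^ n) v)" if "x \<in> U" for x v
      using that U(3) by (subst e) (simp_all add: c_def smul_sum_left smul_Const_mult smul_funpow)
    then have "(\<Sum>x\<in>U. \<Sum>n<N. c x n *\<^sub>C (smul a_var ^^ n) (smul a_var (bas x))) = (\<Sum>s\<in>T. smul (p s) s)"
      unfolding U(3) sum.reindex[OF U(2)] by (intro sum.cong) simp_all
    then have b: "(\<Sum>x\<in>U. \<Sum>n<N. c x n *\<^sub>C (smul a_var ^^ n) (smul a_var (bas x))) \<in> Bp" using T(4) by simp
    obtain x where x: "x \<in> U" "s = smul a_var (bas x)" using T(5) U(3) by blast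
    have "c x n = 0" if "n < N" for n by (rule basis_independent[OF fU U(1) b x(1) that])
    then show ?thesis using e[OF T(5)] by (simp add: c_def x(2))
  qed
  moreover have "S \<subseteq> Ip"
    unfolding S_def using IpI[OF bas_Zp csub_zero[OF Bp_sub]] by force
  ultimately show ?thesis unfolding free_Ca_def fst_conv snd_conv by (intro exI[of _ S]) blast
qed

lemma tw_P_le: "tw_P \<chi>0 \<chi>1 m D \<le> 1"
proof -
  have "free_Ca (sq_mult (a_var ^ 1) (H_P \<chi>0 \<chi>1 m D))"
    using free_Ip by (simp add: sq_mult_def H_P_eq Ip_def)
  then have "tw_P \<chi>0 \<chi>1 m D \<le> enat 1" unfolding tw_P_def by (intro INF_lower) simp
  then show ?thesis by (simp add: one_enat_def)
qed

end

section \<open>Collapse of the spectral sequence\<close>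

text \<open>In such a couple the differential \<open>g \<circ> h\<close> vanishes, and the same holds for all couples derived from it.\<close>

definition degenerate :: "('v, 'w::complex_space) couple \<Rightarrow> bool"
  where "degenerate K \<longleftrightarrow> csub (snd (cE K)) \<and> fst (cE K) \<noteq> {} \<and>
    (\<forall>(z, w)\<in>ch K. w \<in> snd (cA K)) \<and>
    (\<forall>(w, e)\<in>cg K. w \<in> snd (cA K) \<longrightarrow> e \<in> snd (cE K)) \<and>
    (\<forall>z\<in>fst (cE K). \<exists>w\<in>snd (cA K). (z, w) \<in> ch K) \<and>
    snd (cA K) \<times> snd (cE K) \<subseteq> cg K \<and> snd (cA K) \<subseteq> fst (cA K) \<and>
    snd (cA K) \<times> snd (cA K) \<subseteq> cf K \<and> (\<forall>(v, w)\<in>cf K. w \<in> snd (cA K) \<longrightarrow> v \<in> snd (cA K))"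

text \<open>The differential vanishes on classes, so cycles and boundaries, and with them the
  E-term, do not change. That \<open>cf\<close> reflects zero keeps the condition on the new
  \<open>cg\<close>: a preimage of zero is zero, and \<open>cg\<close> sends it to zero.\<close>

lemma degenerate_derived:
  assumes K: "degenerate K"
  shows "cE (derived_couple K) = cE K" "degenerate (derived_couple K)"
proof -
  have E: "csub (snd (cE K))" "fst (cE K) \<noteq> {}" and h: "\<And>z w. (z, w) \<in> ch K \<Longrightarrow> w \<in> snd (cA K)"
    and g: "\<And>w e. (w, e) \<in> cg K \<Longrightarrow> w \<in> snd (cA K) \<Longrightarrow> e \<in> snd (cE K)"
    and hE: "\<And>z. z \<in> fst (cE K) \<Longrightarrow> \<exists>w\<in>snd (cA K). (z, w) \<in> ch K"
    and gE: "\<And>w e. w \<in> snd (cA K) \<Longrightarrow> e \<in> snd (cE K) \<Longrightarrow> (w, e) \<in> cg K"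
    and A: "\<And>w. w \<in> snd (cA K) \<Longrightarrow> w \<in> fst (cA K)"
    and f: "\<And>v w. v \<in> snd (cA K) \<Longrightarrow> w \<in> snd (cA K) \<Longrightarrow> (v, w) \<in> cf K"
    and f': "\<And>v w. (v, w) \<in> cf K \<Longrightarrow> w \<in> snd (cA K) \<Longrightarrow> v \<in> snd (cA K)"
    using K unfolding degenerate_def by blast+
  have d: "(z, e) \<in> ch K O cg K \<Longrightarrow> e \<in> snd (cE K)" for z e using h g by blast
  have d': "z \<in> fst (cE K) \<Longrightarrow> e \<in> snd (cE K) \<Longrightarrow> (z, e) \<in> ch K O cg K" for z e using hE gE by blast
  have 1: "{e \<in> fst (cE K). \<exists>b\<in>snd (cE K). (e, b) \<in> ch K O cg K} = fst (cE K)"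
    using d' csub_zero[OF E(1)] by blast
  have 2: "(ch K O cg K) `` fst (cE K) = snd (cE K)" using d d' E(2) by blast
  have e: "cE (derived_couple K) = cE K"
    unfolding derived_couple_def Let_def by (simp only: 1 2) simp
  have A': "snd (cA K) \<subseteq> cf K `` fst (cA K)" using f A by blast
  have dc: "derived_couple K = \<lparr>cA = (cf K `` fst (cA K), snd (cA K)), cE = cE K,
      cf = cf K \<inter> (cf K `` fst (cA K)) \<times> (cf K `` fst (cA K)),
      cg = {(\<alpha>, e'). \<exists>\<beta> e. (\<beta>, \<alpha>) \<in> cf K \<and> (\<beta>, e) \<in> cg K \<and> e' - e \<in> snd (cE K)},
      ch = ch K \<inter> fst (cE K) \<times> (cf K `` fst (cA K))\<rparr>"
    unfolding derived_couple_def Let_def by (simp only: 1 2) simp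
  show "cE (derived_couple K) = cE K" by (rule e)
  have g1: "e' \<in> snd (cE K)" if "w \<in> snd (cA K)" "(v, w) \<in> cf K" "(v, e) \<in> cg K" "e' - e \<in> snd (cE K)" for w v e e'
    by (rule csub_cong[OF E(1) that(4) g[OF that(3) f'[OF that(2,1)]]])
  have g2: "\<exists>\<beta> e. (\<beta>, w) \<in> cf K \<and> (\<beta>, e) \<in> cg K \<and> e' - e \<in> snd (cE K)" if "w \<in> snd (cA K)" "e' \<in> snd (cE K)" for w e'
    using f[OF that(1,1)] gE[OF that] csub_zero[OF E(1)] by (intro exI[of _ w] exI[of _ e']) simp
  show "degenerate (derived_couple K)"
    unfolding degenerate_def dc couple.simps fst_conv snd_conv
  proof (intro conjI E)
    show "\<forall>(w, e)\<in>{(\<alpha>, e'). \<exists>\<beta> e. (\<beta>, \<alpha>) \<in> cf K \<and> (\<beta>, e) \<in> cg K \<and> e' - e \<in> snd (cE K)}. w \<in> snd (cA K) \<longrightarrow> e \<in> snd (cE K)"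
      using g1 by blast
    show "snd (cA K) \<times> snd (cE K) \<subseteq> {(\<alpha>, e'). \<exists>\<beta> e. (\<beta>, \<alpha>) \<in> cf K \<and> (\<beta>, e) \<in> cg K \<and> e' - e \<in> snd (cE K)}"
      using g2 by blast
    show "\<forall>z\<in>fst (cE K). \<exists>w\<in>snd (cA K). (z, w) \<in> ch K \<inter> fst (cE K) \<times> (cf K `` fst (cA K))"
      using hE A' by blast
    show "snd (cA K) \<times> snd (cA K) \<subseteq> cf K \<inter> (cf K `` fst (cA K)) \<times> (cf K `` fst (cA K))"
      using f A' by blast
  qed (use h f' A' in \<open>blast+\<close>)
qed

lemma degenerate_funpow: "degenerate K \<Longrightarrow> cE ((derived_couple ^^ r) K) = cE K"
proof -
  assume "degenerate K"
  then have "degenerate ((derived_couple ^^ r) K) \<and> cE ((derived_couple ^^ r) K) = cE K"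
    by (induction r) (simp_all add: degenerate_derived)
  then show ?thesis by blast
qed

lemma csub_subtrahend: "csub S \<Longrightarrow> w \<in> S \<Longrightarrow> w - v \<in> S \<Longrightarrow> v \<in> S"
  using csub_diff[of S w "w - v"] by simp

lemma sq_iso_refl: "csub (snd Q) \<Longrightarrow> sq_iso Q Q"
  unfolding sq_iso_def by (intro exI[of _ "\<lambda>v. v"]) (auto simp: csub_zero intro!: bexI)

context thin_KR_diagram
begin

lemma torsion_Ip: "w \<in> Ip \<Longrightarrow> smul a_var w \<in> Bp \<Longrightarrow> w \<in> Bp"
proof -
  assume w: "w \<in> Ip" "smul a_var w \<in> Bp"
  then obtain u b where u: "w = smul a_var u + b" "u \<in> Zp" "b \<in> Bp" unfolding Ip_def by blast
  have "smul a_var (smul a_var u) = smul a_var w - smul a_var b" by (simp add: u(1) lin_simps)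
  then have "smul a_var u \<in> Bp" using torsion_twice[OF u(2)] csub_diff[OF Bp_sub w(2) aBp[OF u(3)]] by simp
  then show "w \<in> Bp" using csub_add[OF Bp_sub _ u(3)] u(1) by simp
qed

text \<open>The connecting homomorphism takes values in the torsion. After one derivation the A-term
  consists of multiples of \<open>a\<close>, on which \<open>a\<close> is injective by
  \<open>torsion_Ip\<close>, so nothing is left for it to hit.\<close>

lemma degenerate_first_derived: "degenerate (derived_couple (KR_couple \<chi>0 \<chi>1 m D))"
proof -
  let ?a = "smul a_var" and ?dc = "d_chi \<chi>0 \<chi>1 D"
  define MN where "MN = snd (sq_homology (d_mf D) (C_N m D))"
  define f where "f = {(u, v). u \<in> Zp \<and> v \<in> Zp \<and> v - ?a u \<in> Bp}"
  define g where "g = {(u, v). u \<in> Zp \<and> v \<in> Zn \<and> v - u \<in> Bn}"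
  define h where "h = {(z, w). z \<in> Zn \<and> w \<in> Zp \<and> (\<exists>y\<in>Z. y - z \<in> MN \<and> ?dc y - ?a w \<in> Bm)}"
  define E where "E = {e \<in> Zn. \<exists>b\<in>Bn. (e, b) \<in> h O g}"
  have K: "KR_couple \<chi>0 \<chi>1 m D = \<lparr>cA = (Zp, Bp), cE = (Zn, Bn), cf = f, cg = g, ch = h\<rparr>"
    unfolding KR_couple_def Let_def H_P_eq H_N_eq sq_homology_d_mf MN_def[symmetric] f_def g_def h_def by simp
  have MN0: "0 \<in> MN"
    unfolding MN_def C_N_def sq_homology_image snd_conv
    using csub_zero[OF C] csub_zero[OF Bm_sub] by (intro CollectI exI[of _ 0]) (simp add: lin_simps Bm_def)
  have hTz: "w \<in> Tz" if "(z, w) \<in> h" for z w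
  proof -
    have w: "w \<in> Zp" and "\<exists>y\<in>Z. y - z \<in> MN \<and> ?dc y - ?a w \<in> Bm" using \<open>(z, w) \<in> h\<close> by (auto simp: h_def)
    then obtain y where y: "y \<in> Z" "?dc y - ?a w \<in> Bm" by blast
    have "?a w \<in> Bp" by (rule csub_subtrahend[OF Bp_sub dcBp[OF y(1)] BmBp[OF y(2)]])
    then show ?thesis using w by (simp add: Tz_def)
  qed
  have hI: "\<exists>z\<in>Zn. (z, w) \<in> h" if "w \<in> Tz" for w
  proof -
    obtain y where y: "y \<in> Z" "?dc y - ?a w \<in> Bm" using connecting_surj[of w] \<open>w \<in> Tz\<close> by (auto simp: Tz_def)
    have "w \<in> Zp" using \<open>w \<in> Tz\<close> by (rule Tz_Zp)
    moreover have "y \<in> Zn" by (rule connecting_Zn[OF y(1) Zp_C[OF \<open>w \<in> Zp\<close>] y(2)])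
    moreover have "\<exists>x\<in>Z. x - y \<in> MN \<and> ?dc x - ?a w \<in> Bm" by (rule bexI[of _ y]) (use y MN0 in simp_all)
    ultimately show ?thesis unfolding h_def by blast
  qed
  \<comment> \<open>The first differential has as its image exactly the torsion, reduced modulo
    \<open>a\<close>.\<close>
  have dE: "(h O g) `` Zn = {w + b | w b. w \<in> Tz \<and> b \<in> Bn}"
  proof (intro set_eqI iffI)
    fix e assume "e \<in> (h O g) `` Zn"
    then obtain z w where zw: "(z, w) \<in> h" "(w, e) \<in> g" by blast
    have "e = w + (e - w)" "e - w \<in> Bn" using zw(2) by (simp_all add: g_def)
    then show "e \<in> {w + b | w b. w \<in> Tz \<and> b \<in> Bn}" using hTz[OF zw(1)] by blast
  next
    fix e assume "e \<in> {w + b | w b. w \<in> Tz \<and> b \<in> Bn}"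
    then obtain w b where w: "e = w + b" "w \<in> Tz" "b \<in> Bn" by blast
    obtain z where "z \<in> Zn" "(z, w) \<in> h" using hI[OF w(2)] by blast
    moreover have "(w, e) \<in> g" using w csub_add[OF Zn_sub Zp_Zn[OF Tz_Zp[OF w(2)]] Bn_Zn[OF w(3)]]
      by (simp add: g_def Tz_Zp)
    ultimately show "e \<in> (h O g) `` Zn" by blast
  qed
  have TB: "csub {w + b | w b. w \<in> Tz \<and> b \<in> Bn}" by (rule csub_sum_sets[OF Tz_sub Bn_sub])
  have fI: "f `` Zp = Ip"
  proof (intro set_eqI iffI)
    fix v assume "v \<in> f `` Zp"
    then obtain u where u: "u \<in> Zp" "v - ?a u \<in> Bp" by (auto simp: f_def)
    from IpI[OF this] show "v \<in> Ip" by simp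
  next
    fix v assume "v \<in> Ip"
    then obtain u b where u: "v = ?a u + b" "u \<in> Zp" "b \<in> Bp" unfolding Ip_def by blast
    have "v \<in> Zp" using csub_add[OF Zp_sub aZp[OF u(2)] Bp_Zp[OF u(3)]] u(1) by simp
    then show "v \<in> f `` Zp" using u by (intro ImageI[of u]) (simp_all add: f_def)
  qed
  have BpIp: "w \<in> Ip" if "w \<in> Bp" for w using IpI[OF csub_zero[OF Zp_sub] that] by (simp add: lin_simps)
  have z0: "0 \<in> Zp" "0 \<in> Zn" "0 \<in> Bn" "0 \<in> Bp" "0 \<in> Z" "0 \<in> Bm"
    by (rule csub_zero, rule Zp_sub Zn_sub Bn_sub Bp_sub Z_sub Bm_sub)+
  have E0: "0 \<in> E"
  proof -
    have "(0, 0) \<in> h" "(0, 0) \<in> g" using z0 MN0 by (auto simp: h_def g_def lin_simps intro: bexI[of _ 0])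
    then show ?thesis unfolding E_def using z0 by blast
  qed
  have dK: "derived_couple (KR_couple \<chi>0 \<chi>1 m D) = \<lparr>cA = (Ip, Bp), cE = (E, {w + b | w b. w \<in> Tz \<and> b \<in> Bn}),
      cf = f \<inter> Ip \<times> Ip,
      cg = {(\<alpha>, e'). \<exists>\<beta> e. (\<beta>, \<alpha>) \<in> f \<and> (\<beta>, e) \<in> g \<and> e' - e \<in> {w + b | w b. w \<in> Tz \<and> b \<in> Bn}},
      ch = h \<inter> E \<times> Ip\<rparr>"
    unfolding K derived_couple_def Let_def couple.simps fst_conv snd_conv dE fI E_def[symmetric] by (rule refl)
  show ?thesis
    unfolding degenerate_def dK couple.simps fst_conv snd_conv
  proof (intro conjI TB)
    show "E \<noteq> {}" using E0 by blast
    show "\<forall>(z, w)\<in>h \<inter> E \<times> Ip. w \<in> Bp" using hTz torsion_Ip unfolding Tz_def by blast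
    show "\<forall>(w, e)\<in>{(\<alpha>, e'). \<exists>\<beta> e. (\<beta>, \<alpha>) \<in> f \<and> (\<beta>, e) \<in> g \<and> e' - e \<in> {w + b | w b. w \<in> Tz \<and> b \<in> Bn}}.
      w \<in> Bp \<longrightarrow> e \<in> {w + b | w b. w \<in> Tz \<and> b \<in> Bn}"
    proof clarify
      fix w e' v e w' b assume w: "w \<in> Bp" "(v, w) \<in> f" "(v, e) \<in> g" "e' - e = w' + b" "w' \<in> Tz" "b \<in> Bn"
      have "w - ?a v \<in> Bp" using w(2) by (simp add: f_def)
      then have "?a v \<in> Bp" by (rule csub_subtrahend[OF Bp_sub w(1)])
      then have "v \<in> Tz" using w(2) by (simp add: f_def Tz_def)
      moreover have "e' = (v + w') + ((e - v) + b)" using w(4) by (simp add: algebra_simps)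
      moreover have "e - v \<in> Bn" using w(3) by (simp add: g_def)
      ultimately show "\<exists>w b. e' = w + b \<and> w \<in> Tz \<and> b \<in> Bn"
        using csub_add[OF Tz_sub _ w(5)] csub_add[OF Bn_sub _ w(6)] by blast
    qed
    \<comment> \<open>A cycle of the first page has a torsion value that vanishes modulo
      \<open>a\<close>; by \<open>Tz_Bn\<close> this value is already zero.\<close>
    show "\<forall>z\<in>E. \<exists>w\<in>Bp. (z, w) \<in> h \<inter> E \<times> Ip"
    proof
      fix z assume z: "z \<in> E"
      then obtain b w where w: "b \<in> Bn" "(z, w) \<in> h" "(w, b) \<in> g" unfolding E_def by blast
      have "b - w \<in> Bn" using w(3) by (simp add: g_def)
      then have "w \<in> Bn" by (rule csub_subtrahend[OF Bn_sub w(1)])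
      moreover have "w \<in> Tz" by (rule hTz[OF w(2)])
      ultimately have "w \<in> Bp" using Tz_Bn by blast
      then show "\<exists>w\<in>Bp. (z, w) \<in> h \<inter> E \<times> Ip" using w(2) z BpIp by blast
    qed
    show "Bp \<times> {w + b | w b. w \<in> Tz \<and> b \<in> Bn} \<subseteq>
      {(\<alpha>, e'). \<exists>\<beta> e. (\<beta>, \<alpha>) \<in> f \<and> (\<beta>, e) \<in> g \<and> e' - e \<in> {w + b | w b. w \<in> Tz \<and> b \<in> Bn}}"
    proof (intro subsetI, elim SigmaE)
      fix x w e' assume x: "w \<in> Bp" "e' \<in> {w + b | w b. w \<in> Tz \<and> b \<in> Bn}" "x = (w, e')"
      have "(0, w) \<in> f" "(0, 0) \<in> g" using z0 x(1) by (simp_all add: f_def g_def lin_simps Bp_Zp)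
      moreover have "e' - 0 \<in> {w + b | w b. w \<in> Tz \<and> b \<in> Bn}" using x(2) by simp
      ultimately show "x \<in> {(\<alpha>, e'). \<exists>\<beta> e. (\<beta>, \<alpha>) \<in> f \<and> (\<beta>, e) \<in> g \<and> e' - e \<in> {w + b | w b. w \<in> Tz \<and> b \<in> Bn}}"
        unfolding x(3) by blast
    qed
    show "Bp \<subseteq> Ip" using BpIp by blast
    show "Bp \<times> Bp \<subseteq> f \<inter> Ip \<times> Ip"
      using BpIp Bp_Zp csub_diff[OF Bp_sub _ aBp] unfolding f_def by blast
    show "\<forall>(v, w)\<in>f \<inter> Ip \<times> Ip. w \<in> Bp \<longrightarrow> v \<in> Bp"
    proof clarify
      fix v w assume w: "(v, w) \<in> f" "v \<in> Ip" "w \<in> Bp"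
      have "w - ?a v \<in> Bp" using w(1) by (simp add: f_def)
      then have "?a v \<in> Bp" by (rule csub_subtrahend[OF Bp_sub w(3)])
      then show "v \<in> Bp" by (rule torsion_Ip[OF w(2)])
    qed
  qed
qed

text \<open>From the first derived couple on the E-term is literally constant, so the identity
  serves as isomorphism.\<close>

lemma collapse: "collapses_at \<chi>0 \<chi>1 m D 2"
  unfolding collapses_at_def bg_iso_def
proof (intro allI)
  fix r i j
  let ?K = "derived_couple (KR_couple \<chi>0 \<chi>1 m D)"
  have "E_page \<chi>0 \<chi>1 m D (2 + r) = bigrade D (cE ((derived_couple ^^ r) ?K))" for r
    by (simp add: E_page_def funpow_Suc_right del: funpow.simps(2))
  then have e: "E_page \<chi>0 \<chi>1 m D (2 + r) = bigrade D (cE ?K)" for r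
    using degenerate_funpow[OF degenerate_first_derived] by simp
  have "csub (snd (cE ?K))" using degenerate_first_derived by (simp add: degenerate_def)
  then have "csub (snd (bigrade D (cE ?K) i j))" by (simp add: bigrade_eq csub_Int G_sub)
  then show "sq_iso (E_page \<chi>0 \<chi>1 m D (2 + r) i j) (E_page \<chi>0 \<chi>1 m D 2 i j)"
    using e[of r] e[of 0] sq_iso_refl by simp
qed

end

section \<open>The decomposition of \<open>H\<^sub>2\<close>\<close>

lemma csub_family:
  "(\<And>l. l < n \<Longrightarrow> csub (Z l)) \<Longrightarrow> csub {v. (\<forall>l<n. v l \<in> Z l) \<and> (\<forall>l\<ge>n. v l = 0)}"
  for Z :: "nat \<Rightarrow> 'v::complex_space set"
  by (rule csubI) (simp_all add: csub_zero csub_add csub_scale scaleC_fun_def scaleC_zero_right)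

lemma has_dim_family:
  fixes Z B :: "nat \<Rightarrow> 'v::complex_space set"
  assumes "\<And>l. l < n \<Longrightarrow> csub (Z l)" "\<And>l. l < n \<Longrightarrow> csub (B l)" "\<And>l. l < n \<Longrightarrow> B l \<subseteq> Z l"
    "\<And>l. l < n \<Longrightarrow> has_dim (Z l) (B l) (d l)"
  shows "has_dim {v. (\<forall>l<n. v l \<in> Z l) \<and> (\<forall>l\<ge>n. v l = 0)} {v. (\<forall>l<n. v l \<in> B l) \<and> (\<forall>l\<ge>n. v l = 0)} (\<Sum>l<n. d l)"
  using assms
proof (induction n)
  case 0
  have "csub {v. (\<forall>l<0. v l \<in> B l) \<and> (\<forall>l\<ge>0. v l = 0)}" by (rule csub_family) simp
  then show ?case by (simp add: has_dim_0)
next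
  case (Suc n)
  let ?F = "\<lambda>Y n. {v. (\<forall>l<n. v l \<in> Y l) \<and> (\<forall>l\<ge>n. v l = (0::'v))}"
  have F: "csub (?F Z n)" "csub (?F B n)" "csub (?F Z (Suc n))" "csub (?F B (Suc n))" using Suc.prems by (intro csub_family; simp)+
  have p: "has_dim (?F Z n \<times> Z n) (?F B n \<times> B n) ((\<Sum>l<n. d l) + d n)"
    by (rule has_dim_prod[OF F(1,2)]) (use Suc in \<open>auto intro!: Suc.prems simp: subset_iff\<close>)
  have "has_dim (?F Z (Suc n)) (?F B (Suc n)) ((\<Sum>l<n. d l) + d n)"
  proof (rule has_dim_iso[where \<phi> = "\<lambda>x. (fst x)(n := snd x)", OF _ _ F(3,4) p])
    show "csub (?F Z n \<times> Z n)" "csub (?F B n \<times> B n)" using F Suc.prems by (auto intro!: csub_Times)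
    show "(fst x)(n := snd x) \<in> ?F Z (Suc n)" if "x \<in> ?F Z n \<times> Z n" for x using that by (auto simp: less_Suc_eq)
    have "(fst (x + y))(n := snd (x + y)) - ((fst x)(n := snd x) + (fst y)(n := snd y)) = 0" for x y :: "(nat \<Rightarrow> 'v) \<times> 'v"
      by (auto simp: fun_eq_iff)
    then show "(fst (x + y))(n := snd (x + y)) - ((fst x)(n := snd x) + (fst y)(n := snd y)) \<in> ?F B (Suc n)" for x y
      using csub_zero[OF F(4)] by simp
    have "(fst (c *\<^sub>C x))(n := snd (c *\<^sub>C x)) - c *\<^sub>C (fst x)(n := snd x) = 0" for c and x :: "(nat \<Rightarrow> 'v) \<times> 'v"
      by (auto simp: fun_eq_iff scaleC_prod_def scaleC_fun_def)
    then show "(fst (c *\<^sub>C x))(n := snd (c *\<^sub>C x)) - c *\<^sub>C (fst x)(n := snd x) \<in> ?F B (Suc n)" for c x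
      using csub_zero[OF F(4)] by simp
    show "(fst x)(n := snd x) \<in> ?F B (Suc n) \<longleftrightarrow> x \<in> ?F B n \<times> B n" if "x \<in> ?F Z n \<times> Z n" for x
      using that by (cases x) (auto simp: less_Suc_eq)
    show "\<exists>x\<in>?F Z n \<times> Z n. w - (fst x)(n := snd x) \<in> ?F B (Suc n)" if "w \<in> ?F Z (Suc n)" for w
    proof (rule bexI[of _ "(w(n := 0), w n)"])
      have "w - (fst (w(n := 0), w n))(n := snd (w(n := 0), w n)) = 0" by (auto simp: fun_eq_iff)
      then show "w - (fst (w(n := 0), w n))(n := snd (w(n := 0), w n)) \<in> ?F B (Suc n)" using csub_zero[OF F(4)] by simp
      show "(w(n := 0), w n) \<in> ?F Z n \<times> Z n" using that by (auto simp: Suc_le_eq)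
    qed
  qed
  then show ?case by simp
qed

lemma csub_bg_C: "csub (fst (bg_C i s i' s'))" "csub (snd (bg_C i s i' s'))" "snd (bg_C i s i' s') \<subseteq> fst (bg_C i s i' s')"
  by (auto simp: bg_C_def csub_def scaleC_zero_right)

lemma has_dim_bg_C: "has_dim (fst (bg_C i s i' s')) (snd (bg_C i s i' s')) (if i' = i \<and> s' = s then 1 else 0)"
proof (cases "i' = i \<and> s' = s")
  case True
  have "has_dim (UNIV :: complex set) {0} 1"
    by (rule has_dim_1[of _ _ 1]) (auto simp: csub_def scaleC_complex_def)
  then show ?thesis using True by (simp add: bg_C_def)
next
  case False
  then show ?thesis using has_dim_0[OF csub_bg_C(2)[of i s i' s']] by (auto simp: bg_C_def)
qed

lemma sum_nth_count_list: "(\<Sum>l<length ps. if ps ! l = x then 1 else 0) = count_list ps x"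
  by (induction ps) (simp_all add: sum.lessThan_Suc_shift del: sum.lessThan_Suc)

lemma count_list_replicate: "count_list (replicate n x) y = (if x = y then n else 0)"
  by (induction n) auto

text \<open>Turns the finitely many nonzero numbers \<open>t i j\<close> into the list of pairs in
  the decomposition.\<close>

lemma list_of_multiplicities: "finite A \<Longrightarrow> \<exists>ps. \<forall>x. count_list ps x = (if x \<in> A then f x else 0)"
proof (induction A rule: finite_induct)
  case empty show ?case by (intro exI[of _ "[]"]) simp
next
  case (insert y A)
  then obtain ps where "\<forall>x. count_list ps x = (if x \<in> A then f x else 0)" by blast
  then show ?case using insert(2) by (intro exI[of _ "replicate (f y) y @ ps"]) (auto simp: count_list_replicate)
qed

lemma xfilt_mono: "j \<le> k \<Longrightarrow> xfilt j \<subseteq> xfilt k"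
  by (auto simp: xfilt_def)

context thin_KR_diagram
begin

text \<open>Each bidegree has dimension \<open>g i j\<close> from the homology at
  \<open>a = 1\<close> plus \<open>t i j + t (i + 1) (j - 4)\<close> from torsion, which is what the
  list with multiplicities \<open>t\<close> contributes.\<close>

lemma decomposition:
  "\<exists>ps :: (int \<times> int) list. bg_iso (bigrade D (H_N \<chi>0 \<chi>1 m D))
    (bg_sum (gr_hat \<chi>0 \<chi>1 m D)
      (bg_family_sum (length ps) (\<lambda>l. let (i, s) = ps ! l in bg_sum (bg_C i s) (bg_C (i - 1) (s + 4)))))"
proof -
  obtain ps :: "(int \<times> int) list" where
      *: "\<forall>x. count_list ps x = (if x \<in> {(i, j). t i j \<noteq> 0} then t (fst x) (snd x) else 0)"
    using list_of_multiplicities[OF finite_t, of "\<lambda>x. t (fst x) (snd x)"] by blast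
  have ps: "count_list ps (i, j) = t i j" for i j using *[rule_format, of "(i, j)"] by auto
  define M where "M l = (let (i, s) = ps ! l in bg_sum (bg_C i s) (bg_C (i - 1) (s + 4)))" for l
  have "bg_iso (bigrade D (H_N \<chi>0 \<chi>1 m D)) (bg_sum (gr_hat \<chi>0 \<chi>1 m D) (bg_family_sum (length ps) M))"
    unfolding bg_iso_def
  proof (intro allI)
    fix i j
    have M: "M l i j = (fst (bg_C (fst (ps ! l)) (snd (ps ! l)) i j) \<times> fst (bg_C (fst (ps ! l) - 1) (snd (ps ! l) + 4) i j),
      snd (bg_C (fst (ps ! l)) (snd (ps ! l)) i j) \<times> snd (bg_C (fst (ps ! l) - 1) (snd (ps ! l) + 4) i j))" for l
      by (simp add: M_def bg_sum_def case_prod_unfold Let_def)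
    \<comment> \<open>A pair meets bidegree \<open>(i, j)\<close> with its first copy if it equals
      \<open>(i, j)\<close>, and with its second copy if it equals
      \<open>(i + 1, j - 4)\<close>.\<close>
    define d where "d l = (if ps ! l = (i, j) then 1 else 0) + (if ps ! l = (i + 1, j - 4) then 1 else 0 :: nat)" for l
    have Ms: "csub (fst (M l i j))" "csub (snd (M l i j))" "snd (M l i j) \<subseteq> fst (M l i j)" for l
      unfolding M fst_conv snd_conv by (intro csub_Times csub_bg_C Sigma_mono)+
    have "has_dim (fst (M l i j)) (snd (M l i j))
      ((if i = fst (ps ! l) \<and> j = snd (ps ! l) then 1 else 0) + (if i = fst (ps ! l) - 1 \<and> j = snd (ps ! l) + 4 then 1 else 0))" for l
      unfolding M fst_conv snd_conv by (intro has_dim_prod csub_bg_C has_dim_bg_C)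
    also have "((if i = fst (ps ! l) \<and> j = snd (ps ! l) then 1 else 0) + (if i = fst (ps ! l) - 1 \<and> j = snd (ps ! l) + 4 then 1 else 0)) = d l" for l
      by (cases "ps ! l") (auto simp: d_def)
    finally have Md: "has_dim (fst (M l i j)) (snd (M l i j)) (d l)" for l .
    let ?T = "bg_family_sum (length ps) M i j"
    have Td: "has_dim (fst ?T) (snd ?T) (\<Sum>l<length ps. d l)"
      unfolding bg_family_sum_def fst_conv snd_conv by (rule has_dim_family[OF Ms Md])
    have Ts: "csub (fst ?T)" "csub (snd ?T)" "snd ?T \<subseteq> fst ?T"
      unfolding bg_family_sum_def fst_conv snd_conv using Ms(3) by (auto intro!: csub_family Ms(1,2))
    have sum: "(\<Sum>l<length ps. d l) = t i j + t (i + 1) (j - 4)"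
      unfolding d_def sum.distrib sum_nth_count_list ps ..
    have "x_filtration D (j - 1) \<subseteq> x_filtration D j"
      unfolding x_filtration_def using xfilt_mono[of "j - 1 - n" "j - n" for n] by (auto simp: subset_iff)
    then have Fm: "Fh i (j - 1) \<subseteq> Fh i j" unfolding Fh_def by blast
    have "has_dim (Fh i j \<times> fst ?T) (Fh i (j - 1) \<times> snd ?T) (g i j + (t i j + t (i + 1) (j - 4)))"
      using has_dim_prod[OF Fh_sub Fh_sub Ts(1,2) Fm Ts(3) has_dim_Fh Td] by (simp only: sum)
    then have "has_dim (Fh i j \<times> fst ?T) (Fh i (j - 1) \<times> snd ?T) (t i j + g i j + t (i + 1) (j - 4))"
      by (simp add: ac_simps)
    from sq_iso_of_has_dim[OF _ _ _ _ has_dim_homology this]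
    show "sq_iso (bigrade D (H_N \<chi>0 \<chi>1 m D) i j) (bg_sum (gr_hat \<chi>0 \<chi>1 m D) (bg_family_sum (length ps) M) i j)"
      unfolding bg_sum_def bigrade_eq H_N_eq gr_hat_eq fst_conv snd_conv
      using Ts Fm by (auto intro!: csub_Int csub_Times Zn_sub Bn_sub G_sub Fh_sub)
  qed
  then show ?thesis unfolding M_def by blast
qed

end

theorem corollary1p25:
  fixes m :: nat and D :: "piece list" and \<chi>0 \<chi>1 :: bmatrix
  assumes "marked_diagram m D"
    and "is_chi False \<chi>0" and "is_chi True \<chi>1"
    and "\<exists>t. lht_N \<chi>0 \<chi>1 m D = Some t \<and> t \<le> 3"
  shows "tw_P \<chi>0 \<chi>1 m D \<le> 1 \<and>
    (collapses_at \<chi>0 \<chi>1 m D 1 \<or> collapses_at \<chi>0 \<chi>1 m D 2) \<and>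
    (\<exists>ps :: (int \<times> int) list.
      bg_iso (bigrade D (H_N \<chi>0 \<chi>1 m D))
        (bg_sum (gr_hat \<chi>0 \<chi>1 m D)
          (bg_family_sum (length ps) (\<lambda>l. let (i, s) = ps ! l in
            bg_sum (bg_C i s) (bg_C (i - 1) (s + 4))))))"
proof -
  interpret thin_KR_diagram m D \<chi>0 \<chi>1
    using assms by unfold_locales
  show ?thesis using tw_P_le collapse decomposition by blast
qed

end
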